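(* Let $p\in(1,2]$, $q\in[2,\infty)$, $a>d/2$ (and $a>\frac dp-\frac d2$), $r=\max\{2,p,q\}$. Let $\mathcal X=B^0_{p,q}(\mathbb T^d)$, $\mathcal Y=L^2(\mathbb T^d)$, $\mathcal R=\frac1r\|\cdot\|_{B^0_{p,q},\mathcal W}^r$, and let $F_a:\mathcal D\subset\mathcal X\to\mathcal Y$ satisfy, for some $L>0$ and all $f_1,f_2\in\mathcal D$, $$\|F_a(f_1)-F_a(f_2)\|_{B^a_{p,q}}\le L\|f_1-f_2\|_{B^0_{p,q}},$$ $$\tfrac1L\|f_1-f_2\|_{B^{-a}_{2,2}}\le\|F_a(f_1)-F_a(f_2)\|_{L^2}\le L\|f_1-f_2\|_{B^{-a}_{2,2}}.$$ Let $g^{\mathrm{obs}}=F_a(f^\dagger)+\varepsilon Z$ with $\varepsilon>0$ and a noise process $Z$ satisfying the deviation inequality in the context (with constants $C_Z,M_Z,\mu$ for the index $\tilde p=p'$). Suppose that $f^\dagger\in\mathcal D\cap B^s_{p,\infty}$ for some $s\in(0,\frac a{q-1})$ with $\|f^\dagger\|_{B^s_{p,\infty}}\le\varrho$. Let $\widehat f_\alpha$ be a global minimizer over $\mathcal D$ of $f\mapsto\frac12\|F_a(f)\|_{L^2}^2-\langle g^{\mathrm{obs}},F_a(f)\rangle+\alpha\mathcal R(f)$ (which exists almost surely). Then there are positive constants $\kappa_0,c,C$ independent of $f^\dagger$, $\widehat f_\alpha$, $\varepsilon$ and $\varrho$ such that for the choice $$\alpha=\kappa_0\,\varrho^{-\frac{qa+\frac{dq}2(1-\frac2q)}{a+s+d/2}}\;\varepsilon^{\frac{2(a+s)-qs}{a+s+d/2}}$$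 one has, for all $t>0$, $$\mathbb P\Big[\|\widehat f_\alpha-f^\dagger\|_{B^0_{p,q}}>(c+t)\,\varrho^{\frac{a+d/2}{a+s+d/2}}\,\varepsilon^{\frac s{a+s+d/2}}\Big]\le\exp\Big(-C_Z\,t^{\mu\left(\frac q2+\frac{(q-2)d}{4a}\right)}\Big).$$ In particular, for any $\sigma\ge1$ (with $C$ allowed to depend on $\sigma$), $$\Big(\mathbb E\,\|\widehat f_\alpha-f^\dagger\|_{B^0_{p,q}}^\sigma\Big)^{1/\sigma}\le C\,\varrho^{\frac{a+d/2}{a+s+d/2}}\,\varepsilon^{\frac s{a+s+d/2}}.$$
   Context: $\mathbb T^d=\mathbb R^d/\mathbb Z^d$; $B^s_{p,q}=B^s_{p,q}(\mathbb T^d)$ are the Besov spaces; $p'$ is the Hölder conjugate of $p$; $\mathcal D\subset\mathcal X$ is nonempty, closed and convex; it is understood that $F_a(f)\in B^a_{p,q}$ for $f\in\mathcal D$, so that $\langle g^{\mathrm{obs}},F_a(f)\rangle$ is defined via the duality pairing of $B^{-d/2}_{p',\infty}$ and $B^{d/2}_{p,1}$. Deviation inequality for $Z$: $Z$ is a random variable with values in the distributions on $\mathbb T^d$; for every $\tilde p\in(1,\infty)$ we have $Z\in B^{-d/2}_{\tilde p,\infty}$ almost surely, and there are constants $C_Z,M_Z,\mu>0$ (possibly depending on $\tilde p$) with $$\mathbb P\big(\|Z\|_{B^{-d/2}_{\tilde p,\infty}}>M_Z+t\big)\le\exp(-C_Zt^\mu)\qquad\text{for all }t>0.$$ $\|\cdot\|_{B^s_{p,q},\mathcal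 W}$ is the wavelet norm: a fixed orthonormal system $(\phi_{j,l})_{j\in\mathbb N_0,\,l\in I_j}$ of $L^2(\mathbb T^d)$ of sufficiently smooth real functions ($C^{m}$ with $m$ larger than all absolute values of smoothness indices that occur; e.g. periodized Daubechies or Meyer wavelets) is assumed to generate the Besov spaces, i.e. for $p,q\in[1,\infty]$ and $|s|<m$ a distribution $f$ lies in $B^s_{p,q}$ iff $$\|f\|_{B^s_{p,q},\mathcal W}=\Big[\sum_{j\in\mathbb N_0}2^{jsq}2^{jd(\frac12-\frac1p)q}\Big(\sum_{l\in I_j}|\langle f,\phi_{j,l}\rangle|^p\Big)^{q/p}\Big]^{1/q}<\infty$$ (usual modifications for $\infty$), this is an equivalent norm, and $f=\sum_{j,l}\langle f,\phi_{j,l}\rangle\phi_{j,l}$ uniquely. All other Besov norms may be any fixed equivalent norms. *)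

theory Defs
  imports "HOL-Probability.Probability"
begin

section \<open>Test functions and distributions on the torus\<close>

text \<open>
  Functions on the torus \<open>\<real>\<^sup>d / \<int>\<^sup>d\<close> are functions on \<^typ>\<open>real ^ 'd\<close> that are
  \<open>1\<close>-periodic in every coordinate, with \<open>d = CARD('d)\<close>. Everything is real-valued.
\<close>

definition torus_periodic :: "(real ^ 'd \<Rightarrow> real) \<Rightarrow> bool" where
  "torus_periodic f \<longleftrightarrow> (\<forall>x i. f (x + axis i 1) = f x)"

definition torus :: "(real ^ 'd) measure" where
  "torus = restrict_space lborel (cbox 0 One)"

definition pderiv1 :: "'d \<Rightarrow> (real ^ 'd \<Rightarrow> real) \<Rightarrow> real ^ 'd \<Rightarrow> real" where
  "pderiv1 i f = (\<lambda>x. frechet_derivative f (at x) (axis i 1))"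

text \<open>Multi-indices are lists of coordinates, read as iterated partial derivatives.\<close>

definition pderivs :: "'d list \<Rightarrow> (real ^ 'd \<Rightarrow> real) \<Rightarrow> real ^ 'd \<Rightarrow> real" where
  "pderivs is f = foldr pderiv1 is f"

definition C_k :: "nat \<Rightarrow> (real ^ 'd \<Rightarrow> real) \<Rightarrow> bool" where
  "C_k k f \<longleftrightarrow>
     (\<forall>is x. length is < k \<longrightarrow> pderivs is f differentiable (at x)) \<and>
     (\<forall>is. length is \<le> k \<longrightarrow> continuous_on UNIV (pderivs is f))"

definition test_functions :: "(real ^ 'd \<Rightarrow> real) set" where
  "test_functions = {\<psi>. torus_periodic \<psi> \<and> (\<forall>is x. pderivs is \<psi> differentiable (at x))}"

text \<open>
  Distributions are the linear functionals on test functions that are bounded by finitely many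
  derivative sup-norms, i.e. \<open>\<bar>u \<psi>\<bar> \<le> C * Max {\<parallel>\<partial>\<^sup>\<beta> \<psi>\<parallel>\<^sub>\<infinity> | \<bar>\<beta>\<bar> \<le> n}\<close> (the maximum is expressed
  through its upper bounds \<open>B\<close>). They are extended by \<open>0\<close> outside the test functions, so that
  equality of functionals is equality of distributions.
\<close>

typedef (overloaded) ('d::finite) distr =
  "{u :: (real ^ 'd \<Rightarrow> real) \<Rightarrow> real.
     (\<forall>\<psi>. \<psi> \<notin> test_functions \<longrightarrow> u \<psi> = 0) \<and>
     (\<forall>\<psi>\<in>test_functions. \<forall>\<eta>\<in>test_functions. u (\<lambda>x. \<psi> x + \<eta> x) = u \<psi> + u \<eta>) \<and>
     (\<forall>\<psi>\<in>test_functions. \<forall>c. u (\<lambda>x. c * \<psi> x) = c * u \<psi>) \<and>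
     (\<exists>n C. \<forall>\<psi>\<in>test_functions. \<forall>B.
        (\<forall>is x. length is \<le> n \<longrightarrow> \<bar>pderivs is \<psi> x\<bar> \<le> B) \<longrightarrow> \<bar>u \<psi>\<bar> \<le> C * B)}"
  morphisms distr_apply Abs_distr
  by (rule exI[of _ "\<lambda>_. 0"]) (auto intro!: exI[of _ "0::real"])

setup_lifting type_definition_distr

lemma distr_bound_add:
  fixes u v :: "(real ^ 'd \<Rightarrow> real) \<Rightarrow> real" and S :: "(real ^ 'd \<Rightarrow> real) set"
  assumes "\<exists>n C. \<forall>\<psi>\<in>S. \<forall>B. (\<forall>is x. length is \<le> n \<longrightarrow> \<bar>pderivs is \<psi> x\<bar> \<le> B) \<longrightarrow> \<bar>u \<psi>\<bar> \<le> C * B"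
    and "\<exists>n C. \<forall>\<psi>\<in>S. \<forall>B. (\<forall>is x. length is \<le> n \<longrightarrow> \<bar>pderivs is \<psi> x\<bar> \<le> B) \<longrightarrow> \<bar>v \<psi>\<bar> \<le> C * B"
  shows "\<exists>n C. \<forall>\<psi>\<in>S. \<forall>B. (\<forall>is x. length is \<le> n \<longrightarrow> \<bar>pderivs is \<psi> x\<bar> \<le> B)
            \<longrightarrow> \<bar>a * u \<psi> + b * v \<psi>\<bar> \<le> C * B"
proof -
  obtain n C where u: "\<And>\<psi> B. \<psi> \<in> S \<Longrightarrow> (\<forall>is x. length is \<le> n \<longrightarrow> \<bar>pderivs is \<psi> x\<bar> \<le> B) \<Longrightarrow> \<bar>u \<psi>\<bar> \<le> C * B"
    using assms(1) by blast
  obtain m D where v: "\<And>\<psi> B. \<psi> \<in> S \<Longrightarrow> (\<forall>is x. length is \<le> m \<longrightarrow> \<bar>pderivs is \<psi> x\<bar> \<le> B) \<Longrightarrow> \<bar>v \<psi>\<bar> \<le> D * B"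
    using assms(2) by blast
  have "\<bar>a * u \<psi> + b * v \<psi>\<bar> \<le> (\<bar>a\<bar> * C + \<bar>b\<bar> * D) * B"
    if "\<psi> \<in> S" and B: "\<forall>is x. length is \<le> max n m \<longrightarrow> \<bar>pderivs is \<psi> x\<bar> \<le> B" for \<psi> B
  proof -
    have "\<bar>u \<psi>\<bar> \<le> C * B" "\<bar>v \<psi>\<bar> \<le> D * B"
      using that by (auto intro!: u v)
    then have "\<bar>a\<bar> * \<bar>u \<psi>\<bar> + \<bar>b\<bar> * \<bar>v \<psi>\<bar> \<le> \<bar>a\<bar> * (C * B) + \<bar>b\<bar> * (D * B)"
      by (intro add_mono mult_left_mono) auto
    moreover have "\<bar>a * u \<psi> + b * v \<psi>\<bar> \<le> \<bar>a\<bar> * \<bar>u \<psi>\<bar> + \<bar>b\<bar> * \<bar>v \<psi>\<bar>"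
      using abs_triangle_ineq[of "a * u \<psi>" "b * v \<psi>"] by (simp add: abs_mult)
    ultimately show ?thesis by (simp add: algebra_simps)
  qed
  then show ?thesis by blast
qed

instantiation distr :: (finite) real_vector
begin

lift_definition zero_distr :: "'a distr" is "\<lambda>_. 0"
  by (auto intro!: exI[of _ "0::real"])

lift_definition plus_distr :: "'a distr \<Rightarrow> 'a distr \<Rightarrow> 'a distr" is "\<lambda>u v \<psi>. u \<psi> + v \<psi>"
  subgoal for u v
    using distr_bound_add[of test_functions u v 1 1] by (simp add: algebra_simps)
  done

lift_definition minus_distr :: "'a distr \<Rightarrow> 'a distr \<Rightarrow> 'a distr" is "\<lambda>u v \<psi>. u \<psi> - v \<psi>"
  subgoal for u v
    using distr_bound_add[of test_functions u v 1 "-1"] by (simp add: algebra_simps)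
  done

lift_definition uminus_distr :: "'a distr \<Rightarrow> 'a distr" is "\<lambda>u \<psi>. - u \<psi>"
  by simp

lift_definition scaleR_distr :: "real \<Rightarrow> 'a distr \<Rightarrow> 'a distr" is "\<lambda>c u \<psi>. c * u \<psi>"
  subgoal for c u
    using distr_bound_add[of test_functions u u c 0] by (simp add: algebra_simps)
  done

instance
  by standard (transfer; force simp: algebra_simps)+

end

lemma pderivs_Nil [simp]: "pderivs [] f = f"
  by (simp add: pderivs_def)

lemma pderivs_Cons: "pderivs (i # is) f = pderiv1 i (pderivs is f)"
  by (simp add: pderivs_def)

lemma pderivs_add:
  assumes "\<And>is x. pderivs is f differentiable (at x)" "\<And>is x. pderivs is g differentiable (at x)"
  shows "pderivs is (\<lambda>x. f x + g x) = (\<lambda>x. pderivs is f x + pderivs is g x)"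
proof (induction "is")
  case (Cons i js)
  have "frechet_derivative (\<lambda>x. pderivs js f x + pderivs js g x) (at x) =
        (\<lambda>h. frechet_derivative (pderivs js f) (at x) h + frechet_derivative (pderivs js g) (at x) h)" for x
    using assms[of js x]
    by (intro frechet_derivative_at[symmetric] has_derivative_add) (auto simp: frechet_derivative_works)
  then show ?case by (simp add: pderivs_Cons Cons pderiv1_def)
qed simp

lemma pderivs_scale:
  assumes "\<And>is x. pderivs is f differentiable (at x)"
  shows "pderivs is (\<lambda>x. c * f x) = (\<lambda>x. c * pderivs is f x)"
proof (induction "is")
  case (Cons i js)
  have "frechet_derivative (\<lambda>x. c * pderivs js f x) (at x) =
        (\<lambda>h. c * frechet_derivative (pderivs js f) (at x) h)" for x
    using assms[of js x]
    by (intro frechet_derivative_at[symmetric] has_derivative_mult_right) (auto simp: frechet_derivative_works)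
  then show ?case by (simp add: pderivs_Cons Cons pderiv1_def)
qed simp

lemma test_functions_add:
  "\<psi> \<in> test_functions \<Longrightarrow> \<eta> \<in> test_functions \<Longrightarrow> (\<lambda>x. \<psi> x + \<eta> x) \<in> test_functions"
  by (auto simp: test_functions_def torus_periodic_def pderivs_add)

lemma test_functions_scale: "\<psi> \<in> test_functions \<Longrightarrow> (\<lambda>x. c * \<psi> x) \<in> test_functions"
  by (auto simp: test_functions_def torus_periodic_def pderivs_scale)

lemma test_functions_continuous: "\<psi> \<in> test_functions \<Longrightarrow> continuous_on A \<psi>"
proof -
  assume "\<psi> \<in> test_functions"
  then have "pderivs [] \<psi> differentiable (at x)" for x
    unfolding test_functions_def by blast
  then show ?thesis
    by (auto intro!: continuous_at_imp_continuous_on differentiable_imp_continuous_within)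
qed

lemma integrable_mult_test_function:
  assumes h: "integrable torus h" and psi: "\<psi> \<in> test_functions"
  shows "integrable torus (\<lambda>x. h x * \<psi> x)"
proof -
  have "compact (\<psi> ` cbox 0 One)"
    by (intro compact_continuous_image test_functions_continuous[OF psi]) simp
  then obtain B where B: "\<forall>x\<in>cbox 0 One. \<bar>\<psi> x\<bar> \<le> B"
    by (auto dest!: compact_imp_bounded simp: bounded_iff)
  have meas: "\<psi> \<in> borel_measurable torus"
    unfolding torus_def
    by (intro measurable_restrict_space1) (simp add: borel_measurable_continuous_onI test_functions_continuous[OF psi])
  show ?thesis
  proof (rule Bochner_Integration.integrable_bound[OF integrable_mult_right[OF integrable_norm[OF h], of B]])
    show "(\<lambda>x. h x * \<psi> x) \<in> borel_measurable torus"
      using meas h by (intro borel_measurable_times) auto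
    show "AE x in torus. norm (h x * \<psi> x) \<le> norm (B * norm (h x))"
    proof (rule AE_I2)
      fix x :: "real ^ 'a" assume "x \<in> space torus"
      then have x: "x \<in> cbox 0 One" by (simp add: torus_def space_restrict_space)
      have "\<bar>h x\<bar> * \<bar>\<psi> x\<bar> \<le> \<bar>h x\<bar> * \<bar>B\<bar>"
        using B x by (intro mult_left_mono) force+
      then show "norm (h x * \<psi> x) \<le> norm (B * norm (h x))"
        by (simp add: abs_mult mult.commute)
    qed
  qed
qed

text \<open>The regular distribution of an integrable function (and \<open>0\<close> for non-integrable ones).\<close>

lift_definition distr_of_fun :: "(real ^ 'd \<Rightarrow> real) \<Rightarrow> ('d::finite) distr" is
  "\<lambda>h \<psi>. if integrable torus h \<and> \<psi> \<in> test_functions then (\<integral>x. h x * \<psi> x \<partial>torus) else 0"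
proof -
  fix h :: "real ^ 'd \<Rightarrow> real"
  let ?u = "\<lambda>\<psi>. if integrable torus h \<and> \<psi> \<in> test_functions then (\<integral>x. h x * \<psi> x \<partial>torus) else 0"
  have bound: "\<bar>?u \<psi>\<bar> \<le> (\<integral>x. \<bar>h x\<bar> \<partial>torus) * B"
    if psi: "\<psi> \<in> test_functions" and B: "\<forall>is x. length is \<le> 0 \<longrightarrow> \<bar>pderivs is \<psi> x\<bar> \<le> B" for \<psi> B
  proof -
    have B': "\<bar>\<psi> x\<bar> \<le> B" for x using B by (metis le0 list.size(3) pderivs_Nil)
    then have "0 \<le> B" by (meson abs_ge_zero order_trans)
    show ?thesis
    proof (cases "integrable torus h")
      case True
      have "\<bar>\<integral>x. h x * \<psi> x \<partial>torus\<bar> \<le> (\<integral>x. \<bar>h x\<bar> * B \<partial>torus)"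
        using B' True
        by (intro order_trans[OF integral_abs_bound] integral_mono integrable_abs
              integrable_mult_test_function psi integrable_mult_left)
           (auto simp: abs_mult intro: mult_left_mono)
      then show ?thesis using True psi by simp
    qed (use \<open>0 \<le> B\<close> in auto)
  qed
  show "(\<forall>\<psi>. \<psi> \<notin> test_functions \<longrightarrow> ?u \<psi> = 0) \<and>
     (\<forall>\<psi>\<in>test_functions. \<forall>\<eta>\<in>test_functions. ?u (\<lambda>x. \<psi> x + \<eta> x) = ?u \<psi> + ?u \<eta>) \<and>
     (\<forall>\<psi>\<in>test_functions. \<forall>c. ?u (\<lambda>x. c * \<psi> x) = c * ?u \<psi>) \<and>
     (\<exists>n C. \<forall>\<psi>\<in>test_functions. \<forall>B.
        (\<forall>is x. length is \<le> n \<longrightarrow> \<bar>pderivs is \<psi> x\<bar> \<le> B) \<longrightarrow> \<bar>?u \<psi>\<bar> \<le> C * B)"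
  proof (intro conjI)
    show "\<forall>\<psi>\<in>test_functions. \<forall>\<eta>\<in>test_functions. ?u (\<lambda>x. \<psi> x + \<eta> x) = ?u \<psi> + ?u \<eta>"
      by (auto simp: test_functions_add integrable_mult_test_function distrib_left)
    show "\<forall>\<psi>\<in>test_functions. \<forall>c. ?u (\<lambda>x. c * \<psi> x) = c * ?u \<psi>"
    proof (intro ballI allI)
      fix \<psi> :: "real ^ 'd \<Rightarrow> real" and c :: real assume psi: "\<psi> \<in> test_functions"
      have "(\<integral>x. h x * (c * \<psi> x) \<partial>torus) = c * (\<integral>x. h x * \<psi> x \<partial>torus)"
        by (subst integral_mult_right_zero[symmetric]) (simp add: ac_simps)
      then show "?u (\<lambda>x. c * \<psi> x) = c * ?u \<psi>" using psi by (simp add: test_functions_scale)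
    qed
    show "\<exists>n C. \<forall>\<psi>\<in>test_functions. \<forall>B.
        (\<forall>is x. length is \<le> n \<longrightarrow> \<bar>pderivs is \<psi> x\<bar> \<le> B) \<longrightarrow> \<bar>?u \<psi>\<bar> \<le> C * B"
      using bound by blast
  qed auto
qed

section \<open>Lebesgue and Besov norms\<close>

text \<open>All norms take values in \<^typ>\<open>ennreal\<close>; \<open>enn_powr\<close> is only used with a positive exponent.\<close>

definition enn_powr :: "ennreal \<Rightarrow> real \<Rightarrow> ennreal" where
  "enn_powr x r = (if x = \<infinity> then \<infinity> else ennreal (enn2real x powr r))"

definition Lp_norm :: "'a measure \<Rightarrow> ennreal \<Rightarrow> ('a \<Rightarrow> ennreal) \<Rightarrow> ennreal" where
  "Lp_norm M p f =
     (if p = \<infinity> then esssup M f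
      else enn_powr (\<integral>\<^sup>+ x. enn_powr (f x) (enn2real p) \<partial>M) (1 / enn2real p))"

text \<open>The infimum is over an empty set, hence \<open>\<infinity>\<close>, if \<open>u\<close> is not a regular distribution.\<close>

definition L2_norm :: "('d::finite) distr \<Rightarrow> ennreal" where
  "L2_norm u = (INF h\<in>{h. integrable torus h \<and> distr_of_fun h = u}. Lp_norm torus 2 (\<lambda>x. ennreal \<bar>h x\<bar>))"

text \<open>
  Smooth radial cutoff: \<open>lp_cutoff \<xi> = 1\<close> for \<open>norm \<xi> \<le> 1\<close> and \<open>lp_cutoff \<xi> = 0\<close> for
  \<open>norm \<xi> \<ge> 2\<close>. Its dyadic dilates give the Littlewood--Paley resolution of unity.
\<close>

definition exp_bump :: "real \<Rightarrow> real" where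
  "exp_bump t = (if t > 0 then exp (- 1 / t) else 0)"

definition lp_cutoff :: "real ^ 'd \<Rightarrow> real" where
  "lp_cutoff \<xi> = exp_bump (2 - norm \<xi>) / (exp_bump (2 - norm \<xi>) + exp_bump (norm \<xi> - 1))"

text \<open>
  \<open>lp_partial J u\<close> is the trigonometric polynomial
  \<open>\<Sum>k. lp_cutoff (k / 2^J) * \<langle>u, e\<^sub>-\<^sub>k\<rangle> * e\<^sub>k\<close>, where \<open>e\<^sub>k x = exp (2 \<pi> \<i> (k \<bullet> x))\<close>, written in real form
  (the cutoff is even, so the imaginary parts cancel).
\<close>

definition lp_partial :: "nat \<Rightarrow> ('d::finite) distr \<Rightarrow> real ^ 'd \<Rightarrow> real" where
  "lp_partial J u x =
     (\<Sum>k | (\<forall>i. k $ i \<in> \<int>) \<and> norm k < 2 ^ (J + 1).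
        lp_cutoff (k /\<^sub>R 2 ^ J) *
        (distr_apply u (\<lambda>y. cos (2 * pi * (k \<bullet> y))) * cos (2 * pi * (k \<bullet> x)) +
         distr_apply u (\<lambda>y. sin (2 * pi * (k \<bullet> y))) * sin (2 * pi * (k \<bullet> x))))"

definition lp_block :: "nat \<Rightarrow> ('d::finite) distr \<Rightarrow> real ^ 'd \<Rightarrow> real" where
  "lp_block j u x = (if j = 0 then lp_partial 0 u x else lp_partial j u x - lp_partial (j - 1) u x)"

definition besov_norm :: "real \<Rightarrow> ennreal \<Rightarrow> ennreal \<Rightarrow> ('d::finite) distr \<Rightarrow> ennreal" where
  "besov_norm s p q u =
     Lp_norm (count_space UNIV) q
       (\<lambda>j. ennreal (2 powr (real j * s)) * Lp_norm torus p (\<lambda>x. ennreal \<bar>lp_block j u x\<bar>))"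

definition besov :: "real \<Rightarrow> ennreal \<Rightarrow> ennreal \<Rightarrow> ('d::finite) distr set" where
  "besov s p q = {u. besov_norm s p q u < \<infinity>}"

definition equivalent_on :: "'a set \<Rightarrow> ('a \<Rightarrow> ennreal) \<Rightarrow> ('a \<Rightarrow> ennreal) \<Rightarrow> bool" where
  "equivalent_on A N1 N2 \<longleftrightarrow>
     (\<exists>c>0. \<exists>C>0. \<forall>u\<in>A. ennreal c * N1 u \<le> N2 u \<and> N2 u \<le> ennreal C * N1 u)"

text \<open>An arbitrary choice of equivalent norms on all the Besov spaces (\<open>\<infinity>\<close> outside the space).\<close>

definition besov_norm_family ::
    "(real \<Rightarrow> ennreal \<Rightarrow> ennreal \<Rightarrow> ('d::finite) distr \<Rightarrow> ennreal) \<Rightarrow> bool" where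
  "besov_norm_family N \<longleftrightarrow>
     (\<forall>s p q. 1 \<le> p \<longrightarrow> 1 \<le> q \<longrightarrow>
        equivalent_on UNIV (besov_norm s p q) (N s p q) \<and>
        (\<forall>u v. N s p q (u + v) \<le> N s p q u + N s p q v) \<and>
        (\<forall>c u. N s p q (c *\<^sub>R u) = ennreal \<bar>c\<bar> * N s p q u))"

text \<open>
  The duality pairing of Besov spaces: as \<open>lp_partial J v\<close> is a test function tending to \<open>v\<close>, this
  is the continuous extension of \<open>\<langle>u, \<psi>\<rangle>\<close> from test functions \<open>\<psi>\<close> to, e.g.,
  \<open>u \<in> B\<^sup>-\<^sup>s\<^sub>p\<^sub>'\<^sub>,\<^sub>\<infinity>\<close> and \<open>v \<in> B\<^sup>s\<^sub>p\<^sub>,\<^sub>1\<close>.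
\<close>

definition pairing :: "('d::finite) distr \<Rightarrow> 'd distr \<Rightarrow> real" where
  "pairing u v = lim (\<lambda>J. distr_apply u (lp_partial J v))"

section \<open>Wavelet systems\<close>

definition wavelet_coeff :: "(nat \<Rightarrow> 'i \<Rightarrow> real ^ 'd \<Rightarrow> real) \<Rightarrow> ('d::finite) distr \<Rightarrow> nat \<Rightarrow> 'i \<Rightarrow> real" where
  "wavelet_coeff \<phi> u j l = pairing u (distr_of_fun (\<phi> j l))"

definition besov_seq_norm ::
    "nat \<Rightarrow> (nat \<Rightarrow> 'i set) \<Rightarrow> real \<Rightarrow> ennreal \<Rightarrow> ennreal \<Rightarrow> (nat \<Rightarrow> 'i \<Rightarrow> real) \<Rightarrow> ennreal" where
  "besov_seq_norm d I s p q c =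
     Lp_norm (count_space UNIV) q
       (\<lambda>j. ennreal (2 powr (real j * s) * 2 powr (real j * real d * (1 / 2 - enn2real (1 / p)))) *
            Lp_norm (count_space (I j)) p (\<lambda>l. ennreal \<bar>c j l\<bar>))"

definition wavelet_norm ::
    "(nat \<Rightarrow> 'i set) \<Rightarrow> (nat \<Rightarrow> 'i \<Rightarrow> real ^ 'd \<Rightarrow> real) \<Rightarrow> real \<Rightarrow> ennreal \<Rightarrow> ennreal
       \<Rightarrow> ('d::finite) distr \<Rightarrow> ennreal" where
  "wavelet_norm I \<phi> s p q u = besov_seq_norm CARD('d) I s p q (wavelet_coeff \<phi> u)"

text \<open>
  The pairing of a distribution with a function that is only \<open>C\<^sup>m\<close> needs the distribution to have
  order below \<open>m\<close>. The following set contains every \<open>B\<^sup>s\<^sub>p\<^sub>,\<^sub>q\<close> with \<open>\<bar>s\<bar> < m\<close> and \<open>p, q \<in> [1, \<infinity>]\<close>; it is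
  the domain on which the wavelet characterization is assumed.
\<close>

definition low_order :: "nat \<Rightarrow> ('d::finite) distr set" where
  "low_order m = (\<Union>t\<in>{t. \<bar>t\<bar> < real m}. besov t 1 \<infinity>)"

text \<open>
  The clause \<open>equivalent_on\<close> contains that \<open>u\<close> lies in \<open>B\<^sup>s\<^sub>p\<^sub>,\<^sub>q\<close> iff its wavelet norm is finite. The
  last two clauses say that the wavelet expansion of \<open>u\<close> converges to \<open>u\<close> in the sense of
  distributions, and that it is the only such expansion with coefficients of order below \<open>m\<close>.
\<close>

definition besov_wavelets ::
    "nat \<Rightarrow> (nat \<Rightarrow> 'i set) \<Rightarrow> (nat \<Rightarrow> 'i \<Rightarrow> real ^ 'd \<Rightarrow> real) \<Rightarrow> ('d::finite) itself \<Rightarrow> bool" where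
  "besov_wavelets m I \<phi> _ \<longleftrightarrow>
     (\<forall>j. finite (I j)) \<and>
     (\<forall>j. \<forall>l\<in>I j. torus_periodic (\<phi> j l) \<and> C_k m (\<phi> j l)) \<and>
     (\<forall>j. \<forall>l\<in>I j. \<forall>j'. \<forall>l'\<in>I j'.
        (\<integral>x. \<phi> j l x * \<phi> j' l' x \<partial>torus) = (if j = j' \<and> l = l' then 1 else 0)) \<and>
     (\<forall>s p q. \<bar>s\<bar> < real m \<longrightarrow> 1 \<le> p \<longrightarrow> 1 \<le> q \<longrightarrow>
        equivalent_on (low_order m) (besov_norm s p q) (wavelet_norm I \<phi> s p q :: 'd distr \<Rightarrow> ennreal)) \<and>
     (\<forall>u\<in>low_order m. \<forall>\<psi>\<in>test_functions.
        (\<lambda>j. \<Sum>l\<in>I j. wavelet_coeff \<phi> u j l * (\<integral>x. \<phi> j l x * \<psi> x \<partial>torus)) sums distr_apply u \<psi>) \<and>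
     (\<forall>u\<in>low_order m. \<forall>c t. \<bar>t\<bar> < real m \<longrightarrow> besov_seq_norm CARD('d) I t 1 \<infinity> c < \<infinity> \<longrightarrow>
        (\<forall>\<psi>\<in>test_functions.
           (\<lambda>j. \<Sum>l\<in>I j. c j l * (\<integral>x. \<phi> j l x * \<psi> x \<partial>torus)) sums distr_apply u \<psi>) \<longrightarrow>
        (\<forall>j. \<forall>l\<in>I j. c j l = wavelet_coeff \<phi> u j l))"

section \<open>Noise and Tikhonov functional\<close>

text \<open>
  The constants are functions of the integrability index. Measurability of the norm is part of
  the definition because the Besov space is not separable, so that an arbitrary equivalent norm
  need not be measurable for the \<open>\<sigma>\<close>-algebra generated by the evaluations at test functions.
\<close>

definition deviation_inequality ::
    "(real \<Rightarrow> ennreal \<Rightarrow> ennreal \<Rightarrow> ('d::finite) distr \<Rightarrow> ennreal) \<Rightarrow> 'w measure \<Rightarrow> ('w \<Rightarrow> 'd distr)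
       \<Rightarrow> (real \<Rightarrow> real) \<Rightarrow> (real \<Rightarrow> real) \<Rightarrow> (real \<Rightarrow> real) \<Rightarrow> bool" where
  "deviation_inequality N M Z C\<^sub>Z M\<^sub>Z \<mu> \<longleftrightarrow>
     (\<forall>\<psi>\<in>test_functions. (\<lambda>\<omega>. distr_apply (Z \<omega>) \<psi>) \<in> borel_measurable M) \<and>
     (\<forall>p>1.
        (\<lambda>\<omega>. N (- real CARD('d) / 2) (ennreal p) \<infinity> (Z \<omega>)) \<in> borel_measurable M \<and>
        (AE \<omega> in M. Z \<omega> \<in> besov (- real CARD('d) / 2) (ennreal p) \<infinity>) \<and>
        C\<^sub>Z p > 0 \<and> M\<^sub>Z p > 0 \<and> \<mu> p > 0 \<and>
        (\<forall>t>0. \<P>(\<omega> in M. N (- real CARD('d) / 2) (ennreal p) \<infinity> (Z \<omega>) > ennreal (M\<^sub>Z p + t))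
                 \<le> exp (- C\<^sub>Z p * t powr \<mu> p)))"

definition tikhonov ::
    "('d distr \<Rightarrow> real) \<Rightarrow> ('d distr \<Rightarrow> 'd distr) \<Rightarrow> ('d::finite) distr \<Rightarrow> real \<Rightarrow> 'd distr \<Rightarrow> real" where
  "tikhonov R F g \<alpha> f = 1 / 2 * (enn2real (L2_norm (F f)))\<^sup>2 - pairing g (F f) + \<alpha> * R f"

definition norm_closed_in :: "'a set \<Rightarrow> ('a::real_vector \<Rightarrow> ennreal) \<Rightarrow> 'a set \<Rightarrow> bool" where
  "norm_closed_in X N D \<longleftrightarrow>
     D \<subseteq> X \<and> (\<forall>f\<in>X. (\<forall>e>0. \<exists>g\<in>D. N (g - f) < ennreal e) \<longrightarrow> f \<in> D)"

end

theory Submission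
  imports Defs "HOL-Complex_Analysis.Great_Picard"
begin

text \<open>
  Comparing the Tikhonov functional at the minimizer and at the truth bounds
  \<open>\<parallel>w\<parallel>\<^sup>2 / 2 + \<alpha> (R f - R f\<^sub>0)\<close> by \<open>\<epsilon> \<langle>Z, w\<rangle>\<close>, where \<open>w = F f - F f\<^sub>0\<close>. Littlewood--Paley duality and the
  two smoothness bounds on \<open>w\<close> give \<open>\<bar>\<langle>Z, w\<rangle>\<bar> \<le> C \<parallel>Z\<parallel> \<parallel>w\<parallel>\<^bsup>1 - \<delta>\<^esup> \<parallel>f - f\<^sub>0\<parallel>\<^bsup>\<delta>\<^esup>\<close> with \<open>\<delta> = d / (2 a)\<close>.
  The wavelet norm is \<open>q\<close>-convex because the finite-dimensional \<open>l\<^sup>p\<close> norm is \<open>2\<close>-convex for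
  \<open>p \<in> (1, 2]\<close>; applied to the midpoint of \<open>f\<close> and \<open>f\<^sub>0\<close> this bounds \<open>R f - R f\<^sub>0\<close> from below by a multiple
  of \<open>\<parallel>f - f\<^sub>0\<parallel>\<^sup>q\<close> up to a term controlled by the smoothness of \<open>f\<^sub>0\<close> and by \<open>\<parallel>w\<parallel>\<close>. Balancing both terms
  gives the deterministic rate, into which the tail bound for \<open>\<parallel>Z\<parallel>\<close> is inserted; taking the constant
  in \<open>\<alpha>\<close> large makes the factor in front of \<open>t\<close> equal to \<open>1\<close>.

  Minimizers exist by the direct method. Uniform convexity replaces reflexivity there: it yields both
  weak closedness of \<open>D\<close> and, with completeness of the Besov space, the limit of a minimizing sequence.
  Completeness and the pairing with wavelets of finite smoothness are read off the wavelet
  expansion and Parseval's identity.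
\<close>
section \<open>Integration over the torus\<close>

text \<open>The scales come from a balance. With the error measured in units of \<open>rate\<close>
  and the residual \<open>W\<close> in units of \<open>\<omega>\<close>, the penalty, the source
  term and the noise term all carry the factor \<open>\<omega>\<^sup>2\<close>; this fixes the
  exponents in \<open>alpha0\<close>. The exponent \<delta> is the position of d/2 between 0 and a:
  the noise has smoothness -d/2, the residual is small in L^2, and its smoothness of order a is paid
  for by the error. Two obstacles shape the rest. Wavelets of finite smoothness need not be test
  functions, so a coefficient is a limit of pairings; its existence must be known before
  coefficients can be added, and convergence of distributions does not directly give convergence of
  coefficients. Hence semicontinuity under such convergence is proved on Littlewood--Paley blocks,
  convexity on wavelet coefficients. Also, a pointwise limit of distributions is shown to be a
  distribution through bounds of uniform order; the estimate by \<open>Phi\<close> with one fixed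
  number of derivatives provides them.\<close>

lemma sum_Basis_nth [simp]: "(\<Sum>b\<in>Basis. (b :: real ^ 'd) $ i) = 1"
proof -
  have "(\<Sum>b\<in>Basis. (b :: real ^ 'd) $ i) = (\<Sum>b\<in>Basis. if axis i 1 = (b :: real ^ 'd) then 1 else 0)"
  proof (intro sum.cong refl)
    fix b :: "real ^ 'd" assume "b \<in> Basis"
    then obtain j where "b = axis j 1" by (auto simp: Basis_vec_def)
    then show "b $ i = (if axis i 1 = b then 1 else 0)" by (auto simp: axis_eq_axis) (auto simp: axis_def)
  qed
  also have "\<dots> = 1" by simp
  finally show ?thesis .
qed

lemma cube_mem: "x \<in> cbox (0 :: real ^ 'd) One \<longleftrightarrow> (\<forall>i. 0 \<le> x $ i \<and> x $ i \<le> 1)"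
  by (simp add: mem_box_cart)

lemma ocube_mem: "x \<in> box (0 :: real ^ 'd) One \<longleftrightarrow> (\<forall>i. 0 < x $ i \<and> x $ i < 1)"
  by (simp add: mem_box_cart)

lemma space_torus [simp]: "space torus = cbox 0 One"
  by (simp add: torus_def space_restrict_space)

lemma sets_torus: "sets torus = sets (restrict_space borel (cbox 0 One))"
  by (simp add: torus_def sets_restrict_space)

lemma emeasure_torus_space: "emeasure torus (cbox (0 :: real ^ 'd) One) = 1"
  by (simp add: torus_def emeasure_restrict_space emeasure_lborel_cbox_eq)

interpretation torus: prob_space "torus :: (real ^ 'd) measure"
  by standard (simp add: emeasure_torus_space)

lemma measurable_torus: "f \<in> borel_measurable borel \<Longrightarrow> f \<in> borel_measurable torus"
  unfolding torus_def by (intro measurable_restrict_space1) simp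

lemma cont_measurable_torus: "continuous_on UNIV f \<Longrightarrow> f \<in> borel_measurable torus"
  for f :: "real ^ 'd \<Rightarrow> 'b::real_normed_vector"
  by (intro measurable_torus borel_measurable_continuous_onI)

lemma cont_bounded_torus:
  fixes f :: "real ^ 'd \<Rightarrow> real"
  assumes "continuous_on UNIV f"
  obtains B where "B \<ge> 0" "\<And>x. x \<in> cbox 0 One \<Longrightarrow> \<bar>f x\<bar> \<le> B"
proof -
  have "compact (f ` cbox 0 One)"
    by (intro compact_continuous_image continuous_on_subset[OF assms]) auto
  then obtain B where "\<forall>x\<in>cbox 0 One. \<bar>f x\<bar> \<le> B"
    by (auto dest!: compact_imp_bounded simp: bounded_iff)
  then show ?thesis by (intro that[of "max B 0"]) fastforce+
qed

lemma cont_integrable_torus: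
  fixes f :: "real ^ 'd \<Rightarrow> real"
  assumes "continuous_on UNIV f"
  shows "integrable torus f"
proof -
  obtain B where "\<And>x. x \<in> cbox 0 One \<Longrightarrow> \<bar>f x\<bar> \<le> B"
    using cont_bounded_torus[OF assms] by blast
  then show ?thesis
    by (intro torus.integrable_const_bound[of _ B] AE_I2 cont_measurable_torus assms) auto
qed

lemma integral_torus_eq:
  fixes f :: "real ^ 'd \<Rightarrow> real"
  shows "integral\<^sup>L torus f = (\<integral>x. indicator (cbox 0 One) x * f x \<partial>lborel)"
  unfolding torus_def by (subst integral_restrict_space) auto

text \<open>The translated cube sticks out of the unit cube on one side. The overhanging slab, moved
  back by the full period \<open>e\<close>, is the part \<open>A\<close> that the translate has
  lost, and periodicity makes the integrand the same on both.\<close>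

lemma integral_torus_shift:
  fixes g :: "real ^ 'd \<Rightarrow> real"
  assumes per: "torus_periodic g" and cont: "continuous_on UNIV g" and t: "0 \<le> t" "t \<le> 1"
  shows "(\<integral>x. g (x + t *\<^sub>R axis i 1) \<partial>torus) = integral\<^sup>L torus g"
proof -
  define e where "e = (axis i 1 :: real ^ 'd)"
  define K where "K = (cbox 0 One :: (real ^ 'd) set)"
  define A where "A = K \<inter> {x. x $ i < t}"
  define A' where "A' = K \<inter> {x. t \<le> x $ i}"
  have Kb: "K \<in> sets borel" by (simp add: K_def)
  have Ab: "A \<in> sets borel" "A' \<in> sets borel"
    unfolding A_def A'_def using Kb by (auto intro!: sets.Int borel_open borel_closed open_Collect_less closed_Collect_le continuous_intros)
  have gm [measurable]: "g \<in> borel_measurable borel" using cont by (rule borel_measurable_continuous_onI)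
  obtain B where B: "B \<ge> 0" "\<And>x. x \<in> K \<Longrightarrow> \<bar>g x\<bar> \<le> B"
    unfolding K_def using cont_bounded_torus[OF cont] by blast
  have int: "integrable lborel (\<lambda>x. indicator S x * g x)" if "S \<in> sets borel" "S \<subseteq> K" for S
  proof (rule Bochner_Integration.integrable_bound)
    show "integrable lborel (\<lambda>x. B * indicator K x)"
      using emeasure_lborel_cbox_finite[of 0 "One :: real ^ 'd"] by (simp add: K_def)
    show "AE x in lborel. norm (indicator S x * g x) \<le> norm (B * indicator K x)"
      using that(2) B by (auto intro!: AE_I2 simp: indicator_def)
  qed (use that in measurable)
  have tr: "(\<integral>x. f (x + v) \<partial>lborel) = (\<integral>x. f x \<partial>lborel)" if [measurable]: "f \<in> borel_measurable borel"
    for f :: "real ^ 'd \<Rightarrow> real" and v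
  proof -
    have "(\<integral>x. f x \<partial>lborel) = (\<integral>x. f x \<partial>distr lborel borel ((+) v))"
      by (simp add: lborel_distr_plus)
    also have "\<dots> = (\<integral>x. f (v + x) \<partial>lborel)" by (subst integral_distr) auto
    finally show ?thesis by (simp add: add.commute)
  qed
  have gper: "g (x - e) = g x" for x
    using per[unfolded torus_periodic_def, rule_format, of "x - e" i] by (simp add: e_def)
  have "(\<integral>x. g (x + t *\<^sub>R e) \<partial>torus) = (\<integral>x. indicator K x * g (x + t *\<^sub>R e) \<partial>lborel)"
    by (simp add: integral_torus_eq K_def)
  also have "\<dots> = (\<integral>x. indicator K (x - t *\<^sub>R e) * g x \<partial>lborel)"
    using tr[of "\<lambda>x. indicator K (x - t *\<^sub>R e) * g x" "t *\<^sub>R e"] Kb by (simp add: measurable_compose_rev)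
  also have "\<dots> = (\<integral>x. indicator A' x * g x + indicator A (x - e) * g (x - e) \<partial>lborel)"
  proof (rule integral_cong_AE)
    have "e \<in> Basis" by (simp add: e_def)
    \<comment> \<open>The two sides can differ only where \<open>x $ i = 1\<close>, the common face
      of the two pieces, and where \<open>x $ i = 1 + t\<close>, the closing face of the translate;
      both are null sets.\<close>
    have ae: "AE x in lborel. x $ i \<noteq> c" for c :: real
      using AE_lborel_inner_neq[OF \<open>e \<in> Basis\<close>, of c] by (simp add: e_def inner_axis)
    show "AE x in lborel. indicator K (x - t *\<^sub>R e) * g x = indicator A' x * g x + indicator A (x - e) * g (x - e)"
      using ae[of 1] ae[of "1 + t"]
    proof eventually_elim
      case (elim x)
      have c: "(x - c *\<^sub>R e) $ k = (if k = i then x $ i - c else x $ k)" for k c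
        by (auto simp: e_def axis_def)
      have c1: "(x - e) $ k = (if k = i then x $ i - 1 else x $ k)" for k
        using c[of 1 k] by simp
      define Q where "Q \<longleftrightarrow> (\<forall>k. k \<noteq> i \<longrightarrow> 0 \<le> x $ k \<and> x $ k \<le> 1)"
      have QK: "(\<forall>k. 0 \<le> x $ k \<and> x $ k \<le> 1) \<longleftrightarrow> Q \<and> 0 \<le> x $ i \<and> x $ i \<le> 1"
        unfolding Q_def by metis
      have 1: "x - t *\<^sub>R e \<in> K \<longleftrightarrow> Q \<and> t \<le> x $ i \<and> x $ i \<le> 1 + t"
        unfolding K_def cube_mem c Q_def by auto
      have 2: "x \<in> A' \<longleftrightarrow> Q \<and> t \<le> x $ i \<and> x $ i \<le> 1"
        unfolding A'_def K_def Int_iff cube_mem QK using t by auto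
      have "(\<forall>k. 0 \<le> (x - e) $ k \<and> (x - e) $ k \<le> 1) \<longleftrightarrow> Q \<and> 1 \<le> x $ i \<and> x $ i \<le> 2"
        unfolding c1 Q_def by auto
      then have 3: "x - e \<in> A \<longleftrightarrow> Q \<and> 1 \<le> x $ i \<and> x $ i < 1 + t"
        unfolding A_def K_def Int_iff cube_mem mem_Collect_eq using c1[of i] t by auto
      have "indicator K (x - t *\<^sub>R e) = (indicator A' x + indicator A (x - e) :: real)"
        unfolding indicator_def using 1 2 3 elim t by auto
      then show ?case by (simp add: gper distrib_right)
    qed
  qed (use Kb Ab in measurable)
  also have "\<dots> = (\<integral>x. indicator A' x * g x \<partial>lborel) + (\<integral>x. indicator A (x - e) * g (x - e) \<partial>lborel)"
  proof (rule Bochner_Integration.integral_add)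
    show "integrable lborel (\<lambda>x. indicator A' x * g x)" by (rule int) (use Ab in \<open>auto simp: A'_def\<close>)
    have "integrable (distr lborel borel ((+) (-e))) (\<lambda>x. indicator A x * g x)"
      unfolding lborel_distr_plus by (rule int) (use Ab in \<open>auto simp: A_def\<close>)
    then show "integrable lborel (\<lambda>x. indicator A (x - e) * g (x - e))"
      by (subst (asm) integrable_distr_eq) (use Ab in auto)
  qed
  also have "(\<integral>x. indicator A (x - e) * g (x - e) \<partial>lborel) = (\<integral>x. indicator A x * g x \<partial>lborel)"
    using tr[of "\<lambda>x. indicator A x * g x" "-e"] Ab by simp
  also have "(\<integral>x. indicator A' x * g x \<partial>lborel) + (\<integral>x. indicator A x * g x \<partial>lborel)
      = (\<integral>x. indicator A' x * g x + indicator A x * g x \<partial>lborel)"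
    by (rule Bochner_Integration.integral_add[symmetric]; rule int) (use Ab in \<open>auto simp: A_def A'_def\<close>)
  also have "\<dots> = (\<integral>x. indicator K x * g x \<partial>lborel)"
    by (intro Bochner_Integration.integral_cong) (auto simp: A_def A'_def indicator_def)
  finally show ?thesis by (simp add: integral_torus_eq K_def e_def)
qed

text \<open>Difference quotients along an axis have integral zero by translation invariance, and
  dominated convergence carries this to the derivative. This is the source of integration by parts
  against characters.\<close>

lemma integral_pderiv1:
  fixes g :: "real ^ 'd \<Rightarrow> real"
  assumes per: "torus_periodic g" and diff: "\<And>x. g differentiable (at x)"
    and cont: "continuous_on UNIV (pderiv1 i g)"
  shows "integral\<^sup>L torus (pderiv1 i g) = 0"
proof -
  define e where "e = (axis i 1 :: real ^ 'd)"
  have gc: "continuous_on UNIV g"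
    using diff by (auto intro!: continuous_at_imp_continuous_on differentiable_imp_continuous_within)
  have der: "((\<lambda>t. g (x + t *\<^sub>R e)) has_real_derivative pderiv1 i g (x + t *\<^sub>R e)) (at t)" for x t
  proof -
    have "(g has_derivative frechet_derivative g (at (x + t *\<^sub>R e))) (at (x + t *\<^sub>R e))"
      using diff by (simp add: frechet_derivative_works)
    moreover have "((\<lambda>t. x + t *\<^sub>R e) has_derivative (\<lambda>h. h *\<^sub>R e)) (at t)"
      by (auto intro!: derivative_eq_intros)
    ultimately have "((\<lambda>t. g (x + t *\<^sub>R e)) has_derivative (\<lambda>h. frechet_derivative g (at (x + t *\<^sub>R e)) (h *\<^sub>R e))) (at t)"
      by (rule has_derivative_compose[rotated])
    moreover have "frechet_derivative g (at (x + t *\<^sub>R e)) (h *\<^sub>R e) = h * pderiv1 i g (x + t *\<^sub>R e)" for h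
      using linear_frechet_derivative[OF diff] by (simp add: linear_cmul pderiv1_def e_def)
    ultimately show ?thesis
      by (simp add: has_field_derivative_def mult_commute_abs)
  qed
  \<comment> \<open>The mean value theorem evaluates the derivative up to one unit beyond
    \<open>x\<close>, so the dominating constant is taken on the doubled cube.\<close>
  obtain B where B: "B \<ge> 0" "\<And>x. x \<in> cbox 0 (2 *\<^sub>R One) \<Longrightarrow> \<bar>pderiv1 i g x\<bar> \<le> B"
  proof -
    have "compact (pderiv1 i g ` cbox 0 (2 *\<^sub>R One))"
      by (intro compact_continuous_image continuous_on_subset[OF cont]) auto
    then obtain B where "\<forall>x\<in>cbox 0 (2 *\<^sub>R One). \<bar>pderiv1 i g x\<bar> \<le> B"
      by (auto dest!: compact_imp_bounded simp: bounded_iff)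
    then show ?thesis by (intro that[of "max B 0"]) fastforce+
  qed
  define h where "h n = inverse (real (Suc n))" for n
  have h: "0 < h n" "h n \<le> 1" for n by (auto simp: h_def field_simps)
  define Q where "Q n x = (g (x + h n *\<^sub>R e) - g x) / h n" for n x
  have "(\<lambda>n. integral\<^sup>L torus (Q n)) \<longlonglongrightarrow> integral\<^sup>L torus (pderiv1 i g)"
  proof (rule integral_dominated_convergence[where w = "\<lambda>_. B"])
    show "pderiv1 i g \<in> borel_measurable torus" by (intro cont_measurable_torus cont)
    show "Q n \<in> borel_measurable torus" for n
      unfolding Q_def
      by (intro cont_measurable_torus continuous_intros continuous_on_compose2[OF gc]) (use h(1)[of n] in auto)
    show "AE x in torus. (\<lambda>n. Q n x) \<longlonglongrightarrow> pderiv1 i g x"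
    proof (rule AE_I2)
      fix x
      have "((\<lambda>t. (g (x + t *\<^sub>R e) - g x) / t) \<longlongrightarrow> pderiv1 i g x) (at 0)"
        using der[of x 0] by (simp add: DERIV_def)
      moreover have "h \<longlonglongrightarrow> 0"
        unfolding h_def by (rule LIMSEQ_inverse_real_of_nat)
      then have "filterlim h (at 0) sequentially"
        using h(1) by (auto simp: filterlim_at less_imp_neq[symmetric])
      ultimately show "(\<lambda>n. Q n x) \<longlonglongrightarrow> pderiv1 i g x"
        unfolding Q_def by (rule filterlim_compose)
    qed
    show "AE x in torus. norm (Q n x) \<le> B" for n
    proof (rule AE_I2)
      fix x :: "real ^ 'd" assume x: "x \<in> space torus"
      obtain z where z: "0 < z" "z < h n" "g (x + h n *\<^sub>R e) - g (x + 0 *\<^sub>R e) = (h n - 0) * pderiv1 i g (x + z *\<^sub>R e)"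
        using MVT2[of 0 "h n" "\<lambda>t. g (x + t *\<^sub>R e)" "\<lambda>t. pderiv1 i g (x + t *\<^sub>R e)"] h(1)[of n] der by blast
      have "0 \<le> (x + z *\<^sub>R e) $ k \<and> (x + z *\<^sub>R e) $ k \<le> 2" for k
        using x z h[of n] unfolding space_torus cube_mem by (auto simp: e_def axis_def add_mono) (smt (verit))+
      then have "x + z *\<^sub>R e \<in> cbox 0 (2 *\<^sub>R One)"
        by (simp add: mem_box_cart)
      from B(2)[OF this] show "norm (Q n x) \<le> B"
        using z(3) h(1)[of n] by (simp add: Q_def)
    qed
  qed simp
  moreover have "integral\<^sup>L torus (Q n) = 0" for n
  proof -
    have "integrable torus (\<lambda>x. g (x + h n *\<^sub>R e))" "integrable torus g"
      by (intro cont_integrable_torus continuous_intros continuous_on_compose2[OF gc] gc; auto)+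
    then show ?thesis
      unfolding Q_def using integral_torus_shift[OF per gc, of "h n" i] h[of n]
      by (simp add: e_def)
  qed
  ultimately show ?thesis by (simp add: LIMSEQ_const_iff)
qed

section \<open>Characters\<close>

definition lattice :: "(real ^ 'd) set" where
  "lattice = {k. \<forall>i. k $ i \<in> \<int>}"

definition cosk :: "real ^ 'd \<Rightarrow> real ^ 'd \<Rightarrow> real" where
  "cosk k y = cos (2 * pi * (k \<bullet> y))"

definition sink :: "real ^ 'd \<Rightarrow> real ^ 'd \<Rightarrow> real" where
  "sink k y = sin (2 * pi * (k \<bullet> y))"

lemma abs_cosk_le [simp]: "\<bar>cosk k y\<bar> \<le> 1" and abs_sink_le [simp]: "\<bar>sink k y\<bar> \<le> 1"
  by (simp_all add: cosk_def sink_def)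

lemma cosk_uminus [simp]: "cosk (- k) = cosk k" and sink_uminus: "sink (- k) x = - sink k x"
  by (auto simp: cosk_def sink_def fun_eq_iff)

lemma periodic_char:
  assumes "k \<in> lattice"
  shows "torus_periodic (cosk k)" "torus_periodic (sink k)"
proof -
  have "\<exists>n. k $ i = of_int n" for i using assms by (auto simp: lattice_def elim: Ints_cases)
  then obtain n where n: "\<And>i. k $ i = of_int (n i)" by metis
  have 1: "2 * pi * (k \<bullet> (x + axis i 1)) = 2 * pi * (k \<bullet> x) + 2 * pi * of_int (n i)" for x i
    by (simp add: inner_add_right inner_axis n algebra_simps)
  have cs: "cos (2 * pi * of_int n) = 1" "sin (2 * pi * of_int n) = 0" for n
    by (metis cos_int_2pin mult.commute mult.left_commute, metis sin_int_2pin mult.commute mult.left_commute)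
  show "torus_periodic (cosk k)" "torus_periodic (sink k)"
    unfolding torus_periodic_def cosk_def sink_def 1 cos_add sin_add cs by auto
qed

lemma cosk_has_derivative:
  "(cosk k has_derivative (\<lambda>h. - (2 * pi * (k \<bullet> h)) * sink k x)) (at x)"
  unfolding cosk_def sink_def by (auto intro!: derivative_eq_intros simp: fun_eq_iff)

lemma sink_has_derivative:
  "(sink k has_derivative (\<lambda>h. (2 * pi * (k \<bullet> h)) * cosk k x)) (at x)"
  unfolding cosk_def sink_def by (auto intro!: derivative_eq_intros simp: fun_eq_iff)

lemma pderiv1_char:
  "pderiv1 i (\<lambda>x. a * cosk k x + b * sink k x) =
     (\<lambda>x. (2 * pi * k $ i * b) * cosk k x + (- 2 * pi * k $ i * a) * sink k x)"
proof
  fix x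
  have "((\<lambda>x. a * cosk k x + b * sink k x) has_derivative
      (\<lambda>h. a * (- (2 * pi * (k \<bullet> h)) * sink k x) + b * ((2 * pi * (k \<bullet> h)) * cosk k x))) (at x)"
    by (intro has_derivative_add has_derivative_mult_right cosk_has_derivative sink_has_derivative)
  from frechet_derivative_at[OF this, symmetric]
  show "pderiv1 i (\<lambda>x. a * cosk k x + b * sink k x) x =
     (2 * pi * k $ i * b) * cosk k x + (- 2 * pi * k $ i * a) * sink k x"
    by (simp add: pderiv1_def inner_axis algebra_simps)
qed

text \<open>Invariance of this two-dimensional span under derivatives is what makes characters
  smooth in the iterated sense required of test functions.\<close>

lemma pderivs_char:
  "\<exists>a' b'. pderivs is (\<lambda>x. a * cosk k x + b * sink k x) = (\<lambda>x. a' * cosk k x + b' * sink k x)"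
proof (induction "is")
  case Nil show ?case by auto
next
  case (Cons i js)
  then obtain a' b' where "pderivs js (\<lambda>x. a * cosk k x + b * sink k x) = (\<lambda>x. a' * cosk k x + b' * sink k x)" by auto
  then show ?case unfolding pderivs_Cons by (simp only: pderiv1_char) blast
qed

lemma test_char: "k \<in> lattice \<Longrightarrow> (\<lambda>x. a * cosk k x + b * sink k x) \<in> test_functions"
proof -
  assume k: "k \<in> lattice"
  have "(\<lambda>x. a * cosk k x + b * sink k x) differentiable (at x)" for a b x
    by (intro differentiable_add differentiable_mult differentiable_const
          differentiableI[OF cosk_has_derivative] differentiableI[OF sink_has_derivative])
  then have "pderivs is (\<lambda>x. a * cosk k x + b * sink k x) differentiable (at x)" for "is" x
    using pderivs_char[of "is" a k b] by metis
  then show ?thesis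
    using periodic_char[OF k] by (simp add: test_functions_def torus_periodic_def)
qed

lemma test_cosk: "k \<in> lattice \<Longrightarrow> cosk k \<in> test_functions"
  and test_sink: "k \<in> lattice \<Longrightarrow> sink k \<in> test_functions"
  using test_char[of k 1 0] test_char[of k 0 1] by simp_all

lemma test_functions_zero: "(\<lambda>x. 0) \<in> test_functions"
  using test_char[of 0 0 0] by (simp add: lattice_def)

lemma test_functions_sum:
  "finite A \<Longrightarrow> (\<And>k. k \<in> A \<Longrightarrow> f k \<in> test_functions) \<Longrightarrow> (\<lambda>x. \<Sum>k\<in>A. f k x) \<in> test_functions"
  by (induction rule: finite_induct) (auto simp: test_functions_zero test_functions_add)

lemma cont_cosk [continuous_intros]: "continuous_on A (cosk k)"
  and cont_sink [continuous_intros]: "continuous_on A (sink k)"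
  unfolding cosk_def[abs_def] sink_def[abs_def] by (intro continuous_intros)+

text \<open>A shift by half a wavelength in a coordinate with \<open>k $ i\<close> nonzero changes
  the sign of both characters. As \<open>k $ i\<close> is an integer, the half wavelength is at most
  one and the translation lemma applies.\<close>

lemma integral_char_zero:
  assumes k: "k \<in> lattice" "k \<noteq> 0"
  shows "integral\<^sup>L torus (cosk k) = 0" "integral\<^sup>L torus (sink k) = 0"
proof -
  obtain i where i: "k $ i \<noteq> 0" using k(2) by (metis vec_eq_iff zero_index)
  obtain n where n: "k $ i = of_int n" using k(1) by (auto simp: lattice_def elim: Ints_cases)
  define t where "t = 1 / (2 * \<bar>k $ i\<bar>)"
  have "\<bar>k $ i\<bar> \<ge> 1" using i n by (metis Ints_of_int Ints_nonzero_abs_ge1 of_int_eq_0_iff)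
  then have t: "0 \<le> t" "t \<le> 1" by (auto simp: t_def field_simps)
  have sh: "2 * pi * (k \<bullet> (x + t *\<^sub>R axis i 1)) = 2 * pi * (k \<bullet> x) + sgn (k $ i) * pi" for x
    using i by (simp add: inner_add_right inner_axis t_def sgn_if field_simps)
  have "cosk k (x + t *\<^sub>R axis i 1) = - cosk k x" "sink k (x + t *\<^sub>R axis i 1) = - sink k x" for x
    unfolding cosk_def sink_def sh using i by (auto simp: sgn_if cos_add sin_add cos_diff sin_diff)
  then show "integral\<^sup>L torus (cosk k) = 0" "integral\<^sup>L torus (sink k) = 0"
    using integral_torus_shift[OF periodic_char(1)[OF k(1)] cont_cosk t, of i]
      integral_torus_shift[OF periodic_char(2)[OF k(1)] cont_sink t, of i] by auto
qed

lemma integral_cosk: "k \<in> lattice \<Longrightarrow> integral\<^sup>L torus (cosk k) = (if k = 0 then 1 else 0)"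
  using integral_char_zero(1)[of k] torus.prob_space by (cases "k = 0") (auto simp: cosk_def[abs_def])

lemma integral_sink: "k \<in> lattice \<Longrightarrow> integral\<^sup>L torus (sink k) = 0"
  using integral_char_zero(2)[of k] by (cases "k = 0") (auto simp: sink_def[abs_def])

lemma lattice_add: "k \<in> lattice \<Longrightarrow> l \<in> lattice \<Longrightarrow> k + l \<in> lattice"
  and lattice_diff: "k \<in> lattice \<Longrightarrow> l \<in> lattice \<Longrightarrow> k - l \<in> lattice"
  and lattice_uminus: "k \<in> lattice \<Longrightarrow> - k \<in> lattice"
  by (auto simp: lattice_def)

text \<open>The cosine is even and the sine odd in the frequency, so \<open>k\<close> and
  \<open>- k\<close> index the same functions up to sign. The second indicator accounts for this; at
  the zero frequency both indicators fire.\<close>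

lemma
  assumes "k \<in> lattice" "l \<in> lattice"
  shows integral_cosk_cosk: "(\<integral>x. cosk k x * cosk l x \<partial>torus) = (of_bool (k = l) + of_bool (k = - l)) / 2"
    and integral_sink_sink: "(\<integral>x. sink k x * sink l x \<partial>torus) = (of_bool (k = l) - of_bool (k = - l)) / 2"
    and integral_cosk_sink: "(\<integral>x. cosk k x * sink l x \<partial>torus) = 0"
proof -
  have int: "integrable torus (cosk m)" "integrable torus (sink m)" for m :: "real ^ 'a"
    by (intro cont_integrable_torus continuous_intros)+
  have e: "k - l = 0 \<longleftrightarrow> k = l" "k + l = 0 \<longleftrightarrow> k = - l" by (auto simp: eq_neg_iff_add_eq_0)
  have 1: "cosk k x * cosk l x = cosk (k - l) x / 2 + cosk (k + l) x / 2" for x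
    by (simp add: cosk_def inner_add_left inner_diff_left distrib_left right_diff_distrib cos_add cos_diff field_simps)
  have 2: "sink k x * sink l x = cosk (k - l) x / 2 - cosk (k + l) x / 2" for x
    by (simp add: cosk_def sink_def inner_add_left inner_diff_left distrib_left right_diff_distrib cos_add cos_diff field_simps)
  have 3: "cosk k x * sink l x = sink (k + l) x / 2 - sink (k - l) x / 2" for x
    by (simp add: cosk_def sink_def inner_add_left inner_diff_left distrib_left right_diff_distrib sin_add sin_diff field_simps)
  show "(\<integral>x. cosk k x * cosk l x \<partial>torus) = (of_bool (k = l) + of_bool (k = - l)) / 2"
    unfolding 1 using assms by (simp add: int integral_cosk lattice_add lattice_diff e add_divide_distrib)
  show "(\<integral>x. sink k x * sink l x \<partial>torus) = (of_bool (k = l) - of_bool (k = - l)) / 2"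
    unfolding 2 using assms by (simp add: int integral_cosk lattice_add lattice_diff e diff_divide_distrib)
  show "(\<integral>x. cosk k x * sink l x \<partial>torus) = 0"
    unfolding 3 using assms by (simp add: int integral_sink lattice_add lattice_diff)
qed

section \<open>Fourier multipliers and Littlewood--Paley blocks\<close>

lemma distr_apply_out: "\<psi> \<notin> test_functions \<Longrightarrow> distr_apply u \<psi> = 0"
  using distr_apply[of u] by auto

lemma distr_apply_add:
  "\<psi> \<in> test_functions \<Longrightarrow> \<eta> \<in> test_functions \<Longrightarrow>
     distr_apply u (\<lambda>x. \<psi> x + \<eta> x) = distr_apply u \<psi> + distr_apply u \<eta>"
  using distr_apply[of u] by auto

lemma distr_apply_scale:
  "\<psi> \<in> test_functions \<Longrightarrow> distr_apply u (\<lambda>x. c * \<psi> x) = c * distr_apply u \<psi>"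
  using distr_apply[of u] by auto

lemma distr_apply_sum:
  "finite A \<Longrightarrow> (\<And>k. k \<in> A \<Longrightarrow> f k \<in> test_functions) \<Longrightarrow>
     distr_apply u (\<lambda>x. \<Sum>k\<in>A. f k x) = (\<Sum>k\<in>A. distr_apply u (f k))"
proof (induction rule: finite_induct)
  case empty
  then show ?case using distr_apply_scale[OF test_functions_zero, of u 0] by simp
next
  case (insert k A)
  then show ?case by (simp add: distr_apply_add test_functions_sum)
qed

lemmas distr_ops = plus_distr.rep_eq minus_distr.rep_eq scaleR_distr.rep_eq uminus_distr.rep_eq zero_distr.rep_eq

lemma distr_apply_fun:
  "integrable torus h \<Longrightarrow> \<psi> \<in> test_functions \<Longrightarrow> distr_apply (distr_of_fun h) \<psi> = (\<integral>x. h x * \<psi> x \<partial>torus)"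
  by (simp add: distr_of_fun.rep_eq)

text \<open>The cutoff of level \<open>J\<close> vanishes outside this ball, so all multipliers up
  to level \<open>J\<close> can be summed over one finite set.\<close>

definition LB :: "nat \<Rightarrow> (real ^ 'd) set" where
  "LB J = {k \<in> lattice. norm k < 2 ^ (J + 1)}"

lemma LB_lattice: "k \<in> LB J \<Longrightarrow> k \<in> lattice"
  by (simp add: LB_def)

lemma LB_uminus [simp]: "- k \<in> LB J \<longleftrightarrow> k \<in> LB J"
  using lattice_uminus[of k] lattice_uminus[of "- k"] by (auto simp: LB_def)

lemma LB_mono: "J \<le> J' \<Longrightarrow> LB J \<subseteq> LB J'"
proof -
  assume "J \<le> J'"
  then have "(2::real) ^ (J + 1) \<le> 2 ^ (J' + 1)" by (intro power_increasing) auto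
  then show ?thesis unfolding LB_def by (auto intro: less_le_trans)
qed

text \<open>Rounding the coordinates down is injective on integer vectors and maps into a finite
  box. The count is needed later, when the decay of single coefficients is summed over a
  block.\<close>

lemma finite_LB [simp]: "finite (LB J :: (real ^ 'd) set)"
  and card_LB: "card (LB J :: (real ^ 'd) set) \<le> (2 * 2 ^ (J + 1) + 1) ^ CARD('d)"
proof -
  define n where "n = (2 ^ (J + 1) :: int)"
  let ?f = "\<lambda>(k :: real ^ 'd) i. \<lfloor>k $ i\<rfloor>"
  let ?S = "PiE (UNIV :: 'd set) (\<lambda>_. {- n..n})"
  have inj: "inj_on ?f (LB J)"
  proof (rule inj_onI)
    fix k l :: "real ^ 'd" assume kl: "k \<in> LB J" "l \<in> LB J" "?f k = ?f l"
    have "k $ i = l $ i" for i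
    proof -
      have "k $ i \<in> \<int>" "l $ i \<in> \<int>" using kl(1,2) by (auto simp: LB_def lattice_def)
      then show ?thesis using fun_cong[OF kl(3), of i] by (auto elim!: Ints_cases)
    qed
    then show "k = l" by (simp add: vec_eq_iff)
  qed
  have sub: "?f ` LB J \<subseteq> ?S"
  proof
    fix g assume "g \<in> ?f ` LB J"
    then obtain k where k: "k \<in> LB J" "g = ?f k" by auto
    have "g i \<in> {-n..n}" for i
    proof -
      have "\<bar>k $ i\<bar> \<le> real_of_int n"
        using component_le_norm_cart[of k i] k(1) by (simp add: LB_def n_def)
      then have "- real_of_int n \<le> k $ i" "k $ i \<le> real_of_int n" by auto
      then show ?thesis
        by (simp add: k(2) le_floor_iff floor_le_iff)
    qed
    then show "g \<in> ?S" by (auto simp: PiE_def extensional_def)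
  qed
  have fin: "finite ?S" by (intro finite_PiE) auto
  show "finite (LB J :: (real ^ 'd) set)"
    using finite_subset[OF sub fin] finite_imageD[OF _ inj] by blast
  have "card (LB J :: (real ^ 'd) set) = card (?f ` LB J)" using card_image[OF inj] by simp
  also have "\<dots> \<le> card ?S" by (intro card_mono fin sub)
  also have "\<dots> = (\<Prod>i\<in>(UNIV :: 'd set). card {-n..n})" by (intro card_PiE) auto
  also have "\<dots> = (2 * 2 ^ (J + 1) + 1) ^ CARD('d)"
  proof -
    have "nat (n + 1 + n) = 2 * 2 ^ (J + 1) + 1"
      by (simp add: n_def nat_add_distrib nat_mult_distrib nat_power_eq flip: mult_2)
    then show ?thesis by (simp add: add.commute)
  qed
  finally show "card (LB J :: (real ^ 'd) set) \<le> (2 * 2 ^ (J + 1) + 1) ^ CARD('d)" .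
qed

text \<open>For an even symbol and a symmetric index set this is the Fourier multiplier operator in
  real form; the imaginary parts cancel between \<open>k\<close> and \<open>- k\<close>.\<close>

definition fmul :: "(real ^ 'd \<Rightarrow> real) \<Rightarrow> (real ^ 'd) set \<Rightarrow> ('d::finite) distr \<Rightarrow> real ^ 'd \<Rightarrow> real" where
  "fmul a K u x = (\<Sum>k\<in>K. a k * (distr_apply u (cosk k) * cosk k x + distr_apply u (sink k) * sink k x))"

text \<open>The real part of the k-th Fourier coefficient of \<open>u\<close> times the conjugate of
  that of \<open>v\<close>.\<close>

definition cprod :: "('d::finite) distr \<Rightarrow> 'd distr \<Rightarrow> real ^ 'd \<Rightarrow> real" where
  "cprod u v k = distr_apply u (cosk k) * distr_apply v (cosk k) + distr_apply u (sink k) * distr_apply v (sink k)"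

lemma cprod_commute: "cprod u v k = cprod v u k"
  by (simp add: cprod_def mult.commute)

lemma cprod_nonneg: "cprod u u k \<ge> 0"
  by (simp add: cprod_def)

lemma fmul_test: "K \<subseteq> lattice \<Longrightarrow> finite K \<Longrightarrow> fmul a K u \<in> test_functions"
  unfolding fmul_def[abs_def]
  by (intro test_functions_sum test_functions_scale test_char) auto

lemma distr_fmul:
  assumes "K \<subseteq> lattice" "finite K"
  shows "distr_apply u (fmul a K v) = (\<Sum>k\<in>K. a k * cprod u v k)"
proof -
  have "distr_apply u (\<lambda>x. a k * (distr_apply v (cosk k) * cosk k x + distr_apply v (sink k) * sink k x))
      = a k * cprod u v k" if "k \<in> lattice" for k
    using that
    by (simp add: distr_apply_scale distr_apply_add test_functions_scale test_char test_cosk test_sink cprod_def)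
  then show ?thesis
    unfolding fmul_def[abs_def] using assms
    by (subst distr_apply_sum) (auto intro!: test_functions_scale test_char sum.cong)
qed

lemma fmul_cont [continuous_intros]: "continuous_on A (fmul a K u)"
  unfolding fmul_def[abs_def] by (intro continuous_intros)

lemma fmul_diff_mult: "fmul a K u x - fmul b K u x = fmul (\<lambda>k. a k - b k) K u x"
  by (simp add: fmul_def sum_subtractf left_diff_distrib)

lemma fmul_add: "fmul a K (u + v) x = fmul a K u x + fmul a K v x"
  and fmul_diff: "fmul a K (u - v) x = fmul a K u x - fmul a K v x"
  and fmul_scale: "fmul a K (c *\<^sub>R u) x = c * fmul a K u x"
  by (simp_all add: fmul_def distr_ops sum.distrib[symmetric] sum_subtractf[symmetric] sum_distrib_left)
     (auto intro!: sum.cong simp: algebra_simps)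

text \<open>Parseval for trigonometric polynomials. In the double sum over frequencies only
  \<open>l = k\<close> and \<open>l = - k\<close> survive, each with weight one half; evenness of
  \<open>b\<close> makes the two contributions equal.\<close>

lemma integral_fmul_fmul:
  fixes u v :: "('d::finite) distr"
  assumes ev: "\<And>k. b (- k) = b k"
  shows "(\<integral>x. fmul a (LB J) u x * fmul b (LB J) v x \<partial>torus) = (\<Sum>k\<in>LB J. a k * b k * cprod u v k)"
proof -
  let ?C = "\<lambda>k. distr_apply u (cosk k)" and ?S = "\<lambda>k. distr_apply u (sink k)"
  let ?C' = "\<lambda>k. distr_apply v (cosk k)" and ?S' = "\<lambda>k. distr_apply v (sink k)"
  have S'm: "?S' (- k) = - ?S' k" if "k \<in> lattice" for k
  proof -
    have "sink (- k) = (\<lambda>x. (-1) * sink k x)" by (auto simp: sink_uminus)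
    then show ?thesis using distr_apply_scale[OF test_sink[OF that], of v "-1"] by simp
  qed
  have int: "integrable torus (\<lambda>x. f x * g x)" if "continuous_on UNIV f" "continuous_on UNIV g" for f g :: "real ^ 'd \<Rightarrow> real"
    by (intro cont_integrable_torus continuous_intros that)
  note ints = int[OF cont_cosk cont_cosk] int[OF cont_sink cont_sink] int[OF cont_cosk cont_sink] int[OF cont_sink cont_cosk]
  have one: "(\<integral>x. (a k * (?C k * cosk k x + ?S k * sink k x)) * (b l * (?C' l * cosk l x + ?S' l * sink l x)) \<partial>torus)
     = a k * b l * (?C k * ?C' l * (of_bool (k = l) + of_bool (k = - l)) / 2 + ?S k * ?S' l * (of_bool (k = l) - of_bool (k = - l)) / 2)"
    if kl: "k \<in> lattice" "l \<in> lattice" for k l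
  proof -
    have sc: "(\<integral>x. sink k x * cosk l x \<partial>torus) = 0"
      using integral_cosk_sink[OF kl(2,1)] by (simp add: mult.commute)
    have e: "(a k * (?C k * cosk k x + ?S k * sink k x)) * (b l * (?C' l * cosk l x + ?S' l * sink l x)) =
      a k * b l * (?C k * ?C' l * (cosk k x * cosk l x) + ?S k * ?S' l * (sink k x * sink l x)
       + ?C k * ?S' l * (cosk k x * sink l x) + ?S k * ?C' l * (sink k x * cosk l x))" for x
      by (simp add: algebra_simps)
    show ?thesis
      unfolding e by (simp add: ints integral_cosk_cosk integral_sink_sink integral_cosk_sink kl sc)
  qed
  have "(\<integral>x. fmul a (LB J) u x * fmul b (LB J) v x \<partial>torus) =
     (\<Sum>k\<in>LB J. \<Sum>l\<in>LB J. (\<integral>x. (a k * (?C k * cosk k x + ?S k * sink k x)) * (b l * (?C' l * cosk l x + ?S' l * sink l x)) \<partial>torus))"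
    unfolding fmul_def sum_product
    by (subst Bochner_Integration.integral_sum, (intro Bochner_Integration.integrable_sum int continuous_intros)+)
       (intro sum.cong refl Bochner_Integration.integral_sum int continuous_intros)
  also have "\<dots> = (\<Sum>k\<in>LB J. \<Sum>l\<in>LB J. (if l = k then a k * b k * cprod u v k / 2 else 0) + (if l = - k then a k * b k * cprod u v k / 2 else 0))"
  proof (intro sum.cong refl)
    fix k l :: "real ^ 'd" assume "k \<in> LB J" "l \<in> LB J"
    then have kl: "k \<in> lattice" "l \<in> lattice" by (auto simp: LB_lattice)
    show "(\<integral>x. (a k * (?C k * cosk k x + ?S k * sink k x)) * (b l * (?C' l * cosk l x + ?S' l * sink l x)) \<partial>torus) =
        (if l = k then a k * b k * cprod u v k / 2 else 0) + (if l = - k then a k * b k * cprod u v k / 2 else 0)"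
    proof (cases "k = 0")
      \<comment> \<open>At the zero frequency the diagonal and the antidiagonal entry coincide, and
        the sine coefficient vanishes because it is odd in \<open>k\<close>.\<close>
      case True
      then show ?thesis
        unfolding one[OF kl] using S'm[OF kl(1)] by (auto simp: cprod_def)
    next
      case False
      have nk: "k \<noteq> - k"
      proof
        assume "k = - k"
        then have "k $ i = - (k $ i)" for i by (metis uminus_vec_def vec_lambda_beta vector_uminus_component)
        then show False using False by (simp add: vec_eq_iff)
      qed
      then have nk': "- k \<noteq> k" by metis
      consider "l = k" | "l = - k" | "l \<noteq> k" "l \<noteq> - k" by blast
      then show ?thesis
      proof cases
        case 1
        then show ?thesis unfolding one[OF kl] using nk by (simp add: cprod_def field_simps)
      next
        case 2
        then show ?thesis
          unfolding one[OF kl] using nk nk' S'm[OF kl(1)] ev[of k] by (simp add: cprod_def field_simps)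
      next
        case 3
        then have "k \<noteq> l" "k \<noteq> - l" by auto
        then show ?thesis unfolding one[OF kl] using 3 by simp
      qed
    qed
  qed
  also have "\<dots> = (\<Sum>k\<in>LB J. a k * b k * cprod u v k)"
    by (intro sum.cong refl) (simp add: sum.distrib)
  finally show ?thesis .
qed

section \<open>Symbols of the dyadic cutoffs and blocks\<close>

definition lpm :: "nat \<Rightarrow> real ^ 'd \<Rightarrow> real" where
  "lpm J k = lp_cutoff (k /\<^sub>R 2 ^ J)"

definition blm :: "nat \<Rightarrow> real ^ 'd \<Rightarrow> real" where
  "blm j k = (if j = 0 then lpm 0 k else lpm j k - lpm (j - 1) k)"

lemma lp_cutoff_range: "0 \<le> lp_cutoff x" "lp_cutoff x \<le> 1"
proof -
  have "exp_bump t \<ge> 0" for t by (simp add: exp_bump_def)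
  then show "0 \<le> lp_cutoff x" "lp_cutoff x \<le> 1"
    unfolding lp_cutoff_def by (auto intro!: divide_nonneg_nonneg add_nonneg_nonneg simp: divide_le_eq_1)
       (smt (verit))
qed

lemma lpm_range: "0 \<le> lpm J k" "lpm J k \<le> 1"
  by (simp_all add: lpm_def lp_cutoff_range)

lemma lpm_uminus [simp]: "lpm J (- k) = lpm J k" and blm_uminus [simp]: "blm J (- k) = blm J k"
  by (simp_all add: lpm_def blm_def lp_cutoff_def)

lemma lpm_one: "norm k \<le> 2 ^ J \<Longrightarrow> lpm J k = 1"
proof -
  assume "norm k \<le> 2 ^ J"
  then have "norm (k /\<^sub>R 2 ^ J) \<le> 1" by (simp add: divide_simps)
  then show ?thesis by (simp add: lpm_def lp_cutoff_def exp_bump_def)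
qed

lemma lpm_zero: "norm k \<ge> 2 ^ (J + 1) \<Longrightarrow> lpm J k = 0"
  by (simp add: lpm_def lp_cutoff_def exp_bump_def divide_simps)

lemma abs_blm_le: "\<bar>blm j k\<bar> \<le> 1"
  using lpm_range[of j k] lpm_range[of "j - 1" k] by (auto simp: blm_def)

lemma blm_low: "j > 0 \<Longrightarrow> norm k \<le> 2 ^ (j - 1) \<Longrightarrow> blm j k = 0"
proof -
  assume j: "j > 0" and k: "norm k \<le> 2 ^ (j - 1)"
  have "(2::real) ^ (j - 1) \<le> 2 ^ j" by (intro power_increasing) auto
  then have "lpm j k = 1" "lpm (j - 1) k = 1" using order_trans[OF k] k by (simp_all add: lpm_one)
  then show ?thesis using j by (simp add: blm_def)
qed

lemma blm_zero: "norm k \<ge> 2 ^ (j + 1) \<Longrightarrow> blm j k = 0"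
proof -
  assume k: "norm k \<ge> 2 ^ (j + 1)"
  have "(2::real) ^ (j - 1 + 1) \<le> 2 ^ (j + 1)" by (intro power_increasing) auto
  then have "lpm j k = 0" "lpm (j - 1) k = 0" using order_trans[OF _ k] k by (simp_all only: lpm_zero)
  then show ?thesis by (cases "j = 0") (simp_all add: blm_def)
qed

lemma fmul_extend:
  assumes "J \<le> J'" "\<And>k. norm k \<ge> 2 ^ (J + 1) \<Longrightarrow> a k = 0"
  shows "fmul a (LB J) u x = fmul a (LB J') u x"
  unfolding fmul_def using LB_mono[OF assms(1)] assms(2)
  by (intro sum.mono_neutral_left finite_LB) (auto simp: LB_def not_less)

lemma lp_partial_eq: "J \<le> J' \<Longrightarrow> lp_partial J u x = fmul (lpm J) (LB J') u x"
  by (subst fmul_extend[symmetric], assumption, simp add: lpm_zero)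
     (simp add: lp_partial_def fmul_def LB_def lattice_def lpm_def cosk_def[abs_def] sink_def[abs_def])

lemma lp_block_eq: "j \<le> J' \<Longrightarrow> lp_block j u x = fmul (blm j) (LB J') u x"
  by (auto simp: lp_block_def lp_partial_eq[of _ J'] fmul_diff_mult) (auto simp: blm_def fmul_def)

lemma lp_partial_fmul: "lp_partial J u = fmul (lpm J) (LB J) u"
  and lp_block_fmul: "lp_block j u = fmul (blm j) (LB j) u"
  by (auto simp: lp_partial_eq[of J J] lp_block_eq[of j j] fun_eq_iff)

lemma lp_partial_sum: "lp_partial J u x = (\<Sum>j\<le>J. lp_block j u x)"
  by (induction J) (auto simp: lp_block_def)

lemma LB_sub: "LB J \<subseteq> lattice" by (auto simp: LB_def)

lemma lp_partial_test: "lp_partial J u \<in> test_functions"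
  and lp_block_test: "lp_block J u \<in> test_functions"
  by (simp_all add: lp_partial_fmul lp_block_fmul fmul_test LB_sub)

lemma lp_partial_cont [continuous_intros]: "continuous_on A (lp_partial J u)"
  and lp_block_cont [continuous_intros]: "continuous_on A (lp_block J u)"
  by (simp_all add: lp_partial_fmul lp_block_fmul continuous_intros)

lemma distr_lp_partial: "distr_apply u (lp_partial J v) = (\<Sum>k\<in>LB J. lpm J k * cprod u v k)"
  and distr_lp_block: "distr_apply u (lp_block J v) = (\<Sum>k\<in>LB J. blm J k * cprod u v k)"
  by (simp_all add: lp_partial_fmul lp_block_fmul distr_fmul LB_sub)

lemma distr_lp_partial_commute: "distr_apply u (lp_partial J v) = distr_apply v (lp_partial J u)"
  by (simp add: distr_lp_partial cprod_commute)

lemma distr_lp_partial_sum: "distr_apply u (lp_partial J v) = (\<Sum>j\<le>J. distr_apply u (lp_block j v))"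
proof -
  have "lp_partial J v = (\<lambda>x. \<Sum>j\<in>{..J}. lp_block j v x)" by (auto simp: lp_partial_sum)
  then show ?thesis by (simp add: distr_apply_sum lp_block_test)
qed

text \<open>The symbols telescope to the difference of the cutoffs of levels \<open>j + 1\<close>
  and \<open>j - 2\<close>, which are one and zero where \<open>blm j\<close> does not vanish. For
  \<open>j\<close> at most one the truncated subtraction starts the range at level 0, and nothing is
  subtracted.\<close>

lemma blm_neighbours: "(\<Sum>i\<in>{j - 1..j + 1}. blm i k) * blm j k = blm j k"
proof (cases "blm j k = 0")
  case False
  then have up: "norm k < 2 ^ (j + 1)" and low: "j > 0 \<Longrightarrow> norm k > 2 ^ (j - 1)"
    using blm_zero[of j k] blm_low[of j k] by fastforce+
  have one: "lpm (j + 1) k = 1" using up by (intro lpm_one) auto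
  have "(\<Sum>i\<in>{j - 1..j + 1}. blm i k) = 1"
  proof (cases "j \<ge> 2")
    case True
    then obtain i where i: "j = i + 2" by (metis le_add_diff_inverse2)
    have "lpm i k = 0" using low i by (intro lpm_zero) auto
    moreover have "{j - 1..j + 1} = {i + 1, i + 2, i + 3}" using i by auto
    ultimately show ?thesis using one i by (simp add: blm_def numeral_eq_Suc)
  next
    case False
    then consider "j = 0" | "j = 1" by linarith
    then show ?thesis
    proof cases
      case 1
      have "{0..1::nat} = {0, 1}" by auto
      then show ?thesis using 1 one by (simp add: blm_def)
    next
      case 2
      have "{0..2::nat} = {0, 1, 2}" by auto
      then show ?thesis using 2 one by (simp add: blm_def numeral_eq_Suc)
    qed
  qed
  then show ?thesis by simp
qed simp

text \<open>Inserting the neighbouring blocks into the symbol turns the action of a distribution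
  into integrals of products of functions, to which Hoelder's inequality applies.\<close>

lemma distr_lp_block_integral:
  "distr_apply u (lp_block j v) = (\<Sum>i\<in>{j - 1..j + 1}. \<integral>x. lp_block i u x * lp_block j v x \<partial>torus)"
proof -
  have "(\<Sum>i\<in>{j - 1..j + 1}. \<integral>x. lp_block i u x * lp_block j v x \<partial>torus) =
     (\<Sum>i\<in>{j - 1..j + 1}. \<Sum>k\<in>LB (j + 1). blm i k * blm j k * cprod u v k)"
    by (intro sum.cong refl) (simp add: lp_block_eq[of _ "j + 1"] integral_fmul_fmul)
  also have "\<dots> = (\<Sum>k\<in>LB (j + 1). (\<Sum>i\<in>{j - 1..j + 1}. blm i k) * blm j k * cprod u v k)"
    by (subst sum.swap) (simp only: sum_distrib_right)
  also have "\<dots> = (\<Sum>k\<in>LB (j + 1). blm j k * cprod u v k)"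
    by (simp only: blm_neighbours)
  also have "\<dots> = (\<Sum>k\<in>LB j. blm j k * cprod u v k)"
    using LB_mono[of j "j + 1"] by (intro sum.mono_neutral_right finite_LB) (auto simp: LB_def not_less blm_zero)
  finally show ?thesis by (simp add: distr_lp_block)
qed

section \<open>Lebesgue norms on the torus\<close>

lemma prob_torus [simp]: "torus.prob (cbox 0 One) = 1"
  using torus.prob_space by simp

definition lpn :: "real \<Rightarrow> (real ^ 'd \<Rightarrow> real) \<Rightarrow> real" where
  "lpn p f = (\<integral>x. \<bar>f x\<bar> powr p \<partial>torus) powr (1 / p)"

lemma lpn_nonneg [simp]: "lpn p f \<ge> 0"
  by (simp add: lpn_def)

text \<open>Young's inequality for the functions normalised to norm one; a vanishing norm cannot be
  normalised and makes the product vanish almost everywhere.\<close>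

lemma Holder_integral:
  fixes f g :: "'a \<Rightarrow> real"
  assumes p: "p > 1" "q > 1" "1 / p + 1 / q = 1"
    and [measurable]: "f \<in> borel_measurable M" "g \<in> borel_measurable M"
    and f: "integrable M (\<lambda>x. \<bar>f x\<bar> powr p)" and g: "integrable M (\<lambda>x. \<bar>g x\<bar> powr q)"
  shows "integrable M (\<lambda>x. f x * g x)"
    and "(\<integral>x. \<bar>f x * g x\<bar> \<partial>M) \<le> (\<integral>x. \<bar>f x\<bar> powr p \<partial>M) powr (1 / p) * (\<integral>x. \<bar>g x\<bar> powr q \<partial>M) powr (1 / q)"
proof -
  have Y: "\<bar>f x * g x\<bar> \<le> \<bar>f x\<bar> powr p / p + \<bar>g x\<bar> powr q / q" for x
    using Youngs_inequality[OF p, of "\<bar>f x\<bar>" "\<bar>g x\<bar>"] by (simp add: abs_mult)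
  show int: "integrable M (\<lambda>x. f x * g x)"
  proof (rule Bochner_Integration.integrable_bound)
    show "integrable M (\<lambda>x. \<bar>f x\<bar> powr p / p + \<bar>g x\<bar> powr q / q)" using f g by simp
    show "AE x in M. norm (f x * g x) \<le> norm (\<bar>f x\<bar> powr p / p + \<bar>g x\<bar> powr q / q)"
      using Y p by (intro AE_I2) (smt (verit) real_norm_def)
  qed measurable
  define A where "A = (\<integral>x. \<bar>f x\<bar> powr p \<partial>M)"
  define B where "B = (\<integral>x. \<bar>g x\<bar> powr q \<partial>M)"
  have AB: "A \<ge> 0" "B \<ge> 0" unfolding A_def B_def by (intro integral_nonneg_AE AE_I2; simp)+
  have z: "(\<integral>x. \<bar>f x * g x\<bar> \<partial>M) = 0" if "A = 0 \<or> B = 0"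
  proof -
    have "(AE x in M. \<bar>f x\<bar> powr p = 0) \<or> (AE x in M. \<bar>g x\<bar> powr q = 0)"
      using that integral_nonneg_eq_0_iff_AE[OF f] integral_nonneg_eq_0_iff_AE[OF g]
      unfolding A_def B_def by auto
    then have "AE x in M. \<bar>f x * g x\<bar> = 0" by (auto simp: powr_eq_0_iff)
    then show ?thesis by (rule integral_eq_zero_AE)
  qed
  have "(\<integral>x. \<bar>f x * g x\<bar> \<partial>M) \<le> A powr (1 / p) * B powr (1 / q)"
  proof (cases "A = 0 \<or> B = 0")
    case False
    then have pos: "A > 0" "B > 0" using AB by auto
    define a where "a = A powr (1 / p)"
    define b where "b = B powr (1 / q)"
    have ab: "a > 0" "b > 0" "a powr p = A" "b powr q = B" using pos p by (auto simp: a_def b_def powr_powr)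
    have Y': "\<bar>f x * g x\<bar> \<le> a * b * (\<bar>f x\<bar> powr p / (A * p) + \<bar>g x\<bar> powr q / (B * q))" for x
    proof -
      have "(\<bar>f x\<bar> / a) * (\<bar>g x\<bar> / b) \<le> (\<bar>f x\<bar> / a) powr p / p + (\<bar>g x\<bar> / b) powr q / q"
        using ab by (intro Youngs_inequality[OF p]) auto
      also have "\<dots> = \<bar>f x\<bar> powr p / (A * p) + \<bar>g x\<bar> powr q / (B * q)"
        using ab by (simp add: powr_divide)
      finally have "\<bar>f x\<bar> * \<bar>g x\<bar> / (a * b) \<le> \<bar>f x\<bar> powr p / (A * p) + \<bar>g x\<bar> powr q / (B * q)" by simp
      then show ?thesis using ab by (simp add: abs_mult pos_divide_le_eq mult.commute)
    qed
    have "(\<integral>x. \<bar>f x * g x\<bar> \<partial>M) \<le> (\<integral>x. a * b * (\<bar>f x\<bar> powr p / (A * p) + \<bar>g x\<bar> powr q / (B * q)) \<partial>M)"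
      using Y' int f g by (intro integral_mono) (auto intro!: integrable_abs)
    also have "\<dots> = a * b * (A / (A * p) + B / (B * q))"
      using f g by (simp add: A_def B_def)
    also have "A / (A * p) + B / (B * q) = 1" using pos p by simp
    finally show ?thesis by (simp add: a_def b_def)
  qed (use z in simp)
  then show "(\<integral>x. \<bar>f x * g x\<bar> \<partial>M) \<le> (\<integral>x. \<bar>f x\<bar> powr p \<partial>M) powr (1 / p) * (\<integral>x. \<bar>g x\<bar> powr q \<partial>M) powr (1 / q)"
    by (simp add: A_def B_def)
qed

lemma cont_powr_integrable:
  fixes f :: "real ^ 'd \<Rightarrow> real"
  assumes "continuous_on UNIV f" "p > 0"
  shows "integrable torus (\<lambda>x. \<bar>f x\<bar> powr p)"
  by (intro cont_integrable_torus continuous_on_powr' continuous_intros assms) (use assms in auto)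

lemma Holder_torus:
  fixes f g :: "real ^ 'd \<Rightarrow> real"
  assumes "p > 1" "q > 1" "1 / p + 1 / q = 1" "continuous_on UNIV f" "continuous_on UNIV g"
  shows "\<bar>\<integral>x. f x * g x \<partial>torus\<bar> \<le> lpn p f * lpn q g"
proof -
  have "\<bar>\<integral>x. f x * g x \<partial>torus\<bar> \<le> (\<integral>x. \<bar>f x * g x\<bar> \<partial>torus)" by (rule integral_abs_bound)
  also have "\<dots> \<le> lpn p f * lpn q g"
    unfolding lpn_def using assms by (intro Holder_integral cont_measurable_torus cont_powr_integrable) auto
  finally show ?thesis .
qed

text \<open>Hoelder against the constant one; the torus has total mass one, so no factor
  appears.\<close>

lemma integral_powr_mono:
  fixes f :: "real ^ 'd \<Rightarrow> real"
  assumes "0 < p" "p \<le> r" and [measurable]: "f \<in> borel_measurable torus"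
    and r: "integrable torus (\<lambda>x. \<bar>f x\<bar> powr r)"
  shows "integrable torus (\<lambda>x. \<bar>f x\<bar> powr p)" "lpn p f \<le> lpn r f"
proof -
  have 1: "integrable torus (\<lambda>x. \<bar>f x\<bar> powr p) \<and> lpn p f \<le> lpn r f"
  proof (cases "p = r")
    case False
    then have pr: "p < r" using assms by simp
    let ?s = "r / p" and ?s' = "r / (r - p)"
    have c: "?s > 1" "?s' > 1" "1 / ?s + 1 / ?s' = 1" using assms pr by (auto simp: field_simps)
    have r': "integrable torus (\<lambda>x. \<bar>\<bar>f x\<bar> powr p\<bar> powr ?s)" "integrable torus (\<lambda>x::real^'d. \<bar>1::real\<bar> powr ?s')"
      using r assms by (simp_all add: powr_powr)
    note H = Holder_integral[OF c _ _ r']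
    have "integrable torus (\<lambda>x. \<bar>f x\<bar> powr p)" using H(1) by simp
    moreover have "(\<integral>x. \<bar>f x\<bar> powr p \<partial>torus) \<le> (\<integral>x. \<bar>f x\<bar> powr r \<partial>torus) powr (p / r)"
      using H(2) assms by (simp add: powr_powr)
    then have "lpn p f \<le> ((\<integral>x. \<bar>f x\<bar> powr r \<partial>torus) powr (p / r)) powr (1 / p)"
      unfolding lpn_def using assms by (intro powr_mono2) (auto intro!: integral_nonneg_AE)
    ultimately show ?thesis using assms by (simp add: lpn_def powr_powr)
  qed (use r in auto)
  then show "integrable torus (\<lambda>x. \<bar>f x\<bar> powr p)" "lpn p f \<le> lpn r f" by auto
qed

lemma lpn_mono_exponent:
  fixes f :: "real ^ 'd \<Rightarrow> real"
  assumes "continuous_on UNIV f" "0 < p" "p \<le> r"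
  shows "lpn p f \<le> lpn r f"
  by (rule integral_powr_mono(2)) (use assms in \<open>auto intro!: cont_measurable_torus cont_powr_integrable\<close>)

lemma Lp_norm_torus:
  fixes f :: "real ^ 'd \<Rightarrow> real"
  assumes "p > 0" "integrable torus (\<lambda>x. \<bar>f x\<bar> powr p)"
  shows "Lp_norm torus (ennreal p) (\<lambda>x. ennreal \<bar>f x\<bar>) = ennreal (lpn p f)"
proof -
  have "(\<integral>\<^sup>+ x. enn_powr (ennreal \<bar>f x\<bar>) p \<partial>torus) = ennreal (\<integral>x. \<bar>f x\<bar> powr p \<partial>torus)"
    using assms(2) by (simp add: enn_powr_def nn_integral_eq_integral)
  then show ?thesis using assms(1)
    by (simp add: Lp_norm_def lpn_def enn_powr_def integral_nonneg_AE)
qed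

lemma Lp_norm_cont:
  fixes f :: "real ^ 'd \<Rightarrow> real"
  assumes "p > 0" "continuous_on UNIV f"
  shows "Lp_norm torus (ennreal p) (\<lambda>x. ennreal \<bar>f x\<bar>) = ennreal (lpn p f)"
  using assms by (intro Lp_norm_torus cont_powr_integrable)

section \<open>Duality of Besov spaces through blocks\<close>

lemma distr_lp_block_le:
  fixes u v :: "('d::finite) distr"
  assumes p: "p > 1" "p' > 1" "1 / p' + 1 / p = 1" and A: "\<And>j. lpn p' (lp_block j u) \<le> A * 2 powr (- (real j * \<tau>))"
    and A0: "A \<ge> 0"
  shows "\<bar>distr_apply u (lp_block j v)\<bar> \<le> 3 * 2 powr \<bar>\<tau>\<bar> * A * (2 powr (- (real j * \<tau>)) * lpn p (lp_block j v))"
proof -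
  have "\<bar>distr_apply u (lp_block j v)\<bar> \<le> (\<Sum>i\<in>{j - 1..j + 1}. \<bar>\<integral>x. lp_block i u x * lp_block j v x \<partial>torus\<bar>)"
    unfolding distr_lp_block_integral by (rule sum_abs)
  also have "\<dots> \<le> (\<Sum>i\<in>{j - 1..j + 1}. 2 powr \<bar>\<tau>\<bar> * A * (2 powr (- (real j * \<tau>)) * lpn p (lp_block j v)))"
  proof (rule sum_mono)
    fix i assume i: "i \<in> {j - 1..j + 1}"
    have "\<bar>\<integral>x. lp_block i u x * lp_block j v x \<partial>torus\<bar> \<le> lpn p' (lp_block i u) * lpn p (lp_block j v)"
      by (intro Holder_torus p continuous_intros)
    also have "\<dots> \<le> (A * 2 powr (- (real i * \<tau>))) * lpn p (lp_block j v)"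
      by (intro mult_right_mono A) auto
    also have "\<dots> \<le> (A * (2 powr \<bar>\<tau>\<bar> * 2 powr (- (real j * \<tau>)))) * lpn p (lp_block j v)"
    proof (intro mult_right_mono mult_left_mono A0)
      \<comment> \<open>Levels of overlapping blocks differ by at most one, so exchanging the weight
        of level \<open>i\<close> for that of level \<open>j\<close> costs at most
        \<open>2 powr \<bar>\<tau>\<bar>\<close>.\<close>
      have "(real j - real i) * \<tau> \<le> \<bar>real j - real i\<bar> * \<bar>\<tau>\<bar>" by (metis abs_ge_self abs_mult)
      also have "\<dots> \<le> 1 * \<bar>\<tau>\<bar>" using i by (intro mult_right_mono) auto
      finally show "2 powr (- (real i * \<tau>)) \<le> 2 powr \<bar>\<tau>\<bar> * 2 powr (- (real j * \<tau>))"
        by (simp add: powr_add[symmetric] algebra_simps)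
    qed auto
    finally show "\<bar>\<integral>x. lp_block i u x * lp_block j v x \<partial>torus\<bar> \<le> 2 powr \<bar>\<tau>\<bar> * A * (2 powr (- (real j * \<tau>)) * lpn p (lp_block j v))"
      by (simp add: mult_ac)
  qed
  also have "\<dots> \<le> 3 * (2 powr \<bar>\<tau>\<bar> * A * (2 powr (- (real j * \<tau>)) * lpn p (lp_block j v)))"
    unfolding sum_constant using A0 by (intro mult_right_mono) (auto intro!: mult_nonneg_nonneg)
  finally show ?thesis by (simp add: mult_ac)
qed

text \<open>The values on \<open>lp_partial J v\<close> are the partial sums of an absolutely
  convergent series over blocks. The majorant \<open>B\<close> is left open: it will be a geometric
  sequence for convergence alone and a minimum of two bounds for interpolation.\<close>

lemma pairing_bound:
  fixes u v :: "('d::finite) distr"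
  assumes p: "p > 1" "p' > 1" "1 / p' + 1 / p = 1" and A: "\<And>j. lpn p' (lp_block j u) \<le> A * 2 powr (- (real j * \<tau>))"
    and A0: "A \<ge> 0"
    and B: "\<And>j. 2 powr (- (real j * \<tau>)) * lpn p (lp_block j v) \<le> B j" "summable B"
  shows "convergent (\<lambda>J. distr_apply u (lp_partial J v))"
    and "\<bar>pairing u v\<bar> \<le> 3 * 2 powr \<bar>\<tau>\<bar> * A * suminf B"
proof -
  let ?K = "3 * 2 powr \<bar>\<tau>\<bar> * A"
  have bd: "\<bar>distr_apply u (lp_block j v)\<bar> \<le> ?K * B j" for j
    using order_trans[OF distr_lp_block_le[OF p A A0] mult_left_mono[OF B(1)]] A0 by simp
  have sK: "summable (\<lambda>j. ?K * B j)" using B(2) by (rule summable_mult)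
  then have sa: "summable (\<lambda>j. \<bar>distr_apply u (lp_block j v)\<bar>)"
    by (rule summable_comparison_test') (use bd in auto)
  then have s: "summable (\<lambda>j. distr_apply u (lp_block j v))" by (rule summable_rabs_cancel)
  then have lim: "(\<lambda>J. distr_apply u (lp_partial J v)) \<longlonglongrightarrow> (\<Sum>j. distr_apply u (lp_block j v))"
    unfolding distr_lp_partial_sum using summable_LIMSEQ' by blast
  then show "convergent (\<lambda>J. distr_apply u (lp_partial J v))" by (rule convergentI)
  have "pairing u v = (\<Sum>j. distr_apply u (lp_block j v))"
    using lim by (simp add: pairing_def limI)
  also have "\<bar>\<dots>\<bar> \<le> (\<Sum>j. \<bar>distr_apply u (lp_block j v)\<bar>)" by (rule summable_rabs[OF sa])
  also have "\<dots> \<le> (\<Sum>j. ?K * B j)" by (intro suminf_le bd sa sK)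
  also have "\<dots> = ?K * suminf B" using B(2) by (rule suminf_mult)
  finally show "\<bar>pairing u v\<bar> \<le> ?K * suminf B" .
qed

section \<open>Parseval's identity\<close>

definition L2fun :: "(real ^ 'd \<Rightarrow> real) \<Rightarrow> bool" where
  "L2fun h \<longleftrightarrow> h \<in> borel_measurable torus \<and> integrable torus (\<lambda>x. (h x)\<^sup>2)"

definition n2 :: "(real ^ 'd \<Rightarrow> real) \<Rightarrow> real" where
  "n2 h = sqrt (\<integral>x. (h x)\<^sup>2 \<partial>torus)"

lemma n2_nonneg [simp]: "n2 h \<ge> 0" and n2_sq: "(n2 h)\<^sup>2 = (\<integral>x. (h x)\<^sup>2 \<partial>torus)"
  by (simp_all add: n2_def)

lemma L2fun_cont: "continuous_on UNIV h \<Longrightarrow> L2fun h"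
  unfolding L2fun_def by (intro conjI cont_measurable_torus cont_integrable_torus continuous_intros)

lemma L2fun_measurable: "L2fun h \<Longrightarrow> h \<in> borel_measurable torus"
  by (simp add: L2fun_def)

lemma L2fun_integrable: "L2fun h \<Longrightarrow> integrable torus h"
  unfolding L2fun_def by (elim conjE) (rule torus.square_integrable_imp_integrable)

lemma L2fun_mult_integrable:
  assumes "L2fun f" "L2fun g" shows "integrable torus (\<lambda>x. f x * g x)"
proof (rule Bochner_Integration.integrable_bound)
  show "integrable torus (\<lambda>x. (f x)\<^sup>2 + (g x)\<^sup>2)" using assms by (simp add: L2fun_def)
  have "\<bar>f x * g x\<bar> \<le> (f x)\<^sup>2 + (g x)\<^sup>2" for x
  proof -
    have "2 * (\<bar>f x\<bar> * \<bar>g x\<bar>) \<le> (f x)\<^sup>2 + (g x)\<^sup>2"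
      using sum_squares_bound[of "\<bar>f x\<bar>" "\<bar>g x\<bar>"] by simp
    moreover have "0 \<le> \<bar>f x\<bar> * \<bar>g x\<bar>" by simp
    ultimately show ?thesis unfolding abs_mult by linarith
  qed
  then show "AE x in torus. norm (f x * g x) \<le> norm ((f x)\<^sup>2 + (g x)\<^sup>2)" by (intro AE_I2) simp
qed (use assms in \<open>auto simp: L2fun_def\<close>)

lemma L2fun_scale: "L2fun f \<Longrightarrow> L2fun (\<lambda>x. c * f x)"
  unfolding L2fun_def by (elim conjE) (simp add: power_mult_distrib)

lemma L2fun_add: assumes "L2fun f" "L2fun g" shows "L2fun (\<lambda>x. f x + g x)"
proof -
  have "(\<lambda>x. (f x + g x)\<^sup>2) = (\<lambda>x. (f x)\<^sup>2 + (g x)\<^sup>2 + 2 * (f x * g x))" by (auto simp: power2_sum)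
  then show ?thesis using assms L2fun_mult_integrable[OF assms] unfolding L2fun_def by (elim conjE) simp
qed

lemma L2fun_diff: "L2fun f \<Longrightarrow> L2fun g \<Longrightarrow> L2fun (\<lambda>x. f x - g x)"
  using L2fun_add[OF _ L2fun_scale[of g "-1"], of f] by simp

lemma L2fun_bounded:
  fixes f :: "real ^ 'd \<Rightarrow> real"
  assumes "f \<in> borel_measurable torus" "\<And>x. x \<in> cbox 0 One \<Longrightarrow> \<bar>f x\<bar> \<le> B"
  shows "L2fun f"
proof -
  have "(f x)\<^sup>2 \<le> B\<^sup>2" if "x \<in> cbox 0 One" for x
    using assms(2)[OF that] by (metis abs_ge_zero power2_abs power_mono)
  then show ?thesis
    unfolding L2fun_def using assms(1)
    by (intro conjI torus.integrable_const_bound[of _ "B\<^sup>2"] AE_I2) auto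
qed

lemma L2_Cauchy_Schwarz:
  assumes "L2fun f" "L2fun g" shows "\<bar>\<integral>x. f x * g x \<partial>torus\<bar> \<le> n2 f * n2 g"
proof -
  have "\<bar>\<integral>x. f x * g x \<partial>torus\<bar> \<le> (\<integral>x. \<bar>f x * g x\<bar> \<partial>torus)" by (rule integral_abs_bound)
  also have "\<dots> \<le> (\<integral>x. \<bar>f x\<bar> powr 2 \<partial>torus) powr (1 / 2) * (\<integral>x. \<bar>g x\<bar> powr 2 \<partial>torus) powr (1 / 2)"
    using assms by (intro Holder_integral(2)) (auto simp: L2fun_def)
  finally show ?thesis by (simp add: n2_def powr_half_sqrt integral_nonneg_AE)
qed

lemma n2_add_le:
  assumes "L2fun f" "L2fun g" shows "n2 (\<lambda>x. f x + g x) \<le> n2 f + n2 g"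
proof (rule power2_le_imp_le)
  have "(n2 (\<lambda>x. f x + g x))\<^sup>2 = (\<integral>x. (f x)\<^sup>2 + (g x)\<^sup>2 + 2 * (f x * g x) \<partial>torus)"
    unfolding n2_sq by (intro Bochner_Integration.integral_cong) (auto simp: power2_sum)
  also have "\<dots> = (n2 f)\<^sup>2 + (n2 g)\<^sup>2 + 2 * (\<integral>x. f x * g x \<partial>torus)"
    using assms L2fun_mult_integrable[OF assms] by (simp add: n2_sq L2fun_def)
  also have "\<dots> \<le> (n2 f + n2 g)\<^sup>2"
    using L2_Cauchy_Schwarz[OF assms] by (simp add: power2_sum)
  finally show "(n2 (\<lambda>x. f x + g x))\<^sup>2 \<le> (n2 f + n2 g)\<^sup>2" .
qed simp

lemma n2_scale: "n2 (\<lambda>x. c * f x) = \<bar>c\<bar> * n2 f"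
  by (simp add: n2_def power_mult_distrib real_sqrt_mult)

lemma n2_minus_commute: "n2 (\<lambda>x. f x - g x) = n2 (\<lambda>x. g x - f x)"
  by (simp add: n2_def power2_commute)

lemma lpn_2: "lpn 2 h = n2 h"
  by (simp add: lpn_def n2_def powr_half_sqrt integral_nonneg_AE)

lemma distr_of_fun_diff: "integrable torus f \<Longrightarrow> integrable torus g \<Longrightarrow>
    distr_of_fun (\<lambda>x. f x - g x) = distr_of_fun f - distr_of_fun g"
  and distr_of_fun_add: "integrable torus f \<Longrightarrow> integrable torus g \<Longrightarrow>
    distr_of_fun (\<lambda>x. f x + g x) = distr_of_fun f + distr_of_fun g"
  and distr_of_fun_scale: "integrable torus f \<Longrightarrow> distr_of_fun (\<lambda>x. c * f x) = c *\<^sub>R distr_of_fun f"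
  by (auto intro!: distr_apply_inject[THEN iffD1]
      simp: distr_ops distr_of_fun.rep_eq fun_eq_iff left_diff_distrib distrib_right integrable_mult_test_function mult.assoc)

section \<open>Mean-square convergence of the Littlewood--Paley partial sums\<close>

abbreviation SJ :: "nat \<Rightarrow> (real ^ 'd \<Rightarrow> real) \<Rightarrow> real ^ 'd \<Rightarrow> real" where
  "SJ J g \<equiv> lp_partial J (distr_of_fun g)"

lemma lp_partial_diff: "lp_partial J (u - v) x = lp_partial J u x - lp_partial J v x"
  and lp_partial_add: "lp_partial J (u + v) x = lp_partial J u x + lp_partial J v x"
  and lp_partial_scale: "lp_partial J (c *\<^sub>R u) x = c * lp_partial J u x"
  by (simp_all add: lp_partial_fmul fmul_diff fmul_add fmul_scale)

lemma L2fun_SJ: "L2fun (lp_partial J u)"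
  by (intro L2fun_cont continuous_intros)

text \<open>The symbol lies between zero and one, so its square is at most itself. The larger sum is
  the inner product of \<open>g\<close> with its own partial sum, and Cauchy--Schwarz lets one
  factor be divided out.\<close>

lemma SJ_contraction:
  assumes g: "L2fun g" shows "n2 (SJ J g) \<le> n2 g"
proof -
  let ?u = "distr_of_fun g"
  have "(n2 (SJ J g))\<^sup>2 = (\<Sum>k\<in>LB J. lpm J k * lpm J k * cprod ?u ?u k)"
    unfolding n2_sq unfolding power2_eq_square lp_partial_fmul by (rule integral_fmul_fmul) simp
  also have "\<dots> \<le> (\<Sum>k\<in>LB J. lpm J k * cprod ?u ?u k)"
    by (intro sum_mono mult_right_mono cprod_nonneg mult_left_le_one_le lpm_range)
  also have "\<dots> = (\<integral>x. g x * SJ J g x \<partial>torus)"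
    by (simp add: distr_lp_partial[symmetric] distr_apply_fun L2fun_integrable[OF g] lp_partial_test)
  also have "\<dots> \<le> n2 g * n2 (SJ J g)"
    using L2_Cauchy_Schwarz[OF g L2fun_SJ] by (metis abs_le_D1)
  finally have "n2 (SJ J g) * n2 (SJ J g) \<le> n2 g * n2 (SJ J g)" by (simp add: power2_eq_square)
  then show ?thesis by (cases "n2 (SJ J g) = 0") (auto simp: mult_le_cancel_right less_le)
qed

text \<open>The class that is enlarged until it is all of L^2, through trigonometric polynomials,
  indicators and simple functions.\<close>

definition fourier_conv :: "(real ^ 'd \<Rightarrow> real) \<Rightarrow> bool" where
  "fourier_conv g \<longleftrightarrow> L2fun g \<and> (\<lambda>J. n2 (\<lambda>x. SJ J g x - g x)) \<longlonglongrightarrow> 0"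

lemma fourier_conv_L2: "fourier_conv g \<Longrightarrow> L2fun g"
  by (simp add: fourier_conv_def)

text \<open>Contraction makes the cost of replacing \<open>g\<close> by an approximation uniform in
  \<open>J\<close>, so three small terms suffice.\<close>

lemma fourier_conv_closed:
  fixes g :: "real ^ 'd \<Rightarrow> real"
  assumes g: "L2fun g" and ap: "\<And>e. e > 0 \<Longrightarrow> \<exists>f. fourier_conv f \<and> n2 (\<lambda>x. g x - f x) < e"
  shows "fourier_conv g"
  unfolding fourier_conv_def
proof (intro conjI g LIMSEQ_I)
  fix r :: real assume r: "r > 0"
  obtain f where f: "fourier_conv f" "n2 (\<lambda>x. g x - f x) < r / 3" using ap[of "r / 3"] r by auto
  then have fL: "L2fun f" by (simp add: fourier_conv_def)
  obtain no where no: "\<And>J. J \<ge> no \<Longrightarrow> n2 (\<lambda>x. SJ J f x - f x) < r / 3"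
    using f(1) LIMSEQ_D[of "\<lambda>J. n2 (\<lambda>x. SJ J f x - f x)" 0 "r / 3"] r unfolding fourier_conv_def by auto
  have "n2 (\<lambda>x. SJ J g x - g x) < r" if J: "J \<ge> no" for J
  proof -
    have e: "SJ J g x - g x = SJ J (\<lambda>x. g x - f x) x + ((SJ J f x - f x) + (f x - g x))" for x
      by (simp add: distr_of_fun_diff L2fun_integrable g fL lp_partial_diff)
    have "n2 (\<lambda>x. SJ J g x - g x) \<le> n2 (SJ J (\<lambda>x. g x - f x)) + (n2 (\<lambda>x. SJ J f x - f x) + n2 (\<lambda>x. f x - g x))"
      unfolding e by (intro order_trans[OF n2_add_le] add_mono order_refl n2_add_le L2fun_add L2fun_diff L2fun_SJ g fL)
    moreover have "n2 (SJ J (\<lambda>x. g x - f x)) \<le> n2 (\<lambda>x. g x - f x)"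
      by (intro SJ_contraction L2fun_diff g fL)
    moreover have "n2 (\<lambda>x. f x - g x) = n2 (\<lambda>x. g x - f x)" by (rule n2_minus_commute)
    ultimately show ?thesis using no[OF J] f(2) by linarith
  qed
  then show "\<exists>no. \<forall>n\<ge>no. norm (n2 (\<lambda>x. SJ n g x - g x) - 0) < r" by auto
qed

lemma fourier_conv_seq:
  fixes g :: "real ^ 'd \<Rightarrow> real"
  assumes g: "L2fun g" and f: "\<And>n. fourier_conv (f n)"
    and lim: "AE x in torus. (\<lambda>n. f n x) \<longlonglongrightarrow> g x"
    and dom: "\<And>n. AE x in torus. \<bar>f n x - g x\<bar> \<le> w x" and w: "L2fun w"
  shows "fourier_conv g"
proof (rule fourier_conv_closed[OF g])
  fix e :: real assume e: "e > 0"
  have m: "g \<in> borel_measurable torus" "\<And>n. f n \<in> borel_measurable torus"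
    using g f fourier_conv_L2 by (auto simp: L2fun_def)
  have "(\<lambda>n. (\<integral>x. (g x - f n x)\<^sup>2 \<partial>torus)) \<longlonglongrightarrow> (\<integral>x. 0 \<partial>(torus :: (real ^ 'd) measure))"
  proof (rule integral_dominated_convergence[where w = "\<lambda>x. (w x)\<^sup>2"])
    show "AE x in torus. (\<lambda>n. (g x - f n x)\<^sup>2) \<longlonglongrightarrow> 0"
      using lim
    proof eventually_elim
      case (elim x)
      have "(\<lambda>n. (g x - f n x)\<^sup>2) \<longlonglongrightarrow> (g x - g x)\<^sup>2" by (intro tendsto_intros elim)
      then show ?case by simp
    qed
    show "AE x in torus. norm ((g x - f n x)\<^sup>2) \<le> (w x)\<^sup>2" for n
      using dom[of n]
    proof eventually_elim
      case (elim x)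
      then have "\<bar>g x - f n x\<bar>\<^sup>2 \<le> (w x)\<^sup>2" by (intro power_mono) auto
      then show ?case by simp
    qed
  qed (use m w in \<open>auto simp: L2fun_def\<close>)
  then have "(\<lambda>n. n2 (\<lambda>x. g x - f n x)) \<longlonglongrightarrow> sqrt 0"
    unfolding n2_def by (intro tendsto_real_sqrt) simp
  then have "\<forall>\<^sub>F n in sequentially. n2 (\<lambda>x. g x - f n x) < e"
    using e by (intro order_tendstoD(2)) auto
  then obtain n where "n2 (\<lambda>x. g x - f n x) < e" by (auto simp: eventually_sequentially)
  then show "\<exists>f. fourier_conv f \<and> n2 (\<lambda>x. g x - f x) < e" using f by blast
qed

lemma fourier_conv_add: assumes "fourier_conv f" "fourier_conv g" shows "fourier_conv (\<lambda>x. f x + g x)"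
  unfolding fourier_conv_def
proof
  have L: "L2fun f" "L2fun g" using assms by (auto simp: fourier_conv_def)
  then show "L2fun (\<lambda>x. f x + g x)" by (rule L2fun_add)
  have e: "SJ J (\<lambda>x. f x + g x) x - (f x + g x) = (SJ J f x - f x) + (SJ J g x - g x)" for J x
    by (simp add: distr_of_fun_add L2fun_integrable L lp_partial_add)
  have "(\<lambda>J. n2 (\<lambda>x. SJ J f x - f x) + n2 (\<lambda>x. SJ J g x - g x)) \<longlonglongrightarrow> 0 + 0"
    using assms by (intro tendsto_add) (auto simp: fourier_conv_def)
  then have lim0: "(\<lambda>J. n2 (\<lambda>x. SJ J f x - f x) + n2 (\<lambda>x. SJ J g x - g x)) \<longlonglongrightarrow> 0" by simp
  show "(\<lambda>J. n2 (\<lambda>x. SJ J (\<lambda>x. f x + g x) x - (f x + g x))) \<longlonglongrightarrow> 0"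
    unfolding e
  proof (rule Lim_null_comparison[OF _ lim0])
    show "\<forall>\<^sub>F J in sequentially. norm (n2 (\<lambda>x. SJ J f x - f x + (SJ J g x - g x))) \<le> n2 (\<lambda>x. SJ J f x - f x) + n2 (\<lambda>x. SJ J g x - g x)"
      using n2_add_le[OF L2fun_diff[OF L2fun_SJ L(1)] L2fun_diff[OF L2fun_SJ L(2)]] by simp
  qed
qed

lemma fourier_conv_scale: assumes "fourier_conv f" shows "fourier_conv (\<lambda>x. c * f x)"
  unfolding fourier_conv_def
proof
  have L: "L2fun f" using assms by (auto simp: fourier_conv_def)
  then show "L2fun (\<lambda>x. c * f x)" by (rule L2fun_scale)
  have e: "SJ J (\<lambda>x. c * f x) x - (c * f x) = c * (SJ J f x - f x)" for J x
    by (simp add: distr_of_fun_scale L2fun_integrable L lp_partial_scale right_diff_distrib)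
  show "(\<lambda>J. n2 (\<lambda>x. SJ J (\<lambda>x. c * f x) x - c * f x)) \<longlonglongrightarrow> 0"
    unfolding e n2_scale using assms by (intro tendsto_mult_right_zero) (simp add: fourier_conv_def)
qed

lemma fourier_conv_diff: "fourier_conv f \<Longrightarrow> fourier_conv g \<Longrightarrow> fourier_conv (\<lambda>x. f x - g x)"
  using fourier_conv_add[OF _ fourier_conv_scale[of g "-1"], of f] by simp

text \<open>Once 2^J exceeds the size of the frequency, the cutoff is one there and the partial sum
  reproduces the character exactly.\<close>

lemma fourier_conv_char:
  fixes k :: "real ^ 'd"
  assumes k: "k \<in> lattice" shows "fourier_conv (cosk k)" "fourier_conv (sink k)"
proof -
  have eqs: "of_bool (k = l) = (of_bool (l = k) :: real)" "of_bool (k = - l) = (of_bool (l = - k) :: real)" for l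
    by (auto simp: minus_equation_iff of_bool_def)
  \<comment> \<open>\<open>P\<close> and \<open>Q\<close> stand for \<open>l = k\<close> and
    \<open>l = - k\<close>. Both hold at the zero frequency, where the two halves on the right add
    up to the full value.\<close>
  have ac: "m * ((of_bool P + of_bool Q) / 2 * c + 0 * s) = (if P then ck / 2 else 0) + (if Q then ck / 2 else 0)"
    if "P \<or> Q \<Longrightarrow> c = ck \<and> m = 1" for P Q and c s ck m :: real
    using that by (cases P; cases Q) auto
  have as: "m * (0 * c + (of_bool P - of_bool Q) / 2 * s) = (if P then sk / 2 else 0) + (if Q then sk / 2 else 0)"
    if "P \<Longrightarrow> s = sk \<and> m = 1" "Q \<Longrightarrow> s = - sk \<and> m = 1" for P Q and c s sk m :: real
    using that by (cases P; cases Q) auto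
  obtain J0 where J0: "norm k < 2 ^ J0" using real_arch_pow[of 2 "norm k"] by auto
  have A: "SJ J (cosk k) x = cosk k x \<and> SJ J (sink k) x = sink k x" if J: "J \<ge> J0" for J x
  proof -
    have "(2::real) ^ J0 \<le> 2 ^ J" "(2::real) ^ J \<le> 2 ^ (J + 1)" using J by (auto intro: power_increasing)
    then have nk: "norm k \<le> 2 ^ J" "norm k < 2 ^ (J + 1)" using J0 by linarith+
    then have kL: "k \<in> LB J" "lpm J k = 1" using k by (auto simp: LB_def lpm_one)
    have int: "integrable torus (cosk k)" "integrable torus (sink k)"
      by (intro cont_integrable_torus continuous_intros)+
    have "SJ J (cosk k) x = (\<Sum>l\<in>LB J. lpm J l * ((of_bool (l = k) + of_bool (l = - k)) / 2 * cosk l x + 0 * sink l x))"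
      unfolding lp_partial_fmul fmul_def
      unfolding eqs[symmetric]
      by (intro sum.cong refl) (simp add: LB_lattice distr_apply_fun int test_cosk test_sink integral_cosk_cosk integral_cosk_sink k)
    also have "\<dots> = (\<Sum>l\<in>LB J. (if l = k then cosk k x / 2 else 0) + (if l = - k then cosk k x / 2 else 0))"
      by (intro sum.cong refl ac) (use kL in \<open>auto simp: sink_uminus\<close>)
    also have "\<dots> = cosk k x" using kL by (simp add: sum.distrib)
    finally have c: "SJ J (cosk k) x = cosk k x" .
    have sc: "(\<integral>x. sink k x * cosk l x \<partial>torus) = 0" if "l \<in> lattice" for l
      using integral_cosk_sink[OF that k] by (simp add: mult.commute)
    have "SJ J (sink k) x = (\<Sum>l\<in>LB J. lpm J l * (0 * cosk l x + (of_bool (l = k) - of_bool (l = - k)) / 2 * sink l x))"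
      unfolding lp_partial_fmul fmul_def
      unfolding eqs[symmetric]
      by (intro sum.cong refl) (simp add: LB_lattice distr_apply_fun int test_cosk test_sink integral_sink_sink sc k)
    also have "\<dots> = (\<Sum>l\<in>LB J. (if l = k then sink k x / 2 else 0) + (if l = - k then sink k x / 2 else 0))"
      by (intro sum.cong refl as) (use kL in \<open>auto simp: sink_uminus\<close>)
    also have "\<dots> = sink k x" using kL by (simp add: sum.distrib)
    finally show ?thesis using c by simp
  qed
  then have ev: "\<forall>\<^sub>F J in sequentially. n2 (\<lambda>x. SJ J (cosk k) x - cosk k x) = 0"
     "\<forall>\<^sub>F J in sequentially. n2 (\<lambda>x. SJ J (sink k) x - sink k x) = 0"
    by (auto simp: n2_def intro!: eventually_sequentiallyI[of J0])
  show "fourier_conv (cosk k)" "fourier_conv (sink k)"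
    using ev by (auto simp: fourier_conv_def intro!: L2fun_cont continuous_intros tendsto_eventually)
qed

inductive trig_poly :: "(real ^ 'd \<Rightarrow> real) \<Rightarrow> bool" where
  tp_cos: "k \<in> lattice \<Longrightarrow> trig_poly (cosk k)"
| tp_sin: "k \<in> lattice \<Longrightarrow> trig_poly (sink k)"
| tp_add: "trig_poly f \<Longrightarrow> trig_poly g \<Longrightarrow> trig_poly (\<lambda>x. f x + g x)"
| tp_scale: "trig_poly f \<Longrightarrow> trig_poly (\<lambda>x. c * f x)"

lemma trig_poly_fourier_conv: "trig_poly f \<Longrightarrow> fourier_conv f"
  by (induction rule: trig_poly.induct) (auto intro: fourier_conv_char fourier_conv_add fourier_conv_scale)

lemma trig_poly_const: "trig_poly (\<lambda>x. c)"
  using tp_scale[OF tp_cos[of 0], of c] by (simp add: lattice_def cosk_def)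

lemma fourier_conv_zero: "fourier_conv (\<lambda>_. 0)"
  by (intro trig_poly_fourier_conv trig_poly_const)

lemma trig_poly_sum: "finite A \<Longrightarrow> (\<And>i. i \<in> A \<Longrightarrow> trig_poly (f i)) \<Longrightarrow> trig_poly (\<lambda>x. \<Sum>i\<in>A. f i x)"
  by (induction rule: finite_induct) (auto intro: trig_poly_const tp_add)

text \<open>Products of characters split into characters of the sum and the difference frequency;
  bilinearity does the rest, one factor at a time.\<close>

lemma trig_poly_mult:
  assumes f: "trig_poly f" and g: "trig_poly g"
  shows "trig_poly (\<lambda>x. f x * g x)"
proof -
  have base: "trig_poly (\<lambda>x. cosk k x * cosk l x)" "trig_poly (\<lambda>x. sink k x * sink l x)"
    "trig_poly (\<lambda>x. cosk k x * sink l x)" "trig_poly (\<lambda>x. sink k x * cosk l x)"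
    if kl: "k \<in> lattice" "l \<in> lattice" for k l :: "real ^ 'a"
  proof -
    have 1: "cosk k x * cosk l x = 1 / 2 * cosk (k - l) x + 1 / 2 * cosk (k + l) x" for x
      by (simp add: cosk_def inner_add_left inner_diff_left distrib_left right_diff_distrib cos_add cos_diff field_simps)
    have 2: "sink k x * sink l x = 1 / 2 * cosk (k - l) x + (- 1 / 2) * cosk (k + l) x" for x
      by (simp add: cosk_def sink_def inner_add_left inner_diff_left distrib_left right_diff_distrib cos_add cos_diff field_simps)
    have 3: "cosk k x * sink l x = 1 / 2 * sink (k + l) x + (- 1 / 2) * sink (k - l) x" for k l x
      by (simp add: cosk_def sink_def inner_add_left inner_diff_left distrib_left right_diff_distrib sin_add sin_diff field_simps)
    have 4: "sink k x * cosk l x = 1 / 2 * sink (l + k) x + (- 1 / 2) * sink (l - k) x" for x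
      using 3[of l x k] by (simp add: mult.commute)
    show "trig_poly (\<lambda>x. cosk k x * cosk l x)" "trig_poly (\<lambda>x. sink k x * sink l x)"
      "trig_poly (\<lambda>x. cosk k x * sink l x)" "trig_poly (\<lambda>x. sink k x * cosk l x)"
      unfolding 1 2 4 3[of k _ l] by (intro tp_add tp_scale tp_cos tp_sin lattice_add lattice_diff kl)+
  qed
  have left: "trig_poly (\<lambda>x. h x * g x)" if "(\<And>k. k \<in> lattice \<Longrightarrow> trig_poly (\<lambda>x. h x * cosk k x))"
     "(\<And>k. k \<in> lattice \<Longrightarrow> trig_poly (\<lambda>x. h x * sink k x))" for h
    using g
  proof (induction rule: trig_poly.induct)
    case (tp_scale g c)
    then show ?case using trig_poly.tp_scale[of "\<lambda>x. h x * g x" c] by (simp add: mult_ac)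
  qed (use that in \<open>auto simp: distrib_left intro: tp_add\<close>)
  show ?thesis using f
  proof (induction rule: trig_poly.induct)
    case (tp_scale f c)
    then show ?case using trig_poly.tp_scale[of "\<lambda>x. f x * g x" c] by (simp add: mult_ac)
  qed (auto simp: distrib_right intro: tp_add left base)
qed

text \<open>One circle per coordinate embeds the torus into Euclidean space. Polynomials in the
  coordinates there pull back to trigonometric polynomials, so the Stone--Weierstrass theorem for
  polynomials on compact sets becomes available.\<close>

definition torus_embed :: "real ^ 'd \<Rightarrow> (real ^ 'd) \<times> (real ^ 'd)" where
  "torus_embed x = (\<chi> i. cosk (axis i 1) x, \<chi> i. sink (axis i 1) x)"

lemma axis_lattice: "axis i 1 \<in> lattice"
  by (auto simp: lattice_def axis_def)

lemma torus_embed_cont: "continuous_on A torus_embed"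
  unfolding torus_embed_def by (intro continuous_intros)

lemma torus_embed_poly:
  assumes "real_polynomial_function f"
  shows "trig_poly (\<lambda>x. f (torus_embed x))"
  using assms
proof (induction rule: real_polynomial_function.induct)
  case (linear f)
  have lin: "linear f" using linear by (rule bounded_linear.linear)
  have "f (torus_embed x) = (\<Sum>b\<in>Basis. f b * (torus_embed x \<bullet> b))" for x
  proof -
    have "f (torus_embed x) = f (\<Sum>b\<in>Basis. (torus_embed x \<bullet> b) *\<^sub>R b)" by (simp add: euclidean_representation)
    also have "\<dots> = (\<Sum>b\<in>Basis. (torus_embed x \<bullet> b) *\<^sub>R f b)" using lin by (simp add: linear_sum linear_cmul)
    finally show ?thesis by (simp add: mult.commute)
  qed
  moreover have "trig_poly (\<lambda>x. torus_embed x \<bullet> b)" if "b \<in> Basis" for b :: "(real ^ 'a) \<times> (real ^ 'a)"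
  proof -
    from that consider i where "b = (axis i 1, 0)" | i where "b = (0, axis i 1)"
      by (auto simp: Basis_prod_def Basis_vec_def)
    then show ?thesis
      by cases (auto simp: torus_embed_def inner_axis intro!: tp_cos tp_sin axis_lattice)
  qed
  ultimately show ?case by (auto intro!: trig_poly_sum tp_scale)
qed (auto intro: trig_poly_const tp_add trig_poly_mult)

text \<open>Opposite faces of the cube have the same image, which is why one of the points has to be
  interior: the coordinates then differ by an integer of modulus less than one.\<close>

lemma torus_embed_inj:
  fixes x y :: "real ^ 'd"
  assumes x: "x \<in> box 0 One" and y: "y \<in> cbox 0 One" and e: "torus_embed x = torus_embed y"
  shows "x = y"
proof -
  have "x $ i = y $ i" for i
  proof -
    have "cosk (axis i 1) x = cosk (axis i 1) y" "sink (axis i 1) x = sink (axis i 1) y"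
      using e by (auto simp: torus_embed_def vec_eq_iff)
    then have "cos (2 * pi * x $ i) = cos (2 * pi * y $ i) \<and> sin (2 * pi * x $ i) = sin (2 * pi * y $ i)"
      by (simp add: cosk_def sink_def inner_axis inner_commute)
    then obtain n :: int where "2 * pi * x $ i = 2 * pi * y $ i + 2 * pi * n"
      using sin_cos_eq_iff by metis
    then have "2 * pi * (x $ i - y $ i) = 2 * pi * n" by (simp add: algebra_simps)
    then have n: "x $ i - y $ i = n" by simp
    have "0 < x $ i" "x $ i < 1" "0 \<le> y $ i" "y $ i \<le> 1" using x y by (auto simp: ocube_mem cube_mem)
    then have "-1 < real_of_int n" "real_of_int n < 1" using n by linarith+
    then have "n = 0" by linarith
    then show ?thesis using n by simp
  qed
  then show ?thesis by (simp add: vec_eq_iff)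
qed

lemma ae_ocube: "AE x in torus. x \<in> box (0 :: real ^ 'd) One"
proof -
  have "AE x in lborel. x \<in> cbox 0 One \<longrightarrow> x \<in> box (0 :: real ^ 'd) One"
  proof -
    have ae: "AE x in lborel. (x :: real ^ 'd) $ i \<noteq> c" for i c
      using AE_lborel_inner_neq[of "axis i 1 :: real ^ 'd" c] by (simp add: inner_axis)
    have "AE x in lborel. \<forall>i\<in>UNIV. (x :: real ^ 'd) $ i \<noteq> 0 \<and> x $ i \<noteq> 1"
      by (rule AE_finite_allI) (auto intro: ae)
    then show ?thesis
      by eventually_elim (auto simp: ocube_mem cube_mem less_le)
  qed
  then show ?thesis unfolding torus_def by (subst AE_restrict_space_iff) auto
qed

text \<open>The indicator is the limit of truncated multiples of the distance to the image of the
  complement, and each of these is uniformly close to a polynomial in the embedding.\<close>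

lemma fourier_conv_open:
  fixes B :: "(real ^ 'd) set"
  assumes B: "open B" "B \<subseteq> box 0 One"
  shows "fourier_conv (indicator B)"
proof -
  let ?K = "cbox 0 One :: (real ^ 'd) set"
  define C where "C = torus_embed ` (?K - B)"
  have cK: "compact (?K - B)" using B(1) by (intro compact_diff) auto
  have C: "compact C" unfolding C_def by (intro compact_continuous_image torus_embed_cont cK)
  \<comment> \<open>The distance to the empty set is zero by convention, so \<open>C\<close> must be
    nonempty; a corner of the cube provides a point.\<close>
  have ne: "C \<noteq> {}"
  proof -
    have "(0 :: real ^ 'd) \<in> ?K" "(0 :: real ^ 'd) \<notin> box 0 One" by (auto simp: cube_mem ocube_mem)
    then show ?thesis using B(2) by (auto simp: C_def)
  qed
  define F where "F n y = min 1 (real n * infdist y C)" for n y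
  have Fc: "continuous_on A (F n)" for A n
    unfolding F_def by (intro continuous_intros)
  have "\<exists>g. real_polynomial_function g \<and> (\<forall>x\<in>torus_embed ` ?K. \<bar>F n x - g x\<bar> < inverse (real (Suc n)))" for n
    using Stone_Weierstrass_real_polynomial_function[OF _ Fc, of "torus_embed ` ?K" "inverse (real (Suc n))" n]
      compact_continuous_image[OF torus_embed_cont, of ?K] by (metis compact_cbox inverse_positive_iff_positive of_nat_0_less_iff zero_less_Suc)
  then obtain g where g: "\<And>n. real_polynomial_function (g n)"
    "\<And>n x. x \<in> ?K \<Longrightarrow> \<bar>F n (torus_embed x) - g n (torus_embed x)\<bar> < inverse (real (Suc n))" by (metis imageI)
  have Bm: "B \<in> sets borel" using B by auto
  have F01: "0 \<le> F n y" "F n y \<le> 1" for n y by (auto simp: F_def infdist_nonneg)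
  have lim: "(\<lambda>n. F n (torus_embed x)) \<longlonglongrightarrow> indicator B x" if x: "x \<in> ?K" for x
  proof (cases "x \<in> B")
    case False
    then have "torus_embed x \<in> C" using x by (auto simp: C_def)
    then show ?thesis using False by (simp add: F_def)
  next
    case True
    have "torus_embed x \<notin> C"
      using torus_embed_inj[of x] True B(2) by (auto simp: C_def)
    then have pos: "infdist (torus_embed x) C > 0"
      using infdist_pos_not_in_closed[OF compact_imp_closed[OF C] ne] by auto
    obtain n0 where n0: "1 < real n0 * infdist (torus_embed x) C" using reals_Archimedean3[OF pos] by blast
    have "F n (torus_embed x) = 1" if "n \<ge> n0" for n
    proof -
      have "real n0 * infdist (torus_embed x) C \<le> real n * infdist (torus_embed x) C"
        using that pos by (intro mult_right_mono) auto
      then show ?thesis using n0 by (simp add: F_def)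
    qed
    then have "\<forall>\<^sub>F n in sequentially. F n (torus_embed x) = 1" by (rule eventually_sequentiallyI)
    then show ?thesis using True by (simp add: tendsto_eventually)
  qed
  show ?thesis
  proof (rule fourier_conv_seq[where f = "\<lambda>n x. g n (torus_embed x)" and w = "\<lambda>_. 2"])
    show "L2fun (indicator B)" by (rule L2fun_bounded[of _ 1]) (use Bm in \<open>auto intro: measurable_torus simp: indicator_def\<close>)
    show "fourier_conv (\<lambda>x. g n (torus_embed x))" for n
      by (intro trig_poly_fourier_conv torus_embed_poly g)
    show "L2fun (\<lambda>_. 2)" by (intro L2fun_cont continuous_intros)
    show "AE x in torus. (\<lambda>n. g n (torus_embed x)) \<longlonglongrightarrow> indicator B x"
    proof (rule AE_I2)
      fix x assume "x \<in> space (torus :: (real ^ 'd) measure)"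
      then have x: "x \<in> ?K" by simp
      have "(\<lambda>n. g n (torus_embed x) - F n (torus_embed x)) \<longlonglongrightarrow> 0"
        using g(2)[OF x] by (intro Lim_null_comparison[OF _ LIMSEQ_inverse_real_of_nat] always_eventually)
          (auto simp: abs_minus_commute intro: less_imp_le)
      from tendsto_add[OF this lim[OF x]] show "(\<lambda>n. g n (torus_embed x)) \<longlonglongrightarrow> indicator B x" by simp
    qed
    show "AE x in torus. \<bar>g n (torus_embed x) - indicator B x\<bar> \<le> 2" for n
    proof (rule AE_I2)
      fix x assume "x \<in> space (torus :: (real ^ 'd) measure)"
      then have x: "x \<in> ?K" by simp
      have "inverse (real (Suc n)) \<le> 1" by (simp add: field_simps)
      then show "\<bar>g n (torus_embed x) - indicator B x\<bar> \<le> 2"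
        using g(2)[OF x, of n] F01[of n "torus_embed x"] by (auto simp: indicator_def)
    qed
  qed
qed

lemma fourier_conv_AE:
  assumes "fourier_conv f" "L2fun g" "AE x in torus. f x = g x"
  shows "fourier_conv g"
  by (rule fourier_conv_seq[where f = "\<lambda>_. f" and w = "\<lambda>_. 0"])
     (use assms in \<open>auto intro!: L2fun_cont continuous_intros elim: eventually_mono\<close>)

text \<open>A pi-lambda argument from open sets. Intersecting with the open cube keeps the
  generators where the embedding is injective; the faces are null and are restored at the
  end.\<close>

lemma fourier_conv_borel:
  fixes A :: "(real ^ 'd) set"
  assumes "A \<in> sets borel"
  shows "fourier_conv (indicator A)"
proof -
  let ?O = "box 0 One :: (real ^ 'd) set"
  let ?G = "{S :: (real ^ 'd) set. open S}"
  have L: "L2fun (indicator S)" if "S \<in> sets borel" for S :: "(real ^ 'd) set"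
    by (rule L2fun_bounded[of _ 1]) (use that in \<open>auto intro: measurable_torus simp: indicator_def\<close>)
  have "A \<in> sigma_sets UNIV ?G" using assms by (simp add: borel_def)
  have "Int_stable ?G" "?G \<subseteq> Pow UNIV" by (auto simp: Int_stable_def)
  from this \<open>A \<in> sigma_sets UNIV ?G\<close> have "fourier_conv (indicator (A \<inter> ?O))"
  proof (induction rule: sigma_sets_induct_disjoint)
    case (basic S)
    then show ?case by (intro fourier_conv_open) auto
  next
    case empty
    show ?case by (simp add: fourier_conv_zero)
  next
    case (compl S)
    have "indicator ((UNIV - S) \<inter> ?O) = (\<lambda>x. indicator ?O x - indicator (S \<inter> ?O) x :: real)"
      by (auto simp: indicator_def fun_eq_iff)
    moreover have "fourier_conv (indicator ?O)" by (rule fourier_conv_open) auto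
    ultimately show ?case using compl by (simp add: fourier_conv_diff)
  next
    case (union S)
    have Sb: "S i \<in> sets borel" for i using union(2) by (auto simp: borel_def)
    have fin: "fourier_conv (\<lambda>x. \<Sum>i<n. indicator (S i \<inter> ?O) x)" for n
    proof (induction n)
      case 0
      show ?case by (simp add: fourier_conv_zero)
    next
      case (Suc n)
      then show ?case using union by (simp add: fourier_conv_add)
    qed
    have sums: "(\<lambda>i. indicator (S i \<inter> ?O) x) sums (indicator (\<Union>(range S) \<inter> ?O) x :: real)" for x
    proof -
      have "(\<lambda>i. indicator (S i \<inter> ?O) x) sums (indicator (\<Union>i. S i \<inter> ?O) x :: real)"
        using union(1) by (intro indicator_sums) (auto simp: disjoint_family_on_def)
      moreover have "(\<Union>i. S i \<inter> ?O) = \<Union>(range S) \<inter> ?O" by auto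
      ultimately show ?thesis by metis
    qed
    show ?case
    proof (rule fourier_conv_seq[OF _ fin, where w = "\<lambda>_. 1"])
      show "L2fun (indicator (\<Union>(range S) \<inter> ?O))" using Sb by (intro L) auto
      show "L2fun (\<lambda>_. 1)" by (intro L2fun_cont continuous_intros)
      show "AE x in torus. (\<lambda>n. \<Sum>i<n. indicator (S i \<inter> ?O) x) \<longlonglongrightarrow> (indicator (\<Union> (range S) \<inter> ?O) (x :: real ^ 'd) :: real)"
        using sums by (intro AE_I2) (simp add: sums_def)
      show "AE x in torus. \<bar>(\<Sum>i<n. indicator (S i \<inter> ?O) x) - indicator (\<Union> (range S) \<inter> ?O) x\<bar> \<le> (1 :: real)" for n
      proof (rule AE_I2)
        fix x :: "real ^ 'd"
        have "(\<Sum>i<n. indicator (S i \<inter> ?O) x :: real) \<le> indicator (\<Union> (range S) \<inter> ?O) x"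
          using sum_le_suminf[OF sums_summable[OF sums], of "{..<n}"] sums_unique[OF sums, of x] by simp
        moreover have "0 \<le> (\<Sum>i<n. indicator (S i \<inter> ?O) x :: real)" by (intro sum_nonneg) simp
        ultimately show "\<bar>(\<Sum>i<n. indicator (S i \<inter> ?O) x) - indicator (\<Union> (range S) \<inter> ?O) x\<bar> \<le> (1::real)"
          by (auto simp: indicator_def split: if_splits)
      qed
    qed
  qed
  then show ?thesis
  proof (rule fourier_conv_AE[OF _ L[OF assms]])
    show "AE x in torus. indicator (A \<inter> ?O) x = (indicator A x :: real)"
      using ae_ocube by eventually_elim (auto simp: indicator_def)
  qed
qed

theorem fourier_conv_L2fun:
  fixes g :: "real ^ 'd \<Rightarrow> real"
  assumes g: "L2fun g"
  shows "fourier_conv g"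
proof -
  obtain s where s: "\<And>i. simple_function torus (s i)" "\<And>x. x \<in> space torus \<Longrightarrow> (\<lambda>i. s i x) \<longlonglongrightarrow> g x"
    "\<And>i x. x \<in> space torus \<Longrightarrow> dist (s i x) 0 \<le> 2 * dist (g x) 0"
    using borel_measurable_implies_sequence_metric[OF L2fun_measurable[OF g], of 0] by metis
  have sc: "fourier_conv (s i)" for i
  proof -
    let ?A = "\<lambda>y. s i -` {y} \<inter> space torus"
    have fin: "finite (s i ` space torus)" and ms: "?A y \<in> sets torus" if "y \<in> s i ` space torus" for y
      using s(1)[of i] that by (auto simp: simple_function_def)
    have fin: "finite (s i ` space torus)" using s(1)[of i] by (auto simp: simple_function_def)
    have mb: "?A y \<in> sets borel" if "y \<in> s i ` space torus" for y
      using ms[OF that] by (auto simp: sets_torus sets_restrict_space)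
    have "fourier_conv (\<lambda>x. \<Sum>y\<in>S. y * indicator (?A y) x)" if "finite S" "S \<subseteq> s i ` space torus" for S
      using that
    proof (induction rule: finite_induct)
      case empty
      show ?case by (simp add: fourier_conv_zero)
    next
      case (insert y S)
      then have "fourier_conv (\<lambda>x. y * indicator (?A y) x + (\<Sum>y\<in>S. y * indicator (?A y) x))"
        by (intro fourier_conv_add fourier_conv_scale fourier_conv_borel mb) auto
      then show ?case unfolding sum.insert[OF insert.hyps] .
    qed
    from this[OF fin order_refl] show ?thesis
    proof (rule fourier_conv_AE)
      have m: "s i \<in> borel_measurable torus" using s(1) by (rule borel_measurable_simple_function)
      have "integrable torus (\<lambda>x. (s i x)\<^sup>2)"
      proof (rule Bochner_Integration.integrable_bound)
        show "integrable torus (\<lambda>x. (2 * g x)\<^sup>2)" using L2fun_scale[OF g, of 2] by (simp add: L2fun_def)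
        show "AE x in torus. norm ((s i x)\<^sup>2) \<le> norm ((2 * g x)\<^sup>2)"
        proof (rule AE_I2)
          fix x :: "real ^ 'd" assume "x \<in> space torus"
          then have "\<bar>s i x\<bar>\<^sup>2 \<le> \<bar>2 * g x\<bar>\<^sup>2" using s(3)[of x i] by (intro power_mono) auto
          then show "norm ((s i x)\<^sup>2) \<le> norm ((2 * g x)\<^sup>2)" by simp
        qed
      qed (use m in measurable)
      then show "L2fun (s i)" using m by (simp add: L2fun_def)
      show "AE x in torus. (\<Sum>y\<in>s i ` space torus. y * indicator (?A y) x) = s i x"
      proof (rule AE_I2)
        fix x :: "real ^ 'd" assume x: "x \<in> space torus"
        have "(\<Sum>y\<in>s i ` space torus. y * indicator (?A y) x) = (\<Sum>y\<in>s i ` space torus. if y = s i x then s i x else 0)"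
          using x by (intro sum.cong) (auto simp: indicator_def)
        also have "\<dots> = s i x" using x fin by simp
        finally show "(\<Sum>y\<in>s i ` space torus. y * indicator (?A y) x) = s i x" .
      qed
    qed
  qed
  show ?thesis
  proof (rule fourier_conv_seq[OF g sc, where w = "\<lambda>x. 3 * \<bar>g x\<bar>"])
    show "AE x in torus. (\<lambda>i. s i x) \<longlonglongrightarrow> g x" using s(2) by (intro AE_I2)
    show "AE x in torus. \<bar>s n x - g x\<bar> \<le> 3 * \<bar>g x\<bar>" for n
      using s(3)[of _ n] by (intro AE_I2) (smt (verit) dist_real_def)
    show "L2fun (\<lambda>x. 3 * \<bar>g x\<bar>)"
      using g by (auto simp: L2fun_def power_mult_distrib)
  qed
qed

lemma Parseval:
  assumes h: "L2fun h" and g: "L2fun g"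
  shows "(\<lambda>J. distr_apply (distr_of_fun h) (lp_partial J (distr_of_fun g))) \<longlonglongrightarrow> (\<integral>x. h x * g x \<partial>torus)"
proof -
  have d: "distr_apply (distr_of_fun h) (SJ J g) - (\<integral>x. h x * g x \<partial>torus) = (\<integral>x. h x * (SJ J g x - g x) \<partial>torus)" for J
    by (simp add: distr_apply_fun L2fun_integrable[OF h] lp_partial_test right_diff_distrib
        L2fun_mult_integrable h g L2fun_SJ)
  have "(\<lambda>J. n2 h * n2 (\<lambda>x. SJ J g x - g x)) \<longlonglongrightarrow> 0"
    using fourier_conv_L2fun[OF g] by (intro tendsto_mult_right_zero) (simp add: fourier_conv_def)
  then have "(\<lambda>J. distr_apply (distr_of_fun h) (SJ J g) - (\<integral>x. h x * g x \<partial>torus)) \<longlonglongrightarrow> 0"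
    by (rule Lim_null_comparison[rotated])
       (auto simp: d intro!: always_eventually L2_Cauchy_Schwarz h L2fun_diff L2fun_SJ g)
  then show ?thesis by (simp add: LIM_zero_iff)
qed

lemma pairing_fun: "L2fun h \<Longrightarrow> L2fun g \<Longrightarrow> pairing (distr_of_fun h) (distr_of_fun g) = (\<integral>x. h x * g x \<partial>torus)"
  unfolding pairing_def by (intro limI Parseval)

section \<open>The L^2 norm as a functional on distributions\<close>

lemma L2_norm_fun:
  assumes g: "L2fun g" shows "L2_norm (distr_of_fun g) = ennreal (n2 g)"
proof -
  have Lp: "Lp_norm torus 2 (\<lambda>x. ennreal \<bar>h x\<bar>) = ennreal (n2 h)" if "L2fun h" for h :: "real ^ 'a \<Rightarrow> real"
    using Lp_norm_torus[of 2 h] that by (simp add: L2fun_def lpn_2)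
  show ?thesis
    unfolding L2_norm_def
  proof (rule antisym)
    show "(INF h\<in>{h. integrable torus h \<and> distr_of_fun h = distr_of_fun g}. Lp_norm torus 2 (\<lambda>x. ennreal \<bar>h x\<bar>)) \<le> ennreal (n2 g)"
      by (intro INF_lower2[of g]) (auto simp: Lp g L2fun_integrable)
    show "ennreal (n2 g) \<le> (INF h\<in>{h. integrable torus h \<and> distr_of_fun h = distr_of_fun g}. Lp_norm torus 2 (\<lambda>x. ennreal \<bar>h x\<bar>))"
    proof (rule INF_greatest)
      fix h assume "h \<in> {h. integrable torus h \<and> distr_of_fun h = distr_of_fun g}"
      then have h: "integrable torus h" "distr_of_fun h = distr_of_fun g" by auto
      show "ennreal (n2 g) \<le> Lp_norm torus 2 (\<lambda>x. ennreal \<bar>h x\<bar>)"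
      proof (cases "L2fun h")
        case True
        \<comment> \<open>Parseval expresses the norm through the distribution alone, so all square
          integrable representatives agree; any other representative contributes infinity to the
          infimum.\<close>
        have "(n2 h)\<^sup>2 = (n2 g)\<^sup>2"
          using pairing_fun[OF True True] pairing_fun[OF g g] h(2) unfolding n2_sq by (simp add: power2_eq_square)
        then have "n2 h = n2 g" by (rule power2_eq_imp_eq) auto
        then show ?thesis using True by (simp add: Lp)
      next
        case False
        have m: "h \<in> borel_measurable torus" using h by auto
        then have "\<not> integrable torus (\<lambda>x. (h x)\<^sup>2)" using False by (simp add: L2fun_def)
        then have "(\<integral>\<^sup>+ x. ennreal ((h x)\<^sup>2) \<partial>torus) = \<infinity>"
          using m by (auto simp: integrable_iff_bounded not_less top.extremum_unique)
        then have "Lp_norm torus 2 (\<lambda>x. ennreal \<bar>h x\<bar>) = \<infinity>"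
          by (simp add: Lp_norm_def enn_powr_def)
        then show ?thesis by simp
      qed
    qed
  qed
qed

lemma L2_norm_finiteE:
  assumes "L2_norm u < \<infinity>"
  obtains h where "L2fun h" "u = distr_of_fun h"
proof -
  from assms obtain h where h: "integrable torus h" "distr_of_fun h = u" "Lp_norm torus 2 (\<lambda>x. ennreal \<bar>h x\<bar>) < \<infinity>"
    unfolding L2_norm_def INF_less_iff by auto
  from h(3) have "(\<integral>\<^sup>+ x. ennreal ((h x)\<^sup>2) \<partial>torus) < \<infinity>"
    by (auto simp: Lp_norm_def enn_powr_def less_top split: if_splits)
  then have "integrable torus (\<lambda>x. (h x)\<^sup>2)"
    using h(1) by (auto simp: integrable_iff_bounded)
  then show ?thesis using h by (intro that[of h]) (auto simp: L2fun_def)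
qed

definition l2 :: "('d::finite) distr \<Rightarrow> real" where
  "l2 u = enn2real (L2_norm u)"

lemma l2_nonneg [simp]: "l2 u \<ge> 0" by (simp add: l2_def)

lemma l2_fun: "L2fun h \<Longrightarrow> l2 (distr_of_fun h) = n2 h"
  by (simp add: l2_def L2_norm_fun)

lemma L2_norm_l2: "L2_norm u < \<infinity> \<Longrightarrow> L2_norm u = ennreal (l2 u)"
  by (simp add: l2_def less_top)

text \<open>The second claim completes the square: for data \<open>v\<close> the data term is half
  the squared distance up to a constant. The third makes the limit in \<open>pairing\<close> genuine
  for square integrable arguments.\<close>

lemma L2_norm_diff:
  assumes "L2_norm u < \<infinity>" "L2_norm v < \<infinity>"
  shows "L2_norm (u - v) < \<infinity>"
    and "1 / 2 * (l2 u)\<^sup>2 - pairing v u = 1 / 2 * (l2 (u - v))\<^sup>2 - 1 / 2 * (l2 v)\<^sup>2"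
    and "convergent (\<lambda>J. distr_apply u (lp_partial J v))"
    and "l2 u \<le> l2 (u - v) + l2 v"
proof -
  from assms(1) obtain f where f: "L2fun f" "u = distr_of_fun f" by (rule L2_norm_finiteE)
  from assms(2) obtain g where g: "L2fun g" "v = distr_of_fun g" by (rule L2_norm_finiteE)
  have uv: "u - v = distr_of_fun (\<lambda>x. f x - g x)" by (simp add: f g distr_of_fun_diff L2fun_integrable)
  have L: "L2fun (\<lambda>x. f x - g x)" by (intro L2fun_diff f g)
  show "L2_norm (u - v) < \<infinity>" using L by (simp add: uv L2_norm_fun)
  have "(n2 (\<lambda>x. f x - g x))\<^sup>2 = (\<integral>x. (f x)\<^sup>2 + (g x)\<^sup>2 - 2 * (g x * f x) \<partial>torus)"
    unfolding n2_sq by (intro Bochner_Integration.integral_cong) (auto simp: power2_diff)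
  also have "\<dots> = (n2 f)\<^sup>2 + (n2 g)\<^sup>2 - 2 * (\<integral>x. g x * f x \<partial>torus)"
    using f g L2fun_mult_integrable[OF g(1) f(1)] by (simp add: n2_sq L2fun_def)
  finally show "1 / 2 * (l2 u)\<^sup>2 - pairing v u = 1 / 2 * (l2 (u - v))\<^sup>2 - 1 / 2 * (l2 v)\<^sup>2"
    unfolding uv l2_fun[OF L] by (simp add: l2_fun f g pairing_fun diff_divide_distrib add_divide_distrib)
  show "convergent (\<lambda>J. distr_apply u (lp_partial J v))"
    using Parseval[OF f(1) g(1)] f g by (auto simp: convergent_def)
  show "l2 u \<le> l2 (u - v) + l2 v"
    using n2_add_le[OF L g(1)] by (simp add: uv l2_fun L f(1)) (simp add: f g l2_fun)
qed

text \<open>A block is at most a difference of two contractions, hence the factor 2; lowering the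
  exponent to \<open>p\<close> is free on a probability space.\<close>

lemma lpn_block_le_l2:
  assumes "L2_norm u < \<infinity>" "0 < p" "p \<le> 2"
  shows "lpn p (lp_block j u) \<le> 2 * l2 u"
proof -
  from assms(1) obtain f where f: "L2fun f" "u = distr_of_fun f" by (rule L2_norm_finiteE)
  have "lpn p (lp_block j u) \<le> n2 (lp_block j u)"
    using lpn_mono_exponent[of "lp_block j u" p 2] assms by (simp add: lpn_2 continuous_intros)
  also have "n2 (lp_block j u) \<le> 2 * n2 f"
  proof (cases j)
    case 0
    have "lp_block j u = lp_partial 0 u" using 0 by (auto simp: lp_block_def)
    then have "n2 (lp_block j u) \<le> n2 f" using SJ_contraction[OF f(1), of 0] by (simp add: f(2))
    then show ?thesis using n2_nonneg[of f] by linarith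
  next
    case (Suc i)
    have "lp_block j u = (\<lambda>x. SJ j f x + (-1) * SJ i f x)" using Suc f by (auto simp: lp_block_def)
    then have "n2 (lp_block j u) \<le> n2 (SJ j f) + n2 (\<lambda>x. (-1) * SJ i f x)"
      using n2_add_le[OF L2fun_SJ L2fun_scale[OF L2fun_SJ, where c = "-1"]] by metis
    also have "\<dots> \<le> 2 * n2 f"
      using SJ_contraction[OF f(1), of j] SJ_contraction[OF f(1), of i] unfolding n2_scale by simp
    finally show ?thesis .
  qed
  finally show ?thesis by (simp add: f l2_fun)
qed

section \<open>Uniform convexity of finite-dimensional l^p norms\<close>

lemma powr_convex_ineq:
  fixes x y p u v :: real
  assumes "p \<ge> 1" "0 \<le> x" "0 \<le> y" "0 \<le> u" "0 \<le> v" "u + v = 1"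
  shows "(u * x + v * y) powr p \<le> u * x powr p + v * y powr p"
proof (cases "x = 0 \<or> y = 0")
  case True
  have le: "w powr p \<le> w" if "0 \<le> w" "w \<le> 1" for w
    using powr_mono'[of 1 p w] that assms(1) by simp
  have "u \<le> 1" "v \<le> 1" using assms by auto
  with True assms le[of u] le[of v] show ?thesis
    by (auto simp: powr_mult intro!: mult_right_mono)
next
  case False
  show ?thesis
  proof -
    have u: "u = 1 - v" using assms by simp
    show ?thesis
      unfolding u using convex_onD[OF powr_convex[OF assms(1)], of v x y] assms False by simp
  qed
qed

lemma powr_concave_ineq:
  fixes x y p u v :: real
  assumes "0 < p" "p \<le> 1" "0 \<le> x" "0 \<le> y" "0 \<le> u" "0 \<le> v" "u + v = 1"
  shows "u * x powr p + v * y powr p \<le> (u * x + v * y) powr p"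
proof -
  have "(u * x powr p + v * y powr p) powr (1 / p) \<le> u * (x powr p) powr (1 / p) + v * (y powr p) powr (1 / p)"
    using assms by (intro powr_convex_ineq) auto
  then have "((u * x powr p + v * y powr p) powr (1 / p)) powr p \<le> (u * x + v * y) powr p"
    using assms by (intro powr_mono2) (simp_all add: powr_powr)
  then show ?thesis using assms by (simp add: powr_powr add_nonneg_nonneg)
qed

text \<open>After division by the sum both terms lie in the unit interval, where the power is at
  most the identity.\<close>

lemma powr_superadd:
  fixes a b r :: real
  assumes "r \<ge> 1" "0 \<le> a" "0 \<le> b"
  shows "a powr r + b powr r \<le> (a + b) powr r"
proof (cases "a + b = 0")
  case False
  then have s: "a + b > 0" using assms by auto
  have le: "w powr r \<le> w" if "0 \<le> w" "w \<le> 1" for w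
    using powr_mono'[of 1 r w] that assms(1) by simp
  have "(a / (a + b)) powr r + (b / (a + b)) powr r \<le> a / (a + b) + b / (a + b)"
    using assms s by (intro add_mono le) auto
  also have "\<dots> = 1" using s by (simp add: add_divide_distrib[symmetric])
  finally have "(a powr r + b powr r) / (a + b) powr r \<le> 1"
    using assms by (simp add: powr_divide add_divide_distrib)
  then show ?thesis using s by (simp add: divide_le_eq_1)
qed (use assms in \<open>auto simp: add_nonneg_eq_0_iff\<close>)

lemma weighted_cancel:
  fixes a b t w :: real
  assumes "a > 0" "b > 0"
  shows "(a + b) * (a / (a + b) * (t / a) + b / (a + b) * (w / b)) = t + w"
proof -
  have "a / (a + b) * (t / a) = t / (a + b)" "b / (a + b) * (w / b) = w / (a + b)" using assms by simp_all
  then show ?thesis using assms by (simp add: add_divide_distrib[symmetric])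
qed

lemma sq_powr: "((z::real)\<^sup>2) powr t = \<bar>z\<bar> powr (2 * t)"
proof -
  have "z\<^sup>2 = \<bar>z\<bar> powr 2" by simp
  then show ?thesis by (simp only: powr_powr)
qed

text \<open>Differentiating the difference of the two sides twice leaves a sum of two Bernoulli
  inequalities with the nonpositive exponent \<open>p - 2\<close>, whose linear terms
  cancel.\<close>

lemma two_point_aux:
  fixes p t :: real
  assumes p: "1 < p" "p \<le> 2" and t: "0 \<le> t" "t \<le> 1"
  shows "1 + p * (p - 1) / 2 * t\<^sup>2 \<le> ((1 + t) powr p + (1 - t) powr p) / 2"
proof -
  have bern: "1 + r * (x - 1) \<le> x powr r" if "r \<le> 0" "x > 0" for r x :: real
  proof -
    have "r * (x - 1) \<le> r * ln x" using ln_le_minus_one[of x] that by (intro mult_left_mono_neg) auto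
    also have "1 + r * ln x \<le> exp (r * ln x)" by (rule exp_ge_add_one_self)
    finally show ?thesis using that by (simp add: powr_def)
  qed
  define f1 where "f1 s = p / 2 * ((1 + s) powr (p - 1) - (1 - s) powr (p - 1)) - p * (p - 1) * s" for s
  define f where "f s = ((1 + s) powr p + (1 - s) powr p) / 2 - (1 + p * (p - 1) / 2 * s\<^sup>2)" for s
  have dp: "((\<lambda>s. (1 + s) powr r) has_real_derivative r * (1 + s) powr (r - 1)) (at s)"
    "((\<lambda>s. (1 - s) powr r) has_real_derivative - (r * (1 - s) powr (r - 1))) (at s)" if "0 \<le> s" "s < 1" for s r
    using DERIV_fun_powr[of "\<lambda>s. 1 + s" 1 s r] DERIV_fun_powr[of "\<lambda>s. 1 - s" "-1" s r] that
    by (auto simp: DERIV_ident intro!: derivative_eq_intros)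
  have d1: "(f1 has_real_derivative (p / 2 * ((p - 1) * (1 + s) powr (p - 2) + (p - 1) * (1 - s) powr (p - 2)) - p * (p - 1))) (at s)"
    if "0 \<le> s" "s < 1" for s
    unfolding f1_def
    by (rule derivative_eq_intros dp[OF that] refl)+ (simp add: algebra_simps)
  have f1: "f1 s \<ge> 0" if s: "0 \<le> s" "s < 1" for s
  proof -
    have "f1 0 \<le> f1 s"
    proof (rule DERIV_nonneg_imp_nondecreasing[OF s(1)])
      fix x assume x: "0 \<le> x" "x \<le> s"
      have "1 + (p - 2) * x \<le> (1 + x) powr (p - 2)" "1 - (p - 2) * x \<le> (1 - x) powr (p - 2)"
        using bern[of "p - 2" "1 + x"] bern[of "p - 2" "1 - x"] x s p by auto
      then have "2 \<le> (1 + x) powr (p - 2) + (1 - x) powr (p - 2)" by linarith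
      then have "p / 2 * (p - 1) * 2 \<le> p / 2 * (p - 1) * ((1 + x) powr (p - 2) + (1 - x) powr (p - 2))"
        using p by (intro mult_left_mono) auto
      moreover have "p / 2 * ((p - 1) * (1 + x) powr (p - 2) + (p - 1) * (1 - x) powr (p - 2))
          = p / 2 * (p - 1) * ((1 + x) powr (p - 2) + (1 - x) powr (p - 2))" by (simp add: field_simps)
      moreover have "p / 2 * (p - 1) * 2 = p * (p - 1)" by simp
      ultimately have "0 \<le> p / 2 * ((p - 1) * (1 + x) powr (p - 2) + (p - 1) * (1 - x) powr (p - 2)) - p * (p - 1)"
        by linarith
      then show "\<exists>y. (f1 has_real_derivative y) (at x) \<and> 0 \<le> y" using d1[of x] x s by auto
    qed
    then show ?thesis by (simp add: f1_def)
  qed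
  have d: "(f has_real_derivative f1 s) (at s)" if "0 < s" "s < 1" for s
  proof -
    have sq: "((\<lambda>s. s\<^sup>2) has_real_derivative 2 * s) (at s)" by (auto intro!: derivative_eq_intros)
    have "((\<lambda>s. 1 / 2 * ((1 + s) powr p + (1 - s) powr p) - (1 + p * (p - 1) / 2 * s\<^sup>2)) has_real_derivative
        (1 / 2 * (p * (1 + s) powr (p - 1) + - (p * (1 - s) powr (p - 1))) - (0 + p * (p - 1) / 2 * (2 * s)))) (at s)"
      using that by (intro DERIV_diff DERIV_cmult DERIV_add DERIV_const dp sq) auto
    moreover have "(\<lambda>s. 1 / 2 * ((1 + s) powr p + (1 - s) powr p) - (1 + p * (p - 1) / 2 * s\<^sup>2)) = f"
      by (simp add: f_def fun_eq_iff)
    moreover have "1 / 2 * (p * (1 + s) powr (p - 1) + - (p * (1 - s) powr (p - 1))) - (0 + p * (p - 1) / 2 * (2 * s)) = f1 s"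
      by (simp add: f1_def right_diff_distrib)
    ultimately show ?thesis by metis
  qed
  have "f 0 \<le> f t"
  proof (cases "t = 0")
    case False
    \<comment> \<open>At the end point 1 only continuity of \<open>f\<close> is used, so
      monotonicity is drawn from the derivative on the open interval.\<close>
    show ?thesis
    proof (rule DERIV_nonneg_imp_increasing_open[of 0 t f])
      show "0 \<le> t" by (rule t)
      show "\<exists>y. (f has_real_derivative y) (at x) \<and> 0 \<le> y" if "0 < x" "x < t" for x
        using d[of x] f1[of x] that t by auto
      show "continuous_on {0..t} f"
        unfolding f_def using p t by (intro continuous_intros continuous_on_powr') auto
    qed
  qed simp
  then show ?thesis by (simp add: f_def)
qed

text \<open>Two-point inequality of Beckner and Ball--Carlen--Lieb; only the constant \<open>p - 1\<close> being positive matters.\<close>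

lemma two_point:
  fixes p A B :: real
  assumes p: "1 < p" "p \<le> 2"
  shows "(A\<^sup>2 + (p - 1) * B\<^sup>2) powr (p / 2) \<le> (\<bar>A + B\<bar> powr p + \<bar>A - B\<bar> powr p) / 2"
proof -
  \<comment> \<open>The tangent of the concave power at 1.\<close>
  have conc: "x powr (p / 2) \<le> 1 + p / 2 * (x - 1)" if "x \<ge> 0" for x :: real
    using powr_concave_ineq[of "p / 2" x 1 "1" 0] powr_concave_ineq[of 1 1 1 1 0] that p
    by (cases "x = 0") (use Youngs_inequality_0[of "p / 2" "1 - p / 2" x 1] in \<open>auto simp: algebra_simps diff_divide_distrib\<close>)
  have main: "(A\<^sup>2 + (p - 1) * B\<^sup>2) powr (p / 2) \<le> ((A + B) powr p + \<bar>A - B\<bar> powr p) / 2"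
    if AB: "0 \<le> A" "0 \<le> B" for A B
  proof (cases "B \<le> A")
    case True
    show ?thesis
    proof (cases "A = 0")
      case False
      then have A: "A > 0" using AB by simp
      define t where "t = B / A"
      have t: "0 \<le> t" "t \<le> 1" "B = A * t" using A AB True by (auto simp: t_def)
      have sq: "A\<^sup>2 powr (p / 2) = A powr p" using A by (simp add: sq_powr)
      have "A\<^sup>2 + (p - 1) * B\<^sup>2 = A\<^sup>2 * (1 + (p - 1) * t\<^sup>2)" by (simp add: t(3) power_mult_distrib algebra_simps)
      then have "(A\<^sup>2 + (p - 1) * B\<^sup>2) powr (p / 2) = A powr p * (1 + (p - 1) * t\<^sup>2) powr (p / 2)"
        using p by (simp add: powr_mult sq)
      also have "\<dots> \<le> A powr p * (1 + p / 2 * ((1 + (p - 1) * t\<^sup>2) - 1))"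
        using p by (intro mult_left_mono conc) auto
      also have "\<dots> \<le> A powr p * (((1 + t) powr p + (1 - t) powr p) / 2)"
      proof (intro mult_left_mono)
        have "1 + p / 2 * ((1 + (p - 1) * t\<^sup>2) - 1) = 1 + p * (p - 1) / 2 * t\<^sup>2" by simp
        then show "1 + p / 2 * ((1 + (p - 1) * t\<^sup>2) - 1) \<le> ((1 + t) powr p + (1 - t) powr p) / 2"
          using two_point_aux[OF p t(1,2)] by linarith
      qed simp
      also have "\<dots> = ((A + B) powr p + \<bar>A - B\<bar> powr p) / 2"
      proof -
        have e: "A + B = A * (1 + t)" "\<bar>A - B\<bar> = A * (1 - t)" using t A AB True by (auto simp: algebra_simps)
        have "(A + B) powr p = A powr p * (1 + t) powr p" "\<bar>A - B\<bar> powr p = A powr p * (1 - t) powr p"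
          unfolding e using A t by (simp_all add: powr_mult)
        then show ?thesis by (simp add: distrib_left)
      qed
      finally show ?thesis .
    qed (use AB True in auto)
  next
    case False
    then have B: "B > 0" "A < B" using AB by auto
    \<comment> \<open>The one-variable inequality applies with the roles exchanged because
      \<open>t\<^sup>2 + (p - 1)\<close> is smaller than \<open>1 + (p - 1) * t\<^sup>2\<close> by
      the nonnegative amount (2 - p)(1 - t^2).\<close>
    define t where "t = A / B"
    have t: "0 \<le> t" "t \<le> 1" "A = B * t" using B AB by (auto simp: t_def)
    have sq: "B\<^sup>2 powr (p / 2) = B powr p" using B by (simp add: sq_powr)
    have "A\<^sup>2 + (p - 1) * B\<^sup>2 = B\<^sup>2 * (t\<^sup>2 + (p - 1))" by (simp add: t(3) power_mult_distrib algebra_simps)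
    then have "(A\<^sup>2 + (p - 1) * B\<^sup>2) powr (p / 2) = B powr p * (t\<^sup>2 + (p - 1)) powr (p / 2)"
      using p by (simp add: powr_mult sq)
    also have "\<dots> \<le> B powr p * (1 + p / 2 * ((t\<^sup>2 + (p - 1)) - 1))"
      using p by (intro mult_left_mono conc) auto
    also have "\<dots> \<le> B powr p * (1 + p * (p - 1) / 2 * t\<^sup>2)"
    proof (intro mult_left_mono add_left_mono)
      have "0 \<le> p / 2 * ((2 - p) * (1 - t\<^sup>2))" using p t by (auto simp: power_le_one)
      then show "p / 2 * ((t\<^sup>2 + (p - 1)) - 1) \<le> p * (p - 1) / 2 * t\<^sup>2" by (simp add: field_simps)
    qed auto
    also have "\<dots> \<le> B powr p * (((1 + t) powr p + (1 - t) powr p) / 2)"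
      using two_point_aux[OF p t(1,2)] by (intro mult_left_mono) auto
    also have "\<dots> = ((A + B) powr p + \<bar>A - B\<bar> powr p) / 2"
    proof -
      have e: "A + B = B * (1 + t)" "\<bar>A - B\<bar> = B * (1 - t)" using t B AB by (auto simp: algebra_simps)
      have "(A + B) powr p = B powr p * (1 + t) powr p" "\<bar>A - B\<bar> powr p = B powr p * (1 - t) powr p"
        unfolding e using B t by (simp_all add: powr_mult)
      then show ?thesis by (simp add: distrib_left)
    qed
    finally show ?thesis .
  qed
  \<comment> \<open>Only the moduli matter: replacing \<open>A\<close> and \<open>B\<close> by them
    at most swaps the moduli of sum and difference.\<close>
  have "{\<bar>A\<bar> + \<bar>B\<bar>, \<bar>\<bar>A\<bar> - \<bar>B\<bar>\<bar>} = {\<bar>A + B\<bar>, \<bar>A - B\<bar>}" by (auto simp: abs_if)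
  then have "(\<bar>A\<bar> + \<bar>B\<bar>) powr p + \<bar>\<bar>A\<bar> - \<bar>B\<bar>\<bar> powr p = \<bar>A + B\<bar> powr p + \<bar>A - B\<bar> powr p"
    by (auto simp: doubleton_eq_iff)
  then show ?thesis using main[of "\<bar>A\<bar>" "\<bar>B\<bar>"] by simp
qed

section \<open>Finite-dimensional l^p norms\<close>

definition lnorm :: "'i set \<Rightarrow> real \<Rightarrow> ('i \<Rightarrow> real) \<Rightarrow> real" where
  "lnorm A p x = (\<Sum>l\<in>A. \<bar>x l\<bar> powr p) powr (1 / p)"

lemma lnorm_nonneg [simp]: "lnorm A p x \<ge> 0"
  by (simp add: lnorm_def)

lemma lnorm_powr: "p > 0 \<Longrightarrow> lnorm A p x powr p = (\<Sum>l\<in>A. \<bar>x l\<bar> powr p)"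
  by (simp add: lnorm_def powr_powr sum_nonneg)

lemma lnorm_scale: "p > 0 \<Longrightarrow> lnorm A p (\<lambda>l. c * x l) = \<bar>c\<bar> * lnorm A p x"
  by (simp add: lnorm_def abs_mult powr_mult sum_distrib_left[symmetric] powr_powr sum_nonneg)

lemma lnorm_component: "finite A \<Longrightarrow> l \<in> A \<Longrightarrow> p > 0 \<Longrightarrow> \<bar>x l\<bar> \<le> lnorm A p x"
proof -
  assume A: "finite A" "l \<in> A" "p > 0"
  have "\<bar>x l\<bar> powr p \<le> (\<Sum>l\<in>A. \<bar>x l\<bar> powr p)" using A by (intro member_le_sum) auto
  then have "(\<bar>x l\<bar> powr p) powr (1 / p) \<le> lnorm A p x"
    unfolding lnorm_def using A by (intro powr_mono2) auto
  then show ?thesis using A by (simp add: powr_powr)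
qed

lemma lnorm_cong: "(\<And>l. l \<in> A \<Longrightarrow> x l = y l) \<Longrightarrow> lnorm A p x = lnorm A p y"
  by (simp add: lnorm_def)

lemma lnorm_eq_0D: "finite A \<Longrightarrow> p > 0 \<Longrightarrow> lnorm A p x = 0 \<Longrightarrow> l \<in> A \<Longrightarrow> x l = 0"
  using lnorm_component[of A l p x] by simp

lemma lnorm_triangle:
  assumes A: "finite A" and p: "p \<ge> 1"
  shows "lnorm A p (\<lambda>l. x l + y l) \<le> lnorm A p x + lnorm A p y"
proof (cases "lnorm A p x = 0 \<or> lnorm A p y = 0")
  case True
  then show ?thesis
  proof
    assume "lnorm A p x = 0"
    then have "lnorm A p (\<lambda>l. x l + y l) = lnorm A p y" using A p lnorm_eq_0D[of A p x] by (intro lnorm_cong) auto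
    then show ?thesis by simp
  next
    assume "lnorm A p y = 0"
    then have "lnorm A p (\<lambda>l. x l + y l) = lnorm A p x" using A p lnorm_eq_0D[of A p y] by (intro lnorm_cong) auto
    then show ?thesis by simp
  qed
next
  case False
  define a where "a = lnorm A p x"
  define b where "b = lnorm A p y"
  have ab: "a > 0" "b > 0" using False by (auto simp: a_def b_def less_le)
  let ?u = "a / (a + b)" and ?v = "b / (a + b)"
  have uv: "?u + ?v = 1" using ab by (simp add: add_divide_distrib[symmetric])
  have pt: "\<bar>x l + y l\<bar> powr p \<le> (a + b) powr p * (?u * (\<bar>x l\<bar> / a) powr p + ?v * (\<bar>y l\<bar> / b) powr p)" for l
  proof -
    have "\<bar>x l + y l\<bar> \<le> (a + b) * (?u * (\<bar>x l\<bar> / a) + ?v * (\<bar>y l\<bar> / b))"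
    proof -
      have "(a + b) * (?u * (\<bar>x l\<bar> / a) + ?v * (\<bar>y l\<bar> / b)) = \<bar>x l\<bar> + \<bar>y l\<bar>"
        using ab by (rule weighted_cancel)
      then show ?thesis by simp
    qed
    then have "\<bar>x l + y l\<bar> powr p \<le> ((a + b) * (?u * (\<bar>x l\<bar> / a) + ?v * (\<bar>y l\<bar> / b))) powr p"
      using p by (intro powr_mono2) auto
    also have "\<dots> = (a + b) powr p * (?u * (\<bar>x l\<bar> / a) + ?v * (\<bar>y l\<bar> / b)) powr p"
      using ab by (simp add: powr_mult)
    also have "\<dots> \<le> (a + b) powr p * (?u * (\<bar>x l\<bar> / a) powr p + ?v * (\<bar>y l\<bar> / b) powr p)"
      using ab p uv by (intro mult_left_mono powr_convex_ineq) auto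
    finally show ?thesis .
  qed
  have "(\<Sum>l\<in>A. \<bar>x l + y l\<bar> powr p) \<le> (\<Sum>l\<in>A. (a + b) powr p * (?u * (\<bar>x l\<bar> / a) powr p + ?v * (\<bar>y l\<bar> / b) powr p))"
    by (intro sum_mono pt)
  also have "\<dots> = (a + b) powr p * (?u * ((\<Sum>l\<in>A. \<bar>x l\<bar> powr p) / a powr p) + ?v * ((\<Sum>l\<in>A. \<bar>y l\<bar> powr p) / b powr p))"
    using ab by (simp add: powr_divide sum_distrib_left[symmetric] sum.distrib sum_divide_distrib[symmetric])
  also have "\<dots> = (a + b) powr p"
    using ab p uv by (simp add: lnorm_powr[symmetric] a_def[symmetric] b_def[symmetric])
  finally have "(\<Sum>l\<in>A. \<bar>x l + y l\<bar> powr p) powr (1 / p) \<le> ((a + b) powr p) powr (1 / p)"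
    using p by (intro powr_mono2) (auto intro: sum_nonneg)
  then show ?thesis using p ab by (simp add: lnorm_def[of A p "\<lambda>l. x l + y l"] a_def[symmetric] b_def[symmetric] powr_powr)
qed

text \<open>For exponents at most one concavity reverses Minkowski's inequality. It is applied to
  squares with exponent \<open>p / 2\<close>.\<close>

lemma reverse_Minkowski:
  fixes x y :: "'i \<Rightarrow> real"
  assumes A: "finite A" and p: "0 < p" "p \<le> 1" and nn: "\<And>l. x l \<ge> 0" "\<And>l. y l \<ge> 0"
  shows "(\<Sum>l\<in>A. x l powr p) powr (1 / p) + (\<Sum>l\<in>A. y l powr p) powr (1 / p) \<le> (\<Sum>l\<in>A. (x l + y l) powr p) powr (1 / p)"
proof -
  define a where "a = (\<Sum>l\<in>A. x l powr p) powr (1 / p)"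
  define b where "b = (\<Sum>l\<in>A. y l powr p) powr (1 / p)"
  have ab0: "a \<ge> 0" "b \<ge> 0" by (auto simp: a_def b_def)
  have ap: "a powr p = (\<Sum>l\<in>A. x l powr p)" "b powr p = (\<Sum>l\<in>A. y l powr p)"
    using p by (auto simp: a_def b_def powr_powr sum_nonneg)
  show ?thesis
  proof (cases "a = 0 \<or> b = 0")
    case True
    have "a \<le> (\<Sum>l\<in>A. (x l + y l) powr p) powr (1 / p)" "b \<le> (\<Sum>l\<in>A. (x l + y l) powr p) powr (1 / p)"
      unfolding a_def b_def using p nn by (intro powr_mono2 sum_mono; auto intro!: sum_nonneg)+
    then show ?thesis using True by (auto simp: a_def[symmetric] b_def[symmetric])
  next
    case False
    then have ab: "a > 0" "b > 0" using ab0 by auto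
    let ?u = "a / (a + b)" and ?v = "b / (a + b)"
    have uv: "?u + ?v = 1" using ab by (simp add: add_divide_distrib[symmetric])
    have "(a + b) powr p = (a + b) powr p * (?u * ((\<Sum>l\<in>A. x l powr p) / a powr p) + ?v * ((\<Sum>l\<in>A. y l powr p) / b powr p))"
      using ab uv by (simp add: ap[symmetric])
    also have "\<dots> = (\<Sum>l\<in>A. (a + b) powr p * (?u * (x l / a) powr p + ?v * (y l / b) powr p))"
      using ab nn by (simp add: powr_divide sum_distrib_left[symmetric] sum.distrib sum_divide_distrib[symmetric])
    also have "\<dots> \<le> (\<Sum>l\<in>A. (x l + y l) powr p)"
    proof (rule sum_mono)
      fix l
      have "(a + b) powr p * (?u * (x l / a) powr p + ?v * (y l / b) powr p) \<le> (a + b) powr p * (?u * (x l / a) + ?v * (y l / b)) powr p"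
        using ab p uv nn by (intro mult_left_mono powr_concave_ineq) auto
      also have "\<dots> = ((a + b) * (?u * (x l / a) + ?v * (y l / b))) powr p"
        using ab nn by (simp add: powr_mult)
      also have "(a + b) * (?u * (x l / a) + ?v * (y l / b)) = x l + y l" using ab by (rule weighted_cancel)
      finally show "(a + b) powr p * (?u * (x l / a) powr p + ?v * (y l / b) powr p) \<le> (x l + y l) powr p" .
    qed
    finally have "((a + b) powr p) powr (1 / p) \<le> (\<Sum>l\<in>A. (x l + y l) powr p) powr (1 / p)"
      using p by (intro powr_mono2) auto
    then show ?thesis using p ab by (simp add: powr_powr a_def[symmetric] b_def[symmetric])
  qed
qed

text \<open>The square of an l^p norm is the l^(p/2) functional of the squares. Reverse Minkowski
  merges the two terms on the left, the two-point inequality acts in each coordinate, and convexity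
  of the power 2/p splits the right-hand side.\<close>

lemma lnorm_2_convex:
  assumes A: "finite A" and p: "1 < p" "p \<le> 2"
  shows "(lnorm A p (\<lambda>l. (x l + y l) / 2))\<^sup>2 + (p - 1) * (lnorm A p (\<lambda>l. (x l - y l) / 2))\<^sup>2
    \<le> ((lnorm A p x)\<^sup>2 + (lnorm A p y)\<^sup>2) / 2"
proof -
  let ?a = "\<lambda>l. (x l + y l) / 2" and ?b = "\<lambda>l. (x l - y l) / 2"
  have sq: "(lnorm A p z)\<^sup>2 = (\<Sum>l\<in>A. \<bar>z l\<bar> powr p) powr (2 / p)" for z
  proof -
    have "(lnorm A p z)\<^sup>2 = lnorm A p z powr 2" by simp
    then show ?thesis by (simp add: lnorm_def powr_powr del: powr_numeral)
  qed
  have s1: "((z :: real)\<^sup>2) powr (p / 2) = \<bar>z\<bar> powr p" for z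
    by (simp add: sq_powr)
  have cb: "(p - 1) * (lnorm A p ?b)\<^sup>2 = (\<Sum>l\<in>A. ((p - 1) * (?b l)\<^sup>2) powr (p / 2)) powr (2 / p)"
    using p by (simp add: sq powr_mult s1 sum_distrib_left[symmetric] powr_powr sum_nonneg del: power_divide)
  have ca: "(lnorm A p ?a)\<^sup>2 = (\<Sum>l\<in>A. ((?a l)\<^sup>2) powr (p / 2)) powr (2 / p)"
    unfolding sq s1 ..
  have "(lnorm A p ?a)\<^sup>2 + (p - 1) * (lnorm A p ?b)\<^sup>2 \<le> (\<Sum>l\<in>A. ((?a l)\<^sup>2 + (p - 1) * (?b l)\<^sup>2) powr (p / 2)) powr (2 / p)"
    unfolding ca cb using reverse_Minkowski[OF A, of "p / 2" "\<lambda>l. (?a l)\<^sup>2" "\<lambda>l. (p - 1) * (?b l)\<^sup>2"] p by simp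
  also have "\<dots> \<le> (\<Sum>l\<in>A. (\<bar>x l\<bar> powr p + \<bar>y l\<bar> powr p) / 2) powr (2 / p)"
  proof (intro powr_mono2 sum_mono)
    fix l
    have "?a l + ?b l = x l" "?a l - ?b l = y l" by (auto simp: field_simps)
    then show "((?a l)\<^sup>2 + (p - 1) * (?b l)\<^sup>2) powr (p / 2) \<le> (\<bar>x l\<bar> powr p + \<bar>y l\<bar> powr p) / 2"
      using two_point[OF p, of "?a l" "?b l"] by simp
  qed (use p in \<open>auto intro!: sum_nonneg\<close>)
  also have "\<dots> = (1 / 2 * (\<Sum>l\<in>A. \<bar>x l\<bar> powr p) + 1 / 2 * (\<Sum>l\<in>A. \<bar>y l\<bar> powr p)) powr (2 / p)"
    by (simp add: sum_divide_distrib[symmetric] sum.distrib add_divide_distrib)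
  also have "\<dots> \<le> 1 / 2 * (\<Sum>l\<in>A. \<bar>x l\<bar> powr p) powr (2 / p) + 1 / 2 * (\<Sum>l\<in>A. \<bar>y l\<bar> powr p) powr (2 / p)"
    using p by (intro powr_convex_ineq) (auto intro!: sum_nonneg)
  also have "\<dots> = ((lnorm A p x)\<^sup>2 + (lnorm A p y)\<^sup>2) / 2" by (simp add: sq)
  finally show ?thesis .
qed

text \<open>As \<open>q / 2\<close> is at least one, superadditivity merges the powers on the left
  and convexity distributes the power on the right. The convexity modulus becomes
  \<open>(p - 1) powr (q / 2)\<close>.\<close>

lemma lnorm_q_convex:
  assumes A: "finite A" and p: "1 < p" "p \<le> 2" and q: "q \<ge> 2"
  shows "lnorm A p (\<lambda>l. (x l + y l) / 2) powr q + (p - 1) powr (q / 2) * lnorm A p (\<lambda>l. (x l - y l) / 2) powr q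
    \<le> (lnorm A p x powr q + lnorm A p y powr q) / 2"
proof -
  let ?a = "lnorm A p (\<lambda>l. (x l + y l) / 2)" and ?b = "lnorm A p (\<lambda>l. (x l - y l) / 2)"
  have s1: "(z\<^sup>2) powr (q / 2) = z powr q" if "z \<ge> 0" for z :: real
    using that by (simp add: sq_powr)
  have "?a powr q + (p - 1) powr (q / 2) * ?b powr q = (?a\<^sup>2) powr (q / 2) + ((p - 1) * ?b\<^sup>2) powr (q / 2)"
    using p by (simp add: s1 powr_mult)
  also have "\<dots> \<le> (?a\<^sup>2 + (p - 1) * ?b\<^sup>2) powr (q / 2)"
    using p q by (intro powr_superadd) auto
  also have "\<dots> \<le> (1 / 2 * (lnorm A p x)\<^sup>2 + 1 / 2 * (lnorm A p y)\<^sup>2) powr (q / 2)"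
    using lnorm_2_convex[OF A p, of x y] p q by (intro powr_mono2) auto
  also have "\<dots> \<le> 1 / 2 * ((lnorm A p x)\<^sup>2) powr (q / 2) + 1 / 2 * ((lnorm A p y)\<^sup>2) powr (q / 2)"
    using q by (intro powr_convex_ineq) auto
  finally show ?thesis by (simp add: s1)
qed

lemma lnorm_2_le:
  assumes A: "finite A" and p: "0 < p" "p \<le> 2"
  shows "lnorm A 2 x \<le> lnorm A p x"
proof (cases "lnorm A p x = 0")
  case True
  have "x l = 0" if "l \<in> A" for l using lnorm_eq_0D[OF A p(1) True that] .
  then have "lnorm A 2 x = 0" by (simp add: lnorm_def)
  then show ?thesis by simp
next
  case False
  define n where "n = lnorm A p x"
  have n: "n > 0" using False by (simp add: n_def less_le)
  have "(\<Sum>l\<in>A. \<bar>x l\<bar> powr 2) \<le> (\<Sum>l\<in>A. \<bar>x l\<bar> powr p * n powr (2 - p))"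
  proof (rule sum_mono)
    fix l assume l: "l \<in> A"
    have "\<bar>x l\<bar> powr 2 = \<bar>x l\<bar> powr p * \<bar>x l\<bar> powr (2 - p)" by (simp flip: powr_add)
    also have "\<dots> \<le> \<bar>x l\<bar> powr p * n powr (2 - p)"
      using lnorm_component[OF A l p(1), of x] p by (intro mult_left_mono powr_mono2) (auto simp: n_def)
    finally show "\<bar>x l\<bar> powr 2 \<le> \<bar>x l\<bar> powr p * n powr (2 - p)" .
  qed
  also have "\<dots> = n powr p * n powr (2 - p)"
    using lnorm_powr[of p A x] p by (simp add: n_def sum_distrib_right)
  also have "\<dots> = n powr 2" by (simp flip: powr_add)
  finally have "(\<Sum>l\<in>A. \<bar>x l\<bar> powr 2) powr (1 / 2) \<le> (n powr 2) powr (1 / 2)"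
    by (intro powr_mono2) (auto intro: sum_nonneg)
  then show ?thesis using n by (simp add: lnorm_def[of A 2] n_def[symmetric] powr_powr del: powr_numeral)
qed

lemma lnorm_Cauchy_Schwarz: "finite A \<Longrightarrow> \<bar>\<Sum>l\<in>A. x l * y l\<bar> \<le> lnorm A 2 x * lnorm A 2 y"
proof -
  have "(\<Sum>l\<in>A. x l * y l)\<^sup>2 \<le> (\<Sum>l\<in>A. (x l)\<^sup>2) * (\<Sum>l\<in>A. (y l)\<^sup>2)" by (rule Cauchy_Schwarz_ineq_sum)
  then have "sqrt ((\<Sum>l\<in>A. x l * y l)\<^sup>2) \<le> sqrt ((\<Sum>l\<in>A. (x l)\<^sup>2) * (\<Sum>l\<in>A. (y l)\<^sup>2))" by (rule real_sqrt_le_mono)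
  then show ?thesis by (simp add: lnorm_def powr_half_sqrt sum_nonneg real_sqrt_mult)
qed

section \<open>Norms of sequences\<close>

lemma enn_powr_ennreal [simp]: "x \<ge> 0 \<Longrightarrow> enn_powr (ennreal x) r = ennreal (x powr r)"
  by (simp add: enn_powr_def)

lemma enn_powr_mono: "x \<le> y \<Longrightarrow> r > 0 \<Longrightarrow> enn_powr x r \<le> enn_powr y r"
  by (auto simp: enn_powr_def top.extremum_unique less_top[symmetric] top_unique intro!: ennreal_leI powr_mono2 enn2real_mono)

lemma enn_powr_inverse: "r > 0 \<Longrightarrow> enn_powr (enn_powr x r) (1 / r) = x"
  by (cases x) (auto simp: enn_powr_def powr_powr)

lemma Lp_norm_count_infty_le: "Lp_norm (count_space A) \<infinity> f \<le> c \<longleftrightarrow> (\<forall>x\<in>A. f x \<le> c)"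
proof
  assume "Lp_norm (count_space A) \<infinity> f \<le> c"
  then have "esssup (count_space A) f \<le> c" by (simp add: Lp_norm_def)
  moreover have "AE x in count_space A. f x \<le> esssup (count_space A) f" by (rule esssup_AE)
  ultimately show "\<forall>x\<in>A. f x \<le> c" by (auto simp: AE_count_space)
next
  assume "\<forall>x\<in>A. f x \<le> c"
  then show "Lp_norm (count_space A) \<infinity> f \<le> c"
    by (auto simp: Lp_norm_def AE_count_space intro!: esssup_I)
qed

lemma Lp_norm_count_member:
  assumes "1 \<le> q" "x \<in> A" shows "f x \<le> Lp_norm (count_space A) q f"
proof (cases "q = \<infinity>")
  case True
  then show ?thesis using Lp_norm_count_infty_le[of A f "Lp_norm (count_space A) q f"] assms by auto
next
  case False
  define r where "r = enn2real q"
  have q: "q = ennreal r" using False by (simp add: r_def less_top)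
  then have r: "q = ennreal r" "r \<ge> 1" using assms(1) by auto
  have "enn_powr (f x) r = (\<integral>\<^sup>+ y. enn_powr (f x) r * indicator {x} y \<partial>count_space A)"
    using assms by (simp add: nn_integral_cmult_indicator)
  also have "\<dots> \<le> (\<integral>\<^sup>+ y. enn_powr (f y) r \<partial>count_space A)"
    by (intro nn_integral_mono) (auto simp: indicator_def)
  finally have "enn_powr (enn_powr (f x) r) (1 / r) \<le> Lp_norm (count_space A) q f"
    unfolding Lp_norm_def using r False by (auto intro!: enn_powr_mono)
  then show ?thesis using r by (simp add: enn_powr_inverse)
qed

lemma Lp_norm_count_real:
  fixes x :: "nat \<Rightarrow> real"
  assumes q: "q > 0" and x: "\<And>j. x j \<ge> 0"
  shows "Lp_norm (count_space UNIV) (ennreal q) (\<lambda>j. ennreal (x j)) =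
    (if summable (\<lambda>j. x j powr q) then ennreal ((\<Sum>j. x j powr q) powr (1 / q)) else \<infinity>)"
proof -
  have "(\<integral>\<^sup>+ j. enn_powr (ennreal (x j)) q \<partial>count_space UNIV) = (\<Sum>j. ennreal (x j powr q))"
    using x by (simp add: nn_integral_count_space_nat)
  also have "\<dots> = (if summable (\<lambda>j. x j powr q) then ennreal (\<Sum>j. x j powr q) else \<infinity>)"
  proof (cases "summable (\<lambda>j. x j powr q)")
    case True
    then show ?thesis by (simp add: suminf_ennreal2)
  next
    case False
    then have "(\<Sum>j. ennreal (x j powr q)) = top"
      using summable_suminf_not_top[of "\<lambda>j. x j powr q"] by fastforce
    then show ?thesis using False by simp
  qed
  finally show ?thesis using q x by (simp add: Lp_norm_def suminf_nonneg enn_powr_def)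
qed

lemma Lp_norm_count_finite:
  fixes x :: "'i \<Rightarrow> real"
  assumes "finite A" "p > 0"
  shows "Lp_norm (count_space A) (ennreal p) (\<lambda>l. ennreal \<bar>x l\<bar>) = ennreal (lnorm A p x)"
  using assms by (simp add: Lp_norm_def nn_integral_count_space_finite lnorm_def sum_nonneg)

section \<open>Besov norms as sequence norms of block norms\<close>

lemma besov_norm_real:
  "p > 0 \<Longrightarrow> besov_norm s (ennreal p) Q u =
    Lp_norm (count_space UNIV) Q (\<lambda>j. ennreal (2 powr (real j * s) * lpn p (lp_block j u)))"
  unfolding besov_norm_def
  by (simp add: Lp_norm_cont lp_block_cont ennreal_mult)

lemma besov_norm_infty_le_iff:
  "p > 0 \<Longrightarrow> A \<ge> 0 \<Longrightarrow> besov_norm s (ennreal p) \<infinity> u \<le> ennreal A \<longleftrightarrow>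
     (\<forall>j. 2 powr (real j * s) * lpn p (lp_block j u) \<le> A)"
  unfolding besov_norm_real Lp_norm_count_infty_le by (simp add: ennreal_le_iff)

text \<open>Mass one orders the inner exponents, and a supremum is below every sequence norm. With
  inner exponent 1 the left-hand side is the norm used in \<open>low_order\<close>.\<close>

lemma besov_norm_embed:
  assumes "0 < p1" "p1 \<le> p2" "1 \<le> Q"
  shows "besov_norm s (ennreal p1) \<infinity> u \<le> besov_norm s (ennreal p2) Q u"
proof -
  have "besov_norm s (ennreal p1) \<infinity> u \<le> besov_norm s (ennreal p2) Q u \<longleftrightarrow>
     (\<forall>j. ennreal (2 powr (real j * s) * lpn p1 (lp_block j u)) \<le> besov_norm s (ennreal p2) Q u)"
    unfolding besov_norm_real[OF assms(1)] Lp_norm_count_infty_le by simp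
  also have "\<dots>"
  proof
    fix j
    have "ennreal (2 powr (real j * s) * lpn p1 (lp_block j u)) \<le> ennreal (2 powr (real j * s) * lpn p2 (lp_block j u))"
      using assms by (intro ennreal_leI mult_left_mono lpn_mono_exponent lp_block_cont) auto
    also have "\<dots> \<le> besov_norm s (ennreal p2) Q u"
      using assms by (simp add: besov_norm_real Lp_norm_count_member[of Q j UNIV "\<lambda>j. ennreal (2 powr (real j * s) * lpn p2 (lp_block j u))"])
    finally show "ennreal (2 powr (real j * s) * lpn p1 (lp_block j u)) \<le> besov_norm s (ennreal p2) Q u" .
  qed
  finally show ?thesis .
qed

lemma low_orderI: "\<bar>s\<bar> < real m \<Longrightarrow> 1 \<le> p \<Longrightarrow> 1 \<le> Q \<Longrightarrow> u \<in> besov s (ennreal p) Q \<Longrightarrow> u \<in> low_order m"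
  unfolding low_order_def besov_def using besov_norm_embed[of 1 p Q s u]
  by (auto intro!: bexI[of _ s] intro: le_less_trans)

section \<open>Decay of the Littlewood--Paley blocks of test functions\<close>

lemma test_differentiable: "\<psi> \<in> test_functions \<Longrightarrow> \<psi> differentiable (at x)"
  unfolding test_functions_def using pderivs_Nil by (metis (mono_tags, lifting) mem_Collect_eq)

lemma pderivs_snoc: "pderivs (is @ [i]) \<psi> = pderivs is (pderiv1 i \<psi>)"
  by (simp add: pderivs_def)

lemma test_pderiv1:
  assumes psi: "\<psi> \<in> test_functions"
  shows "pderiv1 i \<psi> \<in> test_functions"
proof -
  have "pderiv1 i \<psi> (x + axis k 1) = pderiv1 i \<psi> x" for x k
  proof -
    let ?D = "frechet_derivative \<psi> (at (x + axis k 1))"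
    have "(\<psi> has_derivative ?D) (at (x + axis k 1))"
      using test_differentiable[OF psi] by (simp add: frechet_derivative_works)
    moreover have "((\<lambda>y. y + axis k 1) has_derivative (\<lambda>h. h)) (at x)"
      by (auto intro!: derivative_eq_intros)
    ultimately have "((\<lambda>y. \<psi> (y + axis k 1)) has_derivative ?D) (at x)"
      using has_derivative_compose by fastforce
    moreover have "(\<lambda>y. \<psi> (y + axis k 1)) = \<psi>"
      using psi by (auto simp: test_functions_def torus_periodic_def)
    ultimately have "?D = frechet_derivative \<psi> (at x)" by (simp add: frechet_derivative_at)
    then show ?thesis by (simp add: pderiv1_def)
  qed
  moreover have "pderivs is (pderiv1 i \<psi>) differentiable (at x)" for "is" x
    using psi unfolding pderivs_snoc[symmetric] test_functions_def by blast
  ultimately show ?thesis by (simp add: test_functions_def torus_periodic_def)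
qed

lemma test_cont: "\<psi> \<in> test_functions \<Longrightarrow> continuous_on UNIV \<psi>"
  by (rule test_functions_continuous)

lemma test_periodic: "\<psi> \<in> test_functions \<Longrightarrow> torus_periodic \<psi>"
  by (simp add: test_functions_def)

text \<open>The product with a character is periodic, so its derivative integrates to zero.\<close>

lemma integral_by_parts:
  assumes psi: "\<psi> \<in> test_functions" and k: "k \<in> lattice"
  shows "(\<integral>x. pderiv1 i \<psi> x * cosk k x \<partial>torus) = (2 * pi * k $ i) * (\<integral>x. \<psi> x * sink k x \<partial>torus)"
    and "(\<integral>x. pderiv1 i \<psi> x * sink k x \<partial>torus) = - (2 * pi * k $ i) * (\<integral>x. \<psi> x * cosk k x \<partial>torus)"
proof -
  note D = test_differentiable[OF psi, unfolded frechet_derivative_works]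
  have per: "torus_periodic (\<lambda>x. \<psi> x * f x)" if "torus_periodic f" for f
    using that test_periodic[OF psi] by (simp add: torus_periodic_def)
  have cont: "continuous_on UNIV \<psi>" "continuous_on UNIV (pderiv1 i \<psi>)"
    by (intro test_cont psi test_pderiv1)+
  have int: "integrable torus (\<lambda>x. f x * g x)" if "continuous_on UNIV f" "continuous_on UNIV g" for f g :: "real ^ 'a \<Rightarrow> real"
    by (intro cont_integrable_torus continuous_intros that)
  have dc: "((\<lambda>x. \<psi> x * cosk k x) has_derivative
      (\<lambda>h. \<psi> x * (- (2 * pi * (k \<bullet> h)) * sink k x) + frechet_derivative \<psi> (at x) h * cosk k x)) (at x)" for x
    by (intro has_derivative_mult D cosk_has_derivative)
  have pc: "pderiv1 i (\<lambda>x. \<psi> x * cosk k x) = (\<lambda>x. pderiv1 i \<psi> x * cosk k x - (2 * pi * k $ i) * (\<psi> x * sink k x))"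
    by (rule ext) (simp add: pderiv1_def frechet_derivative_at[OF dc, symmetric] inner_axis)
  have "integral\<^sup>L torus (pderiv1 i (\<lambda>x. \<psi> x * cosk k x)) = 0"
    by (rule integral_pderiv1)
       (auto simp: pc intro!: per periodic_char k differentiableI[OF dc] continuous_intros cont)
  then show "(\<integral>x. pderiv1 i \<psi> x * cosk k x \<partial>torus) = (2 * pi * k $ i) * (\<integral>x. \<psi> x * sink k x \<partial>torus)"
    unfolding pc by (simp add: int cont continuous_intros)
  have ds: "((\<lambda>x. \<psi> x * sink k x) has_derivative
      (\<lambda>h. \<psi> x * ((2 * pi * (k \<bullet> h)) * cosk k x) + frechet_derivative \<psi> (at x) h * sink k x)) (at x)" for x
    by (intro has_derivative_mult D sink_has_derivative)
  have ps: "pderiv1 i (\<lambda>x. \<psi> x * sink k x) = (\<lambda>x. pderiv1 i \<psi> x * sink k x + (2 * pi * k $ i) * (\<psi> x * cosk k x))"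
    by (rule ext) (simp add: pderiv1_def frechet_derivative_at[OF ds, symmetric] inner_axis)
  have "integral\<^sup>L torus (pderiv1 i (\<lambda>x. \<psi> x * sink k x)) = 0"
    by (rule integral_pderiv1)
       (auto simp: ps intro!: per periodic_char k differentiableI[OF ds] continuous_intros cont)
  then show "(\<integral>x. pderiv1 i \<psi> x * sink k x \<partial>torus) = - (2 * pi * k $ i) * (\<integral>x. \<psi> x * cosk k x \<partial>torus)"
    unfolding ps by (simp add: int cont continuous_intros)
qed

definition fourier_size :: "(real ^ 'd \<Rightarrow> real) \<Rightarrow> real ^ 'd \<Rightarrow> real" where
  "fourier_size \<psi> k = \<bar>\<integral>x. \<psi> x * cosk k x \<partial>torus\<bar> + \<bar>\<integral>x. \<psi> x * sink k x \<partial>torus\<bar>"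

lemma fourier_size_le:
  assumes cont: "continuous_on UNIV \<psi>" and B: "\<And>x. x \<in> cbox 0 One \<Longrightarrow> \<bar>\<psi> x\<bar> \<le> B"
  shows "fourier_size \<psi> k \<le> 2 * B"
proof -
  have 1: "\<bar>\<integral>x. \<psi> x * f x \<partial>torus\<bar> \<le> B" if f: "continuous_on UNIV f" "\<And>x. \<bar>f x\<bar> \<le> 1" for f
  proof -
    have "\<bar>\<integral>x. \<psi> x * f x \<partial>torus\<bar> \<le> (\<integral>x. \<bar>\<psi> x * f x\<bar> \<partial>torus)" by (rule integral_abs_bound)
    also have "\<dots> \<le> B"
    proof (rule torus.integral_le_const)
      show "integrable torus (\<lambda>x. \<bar>\<psi> x * f x\<bar>)" by (intro cont_integrable_torus continuous_intros cont f)
      show "AE x in torus. \<bar>\<psi> x * f x\<bar> \<le> B"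
      proof (rule AE_I2)
        fix x :: "real ^ 'a" assume "x \<in> space torus"
        then have x: "x \<in> cbox 0 One" by simp
        have "\<bar>\<psi> x\<bar> * \<bar>f x\<bar> \<le> B * 1" using B[OF x] f(2)[of x] by (intro mult_mono) auto
        then show "\<bar>\<psi> x * f x\<bar> \<le> B" by (simp add: abs_mult)
      qed
    qed
    finally show ?thesis .
  qed
  show ?thesis
    unfolding fourier_size_def using 1[OF cont_cosk abs_cosk_le, of k] 1[OF cont_sink abs_sink_le, of k] by linarith
qed

lemma fourier_size_pderivs:
  assumes "\<psi> \<in> test_functions" "k \<in> lattice"
  shows "fourier_size (pderivs (replicate n i) \<psi>) k = (2 * pi * \<bar>k $ i\<bar>) ^ n * fourier_size \<psi> k
     \<and> pderivs (replicate n i) \<psi> \<in> test_functions"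
proof (induction n)
  case (Suc n)
  have "fourier_size (pderiv1 i \<eta>) k = (2 * pi * \<bar>k $ i\<bar>) * fourier_size \<eta> k" if "\<eta> \<in> test_functions" for \<eta>
    using that assms(2) by (simp add: fourier_size_def integral_by_parts abs_mult distrib_left)
  then show ?case using Suc by (simp add: pderivs_Cons test_pderiv1)
qed (use assms in simp)

text \<open>Some coordinate of \<open>k\<close> carries at least the fraction 1/d of its size, by
  comparison with the sum of the moduli; differentiating in that direction alone gives the decay.
  The factor 2 pi is estimated below by one.\<close>

lemma fourier_size_decay:
  fixes \<psi> :: "real ^ 'd \<Rightarrow> real"
  assumes psi: "\<psi> \<in> test_functions" and k: "k \<in> lattice" "norm k \<ge> R" "R > 0"
    and B: "\<And>i x. x \<in> cbox 0 One \<Longrightarrow> \<bar>pderivs (replicate n i) \<psi> x\<bar> \<le> B"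
  shows "fourier_size \<psi> k \<le> 2 * B * (real CARD('d) / R) ^ n"
proof -
  have "\<exists>i. R / real CARD('d) \<le> \<bar>k $ i\<bar>"
  proof (rule ccontr)
    assume "\<not> ?thesis"
    then have "(\<Sum>i\<in>UNIV. \<bar>k $ i\<bar>) < (\<Sum>i\<in>(UNIV :: 'd set). R / real CARD('d))"
      by (intro sum_strict_mono) (auto simp: not_le)
    then show False using norm_le_l1_cart[of k] k(2) by simp
  qed
  then obtain i where i: "R / real CARD('d) \<le> \<bar>k $ i\<bar>" by blast
  have "1 * (R / real CARD('d)) \<le> 2 * pi * \<bar>k $ i\<bar>"
    using i k(3) pi_gt3 by (intro mult_mono) auto
  then have "(R / real CARD('d)) ^ n \<le> (2 * pi * \<bar>k $ i\<bar>) ^ n"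
    using k(3) by (intro power_mono) auto
  then have "(R / real CARD('d)) ^ n * fourier_size \<psi> k \<le> (2 * pi * \<bar>k $ i\<bar>) ^ n * fourier_size \<psi> k"
    by (intro mult_right_mono) (auto simp: fourier_size_def)
  also have "\<dots> = fourier_size (pderivs (replicate n i) \<psi>) k"
    using fourier_size_pderivs[OF psi k(1), of n i] by simp
  also have "\<dots> \<le> 2 * B"
    using fourier_size_pderivs[OF psi k(1), of n i] by (intro fourier_size_le test_cont B) auto
  finally show ?thesis using k(3) by (simp add: power_divide field_simps)
qed

text \<open>A block has at most of the order of 2^(j d) frequencies. Of the
  \<open>CARD('d) + n\<close> derivatives, \<open>CARD('d)\<close> pay for counting them and
  \<open>n\<close> remain as decay.\<close>

lemma lp_block_test_bound:
  fixes \<psi> :: "real ^ 'd \<Rightarrow> real"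
  assumes psi: "\<psi> \<in> test_functions" and B: "\<And>x. x \<in> cbox 0 One \<Longrightarrow> \<bar>\<psi> x\<bar> \<le> B"
    "\<And>i x. x \<in> cbox 0 One \<Longrightarrow> \<bar>pderivs (replicate (CARD('d) + n) i) \<psi> x\<bar> \<le> B"
  shows "2 ^ (j * n) * \<bar>lp_block j (distr_of_fun \<psi>) x\<bar> \<le> 8 ^ CARD('d) * 2 * (2 * real CARD('d)) ^ (CARD('d) + n) * B"
proof -
  let ?d = "CARD('d)"
  let ?N = "?d + n"
  have "real ?d \<ge> 1" by (simp add: Suc_le_eq)
  then have d2: "1 \<le> 2 * real ?d" by linarith
  have "(0 :: real ^ 'd) \<in> cbox 0 One" by (simp add: cube_mem)
  from B(1)[OF this] have B0: "B \<ge> 0" by linarith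
  have cont: "continuous_on UNIV \<psi>" by (rule test_cont[OF psi])
  have coef: "\<bar>distr_apply (distr_of_fun \<psi>) (cosk k)\<bar> + \<bar>distr_apply (distr_of_fun \<psi>) (sink k)\<bar> = fourier_size \<psi> k"
    if "k \<in> lattice" for k
    using that by (simp add: fourier_size_def distr_apply_fun cont_integrable_torus cont test_cosk test_sink)
  define M where "M = 2 * B * (2 * real ?d / 2 ^ j) ^ ?N"
  have M0: "M \<ge> 0" using B0 by (simp add: M_def)
  have trm: "\<bar>blm j k * (distr_apply (distr_of_fun \<psi>) (cosk k) * cosk k x + distr_apply (distr_of_fun \<psi>) (sink k) * sink k x)\<bar> \<le> M"
    if k: "k \<in> LB j" for k
  proof (cases "blm j k = 0")
    case False
    have kl: "k \<in> lattice" using k by (rule LB_lattice)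
    have "\<bar>blm j k * (distr_apply (distr_of_fun \<psi>) (cosk k) * cosk k x + distr_apply (distr_of_fun \<psi>) (sink k) * sink k x)\<bar>
      \<le> 1 * (\<bar>distr_apply (distr_of_fun \<psi>) (cosk k)\<bar> * 1 + \<bar>distr_apply (distr_of_fun \<psi>) (sink k)\<bar> * 1)"
      unfolding abs_mult[of "blm j k"]
      by (intro mult_mono abs_blm_le order_trans[OF abs_triangle_ineq] add_mono)
         (auto simp: abs_mult intro!: mult_left_le)
    also have "\<dots> = fourier_size \<psi> k" using coef[OF kl] by simp
    also have "\<dots> \<le> M"
    proof (cases "j = 0")
      \<comment> \<open>At level zero there is no lower bound on the frequency; the supremum of
        \<psi> itself suffices.\<close>
      case True
      have "2 * B * 1 \<le> 2 * B * (2 * real ?d) ^ ?N"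
        using B0 d2 by (intro mult_left_mono one_le_power d2) auto
      then show ?thesis using fourier_size_le[OF cont B(1), of k] True by (simp add: M_def)
    next
      case j: False
      have nk: "norm k \<ge> 2 ^ (j - 1)" using blm_low[of j k] False j by force
      have "real ?d / 2 ^ (j - 1) = 2 * real ?d / 2 ^ j" using j by (cases j) auto
      then show ?thesis using fourier_size_decay[OF psi kl nk _ B(2)] by (simp add: M_def)
    qed
    finally show ?thesis .
  qed (use M0 in simp)
  have "\<bar>lp_block j (distr_of_fun \<psi>) x\<bar> \<le> (\<Sum>k\<in>(LB j :: (real ^ 'd) set). M)"
    unfolding lp_block_fmul fmul_def by (intro order_trans[OF sum_abs] sum_mono trm)
  also have "\<dots> = real (card (LB j :: (real ^ 'd) set)) * M" by simp
  also have "\<dots> \<le> (8 * 2 ^ j) ^ ?d * M"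
  proof (intro mult_right_mono M0)
    have "real (card (LB j :: (real ^ 'd) set)) \<le> real ((2 * 2 ^ (j + 1) + 1) ^ ?d)"
      using card_LB[where 'd = 'd, of j] by (rule of_nat_mono)
    also have "\<dots> = (4 * 2 ^ j + 1) ^ ?d" by (simp add: add.commute)
    also have "\<dots> \<le> (8 * 2 ^ j) ^ ?d"
    proof (rule power_mono)
      have "(1::real) \<le> 2 ^ j" by simp
      then show "(4 * 2 ^ j + 1 :: real) \<le> 8 * 2 ^ j" by linarith
    qed simp
    finally show "real (card (LB j :: (real ^ 'd) set)) \<le> (8 * 2 ^ j) ^ ?d" .
  qed
  finally have "2 ^ (j * n) * \<bar>lp_block j (distr_of_fun \<psi>) x\<bar> \<le> 2 ^ (j * n) * ((8 * 2 ^ j) ^ ?d * M)"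
    by (intro mult_left_mono) auto
  also have "\<dots> = 8 ^ ?d * 2 * (2 * real ?d) ^ ?N * B"
    by (simp add: M_def power_mult_distrib power_divide power_add power_mult[symmetric] field_simps)
  finally show ?thesis .
qed

lemma lpn_le_sup:
  fixes f :: "real ^ 'd \<Rightarrow> real"
  assumes "p > 0" "continuous_on UNIV f" "\<And>x. \<bar>f x\<bar> \<le> B"
  shows "lpn p f \<le> B"
proof -
  have B0: "B \<ge> 0" using assms(3)[of 0] by linarith
  have "(\<integral>x. \<bar>f x\<bar> powr p \<partial>torus) \<le> B powr p"
    using assms by (intro torus.integral_le_const cont_powr_integrable AE_I2 powr_mono2) auto
  then have "lpn p f \<le> (B powr p) powr (1 / p)"
    unfolding lpn_def using assms by (intro powr_mono2) (auto intro!: integral_nonneg_AE)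
  then show ?thesis using assms B0 by (simp add: powr_powr)
qed

text \<open>The number of derivatives and the constant depend on \<open>a\<close> and the dimension
  only. This uniformity in \<psi> later becomes the order of a limit distribution.\<close>

lemma test_besov_bound:
  fixes a :: real
  obtains n K where "K > 0"
    "\<And>(\<psi> :: real ^ 'd \<Rightarrow> real) B j. \<psi> \<in> test_functions \<Longrightarrow> (\<And>x. x \<in> cbox 0 One \<Longrightarrow> \<bar>\<psi> x\<bar> \<le> B) \<Longrightarrow>
      (\<And>i x. x \<in> cbox 0 One \<Longrightarrow> \<bar>pderivs (replicate n i) \<psi> x\<bar> \<le> B) \<Longrightarrow>
      2 powr (real j * a) * lpn 2 (lp_block j (distr_of_fun \<psi>)) \<le> K * B"
proof -
  define n where "n = nat \<lceil>a\<rceil>"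
  have na: "a \<le> real n" unfolding n_def by linarith
  let ?K = "8 ^ CARD('d) * 2 * (2 * real CARD('d)) ^ (CARD('d) + n)"
  show thesis
  proof (rule that[of ?K "CARD('d) + n"])
    show "?K > 0" by simp
    fix \<psi> :: "real ^ 'd \<Rightarrow> real" and B j
    assume psi: "\<psi> \<in> test_functions" and B: "\<And>x. x \<in> cbox 0 One \<Longrightarrow> \<bar>\<psi> x\<bar> \<le> B"
      "\<And>i x. x \<in> cbox 0 One \<Longrightarrow> \<bar>pderivs (replicate (CARD('d) + n) i) \<psi> x\<bar> \<le> B"
    have "\<bar>lp_block j (distr_of_fun \<psi>) x\<bar> \<le> ?K * B / 2 ^ (j * n)" for x
      using lp_block_test_bound[OF psi B, of j x] by (simp add: field_simps)
    then have "lpn 2 (lp_block j (distr_of_fun \<psi>)) \<le> ?K * B / 2 ^ (j * n)"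
      by (intro lpn_le_sup lp_block_cont) auto
    moreover have "2 powr (real j * a) \<le> 2 ^ (j * n)"
    proof -
      have "2 powr (real j * a) \<le> 2 powr (real (j * n))" using na by (intro powr_mono) (auto intro: mult_left_mono)
      also have "2 powr (real (j * n)) = 2 ^ (j * n)" by (rule powr_realpow) simp
      finally show ?thesis .
    qed
    ultimately have "2 powr (real j * a) * lpn 2 (lp_block j (distr_of_fun \<psi>)) \<le> 2 ^ (j * n) * (?K * B / 2 ^ (j * n))"
      by (intro mult_mono) auto
    then show "2 powr (real j * a) * lpn 2 (lp_block j (distr_of_fun \<psi>)) \<le> ?K * B" by simp
  qed
qed

lemma test_derivs_bounded:
  fixes \<psi> :: "real ^ 'd \<Rightarrow> real"
  assumes psi: "\<psi> \<in> test_functions"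
  obtains B where "\<And>x. x \<in> cbox 0 One \<Longrightarrow> \<bar>\<psi> x\<bar> \<le> B"
    "\<And>i x. x \<in> cbox 0 One \<Longrightarrow> \<bar>pderivs (replicate n i) \<psi> x\<bar> \<le> B"
proof -
  have "\<exists>b. b \<ge> 0 \<and> (\<forall>x\<in>cbox 0 One. \<bar>pderivs (replicate n i) \<psi> x\<bar> \<le> b)" for i
  proof -
    have "continuous_on UNIV (pderivs (replicate n i) \<psi>)"
      using fourier_size_pderivs[OF psi, of 0 n i] by (auto simp: lattice_def intro: test_cont)
    from cont_bounded_torus[OF this] show ?thesis by metis
  qed
  then obtain b where b: "\<And>i. b i \<ge> 0" "\<And>i x. x \<in> cbox 0 One \<Longrightarrow> \<bar>pderivs (replicate n i) \<psi> x\<bar> \<le> b i" by metis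
  obtain b0 where b0: "b0 \<ge> 0" "\<And>x. x \<in> cbox 0 One \<Longrightarrow> \<bar>\<psi> x\<bar> \<le> b0"
    using cont_bounded_torus[OF test_cont[OF psi]] by metis
  have bS: "b i \<le> (\<Sum>i\<in>UNIV. b i)" for i using b(1) by (intro member_le_sum) auto
  have S0: "0 \<le> (\<Sum>i\<in>UNIV. b i)" using b(1) by (intro sum_nonneg) auto
  show thesis
  proof (rule that[of "b0 + (\<Sum>i\<in>UNIV. b i)"])
    fix i and x :: "real ^ 'd" assume x: "x \<in> cbox 0 One"
    show "\<bar>\<psi> x\<bar> \<le> b0 + (\<Sum>i\<in>UNIV. b i)" using b0(2)[OF x] S0 by linarith
    show "\<bar>pderivs (replicate n i) \<psi> x\<bar> \<le> b0 + (\<Sum>i\<in>UNIV. b i)" using b(2)[OF x, of i] bS[of i] b0(1) by linarith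
  qed
qed

section \<open>Wavelet coefficients and completeness of Besov spaces\<close>

lemma conjugate_exponent:
  fixes p :: real
  assumes "p > 1"
  shows "p / (p - 1) > 1" "1 / (p / (p - 1)) + 1 / p = 1" "1 / p + 1 / (p / (p - 1)) = 1"
  using assms by (auto simp: field_simps)

locale besov_setting =
  fixes m :: nat and I :: "nat \<Rightarrow> 'i set" and \<phi> :: "nat \<Rightarrow> 'i \<Rightarrow> real ^ ('d::finite) \<Rightarrow> real"
    and N :: "real \<Rightarrow> ennreal \<Rightarrow> ennreal \<Rightarrow> 'd distr \<Rightarrow> ennreal" and p q a :: real
  assumes p: "1 < p" "p \<le> 2" and q: "2 \<le> q"
    and a: "a > real CARD('d) / 2" "a > real CARD('d) / p - real CARD('d) / 2" "a < real m"
    and norms: "besov_norm_family N"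
    and wavelets: "besov_wavelets m I \<phi> TYPE('d)"
begin

definition X0 :: "'d distr set" where
  "X0 = besov 0 (ennreal p) (ennreal q)"

text \<open>The wavelet counterpart of \<open>lpn P (lp_block j u)\<close>; the weight is the
  typical L^P norm of an L^2-normalised wavelet of level \<open>j\<close>.\<close>

definition wl :: "real \<Rightarrow> 'd distr \<Rightarrow> nat \<Rightarrow> real" where
  "wl P u j = 2 powr (real j * real CARD('d) * (1 / 2 - 1 / P)) * lnorm (I j) P (wavelet_coeff \<phi> u j)"

definition bl :: "'d distr \<Rightarrow> nat \<Rightarrow> real" where
  "bl u j = lpn p (lp_block j u)"

text \<open>The q-th power of the wavelet norm of B^0_{p,q}. Without the root it is a plain sum over
  levels, so convexity and tangent inequalities can be used level by level.\<close>

definition Phi :: "'d distr \<Rightarrow> real" where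
  "Phi u = (\<Sum>j. wl p u j powr q)"

definition nrm :: "'d distr \<Rightarrow> real" where
  "nrm u = enn2real (N 0 (ennreal p) (ennreal q) u)"

lemma a_pos: "a > 0"
  using a(1) by (smt (verit) of_nat_0_le_iff divide_nonneg_nonneg)

lemma pq1: "1 \<le> ennreal p" "1 \<le> ennreal q"
  using p q by auto

lemma finI: "finite (I j)"
  using wavelets by (simp add: besov_wavelets_def)

lemma phi_cont: "l \<in> I j \<Longrightarrow> continuous_on UNIV (\<phi> j l)"
proof -
  assume "l \<in> I j"
  then have "C_k m (\<phi> j l)" using wavelets by (simp add: besov_wavelets_def)
  then have "continuous_on UNIV (pderivs [] (\<phi> j l))" unfolding C_k_def by (metis le0 list.size(3))
  then show ?thesis by simp
qed

lemma phi_L2: "l \<in> I j \<Longrightarrow> L2fun (\<phi> j l)"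
  by (intro L2fun_cont phi_cont)

lemma phi_orth: "l \<in> I j \<Longrightarrow> l' \<in> I j' \<Longrightarrow>
    (\<integral>x. \<phi> j l x * \<phi> j' l' x \<partial>torus) = (if j = j' \<and> l = l' then 1 else 0)"
  using wavelets unfolding besov_wavelets_def by blast

lemma wavelet_equiv: "\<bar>\<sigma>\<bar> < real m \<Longrightarrow> 1 \<le> P \<Longrightarrow> 1 \<le> Q \<Longrightarrow>
    equivalent_on (low_order m) (besov_norm \<sigma> P Q) (wavelet_norm I \<phi> \<sigma> P Q)"
  using wavelets unfolding besov_wavelets_def by blast

lemma wavelet_expansion: "u \<in> low_order m \<Longrightarrow> \<psi> \<in> test_functions \<Longrightarrow>
    (\<lambda>j. \<Sum>l\<in>I j. wavelet_coeff \<phi> u j l * (\<integral>x. \<phi> j l x * \<psi> x \<partial>torus)) sums distr_apply u \<psi>"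
  using wavelets unfolding besov_wavelets_def by blast

lemma N_equiv: "1 \<le> P \<Longrightarrow> 1 \<le> Q \<Longrightarrow> equivalent_on UNIV (besov_norm \<sigma> P Q) (N \<sigma> P Q)"
  and N_triangle: "1 \<le> P \<Longrightarrow> 1 \<le> Q \<Longrightarrow> N \<sigma> P Q (u + v) \<le> N \<sigma> P Q u + N \<sigma> P Q v"
  and N_scale: "1 \<le> P \<Longrightarrow> 1 \<le> Q \<Longrightarrow> N \<sigma> P Q (c *\<^sub>R u) = ennreal \<bar>c\<bar> * N \<sigma> P Q u"
  using norms unfolding besov_norm_family_def by blast+

lemma besov_iff_N: "1 \<le> P \<Longrightarrow> 1 \<le> Q \<Longrightarrow> u \<in> besov \<sigma> P Q \<longleftrightarrow> N \<sigma> P Q u < \<infinity>"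
proof -
  assume "1 \<le> P" "1 \<le> Q"
  from N_equiv[OF this, of \<sigma>] obtain c C where c: "c > 0" "C > 0"
    "ennreal c * besov_norm \<sigma> P Q u \<le> N \<sigma> P Q u" "N \<sigma> P Q u \<le> ennreal C * besov_norm \<sigma> P Q u"
    unfolding equivalent_on_def by auto
  show ?thesis
  proof
    assume "u \<in> besov \<sigma> P Q"
    then have "ennreal C * besov_norm \<sigma> P Q u < \<infinity>" by (simp add: besov_def ennreal_mult_less_top)
    then show "N \<sigma> P Q u < \<infinity>" using c(4) by (rule le_less_trans[rotated])
  next
    assume "N \<sigma> P Q u < \<infinity>"
    then have "ennreal c * besov_norm \<sigma> P Q u < \<infinity>" using c(3) by (rule le_less_trans[rotated])
    then show "u \<in> besov \<sigma> P Q" using c(1) by (auto simp: besov_def ennreal_mult_less_top)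
  qed
qed

lemma X0_iff_N: "u \<in> X0 \<longleftrightarrow> N 0 (ennreal p) (ennreal q) u < \<infinity>"
  unfolding X0_def using besov_iff_N[OF pq1] .

lemma X0_add: "u \<in> X0 \<Longrightarrow> v \<in> X0 \<Longrightarrow> u + v \<in> X0"
  unfolding X0_iff_N using N_triangle[OF pq1, of 0 u v] by (auto intro: le_less_trans)

lemma X0_scale: "u \<in> X0 \<Longrightarrow> c *\<^sub>R u \<in> X0"
  unfolding X0_iff_N by (simp add: N_scale[OF pq1] ennreal_mult_less_top)

lemma X0_diff: "u \<in> X0 \<Longrightarrow> v \<in> X0 \<Longrightarrow> u - v \<in> X0"
  using X0_add[of u "(-1) *\<^sub>R v"] X0_scale[of v "-1"] by simp

lemma X0_low: "u \<in> X0 \<Longrightarrow> u \<in> low_order m"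
  unfolding X0_def using a a_pos pq1 by (intro low_orderI[of 0 m "p" "ennreal q"]) auto

text \<open>The uniform bound on blocks places square integrable functions in
  B^0_{2,infinity}.\<close>

lemma L2_low: "L2fun h \<Longrightarrow> distr_of_fun h \<in> low_order m"
proof -
  assume h: "L2fun h"
  have "besov_norm 0 (ennreal 2) \<infinity> (distr_of_fun h) \<le> ennreal (2 * l2 (distr_of_fun h))"
    using h by (subst besov_norm_infty_le_iff) (auto simp: L2_norm_fun intro!: lpn_block_le_l2)
  then have "distr_of_fun h \<in> besov 0 (ennreal 2) \<infinity>"
    by (auto simp: besov_def less_top[symmetric] top_unique)
  then show ?thesis using a a_pos by (intro low_orderI[of 0 m 2 \<infinity>]) auto
qed

lemma coeff_L2: "L2fun h \<Longrightarrow> l \<in> I j \<Longrightarrow> wavelet_coeff \<phi> (distr_of_fun h) j l = (\<integral>x. h x * \<phi> j l x \<partial>torus)"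
  by (simp add: wavelet_coeff_def pairing_fun phi_L2)

lemma wavelet_norm_real:
  assumes P: "P > 0"
  shows "wavelet_norm I \<phi> \<sigma> (ennreal P) Q u = Lp_norm (count_space UNIV) Q (\<lambda>j. ennreal (2 powr (real j * \<sigma>) * wl P u j))"
proof -
  have "enn2real (1 / ennreal P) = 1 / P"
    using P divide_ennreal[of 1 P] by simp
  then show ?thesis
    using P by (simp add: wavelet_norm_def besov_seq_norm_def Lp_norm_count_finite finI wl_def ennreal_mult mult.assoc)
qed

lemma wl_nonneg [simp]: "wl P u j \<ge> 0" and bl_nonneg [simp]: "bl u j \<ge> 0"
  by (simp_all add: wl_def bl_def)

text \<open>The wavelet characterization with outer exponent infinity, unpacked into real
  inequalities for single levels; the constant does not depend on the distribution.\<close>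

lemma wl_le_besov:
  assumes "\<bar>\<sigma>\<bar> < real m" "1 \<le> P"
  obtains C where "C > 0" "\<And>u A j. u \<in> low_order m \<Longrightarrow> (\<And>i. 2 powr (real i * \<sigma>) * lpn P (lp_block i u) \<le> A)
    \<Longrightarrow> 2 powr (real j * \<sigma>) * wl P u j \<le> C * A"
proof -
  from wavelet_equiv[OF assms(1), of "ennreal P" \<infinity>] assms(2) obtain c C where c: "C > 0"
    "\<And>u. u \<in> low_order m \<Longrightarrow> wavelet_norm I \<phi> \<sigma> (ennreal P) \<infinity> u \<le> ennreal C * besov_norm \<sigma> (ennreal P) \<infinity> u"
    unfolding equivalent_on_def by auto
  show thesis
  proof (rule that[OF c(1)])
    fix u :: "'d distr" and A j assume u: "u \<in> low_order m" and A: "\<And>i. 2 powr (real i * \<sigma>) * lpn P (lp_block i u) \<le> A"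
    have A0: "A \<ge> 0" using order_trans[OF _ A[of 0]] by simp
    have "besov_norm \<sigma> (ennreal P) \<infinity> u \<le> ennreal A" using A A0 assms by (subst besov_norm_infty_le_iff) auto
    then have "ennreal C * besov_norm \<sigma> (ennreal P) \<infinity> u \<le> ennreal C * ennreal A" by (rule mult_left_mono) simp
    then have "wavelet_norm I \<phi> \<sigma> (ennreal P) \<infinity> u \<le> ennreal (C * A)"
      using c(2)[OF u] c(1) A0 by (auto simp: ennreal_mult intro: order_trans)
    then show "2 powr (real j * \<sigma>) * wl P u j \<le> C * A"
      using A0 c(1) unfolding wavelet_norm_real[OF less_le_trans[OF zero_less_one assms(2)]] Lp_norm_count_infty_le
      by (auto simp: ennreal_le_iff)
  qed
qed

lemma besov_le_wl:
  assumes "\<bar>\<sigma>\<bar> < real m" "1 \<le> P"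
  obtains C where "C > 0" "\<And>u A j. u \<in> low_order m \<Longrightarrow> (\<And>i. 2 powr (real i * \<sigma>) * wl P u i \<le> A)
    \<Longrightarrow> 2 powr (real j * \<sigma>) * lpn P (lp_block j u) \<le> C * A"
proof -
  from wavelet_equiv[OF assms(1), of "ennreal P" \<infinity>] assms(2) obtain c where c: "c > 0"
    "\<And>u. u \<in> low_order m \<Longrightarrow> ennreal c * besov_norm \<sigma> (ennreal P) \<infinity> u \<le> wavelet_norm I \<phi> \<sigma> (ennreal P) \<infinity> u"
    unfolding equivalent_on_def by auto
  show thesis
  proof (rule that[of "1 / c"])
    show "1 / c > 0" using c by simp
    fix u A j assume u: "u \<in> low_order m" and A: "\<And>i. 2 powr (real i * \<sigma>) * wl P u i \<le> A"
    have A0: "A \<ge> 0" using order_trans[OF _ A[of 0]] by simp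
    have "wavelet_norm I \<phi> \<sigma> (ennreal P) \<infinity> u \<le> ennreal A"
      using A A0 assms unfolding wavelet_norm_real[OF less_le_trans[OF zero_less_one assms(2)]] Lp_norm_count_infty_le
      by (auto simp: ennreal_le_iff)
    then have 1: "ennreal c * besov_norm \<sigma> (ennreal P) \<infinity> u \<le> ennreal A" using c(2)[OF u] by (rule order_trans[rotated])
    have "ennreal (2 powr (real j * \<sigma>) * lpn P (lp_block j u)) \<le> besov_norm \<sigma> (ennreal P) \<infinity> u"
      using assms by (subst besov_norm_real) (auto intro: Lp_norm_count_member)
    then have "ennreal c * ennreal (2 powr (real j * \<sigma>) * lpn P (lp_block j u)) \<le> ennreal A"
      using 1 by (meson mult_left_mono order_trans zero_le)
    then have "c * (2 powr (real j * \<sigma>) * lpn P (lp_block j u)) \<le> A"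
      using c(1) A0 by (simp add: ennreal_mult[symmetric] ennreal_le_iff)
    then show "2 powr (real j * \<sigma>) * lpn P (lp_block j u) \<le> 1 / c * A"
      using c(1) by (simp add: field_simps)
  qed
qed

lemma besov_norm_X0:
  "besov_norm 0 (ennreal p) (ennreal q) u =
    (if summable (\<lambda>j. bl u j powr q) then ennreal ((\<Sum>j. bl u j powr q) powr (1 / q)) else \<infinity>)"
  using p q Lp_norm_count_real[of q "bl u"] by (simp add: besov_norm_real bl_def)

lemma wavelet_norm_X0:
  "wavelet_norm I \<phi> 0 (ennreal p) (ennreal q) u =
    (if summable (\<lambda>j. wl p u j powr q) then ennreal (Phi u powr (1 / q)) else \<infinity>)"
  using p q Lp_norm_count_real[of q "wl p u"] by (simp add: wavelet_norm_real Phi_def)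

lemma X0_iff_bl: "u \<in> X0 \<longleftrightarrow> summable (\<lambda>j. bl u j powr q)"
  unfolding X0_def besov_def using besov_norm_X0[of u] by auto

lemma equiv_X0:
  obtains c C where "c > 0" "C > 0"
    "\<And>u. u \<in> X0 \<Longrightarrow> summable (\<lambda>j. wl p u j powr q)"
    "\<And>u. u \<in> X0 \<Longrightarrow> c * (\<Sum>j. bl u j powr q) powr (1 / q) \<le> Phi u powr (1 / q)"
    "\<And>u. u \<in> X0 \<Longrightarrow> Phi u powr (1 / q) \<le> C * (\<Sum>j. bl u j powr q) powr (1 / q)"
proof -
  from wavelet_equiv[of 0, OF _ pq1] a a_pos obtain c C where c: "c > 0" "C > 0"
    "\<And>u. u \<in> low_order m \<Longrightarrow> ennreal c * besov_norm 0 (ennreal p) (ennreal q) u \<le> wavelet_norm I \<phi> 0 (ennreal p) (ennreal q) u"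
    "\<And>u. u \<in> low_order m \<Longrightarrow> wavelet_norm I \<phi> 0 (ennreal p) (ennreal q) u \<le> ennreal C * besov_norm 0 (ennreal p) (ennreal q) u"
    unfolding equivalent_on_def by auto
  have s: "summable (\<lambda>j. wl p u j powr q)" if u: "u \<in> X0" for u
  proof (rule ccontr)
    assume "\<not> ?thesis"
    then have "ennreal C * besov_norm 0 (ennreal p) (ennreal q) u = \<infinity>"
      using c(4)[OF X0_low[OF u]] by (simp add: wavelet_norm_X0 top_unique)
    moreover have "besov_norm 0 (ennreal p) (ennreal q) u < \<infinity>" using u by (simp add: X0_def besov_def)
    ultimately show False by (simp add: ennreal_mult_eq_top_iff)
  qed
  show thesis
  proof (rule that[OF c(1,2) s])
    fix u assume u: "u \<in> X0"
    then have b: "summable (\<lambda>j. bl u j powr q)" by (simp add: X0_iff_bl)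
    show "c * (\<Sum>j. bl u j powr q) powr (1 / q) \<le> Phi u powr (1 / q)"
      using c(3)[OF X0_low[OF u]] c(1) by (simp add: wavelet_norm_X0 besov_norm_X0 s[OF u] b ennreal_mult[symmetric] ennreal_le_iff)
    show "Phi u powr (1 / q) \<le> C * (\<Sum>j. bl u j powr q) powr (1 / q)"
      using c(4)[OF X0_low[OF u]] c(2) by (simp add: wavelet_norm_X0 besov_norm_X0 s[OF u] b ennreal_mult[symmetric] ennreal_le_iff)
  qed
qed

lemma wl_summable: "u \<in> X0 \<Longrightarrow> summable (\<lambda>j. wl p u j powr q)"
  by (rule equiv_X0) auto

lemma Phi_nonneg: "u \<in> X0 \<Longrightarrow> Phi u \<ge> 0"
  unfolding Phi_def by (intro suminf_nonneg wl_summable) auto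

lemma nrm_nonneg [simp]: "nrm u \<ge> 0"
  by (simp add: nrm_def)

lemma N_nrm: "u \<in> X0 \<Longrightarrow> N 0 (ennreal p) (ennreal q) u = ennreal (nrm u)"
  unfolding X0_iff_N nrm_def by simp

lemma nrm_equiv:
  obtains c C where "c > 0" "C > 0"
    "\<And>u. u \<in> X0 \<Longrightarrow> c * Phi u powr (1 / q) \<le> nrm u" "\<And>u. u \<in> X0 \<Longrightarrow> nrm u \<le> C * Phi u powr (1 / q)"
proof (rule equiv_X0)
  fix c C assume c: "c > 0" "C > 0"
    "\<And>u. u \<in> X0 \<Longrightarrow> summable (\<lambda>j. wl p u j powr q)"
    "\<And>u. u \<in> X0 \<Longrightarrow> c * (\<Sum>j. bl u j powr q) powr (1 / q) \<le> Phi u powr (1 / q)"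
    "\<And>u. u \<in> X0 \<Longrightarrow> Phi u powr (1 / q) \<le> C * (\<Sum>j. bl u j powr q) powr (1 / q)"
  from N_equiv[OF pq1, of 0] obtain e E where e: "e > 0" "E > 0"
    "\<And>u. ennreal e * besov_norm 0 (ennreal p) (ennreal q) u \<le> N 0 (ennreal p) (ennreal q) u"
    "\<And>u. N 0 (ennreal p) (ennreal q) u \<le> ennreal E * besov_norm 0 (ennreal p) (ennreal q) u"
    unfolding equivalent_on_def by auto
  show thesis
  proof (rule that[of "e / C" "E / c"])
    show "e / C > 0" "E / c > 0" using c e by auto
    fix u assume u: "u \<in> X0"
    then have b: "summable (\<lambda>j. bl u j powr q)" by (simp add: X0_iff_bl)
    have 1: "e * (\<Sum>j. bl u j powr q) powr (1 / q) \<le> nrm u"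
      using e(3)[of u] e(1) by (simp add: N_nrm[OF u] besov_norm_X0 b ennreal_mult[symmetric] ennreal_le_iff)
    have 2: "nrm u \<le> E * (\<Sum>j. bl u j powr q) powr (1 / q)"
      using e(4)[of u] e(2) by (simp add: N_nrm[OF u] besov_norm_X0 b ennreal_mult[symmetric] ennreal_le_iff)
    have "e / C * Phi u powr (1 / q) \<le> e / C * (C * (\<Sum>j. bl u j powr q) powr (1 / q))"
      using c(5)[OF u] c(2) e(1) by (intro mult_left_mono) auto
    also have "\<dots> \<le> nrm u" using 1 c(2) by simp
    finally show "e / C * Phi u powr (1 / q) \<le> nrm u" .
    have "E * (\<Sum>j. bl u j powr q) powr (1 / q) = E / c * (c * (\<Sum>j. bl u j powr q) powr (1 / q))" using c(1) by simp
    also have "\<dots> \<le> E / c * Phi u powr (1 / q)"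
      using c(4)[OF u] c(1) e(2) by (intro mult_left_mono) auto
    finally show "nrm u \<le> E / c * Phi u powr (1 / q)" using 2 by linarith
  qed
qed

text \<open>Orthonormality leaves a single nonzero coefficient, so the characterization itself gives
  the wavelet smoothness \<open>a\<close> with the conjugate exponent; its derivatives are never
  estimated.\<close>

lemma phi_besov:
  assumes l: "l \<in> I j"
  obtains C where "\<And>J. lpn (p / (p - 1)) (lp_block J (distr_of_fun (\<phi> j l))) \<le> C * 2 powr (- (real J * a))" "C \<ge> 0"
proof -
  let ?p' = "p / (p - 1)" and ?u = "distr_of_fun (\<phi> j l)"
  have p': "1 \<le> ?p'" using conjugate_exponent(1)[OF p(1)] by simp
  have ma: "\<bar>a\<bar> < real m" using a a_pos by simp
  have coeff: "wavelet_coeff \<phi> ?u i k = (if i = j \<and> k = l then 1 else 0)" if "k \<in> I i" for i k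
    using coeff_L2[OF phi_L2[OF l] that] phi_orth[OF l that] by auto
  have lz: "wl ?p' ?u i = 0" if "i \<noteq> j" for i
    unfolding wl_def using that coeff p' by (simp add: lnorm_def)
  define A where "A = 2 powr (real j * a) * wl ?p' ?u j"
  have A: "2 powr (real i * a) * wl ?p' ?u i \<le> A" for i
    using lz[of i] by (cases "i = j") (auto simp: A_def)
  from besov_le_wl[OF ma p'] obtain C where C: "C > 0"
    "\<And>u A j. u \<in> low_order m \<Longrightarrow> (\<And>i. 2 powr (real i * a) * wl ?p' u i \<le> A) \<Longrightarrow> 2 powr (real j * a) * lpn ?p' (lp_block j u) \<le> C * A"
    by blast
  show thesis
  proof (rule that[of "C * A"])
    fix J
    have "2 powr (real J * a) * lpn ?p' (lp_block J ?u) \<le> C * A"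
      by (rule C(2)[OF L2_low[OF phi_L2[OF l]] A])
    then show "lpn ?p' (lp_block J ?u) \<le> C * A * 2 powr (- (real J * a))"
      by (simp add: powr_minus field_simps)
    show "C * A \<ge> 0" using C(1) by (simp add: A_def)
  qed
qed

lemma bl_le: "u \<in> X0 \<Longrightarrow> bl u j \<le> (\<Sum>j. bl u j powr q) powr (1 / q)"
proof -
  assume u: "u \<in> X0"
  have "bl u j powr q \<le> (\<Sum>j. bl u j powr q)"
    using u sum_le_suminf[of "\<lambda>j. bl u j powr q" "{j}"] by (auto simp: X0_iff_bl)
  then have "(bl u j powr q) powr (1 / q) \<le> (\<Sum>j. bl u j powr q) powr (1 / q)"
    using q by (intro powr_mono2) auto
  then show ?thesis using q by (simp add: powr_powr)
qed

lemma geometric_powr_summable: "b > 0 \<Longrightarrow> summable (\<lambda>j. 2 powr (- (real j * b)))"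
proof -
  assume b: "b > 0"
  have "2 powr (- (real j * b)) = (2 powr (- b)) ^ j" for j
    by (simp add: powr_realpow[symmetric] powr_powr mult.commute)
  moreover have "2 powr (- b) < 1" using b by (intro powr_less_one) auto
  ultimately show ?thesis by (simp add: summable_geometric_iff)
qed

text \<open>Linearity of the coefficients rests on this, because \<open>lim\<close> is meaningful
  only for convergent sequences. The blocks of \<open>u\<close> are bounded and those of the wavelet
  decay geometrically.\<close>

lemma coeff_convergent:
  assumes u: "u \<in> X0" and l: "l \<in> I j"
  shows "convergent (\<lambda>J. distr_apply u (lp_partial J (distr_of_fun (\<phi> j l))))"
proof -
  let ?p' = "p / (p - 1)"
  from phi_besov[OF l] obtain C where C: "\<And>J. lpn ?p' (lp_block J (distr_of_fun (\<phi> j l))) \<le> C * 2 powr (- (real J * a))" "C \<ge> 0"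
    by blast
  note cj = conjugate_exponent[OF p(1)]
  show ?thesis
  proof (rule pairing_bound(1)[where p = ?p' and p' = p and \<tau> = 0 and A = "(\<Sum>j. bl u j powr q) powr (1 / q)" and B = "\<lambda>J. C * 2 powr (- (real J * a))"])
    show "lpn p (lp_block j u) \<le> (\<Sum>j. bl u j powr q) powr (1 / q) * 2 powr (- (real j * 0))" for j
      using bl_le[OF u, of j] by (simp add: bl_def)
    show "summable (\<lambda>J. C * 2 powr (- (real J * a)))" by (intro summable_mult geometric_powr_summable a_pos)
  qed (use cj p C in auto)
qed

lemma coeff_add: "u \<in> X0 \<Longrightarrow> v \<in> X0 \<Longrightarrow> l \<in> I j \<Longrightarrow>
     wavelet_coeff \<phi> (u + v) j l = wavelet_coeff \<phi> u j l + wavelet_coeff \<phi> v j l"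
  and coeff_diff: "u \<in> X0 \<Longrightarrow> v \<in> X0 \<Longrightarrow> l \<in> I j \<Longrightarrow>
     wavelet_coeff \<phi> (u - v) j l = wavelet_coeff \<phi> u j l - wavelet_coeff \<phi> v j l"
  and coeff_scale: "u \<in> X0 \<Longrightarrow> l \<in> I j \<Longrightarrow> wavelet_coeff \<phi> (c *\<^sub>R u) j l = c * wavelet_coeff \<phi> u j l"
  unfolding wavelet_coeff_def pairing_def distr_ops
  by (auto simp: convergent_LIMSEQ_iff intro!: limI tendsto_add tendsto_diff tendsto_mult tendsto_const coeff_convergent[unfolded convergent_LIMSEQ_iff])

lemma wl_cong: "(\<And>l. l \<in> I j \<Longrightarrow> wavelet_coeff \<phi> u j l = x l) \<Longrightarrow>
    wl P u j = 2 powr (real j * real CARD('d) * (1 / 2 - 1 / P)) * lnorm (I j) P x"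
  unfolding wl_def by (intro arg_cong2[where f = "(*)"] lnorm_cong refl) auto

lemma wl_scale: "u \<in> X0 \<Longrightarrow> P > 0 \<Longrightarrow> wl P (c *\<^sub>R u) j = \<bar>c\<bar> * wl P u j"
  using wl_cong[of j "c *\<^sub>R u" "\<lambda>l. c * wavelet_coeff \<phi> u j l" P]
  by (simp add: coeff_scale lnorm_scale wl_def)

lemma wl_add_le: "u \<in> X0 \<Longrightarrow> v \<in> X0 \<Longrightarrow> wl p (u + v) j \<le> wl p u j + wl p v j"
  using wl_cong[of j "u + v" "\<lambda>l. wavelet_coeff \<phi> u j l + wavelet_coeff \<phi> v j l" p] p
    lnorm_triangle[OF finI[of j], of p "wavelet_coeff \<phi> u j" "wavelet_coeff \<phi> v j"]
  by (simp add: coeff_add wl_def distrib_left[symmetric])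

lemma Phi_scale: "u \<in> X0 \<Longrightarrow> Phi (c *\<^sub>R u) = \<bar>c\<bar> powr q * Phi u"
  unfolding Phi_def using p by (simp add: wl_scale powr_mult suminf_mult wl_summable)

lemma wl_convex:
  assumes u: "u \<in> X0" and v: "v \<in> X0"
  shows "wl p ((1 / 2) *\<^sub>R (u + v)) j powr q + (p - 1) powr (q / 2) * wl p ((1 / 2) *\<^sub>R (u - v)) j powr q
    \<le> (wl p u j powr q + wl p v j powr q) / 2"
proof -
  let ?w = "2 powr (real j * real CARD('d) * (1 / 2 - 1 / p))"
  have s: "wl p ((1 / 2) *\<^sub>R (u + v)) j = ?w * lnorm (I j) p (\<lambda>l. (wavelet_coeff \<phi> u j l + wavelet_coeff \<phi> v j l) / 2)"
    using u v by (intro wl_cong) (simp add: coeff_scale coeff_add X0_add)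
  have d: "wl p ((1 / 2) *\<^sub>R (u - v)) j = ?w * lnorm (I j) p (\<lambda>l. (wavelet_coeff \<phi> u j l - wavelet_coeff \<phi> v j l) / 2)"
    using u v by (intro wl_cong) (simp add: coeff_scale coeff_diff X0_diff)
  have "?w powr q * (lnorm (I j) p (\<lambda>l. (wavelet_coeff \<phi> u j l + wavelet_coeff \<phi> v j l) / 2) powr q
      + (p - 1) powr (q / 2) * lnorm (I j) p (\<lambda>l. (wavelet_coeff \<phi> u j l - wavelet_coeff \<phi> v j l) / 2) powr q)
    \<le> ?w powr q * ((lnorm (I j) p (wavelet_coeff \<phi> u j) powr q + lnorm (I j) p (wavelet_coeff \<phi> v j) powr q) / 2)"
    by (intro mult_left_mono lnorm_q_convex finI p q) auto
  then show ?thesis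
    unfolding s d wl_def[of p u] wl_def[of p v] by (simp add: powr_mult algebra_simps)
qed

lemma Phi_convex:
  assumes u: "u \<in> X0" and v: "v \<in> X0"
  shows "Phi ((1 / 2) *\<^sub>R (u + v)) + (p - 1) powr (q / 2) * Phi ((1 / 2) *\<^sub>R (u - v)) \<le> (Phi u + Phi v) / 2"
proof -
  have X: "(1 / 2) *\<^sub>R (u + v) \<in> X0" "(1 / 2) *\<^sub>R (u - v) \<in> X0" by (intro X0_scale X0_add X0_diff u v)+
  have "Phi ((1 / 2) *\<^sub>R (u + v)) + (p - 1) powr (q / 2) * Phi ((1 / 2) *\<^sub>R (u - v)) =
      (\<Sum>j. wl p ((1 / 2) *\<^sub>R (u + v)) j powr q + (p - 1) powr (q / 2) * wl p ((1 / 2) *\<^sub>R (u - v)) j powr q)"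
    by (simp only: Phi_def suminf_mult[OF wl_summable[OF X(2)], symmetric]
        suminf_add[OF wl_summable[OF X(1)] summable_mult[OF wl_summable[OF X(2)]]])
  also have "\<dots> \<le> (\<Sum>j. (wl p u j powr q + wl p v j powr q) / 2)"
    using wl_summable[OF X(1)] wl_summable[OF X(2)] wl_summable[OF u] wl_summable[OF v]
    by (intro suminf_le wl_convex u v summable_add summable_mult summable_divide)
  also have "\<dots> = (Phi u + Phi v) / 2"
    by (simp only: Phi_def suminf_divide[OF summable_add[OF wl_summable[OF u] wl_summable[OF v]]]
        suminf_add[OF wl_summable[OF u] wl_summable[OF v]])
  finally show ?thesis .
qed

lemma wl_le_Phi: "u \<in> X0 \<Longrightarrow> wl p u j \<le> Phi u powr (1 / q)"
proof -
  assume u: "u \<in> X0"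
  have "wl p u j powr q \<le> Phi u"
    unfolding Phi_def using sum_le_suminf[OF wl_summable[OF u], of "{j}"] by auto
  then have "(wl p u j powr q) powr (1 / q) \<le> Phi u powr (1 / q)"
    using q by (intro powr_mono2) auto
  then show ?thesis using q by (simp add: powr_powr)
qed

text \<open>Passing from exponent \<open>p\<close> to 2 costs smoothness d/p - d/2, and
  \<open>gap\<close> is what remains of \<open>a\<close> afterwards. Its positivity embeds
  \<open>X0\<close> into B^{-a}_{2,2} with geometric decay to spare.\<close>

definition gap :: real where
  "gap = a - (real CARD('d) / p - real CARD('d) / 2)"

lemma gap_pos: "gap > 0" using a by (simp add: gap_def)

lemma lnorm2_coeff: "2 powr (- (real j * a)) * lnorm (I j) 2 (wavelet_coeff \<phi> u j) \<le> 2 powr (- (real j * gap)) * wl p u j"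
proof -
  have "2 powr (- (real j * a)) * lnorm (I j) 2 (wavelet_coeff \<phi> u j) \<le> 2 powr (- (real j * a)) * lnorm (I j) p (wavelet_coeff \<phi> u j)"
    using p by (intro mult_left_mono lnorm_2_le finI) auto
  also have "\<dots> = 2 powr (- (real j * gap)) * wl p u j"
  proof -
    have "- (real j * a) = - (real j * gap) + real j * real CARD('d) * (1 / 2 - 1 / p)"
      by (simp add: gap_def algebra_simps)
    then show ?thesis by (simp only: wl_def powr_add mult.assoc)
  qed
  finally show ?thesis .
qed

text \<open>The wavelet expansion of \<open>u\<close> is paired with the coefficients of \<psi>,
  whose decay of order \<open>a\<close> comes from the block estimate for test functions; the gap
  makes the sum over levels converge. The point is that \<open>n\<close> is the same for all
  \<open>u\<close>.\<close>

lemma distr_apply_bound: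
  obtains n K where "K > 0"
    "\<And>u \<psi> B. u \<in> X0 \<Longrightarrow> \<psi> \<in> test_functions \<Longrightarrow> (\<And>x. x \<in> cbox 0 One \<Longrightarrow> \<bar>\<psi> x\<bar> \<le> B) \<Longrightarrow>
      (\<And>i x. x \<in> cbox 0 One \<Longrightarrow> \<bar>pderivs (replicate n i) \<psi> x\<bar> \<le> B) \<Longrightarrow>
      \<bar>distr_apply u \<psi>\<bar> \<le> K * Phi u powr (1 / q) * B"
proof (rule test_besov_bound[where ?'d = 'd and a = a])
  fix n K assume K: "K > 0" and tb: "\<And>(\<psi> :: real ^ 'd \<Rightarrow> real) B j. \<psi> \<in> test_functions \<Longrightarrow> (\<And>x. x \<in> cbox 0 One \<Longrightarrow> \<bar>\<psi> x\<bar> \<le> B) \<Longrightarrow>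
      (\<And>i x. x \<in> cbox 0 One \<Longrightarrow> \<bar>pderivs (replicate n i) \<psi> x\<bar> \<le> B) \<Longrightarrow>
      2 powr (real j * a) * lpn 2 (lp_block j (distr_of_fun \<psi>)) \<le> K * B"
  have ma: "\<bar>a\<bar> < real m" using a a_pos by simp
  from wl_le_besov[OF ma, of 2] obtain C where C: "C > 0" "\<And>u A j. u \<in> low_order m \<Longrightarrow> (\<And>i. 2 powr (real i * a) * lpn 2 (lp_block i u) \<le> A)
    \<Longrightarrow> 2 powr (real j * a) * wl 2 u j \<le> C * A" by (metis one_le_numeral)
  let ?S = "\<Sum>j. 2 powr (- (real j * gap))"
  note sg = geometric_powr_summable[OF gap_pos]
  have S: "?S > 0" using suminf_pos[OF sg] by simp
  show thesis
  proof (rule that[of "C * K * ?S" n])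
    show "C * K * ?S > 0" using C K S by simp
    fix u B and \<psi> :: "real ^ 'd \<Rightarrow> real"
    assume u: "u \<in> X0" and psi: "\<psi> \<in> test_functions" and B: "\<And>x. x \<in> cbox 0 One \<Longrightarrow> \<bar>\<psi> x\<bar> \<le> B"
      "\<And>i x. x \<in> cbox 0 One \<Longrightarrow> \<bar>pderivs (replicate n i) \<psi> x\<bar> \<le> B"
    have psiL: "L2fun \<psi>" by (intro L2fun_cont test_cont psi)
    let ?v = "distr_of_fun \<psi>"
    let ?P = "Phi u powr (1 / q)"
    have v: "2 powr (real j * a) * lnorm (I j) 2 (wavelet_coeff \<phi> ?v j) \<le> C * (K * B)" for j
      using C(2)[OF L2_low[OF psiL] tb[OF psi B], of j] by (simp add: wl_def)
    have KB: "C * (K * B) \<ge> 0" by (rule order_trans[OF _ v[of 0]]) simp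
    have trm: "\<bar>\<Sum>l\<in>I j. wavelet_coeff \<phi> u j l * (\<integral>x. \<phi> j l x * \<psi> x \<partial>torus)\<bar> \<le> 2 powr (- (real j * gap)) * (C * K * ?P * B)" for j
    proof -
      have "(\<Sum>l\<in>I j. wavelet_coeff \<phi> u j l * (\<integral>x. \<phi> j l x * \<psi> x \<partial>torus)) = (\<Sum>l\<in>I j. wavelet_coeff \<phi> u j l * wavelet_coeff \<phi> ?v j l)"
        by (intro sum.cong refl) (simp add: coeff_L2[OF psiL] mult.commute)
      also have "\<bar>\<dots>\<bar> \<le> lnorm (I j) 2 (wavelet_coeff \<phi> u j) * lnorm (I j) 2 (wavelet_coeff \<phi> ?v j)"
        by (rule lnorm_Cauchy_Schwarz[OF finI])
      also have "\<dots> = (2 powr (- (real j * a)) * lnorm (I j) 2 (wavelet_coeff \<phi> u j)) * (2 powr (real j * a) * lnorm (I j) 2 (wavelet_coeff \<phi> ?v j))"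
        by (simp add: powr_minus)
      also have "\<dots> \<le> (2 powr (- (real j * gap)) * ?P) * (C * (K * B))"
        using wl_le_Phi[OF u, of j]
        by (intro mult_mono v KB order_trans[OF lnorm2_coeff] mult_left_mono) auto
      finally show ?thesis by (simp add: mult_ac)
    qed
    note ex = wavelet_expansion[OF X0_low[OF u] psi]
    have sg': "summable (\<lambda>j. 2 powr (- (real j * gap)) * (C * K * ?P * B))" by (intro summable_mult2 sg)
    have sa: "summable (\<lambda>j. \<bar>\<Sum>l\<in>I j. wavelet_coeff \<phi> u j l * (\<integral>x. \<phi> j l x * \<psi> x \<partial>torus)\<bar>)"
      by (rule summable_comparison_test'[OF sg']) (use trm in auto)
    have "\<bar>distr_apply u \<psi>\<bar> \<le> (\<Sum>j. \<bar>\<Sum>l\<in>I j. wavelet_coeff \<phi> u j l * (\<integral>x. \<phi> j l x * \<psi> x \<partial>torus)\<bar>)"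
      using summable_rabs[OF sa] sums_unique[OF ex] by simp
    also have "\<dots> \<le> (\<Sum>j. 2 powr (- (real j * gap)) * (C * K * ?P * B))"
      by (intro suminf_le trm sa sg')
    also have "\<dots> = ?S * (C * K * ?P * B)" by (rule suminf_mult2[OF sg, symmetric])
    also have "\<dots> = C * K * ?S * ?P * B" by (simp only: mult_ac)
    finally show "\<bar>distr_apply u \<psi>\<bar> \<le> C * K * ?S * ?P * B" .
  qed
qed

text \<open>A block has finitely many coefficients, each the value of the distribution at a test
  function, so block norms converge under convergence of distributions. Wavelets need not be test
  functions, which is why this is done on blocks.\<close>

lemma Fatou_bl:
  assumes w: "\<And>n. w n \<in> X0" and c: "\<And>n. (\<Sum>j. bl (w n) j powr q) \<le> c"
    and lim: "\<And>\<psi>. \<psi> \<in> test_functions \<Longrightarrow> (\<lambda>n. distr_apply (w n) \<psi>) \<longlonglongrightarrow> distr_apply v \<psi>"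
  shows "v \<in> X0" "(\<Sum>j. bl v j powr q) \<le> c"
proof -
  have bl_lim: "(\<lambda>n. bl (w n) j) \<longlonglongrightarrow> bl v j" for j
  proof -
    \<comment> \<open>The coefficients at each frequency converge and are therefore bounded in
      \<open>n\<close>; \<open>SOME\<close> turns these bounds into a function that can be summed
      over \<open>LB j\<close>.\<close>
    define Bd where "Bd k = (SOME b. \<forall>n. \<bar>distr_apply (w n) (cosk k)\<bar> + \<bar>distr_apply (w n) (sink k)\<bar> \<le> b)" for k
    have Bd: "\<bar>distr_apply (w n) (cosk k)\<bar> + \<bar>distr_apply (w n) (sink k)\<bar> \<le> Bd k" if k: "k \<in> lattice" for k n
    proof -
      have "Bseq (\<lambda>n. distr_apply (w n) (cosk k))" "Bseq (\<lambda>n. distr_apply (w n) (sink k))"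
        using lim[OF test_cosk[OF k]] lim[OF test_sink[OF k]] by (auto intro: convergent_imp_Bseq convergentI)
      then obtain b1 b2 where "\<And>n. \<bar>distr_apply (w n) (cosk k)\<bar> \<le> b1" "\<And>n. \<bar>distr_apply (w n) (sink k)\<bar> \<le> b2"
        by (auto simp: Bseq_def)
      then have "\<forall>n. \<bar>distr_apply (w n) (cosk k)\<bar> + \<bar>distr_apply (w n) (sink k)\<bar> \<le> b1 + b2" by (meson add_mono)
      then have "\<exists>b. \<forall>n. \<bar>distr_apply (w n) (cosk k)\<bar> + \<bar>distr_apply (w n) (sink k)\<bar> \<le> b" by blast
      from someI_ex[OF this] show ?thesis unfolding Bd_def by blast
    qed
    have pt: "(\<lambda>n. lp_block j (w n) x) \<longlonglongrightarrow> lp_block j v x" for x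
      unfolding lp_block_fmul fmul_def
      by (intro tendsto_intros lim test_cosk test_sink) (auto simp: LB_lattice)
    define D where "D = (\<Sum>k\<in>LB j. Bd k)"
    have dom: "\<bar>lp_block j (w n) x\<bar> \<le> D" for n x
      unfolding lp_block_fmul fmul_def D_def
    proof (intro order_trans[OF sum_abs] sum_mono)
      fix k :: "real ^ 'd" assume k: "k \<in> LB j"
      have "\<bar>blm j k * (distr_apply (w n) (cosk k) * cosk k x + distr_apply (w n) (sink k) * sink k x)\<bar>
        \<le> 1 * (\<bar>distr_apply (w n) (cosk k)\<bar> * 1 + \<bar>distr_apply (w n) (sink k)\<bar> * 1)"
        unfolding abs_mult[of "blm j k"]
        by (intro mult_mono abs_blm_le order_trans[OF abs_triangle_ineq] add_mono)
           (auto simp: abs_mult intro!: mult_left_le)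
      also have "\<dots> \<le> Bd k" using Bd[OF LB_lattice[OF k], of n] by simp
      finally show "\<bar>blm j k * (distr_apply (w n) (cosk k) * cosk k x + distr_apply (w n) (sink k) * sink k x)\<bar> \<le> Bd k" .
    qed
    have "(\<lambda>n. (\<integral>x. \<bar>lp_block j (w n) x\<bar> powr p \<partial>torus)) \<longlonglongrightarrow> (\<integral>x. \<bar>lp_block j v x\<bar> powr p \<partial>torus)"
    proof (rule integral_dominated_convergence[where w = "\<lambda>_. D powr p"])
      show "(\<lambda>x. \<bar>lp_block j v x\<bar> powr p) \<in> borel_measurable torus"
        using p by (intro borel_measurable_integrable cont_powr_integrable lp_block_cont) auto
      show "(\<lambda>x. \<bar>lp_block j (w n) x\<bar> powr p) \<in> borel_measurable torus" for n
        using p by (intro borel_measurable_integrable cont_powr_integrable lp_block_cont) auto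
      show "AE x in torus. (\<lambda>n. \<bar>lp_block j (w n) x\<bar> powr p) \<longlonglongrightarrow> \<bar>lp_block j v x\<bar> powr p"
        using p by (intro AE_I2 tendsto_powr' tendsto_rabs pt tendsto_const) auto
      show "AE x in torus. norm (\<bar>lp_block j (w n) x\<bar> powr p) \<le> D powr p" for n
        using p dom by (intro AE_I2) (auto intro!: powr_mono2)
    qed simp
    then show ?thesis
      unfolding bl_def lpn_def using p by (intro tendsto_powr' tendsto_const) (auto intro!: always_eventually integral_nonneg_AE)
  qed
  have part: "(\<Sum>j<J. bl v j powr q) \<le> c" for J
  proof (rule LIMSEQ_le_const2)
    show "(\<lambda>n. \<Sum>j<J. bl (w n) j powr q) \<longlonglongrightarrow> (\<Sum>j<J. bl v j powr q)"
      using q by (intro tendsto_sum tendsto_powr' bl_lim tendsto_const) auto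
    have "(\<Sum>j<J. bl (w n) j powr q) \<le> c" for n
      using sum_le_suminf[of "\<lambda>j. bl (w n) j powr q" "{..<J}"] w[of n] c[of n] by (simp add: X0_iff_bl)
    then show "\<exists>N. \<forall>n\<ge>N. (\<Sum>j<J. bl (w n) j powr q) \<le> c" by blast
  qed
  have s: "summable (\<lambda>j. bl v j powr q)" by (rule summableI_nonneg_bounded[OF _ part]) simp
  then show "v \<in> X0" by (simp add: X0_iff_bl)
  show "(\<Sum>j. bl v j powr q) \<le> c" using s part by (intro suminf_le_const) auto
qed

text \<open>The limit is built as a functional on test functions, continuous by the uniform order in
  \<open>distr_apply_bound\<close>. Convergence in norm comes from Fatou applied to differences with
  the tail of the sequence.\<close>

lemma X0_complete:
  assumes h: "\<And>n. h n \<in> X0" and cauchy: "\<And>e. e > 0 \<Longrightarrow> \<exists>M. \<forall>m\<ge>M. \<forall>n\<ge>M. Phi (h n - h m) < e"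
  obtains u where "u \<in> X0" "(\<lambda>n. Phi (h n - u)) \<longlonglongrightarrow> 0"
proof (rule distr_apply_bound)
  fix n K assume K: "K > 0" and bound: "\<And>u \<psi> B. u \<in> X0 \<Longrightarrow> \<psi> \<in> test_functions \<Longrightarrow> (\<And>x. x \<in> cbox 0 One \<Longrightarrow> \<bar>\<psi> x\<bar> \<le> B) \<Longrightarrow>
      (\<And>i x. x \<in> cbox 0 One \<Longrightarrow> \<bar>pderivs (replicate n i) \<psi> x\<bar> \<le> B) \<Longrightarrow>
      \<bar>distr_apply u \<psi>\<bar> \<le> K * Phi u powr (1 / q) * B"
  have cauchy': "\<exists>M. \<forall>m\<ge>M. \<forall>n\<ge>M. Phi (h n - h m) powr (1 / q) < e" if "e > 0" for e
  proof -
    from cauchy[of "e powr q"] that obtain M where M: "\<And>m n. m \<ge> M \<Longrightarrow> n \<ge> M \<Longrightarrow> Phi (h n - h m) < e powr q" by auto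
    have "Phi (h n - h m) powr (1 / q) < (e powr q) powr (1 / q)" if "m \<ge> M" "n \<ge> M" for m n
      using M[OF that] q Phi_nonneg[OF X0_diff[OF h h]] by (intro powr_less_mono2) auto
    then show ?thesis using that q by (auto simp: powr_powr)
  qed
  have conv: "convergent (\<lambda>j. distr_apply (h j) \<psi>)" if psi: "\<psi> \<in> test_functions" for \<psi>
  proof -
    obtain B where B: "\<And>x. x \<in> cbox 0 One \<Longrightarrow> \<bar>\<psi> x\<bar> \<le> B"
      "\<And>i x. x \<in> cbox 0 One \<Longrightarrow> \<bar>pderivs (replicate n i) \<psi> x\<bar> \<le> B"
      using test_derivs_bounded[OF psi, of n] by blast
    have "B \<ge> 0" using B(1)[of 0] by (force simp: cube_mem)
    have "Cauchy (\<lambda>j. distr_apply (h j) \<psi>)"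
    proof (rule metric_CauchyI)
      fix e :: real assume e: "e > 0"
      \<comment> \<open>\<open>B + 1\<close> keeps the divisor positive when \<psi> vanishes on the
        cube.\<close>
      have pos: "K * (B + 1) > 0" using K \<open>B \<ge> 0\<close> by simp
      from cauchy'[of "e / (K * (B + 1))"] e pos obtain M where
        M: "\<And>m n. m \<ge> M \<Longrightarrow> n \<ge> M \<Longrightarrow> Phi (h n - h m) powr (1 / q) < e / (K * (B + 1))" by auto
      have "dist (distr_apply (h i) \<psi>) (distr_apply (h j) \<psi>) < e" if "i \<ge> M" "j \<ge> M" for i j
      proof -
        have "dist (distr_apply (h i) \<psi>) (distr_apply (h j) \<psi>) = \<bar>distr_apply (h i - h j) \<psi>\<bar>"
          by (simp add: dist_real_def distr_ops)
        also have "\<dots> \<le> K * Phi (h i - h j) powr (1 / q) * B"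
          by (intro bound X0_diff h psi B)
        also have "\<dots> \<le> Phi (h i - h j) powr (1 / q) * (K * (B + 1))"
        proof -
          have "K * Phi (h i - h j) powr (1 / q) * B \<le> K * Phi (h i - h j) powr (1 / q) * (B + 1)"
            using K by (intro mult_left_mono) auto
          then show ?thesis by (simp only: mult_ac)
        qed
        also have "\<dots> < e" using M[OF that(2,1)] pos by (simp add: pos_less_divide_eq)
        finally show ?thesis .
      qed
      then show "\<exists>M. \<forall>m\<ge>M. \<forall>n\<ge>M. dist (distr_apply (h m) \<psi>) (distr_apply (h n) \<psi>) < e" by blast
    qed
    then show ?thesis by (rule Cauchy_convergent)
  qed
  from cauchy'[of 1] obtain M1 where M1: "\<And>j. j \<ge> M1 \<Longrightarrow> Phi (h j - h M1) powr (1 / q) < 1" by auto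
  define U where "U \<psi> = lim (\<lambda>j. distr_apply (h j) \<psi>)" for \<psi>
  have Ulim: "(\<lambda>j. distr_apply (h j) \<psi>) \<longlonglongrightarrow> U \<psi>" if "\<psi> \<in> test_functions" for \<psi>
    using conv[OF that] by (simp add: U_def convergent_LIMSEQ_iff)
  \<comment> \<open>The first summand bounds the single member \<open>h M1\<close>, the second the
    differences to all later members, whose norm is below one.\<close>
  define Kb where "Kb = K * Phi (h M1) powr (1 / q) + K"
  have Ubound: "\<bar>U \<psi>\<bar> \<le> Kb * B" if psi: "\<psi> \<in> test_functions"
    and B: "\<forall>is x. length is \<le> n \<longrightarrow> \<bar>pderivs is \<psi> x\<bar> \<le> B" for \<psi> B
  proof (rule LIMSEQ_le_const2[OF tendsto_rabs[OF Ulim[OF psi]]])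
    have B1: "\<bar>\<psi> x\<bar> \<le> B" for x using B by (metis le0 list.size(3) pderivs_Nil)
    then have B0: "B \<ge> 0" using order_trans[OF abs_ge_zero] by blast
    have B2: "\<bar>pderivs (replicate n i) \<psi> x\<bar> \<le> B" for i x using B by simp
    have "\<bar>distr_apply (h j) \<psi>\<bar> \<le> Kb * B" if j: "j \<ge> M1" for j
    proof -
      have "\<bar>distr_apply (h j) \<psi>\<bar> \<le> \<bar>distr_apply (h M1) \<psi>\<bar> + \<bar>distr_apply (h j - h M1) \<psi>\<bar>"
        by (simp add: distr_ops)
      also have "\<dots> \<le> K * Phi (h M1) powr (1 / q) * B + K * Phi (h j - h M1) powr (1 / q) * B"
        by (intro add_mono bound X0_diff h psi B1 B2)
      also have "\<dots> \<le> K * Phi (h M1) powr (1 / q) * B + K * 1 * B"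
        using M1[OF j] K B0 by (intro add_left_mono mult_right_mono mult_left_mono) auto
      finally show ?thesis by (simp add: Kb_def distrib_right)
    qed
    then show "\<exists>N. \<forall>j\<ge>N. \<bar>distr_apply (h j) \<psi>\<bar> \<le> Kb * B" by blast
  qed
  define u where "u = Abs_distr U"
  have Uu: "distr_apply u = U"
    unfolding u_def
  proof (rule Abs_distr_inverse, rule CollectI, intro conjI)
    show "\<forall>\<psi>. \<psi> \<notin> test_functions \<longrightarrow> U \<psi> = 0" by (auto simp: U_def distr_apply_out)
    show "\<forall>\<psi>\<in>test_functions. \<forall>\<eta>\<in>test_functions. U (\<lambda>x. \<psi> x + \<eta> x) = U \<psi> + U \<eta>"
    proof (intro ballI)
      fix \<psi> \<eta> :: "real ^ 'd \<Rightarrow> real" assume t: "\<psi> \<in> test_functions" "\<eta> \<in> test_functions"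
      have "(\<lambda>j. distr_apply (h j) (\<lambda>x. \<psi> x + \<eta> x)) \<longlonglongrightarrow> U \<psi> + U \<eta>"
        unfolding distr_apply_add[OF t] by (intro tendsto_add Ulim t)
      then show "U (\<lambda>x. \<psi> x + \<eta> x) = U \<psi> + U \<eta>" unfolding U_def[of "\<lambda>x. \<psi> x + \<eta> x"] by (rule limI)
    qed
    show "\<forall>\<psi>\<in>test_functions. \<forall>c. U (\<lambda>x. c * \<psi> x) = c * U \<psi>"
    proof (intro ballI allI)
      fix \<psi> :: "real ^ 'd \<Rightarrow> real" and c assume t: "\<psi> \<in> test_functions"
      have "(\<lambda>j. distr_apply (h j) (\<lambda>x. c * \<psi> x)) \<longlonglongrightarrow> c * U \<psi>"
        unfolding distr_apply_scale[OF t] by (intro tendsto_mult tendsto_const Ulim t)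
      then show "U (\<lambda>x. c * \<psi> x) = c * U \<psi>" unfolding U_def[of "\<lambda>x. c * \<psi> x"] by (rule limI)
    qed
    show "\<exists>n C. \<forall>\<psi>\<in>test_functions. \<forall>B. (\<forall>is x. length is \<le> n \<longrightarrow> \<bar>pderivs is \<psi> x\<bar> \<le> B) \<longrightarrow> \<bar>U \<psi>\<bar> \<le> C * B"
      using Ubound by blast
  qed
  show thesis
  proof (rule equiv_X0)
    fix c C assume c: "c > 0" "C > 0"
      "\<And>u. u \<in> X0 \<Longrightarrow> c * (\<Sum>j. bl u j powr q) powr (1 / q) \<le> Phi u powr (1 / q)"
      "\<And>u. u \<in> X0 \<Longrightarrow> Phi u powr (1 / q) \<le> C * (\<Sum>j. bl u j powr q) powr (1 / q)"
    have inv: "(y powr (1 / q)) powr q = y" if "y \<ge> 0" for y using that q by (simp add: powr_powr)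
    have blPhi: "(\<Sum>j. bl v j powr q) \<le> Phi v / c powr q" if v: "v \<in> X0" for v
    proof -
      have s: "summable (\<lambda>j. bl v j powr q)" using v by (simp add: X0_iff_bl)
      have "(c * (\<Sum>j. bl v j powr q) powr (1 / q)) powr q \<le> (Phi v powr (1 / q)) powr q"
        using c(1) c(3)[OF v] q by (intro powr_mono2) auto
      then show ?thesis using c(1) Phi_nonneg[OF v] s
        by (simp add: powr_mult inv suminf_nonneg pos_le_divide_eq mult.commute)
    qed
    have Phibl: "Phi v \<le> C powr q * (\<Sum>j. bl v j powr q)" if v: "v \<in> X0" for v
    proof -
      have s: "summable (\<lambda>j. bl v j powr q)" using v by (simp add: X0_iff_bl)
      have "(Phi v powr (1 / q)) powr q \<le> (C * (\<Sum>j. bl v j powr q) powr (1 / q)) powr q"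
        using c(4)[OF v] q by (intro powr_mono2) auto
      then show ?thesis using c(2) Phi_nonneg[OF v] s by (simp add: powr_mult inv suminf_nonneg)
    qed
    \<comment> \<open>The second index runs to infinity: \<open>h k - h (i + M)\<close> converges to
      \<open>h k - u\<close> as distributions, and Fatou keeps the bound.\<close>
    have key: "h k - u \<in> X0 \<and> (\<Sum>j. bl (h k - u) j powr q) \<le> e / c powr q"
      if M: "\<And>i. i \<ge> M \<Longrightarrow> Phi (h k - h i) \<le> e" for M k e
    proof -
      have 1: "(\<Sum>j. bl (h k - h (i + M)) j powr q) \<le> e / c powr q" for i
        using order_trans[OF blPhi[OF X0_diff[OF h h]] divide_right_mono[OF M[of "i + M"]]] by simp
      have 2: "(\<lambda>i. distr_apply (h k - h (i + M)) \<psi>) \<longlonglongrightarrow> distr_apply (h k - u) \<psi>" if "\<psi> \<in> test_functions" for \<psi>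
        unfolding distr_ops Uu by (intro tendsto_diff tendsto_const LIMSEQ_ignore_initial_segment Ulim that)
      show ?thesis using Fatou_bl[OF X0_diff[OF h h] 1 2] by blast
    qed
    from cauchy[of 1] obtain M where M: "\<And>i k. i \<ge> M \<Longrightarrow> k \<ge> M \<Longrightarrow> Phi (h k - h i) < 1" by auto
    have "h M - u \<in> X0" using key[of M M 1] M by (meson order_refl less_imp_le)
    then have uX: "u \<in> X0" using X0_diff[OF h[of M], of "h M - u"] by simp
    have "(\<lambda>k. Phi (h k - u)) \<longlonglongrightarrow> 0"
    proof (rule LIMSEQ_I)
      fix e :: real assume e: "e > 0"
      \<comment> \<open>Scaled by both equivalence constants, so that going from \<open>Phi\<close>
        to blocks and back ends at \<open>e / 2\<close>.\<close>
      define e' where "e' = e / 2 * c powr q / C powr q"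
      have e': "e' > 0" using e c by (simp add: e'_def)
      from cauchy[OF e'] obtain M where M: "\<And>i k. i \<ge> M \<Longrightarrow> k \<ge> M \<Longrightarrow> Phi (h k - h i) < e'" by auto
      have "norm (Phi (h k - u) - 0) < e" if k: "k \<ge> M" for k
      proof -
        have "Phi (h k - u) \<le> C powr q * (e' / c powr q)"
          using key[of M k e'] M k Phibl[OF X0_diff[OF h uX], of k]
          by (meson order_trans less_imp_le mult_left_mono powr_ge_zero)
        also have "\<dots> = e / 2" using c by (simp add: e'_def)
        finally show ?thesis using Phi_nonneg[OF X0_diff[OF h uX], of k] e by simp
      qed
      then show "\<exists>no. \<forall>k\<ge>no. norm (Phi (h k - u) - 0) < e" by blast
    qed
    then show thesis using that[OF uX] by blast
  qed
qed

end

section \<open>Elementary inequalities for the rates\<close>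

text \<open>Both arguments of the minimum are geometric in \<open>j\<close>, so the sum is comparable to the value at the crossover.\<close>

lemma sum_min_geometric:
  fixes u v :: real
  assumes uv: "u > 0" "v > 0"
  obtains K where "K > 0"
    "\<And>X Y. X \<ge> 0 \<Longrightarrow> Y \<ge> 0 \<Longrightarrow> summable (\<lambda>j. min (2 powr (real j * u) * X) (2 powr (- (real j * v)) * Y))"
    "\<And>X Y. X \<ge> 0 \<Longrightarrow> Y \<ge> 0 \<Longrightarrow> (\<Sum>j. min (2 powr (real j * u) * X) (2 powr (- (real j * v)) * Y))
       \<le> K * (X powr (v / (u + v)) * Y powr (u / (u + v)))"
proof -
  \<comment> \<open>The smaller of the two rates, so that one ratio \<open>r\<close> serves on
    either side of the crossover.\<close>
  define w where "w = min u v"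
  define r where "r = 2 powr (- w)"
  have w: "w > 0" "w \<le> u" "w \<le> v" using uv by (auto simp: w_def)
  have r: "0 < r" "r < 1" unfolding r_def using w by (auto intro!: powr_less_one)
  have rk: "2 powr (- (real k * w)) = r ^ k" for k
    by (simp add: r_def powr_realpow[symmetric] powr_powr mult.commute)
  have sr: "summable (\<lambda>k. r ^ k)" using r by (intro summable_geometric) auto
  have gs: "(\<Sum>k<n. r ^ k) \<le> 1 / (1 - r)" for n
    using sum_le_suminf[OF sr, of "{..<n}"] r suminf_geometric[of r] by auto
  show thesis
  proof (rule that[of "2 / (1 - r)"])
    show "2 / (1 - r) > 0" using r by simp
    fix X Y :: real assume XY: "X \<ge> 0" "Y \<ge> 0"
    let ?f = "\<lambda>j. min (2 powr (real j * u) * X) (2 powr (- (real j * v)) * Y)"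
    let ?M = "X powr (v / (u + v)) * Y powr (u / (u + v))"
    have f0: "?f j \<ge> 0" for j using XY by simp
    have part: "(\<Sum>j<J. ?f j) \<le> 2 / (1 - r) * ?M" for J
    proof (cases "X = 0 \<or> Y = 0")
      case True
      then have "?f j \<le> 0" for j by (auto simp: min_le_iff_disj)
      then have "?f j = 0" for j using f0[of j] by (meson antisym)
      then show ?thesis using r by simp
    next
      case False
      then have pos: "X > 0" "Y > 0" using XY by auto
      \<comment> \<open>The real level at which both arguments of the minimum coincide; their common
        value is \<open>?M\<close>.\<close>
      define t where "t = log 2 (Y / X) / (u + v)"
      have Mp: "?M > 0" using pos by simp
      have lt: "log 2 (Y / X) = t * (u + v)" using uv by (simp add: t_def)
      have X: "X = ?M * 2 powr (- (t * u))"
      proof -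
        have "2 powr (t * (u + v)) = Y / X" using pos by (simp add: lt[symmetric])
        then have "Y = X * 2 powr (t * (u + v))" using pos by simp
        then have "Y powr (u / (u + v)) = X powr (u / (u + v)) * 2 powr (t * u)"
          using pos uv by (simp add: powr_mult powr_powr)
        moreover have "X powr (v / (u + v)) * X powr (u / (u + v)) = X"
          using pos uv by (simp add: powr_add[symmetric] add_divide_distrib[symmetric] add.commute)
        ultimately show ?thesis using pos by (simp add: powr_minus field_simps)
      qed
      have Y: "Y = ?M * 2 powr (t * v)"
      proof -
        have "2 powr (t * (u + v)) = Y / X" using pos by (simp add: lt[symmetric])
        then have "Y = X * 2 powr (t * (u + v))" using pos by simp
        also have "\<dots> = ?M * (2 powr (- (t * u)) * 2 powr (t * (u + v)))" using X by simp
        also have "2 powr (- (t * u)) * 2 powr (t * (u + v)) = 2 powr (t * v)"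
          by (simp add: powr_add[symmetric] algebra_simps)
        finally show ?thesis .
      qed
      have up: "?f j \<le> ?M * 2 powr (- ((t - real j) * w))" if "real j \<le> t" for j
      proof -
        have "?f j \<le> 2 powr (real j * u) * X" by simp
        also have "\<dots> = ?M * 2 powr (- ((t - real j) * u))"
          by (subst X) (simp add: powr_add[symmetric] algebra_simps)
        also have "\<dots> \<le> ?M * 2 powr (- ((t - real j) * w))"
          using that w Mp by (intro mult_left_mono powr_mono) (auto intro: mult_left_mono)
        finally show ?thesis .
      qed
      have dn: "?f j \<le> ?M * 2 powr (- ((real j - t) * w))" if "t \<le> real j" for j
      proof -
        have "?f j \<le> 2 powr (- (real j * v)) * Y" by simp
        also have "\<dots> = ?M * 2 powr (- ((real j - t) * v))"
          by (subst Y) (simp add: powr_add[symmetric] algebra_simps)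
        also have "\<dots> \<le> ?M * 2 powr (- ((real j - t) * w))"
          using that w Mp by (intro mult_left_mono powr_mono) (auto intro: mult_left_mono)
        finally show ?thesis .
      qed
      \<comment> \<open>For a negative crossover \<open>n\<close> is zero and only the decaying side
        is present.\<close>
      define n where "n = nat \<lceil>t\<rceil>"
      have n1: "t \<le> real n" unfolding n_def by linarith
      have n2: "real j < t" if "j < n" for j using that unfolding n_def by linarith
      \<comment> \<open>The distance from \<open>j\<close> to the crossover is at least
        \<open>n - Suc j\<close> but not always \<open>n - j\<close>, because \<open>t\<close> may
        lie just above \<open>n - 1\<close>.\<close>
      have n3: "real j + real (n - Suc j) \<le> t" if "j < n" for j
      proof -
        have "j + (n - Suc j) < n" using that by simp
        then show ?thesis using n2[of "j + (n - Suc j)"] by simp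
      qed
      have A: "(\<Sum>j<n. ?f j) \<le> ?M * (1 / (1 - r))"
      proof -
        have "(\<Sum>j<n. ?f j) \<le> (\<Sum>j<n. ?M * r ^ (n - Suc j))"
        proof (rule sum_mono)
          fix j assume "j \<in> {..<n}"
          then have j: "j < n" by simp
          have "?f j \<le> ?M * 2 powr (- ((t - real j) * w))" using n2[OF j] by (intro up) simp
          also have "\<dots> \<le> ?M * 2 powr (- (real (n - Suc j) * w))"
            using n3[OF j] w Mp by (intro mult_left_mono powr_mono) (auto intro: mult_right_mono)
          finally show "?f j \<le> ?M * r ^ (n - Suc j)" by (simp only: rk)
        qed
        also have "\<dots> = ?M * (\<Sum>j<n. r ^ j)"
          by (simp only: sum_distrib_left[symmetric] sum.nat_diff_reindex[of "\<lambda>k. r ^ k" n])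
        also have "\<dots> \<le> ?M * (1 / (1 - r))" using Mp gs by (intro mult_left_mono) auto
        finally show ?thesis .
      qed
      have B: "(\<Sum>j<k. ?f (n + j)) \<le> ?M * (1 / (1 - r))" for k
      proof -
        have "(\<Sum>j<k. ?f (n + j)) \<le> (\<Sum>j<k. ?M * r ^ j)"
        proof (rule sum_mono)
          fix j
          have "?f (n + j) \<le> ?M * 2 powr (- ((real (n + j) - t) * w))" using n1 by (intro dn) simp
          also have "\<dots> \<le> ?M * 2 powr (- (real j * w))"
            using n1 w Mp by (intro mult_left_mono powr_mono) (auto intro: mult_right_mono)
          finally show "?f (n + j) \<le> ?M * r ^ j" by (simp only: rk)
        qed
        also have "\<dots> = ?M * (\<Sum>j<k. r ^ j)" by (simp only: sum_distrib_left)
        also have "\<dots> \<le> ?M * (1 / (1 - r))" using Mp gs by (intro mult_left_mono) auto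
        finally show ?thesis .
      qed
      have "(\<Sum>j<J. ?f j) \<le> (\<Sum>j<n + J. ?f j)" using f0 by (intro sum_mono2) auto
      also have "\<dots> = (\<Sum>j<n. ?f j) + (\<Sum>j<J. ?f (n + j))"
        by (induction J) (auto simp: add.assoc)
      also have "\<dots> \<le> ?M * (1 / (1 - r)) + ?M * (1 / (1 - r))" by (intro add_mono A B)
      finally show ?thesis by simp
    qed
    show s: "summable ?f" by (rule summableI_nonneg_bounded[OF f0 part])
    show "suminf ?f \<le> 2 / (1 - r) * ?M" using s part by (intro suminf_le_const) auto
  qed
qed

lemma powr_le_iff_root:
  fixes x y e :: real
  assumes "e > 0" "x \<ge> 0" "y \<ge> 0" "x powr e \<le> y"
  shows "x \<le> y powr (1 / e)"
proof -
  have "(x powr e) powr (1 / e) \<le> y powr (1 / e)" using assms by (intro powr_mono2) auto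
  then show ?thesis using assms by (simp add: powr_powr)
qed

text \<open>The tangent of the convex power at \<open>y\<close>, with the drop from \<open>y\<close>
  to \<open>x\<close> bounded by \<open>z\<close>. Since only \<open>y \<le> x + z\<close> is
  assumed, a triangle inequality for norms is enough to use it as a subgradient inequality.\<close>

lemma powr_gradient:
  fixes x y z q :: real
  assumes q: "q \<ge> 1" and nn: "x \<ge> 0" "y \<ge> 0" "z \<ge> 0" and le: "y \<le> x + z"
  shows "y powr q - q * y powr (q - 1) * z \<le> x powr q"
proof (cases "y = 0")
  case True
  then show ?thesis by simp
next
  case False
  then have y: "y > 0" using nn by simp
  \<comment> \<open>Bernoulli's inequality, read off from Young's inequality with the weights 1 -
    1/q and 1/q.\<close>
  have bern: "1 + q * (s - 1) \<le> s powr q" if "s \<ge> 0" for s :: real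
  proof (cases "s = 0")
    case False
    have "(1 - 1 / q) * 1 + 1 / q * s powr q \<ge> 1 powr (1 - 1 / q) * (s powr q) powr (1 / q)"
      using Youngs_inequality_0[of "1 - 1 / q" "1 / q" 1 "s powr q"] that False q by simp
    then have "s \<le> (1 - 1 / q) + 1 / q * s powr q" using that q by (simp add: powr_powr)
    then have "q * s \<le> q * ((1 - 1 / q) + 1 / q * s powr q)" using q by (intro mult_left_mono) auto
    then show ?thesis using q by (simp add: distrib_left right_diff_distrib)
  qed (use q in auto)
  have "y powr q * (1 + q * (x / y - 1)) \<le> y powr q * (x / y) powr q"
    using nn y by (intro mult_left_mono bern) auto
  also have "\<dots> = x powr q" using nn y by (simp add: powr_divide)
  finally have "y powr q + q * (y powr q / y) * (x - y) \<le> x powr q" using y by (simp add: field_simps)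
  moreover have "y powr q / y = y powr (q - 1)" using y by (simp add: powr_diff)
  moreover have "q * y powr (q - 1) * (- z) \<le> q * y powr (q - 1) * (x - y)"
    using le q by (intro mult_left_mono) auto
  ultimately show ?thesis by simp
qed

text \<open>The variables are already divided by their expected size, so the two terms on the right are compared
  with the left-hand side at scale one.\<close>

lemma scaled_rate:
  fixes q \<theta> \<delta> k1 K2 K3 :: real
  assumes q: "q \<ge> 2" and \<theta>: "0 < \<theta>" "\<theta> < 1" and \<delta>: "0 < \<delta>" "\<delta> < 1" and K: "k1 > 0" "K2 > 0" "K3 > 0"
  defines "e \<equiv> q / 2 + (q - 2) * \<delta> / 2"
  obtains \<kappa> c where "\<kappa> > 0" "c > 0"
    "\<And>x y \<zeta>. x \<ge> 0 \<Longrightarrow> y \<ge> 0 \<Longrightarrow> \<zeta> \<ge> 0 \<Longrightarrow>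
       1 / 2 * y\<^sup>2 + \<kappa> * k1 * x powr q \<le> \<kappa> * K2 * (x powr (1 - \<theta>) * y powr \<theta>) + K3 * \<zeta> * (y powr (1 - \<delta>) * x powr \<delta>) \<Longrightarrow>
       x \<le> max c (\<zeta> powr (1 / e))"
proof -
  \<comment> \<open>Chosen so that the same factor stands on both sides when the noise term
    dominates; it cancels and leaves exactly \<open>\<zeta> powr (1 / e)\<close>.\<close>
  define K' where "K' = 2 * K3 * (4 * K3) powr ((1 - \<delta>) / (1 + \<delta>))"
  define \<kappa> where "\<kappa> = K' / k1"
  \<comment> \<open>The power of \<open>x\<close> that survives when the source term dominates and
    \<open>y\<close> has been eliminated; \<open>c\<close> is the resulting bound on
    \<open>x\<close>.\<close>
  define b where "b = q - 1 + \<theta> - (1 - \<theta>) * (\<theta> / (2 - \<theta>))"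
  define c where "c = (2 * K2 * (4 * \<kappa> * K2) powr (\<theta> / (2 - \<theta>)) / k1) powr (1 / b)"
  have K': "K' > 0" using K by (simp add: K'_def)
  have \<kappa>: "\<kappa> > 0" using K K' by (simp add: \<kappa>_def)
  have "(1 - \<theta>) * (\<theta> / (2 - \<theta>)) \<le> 1 * \<theta>"
    using \<theta> by (intro mult_mono) (auto simp: divide_le_eq)
  then have b: "b > 0" using q by (simp add: b_def)
  have c: "c > 0" using K \<kappa> by (simp add: c_def)
  have e: "e > 0"
  proof -
    have "(q - 2) * \<delta> \<ge> 0" using q \<delta> by simp
    then show ?thesis using q by (simp add: e_def)
  qed
  show thesis
  proof (rule that[OF \<kappa> c])
    fix x y \<zeta> :: real
    assume nn: "x \<ge> 0" "y \<ge> 0" "\<zeta> \<ge> 0" and ineq: "1 / 2 * y\<^sup>2 + \<kappa> * k1 * x powr q \<le> \<kappa> * K2 * (x powr (1 - \<theta>) * y powr \<theta>) + K3 * \<zeta> * (y powr (1 - \<delta>) * x powr \<delta>)"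
    show "x \<le> max c (\<zeta> powr (1 / e))"
    proof (cases "x = 0")
      case True
      then show ?thesis using c by simp
    next
      case False
      then have x: "x > 0" using nn by simp
      \<comment> \<open>Both terms on the right carry a positive power of \<open>y\<close>, so they
        could not balance the penalty at \<open>y = 0\<close>.\<close>
      have y: "y > 0"
      proof (rule ccontr)
        assume "\<not> y > 0"
        then have "y = 0" using nn by simp
        then have "\<kappa> * k1 * x powr q \<le> 0" using ineq by simp
        moreover have "\<kappa> * k1 * x powr q > 0" using \<kappa> K x by simp
        ultimately show False by simp
      qed
      define A where "A = \<kappa> * K2 * (x powr (1 - \<theta>) * y powr \<theta>)"
      define B where "B = K3 * \<zeta> * (y powr (1 - \<delta>) * x powr \<delta>)"
      have y2: "y\<^sup>2 = y powr 2" using y by simp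
      have kx: "\<kappa> * k1 * x powr q > 0" using \<kappa> K x by simp
      have AB: "1 / 2 * y powr 2 \<le> A + B" "\<kappa> * k1 * x powr q \<le> A + B"
      proof -
        have "1 / 2 * y\<^sup>2 \<ge> 0" by simp
        then show "1 / 2 * y powr 2 \<le> A + B" "\<kappa> * k1 * x powr q \<le> A + B"
          using ineq kx unfolding A_def B_def y2 by linarith+
      qed
      show ?thesis
      proof (cases "B \<le> A")
        case True
        have "y powr \<theta> * y powr (2 - \<theta>) \<le> y powr \<theta> * (4 * \<kappa> * K2 * x powr (1 - \<theta>))"
          using AB(1) True by (simp add: powr_add[symmetric] A_def mult_ac)
        then have "y powr (2 - \<theta>) \<le> 4 * \<kappa> * K2 * x powr (1 - \<theta>)"
          using y by (simp add: mult_le_cancel_left_pos)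
        then have "y \<le> (4 * \<kappa> * K2 * x powr (1 - \<theta>)) powr (1 / (2 - \<theta>))"
          using \<theta> y \<kappa> K by (intro powr_le_iff_root) auto
        then have "y powr \<theta> \<le> ((4 * \<kappa> * K2 * x powr (1 - \<theta>)) powr (1 / (2 - \<theta>))) powr \<theta>"
          using \<theta> y by (intro powr_mono2) auto
        also have "\<dots> = (4 * \<kappa> * K2) powr (\<theta> / (2 - \<theta>)) * x powr ((1 - \<theta>) * (\<theta> / (2 - \<theta>)))"
          using \<kappa> K by (simp add: powr_powr powr_mult)
        finally have yt: "y powr \<theta> \<le> (4 * \<kappa> * K2) powr (\<theta> / (2 - \<theta>)) * x powr ((1 - \<theta>) * (\<theta> / (2 - \<theta>)))" .
        have "\<kappa> * k1 * x powr q \<le> \<kappa> * (2 * K2 * (x powr (1 - \<theta>) * y powr \<theta>))"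
          using AB(2) True by (simp add: A_def mult_ac)
        then have "k1 * x powr q \<le> 2 * K2 * (x powr (1 - \<theta>) * y powr \<theta>)"
          using \<kappa> by (simp add: mult.assoc)
        also have "\<dots> \<le> 2 * K2 * (x powr (1 - \<theta>) * ((4 * \<kappa> * K2) powr (\<theta> / (2 - \<theta>)) * x powr ((1 - \<theta>) * (\<theta> / (2 - \<theta>)))))"
          using yt K by (intro mult_left_mono) auto
        also have "\<dots> = (2 * K2 * (4 * \<kappa> * K2) powr (\<theta> / (2 - \<theta>))) * x powr (1 - \<theta> + (1 - \<theta>) * (\<theta> / (2 - \<theta>)))"
          by (simp add: powr_add)
        also have "1 - \<theta> + (1 - \<theta>) * (\<theta> / (2 - \<theta>)) = q - b" by (simp add: b_def)
        finally have "k1 * x powr q \<le> (2 * K2 * (4 * \<kappa> * K2) powr (\<theta> / (2 - \<theta>))) * x powr (q - b)" .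
        then have "k1 * x powr b * x powr (q - b) \<le> (2 * K2 * (4 * \<kappa> * K2) powr (\<theta> / (2 - \<theta>))) * x powr (q - b)"
          by (simp add: mult.assoc powr_add[symmetric])
        then have "k1 * x powr b \<le> 2 * K2 * (4 * \<kappa> * K2) powr (\<theta> / (2 - \<theta>))"
          using x by (simp add: mult_le_cancel_right_pos)
        then have "x powr b \<le> 2 * K2 * (4 * \<kappa> * K2) powr (\<theta> / (2 - \<theta>)) / k1"
          using K by (simp add: pos_le_divide_eq mult.commute)
        then have "x \<le> c" unfolding c_def using b x K by (intro powr_le_iff_root) auto
        then show ?thesis by simp
      next
        case False
        have "y powr (1 - \<delta>) * y powr (1 + \<delta>) \<le> y powr (1 - \<delta>) * (4 * K3 * \<zeta> * x powr \<delta>)"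
          using AB(1) False by (simp add: powr_add[symmetric] B_def mult_ac)
        then have "y powr (1 + \<delta>) \<le> 4 * K3 * \<zeta> * x powr \<delta>"
          using y by (simp add: mult_le_cancel_left_pos)
        then have "y \<le> (4 * K3 * \<zeta> * x powr \<delta>) powr (1 / (1 + \<delta>))"
          using \<delta> y nn K by (intro powr_le_iff_root) auto
        then have "y powr (1 - \<delta>) \<le> ((4 * K3 * \<zeta> * x powr \<delta>) powr (1 / (1 + \<delta>))) powr (1 - \<delta>)"
          using \<delta> y by (intro powr_mono2) auto
        also have "\<dots> = (4 * K3) powr ((1 - \<delta>) / (1 + \<delta>)) * \<zeta> powr ((1 - \<delta>) / (1 + \<delta>)) * x powr (\<delta> * ((1 - \<delta>) / (1 + \<delta>)))"
          using nn K by (simp add: powr_powr powr_mult)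
        finally have yt: "y powr (1 - \<delta>) \<le> (4 * K3) powr ((1 - \<delta>) / (1 + \<delta>)) * \<zeta> powr ((1 - \<delta>) / (1 + \<delta>)) * x powr (\<delta> * ((1 - \<delta>) / (1 + \<delta>)))" .
        have "B > 0" using False kx AB(2) by linarith
        then have z: "\<zeta> > 0" using K nn by (cases "\<zeta> = 0") (auto simp: B_def)
        have "K' * x powr q \<le> 2 * K3 * \<zeta> * (x powr \<delta> * y powr (1 - \<delta>))"
          using AB(2) False K by (simp add: B_def \<kappa>_def mult_ac)
        also have "\<dots> \<le> 2 * K3 * \<zeta> * (x powr \<delta> * ((4 * K3) powr ((1 - \<delta>) / (1 + \<delta>)) * \<zeta> powr ((1 - \<delta>) / (1 + \<delta>)) * x powr (\<delta> * ((1 - \<delta>) / (1 + \<delta>)))))"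
          using yt K z by (intro mult_left_mono) auto
        also have "\<dots> = K' * ((\<zeta> * \<zeta> powr ((1 - \<delta>) / (1 + \<delta>))) * x powr (\<delta> + \<delta> * ((1 - \<delta>) / (1 + \<delta>))))"
          by (simp add: K'_def powr_add mult_ac)
        also have "\<zeta> * \<zeta> powr ((1 - \<delta>) / (1 + \<delta>)) = \<zeta> powr (2 / (1 + \<delta>))"
        proof -
          have "1 + (1 - \<delta>) / (1 + \<delta>) = 2 / (1 + \<delta>)" using \<delta> by (simp add: field_simps)
          then show ?thesis using z powr_add[of \<zeta> 1 "(1 - \<delta>) / (1 + \<delta>)"] by simp
        qed
        also have "\<delta> + \<delta> * ((1 - \<delta>) / (1 + \<delta>)) = q - 2 * e / (1 + \<delta>)"
          using \<delta> by (simp add: e_def field_simps)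
        finally have "x powr q \<le> \<zeta> powr (2 / (1 + \<delta>)) * x powr (q - 2 * e / (1 + \<delta>))"
          using K' by (simp add: mult_le_cancel_left_pos)
        then have "x powr (2 * e / (1 + \<delta>)) * x powr (q - 2 * e / (1 + \<delta>)) \<le> \<zeta> powr (2 / (1 + \<delta>)) * x powr (q - 2 * e / (1 + \<delta>))"
          by (simp add: powr_add[symmetric])
        then have "x powr (2 * e / (1 + \<delta>)) \<le> \<zeta> powr (2 / (1 + \<delta>))"
          using x by (simp add: mult_le_cancel_right_pos)
        then have "x \<le> (\<zeta> powr (2 / (1 + \<delta>))) powr (1 / (2 * e / (1 + \<delta>)))"
          using e \<delta> x by (intro powr_le_iff_root) auto
        also have "\<dots> = \<zeta> powr (1 / e)"
        proof -
          have "2 / X * (1 / (2 * e / X)) = 1 / e" if "X \<noteq> 0" for X :: real using that e by simp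
          from this[of "1 + \<delta>"] have "2 / (1 + \<delta>) * (1 / (2 * e / (1 + \<delta>))) = 1 / e" using \<delta> by linarith
          then show ?thesis by (simp only: powr_powr)
        qed
        finally show ?thesis by simp
      qed
    qed
  qed
qed

text \<open>The balance of penalty, source term and noise term, in this order. In logarithms each
  becomes a linear identity in \<open>ln \<rho>\<close> and \<open>ln \<epsilon>\<close>.\<close>

lemma rate_scaling:
  fixes a d s q \<epsilon> \<rho> \<kappa> :: real
  assumes pos: "a > 0" "d > 0" "s > 0" "q > 1" "\<epsilon> > 0" "\<rho> > 0"
  defines "Dn \<equiv> a + s + d / 2"
  defines "rate \<equiv> \<rho> powr ((a + d / 2) / Dn) * \<epsilon> powr (s / Dn)"
    and "\<omega> \<equiv> \<rho> powr (d / 2 / Dn) * \<epsilon> powr ((a + s) / Dn)"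
    and "\<alpha>0 \<equiv> \<rho> powr (- (q * a + d * q / 2 * (1 - 2 / q)) / Dn) * \<epsilon> powr ((2 * (a + s) - q * s) / Dn)"
    and "\<theta> \<equiv> s * (q - 1) / a" and "\<delta> \<equiv> d / (2 * a)"
  shows "\<alpha>0 * rate powr q = \<omega>\<^sup>2"
    and "\<alpha>0 * \<rho> powr (q - 1) * (rate powr (1 - \<theta>) * \<omega> powr \<theta>) = \<omega>\<^sup>2"
    and "\<epsilon> * (\<omega> powr (1 - \<delta>) * rate powr \<delta>) = \<omega>\<^sup>2"
proof -
  have D: "Dn > 0" using pos by (simp add: Dn_def)
  define r where "r = ln \<rho>"
  define E where "E = ln \<epsilon>"
  have pr: "\<rho> powr x = exp (x * r)" "\<epsilon> powr x = exp (x * E)" for x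
    using pos by (simp_all add: powr_def r_def E_def)
  have e0: "- (q * a + d * q / 2 * (1 - 2 / q)) = - (q * a + d * q / 2 - d)"
    using pos by (simp add: right_diff_distrib)
  have ex: "rate = exp (((a + d / 2) * r + s * E) / Dn)" "\<omega> = exp ((d / 2 * r + (a + s) * E) / Dn)"
    "\<alpha>0 = exp ((- (q * a + d * q / 2 - d) * r + (2 * (a + s) - q * s) * E) / Dn)"
    unfolding rate_def \<omega>_def \<alpha>0_def pr exp_add[symmetric] e0
    by (simp_all only: times_divide_eq_left add_divide_distrib[symmetric])
  have ex': "\<rho> = exp r" "\<epsilon> = exp E"
    using pos by (simp_all add: r_def E_def)
  have pw: "exp x powr y = exp (x * y)" for x y :: real by (simp add: powr_def mult.commute)
  have sq: "\<omega>\<^sup>2 = exp (2 * ((d / 2 * r + (a + s) * E) / Dn))" by (simp add: ex(2) exp_double[symmetric])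
  show "\<alpha>0 * rate powr q = \<omega>\<^sup>2"
    unfolding sq unfolding ex(1,3) pw exp_add[symmetric]
    using D by (simp add: field_simps)
  \<comment> \<open>Puts the exponents over the common denominator \<open>Dn\<close>, so that only
    an identity of numerators is left to check.\<close>
  have gen: "(A + Dn * x + B * y + C * z) / Dn = A / Dn + x + (B / Dn * y + C / Dn * z)" for A B C x y z
    using D by (simp add: add_divide_distrib)
  have "(- (q * a + d * q / 2 - d) * r + (2 * (a + s) - q * s) * E) + Dn * (r * (q - 1)) + ((a + d / 2) * r + s * E) * (1 - \<theta>) + (d / 2 * r + (a + s) * E) * \<theta>
      = 2 * (d / 2 * r + (a + s) * E)"
    unfolding \<theta>_def Dn_def using pos by (simp add: field_simps)
  from gen[of "- (q * a + d * q / 2 - d) * r + (2 * (a + s) - q * s) * E" "r * (q - 1)" "(a + d / 2) * r + s * E" "1 - \<theta>" "d / 2 * r + (a + s) * E" \<theta>, unfolded this]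
  show "\<alpha>0 * \<rho> powr (q - 1) * (rate powr (1 - \<theta>) * \<omega> powr \<theta>) = \<omega>\<^sup>2"
    unfolding sq unfolding ex(1,2,3) ex'(1) pw exp_add[symmetric] by simp
  have "0 + Dn * E + (d / 2 * r + (a + s) * E) * (1 - \<delta>) + ((a + d / 2) * r + s * E) * \<delta> = 2 * (d / 2 * r + (a + s) * E)"
    unfolding \<delta>_def Dn_def using pos by (simp add: field_simps)
  from gen[of 0 E "d / 2 * r + (a + s) * E" "1 - \<delta>" "(a + d / 2) * r + s * E" \<delta>, unfolded this]
  show "\<epsilon> * (\<omega> powr (1 - \<delta>) * rate powr \<delta>) = \<omega>\<^sup>2"
    unfolding sq unfolding ex(1,2) ex'(2) pw exp_add[symmetric] by simp
qed

section \<open>The Tikhonov functional\<close>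

lemma l2_minus_commute: "L2_norm u < \<infinity> \<Longrightarrow> L2_norm v < \<infinity> \<Longrightarrow> l2 (u - v) = l2 (v - u)"
proof -
  assume u: "L2_norm u < \<infinity>" and v: "L2_norm v < \<infinity>"
  from u obtain f where f: "L2fun f" "u = distr_of_fun f" by (rule L2_norm_finiteE)
  from v obtain g where g: "L2fun g" "v = distr_of_fun g" by (rule L2_norm_finiteE)
  show ?thesis
    unfolding f(2) g(2) distr_of_fun_diff[OF L2fun_integrable[OF f(1)] L2fun_integrable[OF g(1)], symmetric]
      distr_of_fun_diff[OF L2fun_integrable[OF g(1)] L2fun_integrable[OF f(1)], symmetric]
      l2_fun[OF L2fun_diff[OF f(1) g(1)]] l2_fun[OF L2fun_diff[OF g(1) f(1)]]
    by (rule n2_minus_commute)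
qed

locale tikhonov_setting = besov_setting m I \<phi> N p q a
  for m :: nat and I :: "nat \<Rightarrow> 'i set" and \<phi> :: "nat \<Rightarrow> 'i \<Rightarrow> real ^ ('d::finite) \<Rightarrow> real"
    and N :: "real \<Rightarrow> ennreal \<Rightarrow> ennreal \<Rightarrow> 'd distr \<Rightarrow> ennreal" and p q a :: real +
  fixes D :: "'d distr set" and F :: "'d distr \<Rightarrow> 'd distr" and L :: real
  assumes D: "D \<noteq> {}" "convex D" "norm_closed_in (besov 0 (ennreal p) (ennreal q)) (N 0 (ennreal p) (ennreal q)) D"
    and F: "\<And>f. f \<in> D \<Longrightarrow> F f \<in> besov a (ennreal p) (ennreal q)" "\<And>f. f \<in> D \<Longrightarrow> L2_norm (F f) < \<infinity>"
    and L: "L > 0"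
    and F_Lipschitz: "\<And>f1 f2. f1 \<in> D \<Longrightarrow> f2 \<in> D \<Longrightarrow>
      N a (ennreal p) (ennreal q) (F f1 - F f2) \<le> ennreal L * N 0 (ennreal p) (ennreal q) (f1 - f2)"
    and F_two_sided: "\<And>f1 f2. f1 \<in> D \<Longrightarrow> f2 \<in> D \<Longrightarrow>
      ennreal (1 / L) * N (- a) 2 2 (f1 - f2) \<le> L2_norm (F f1 - F f2) \<and>
      L2_norm (F f1 - F f2) \<le> ennreal L * N (- a) 2 2 (f1 - f2)"
begin

section \<open>Residuals, noise and their pairing\<close>

definition W :: "'d distr \<Rightarrow> 'd distr \<Rightarrow> real" where
  "W f g = l2 (F f - F g)"

text \<open>A bound on the B^{-d/2}_{p',infinity} norm, level by level; the double minus matches the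
  duality estimate \<open>pairing_bound\<close> at \<tau> = -d/2.\<close>

definition noise :: "'d distr \<Rightarrow> real \<Rightarrow> bool" where
  "noise Z \<zeta> \<longleftrightarrow> \<zeta> \<ge> 0 \<and> (\<forall>j. lpn (p / (p - 1)) (lp_block j Z) \<le> \<zeta> * 2 powr (- (real j * (- (real CARD('d) / 2)))))"

text \<open>The share of the smoothness-\<open>a\<close> bound that compensates the growth 2^(j d/2)
  of the noise.\<close>

definition \<delta> :: real where
  "\<delta> = real CARD('d) / (2 * a)"

lemma delta: "0 < \<delta>" "\<delta> < 1"
  using a(1) a_pos by (simp_all add: \<delta>_def)

lemma D_X0: "f \<in> D \<Longrightarrow> f \<in> X0"
  using D(3) by (auto simp: norm_closed_in_def X0_def)

lemma W_nonneg [simp]: "W f g \<ge> 0" by (simp add: W_def)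

lemma L2_diff: "f \<in> D \<Longrightarrow> g \<in> D \<Longrightarrow> L2_norm (F f - F g) < \<infinity>"
  by (intro L2_norm_diff(1) F)

lemma L2_W: "f \<in> D \<Longrightarrow> g \<in> D \<Longrightarrow> L2_norm (F f - F g) = ennreal (W f g)"
  unfolding W_def by (intro L2_norm_l2 L2_diff)

lemma block_a:
  obtains C where "C > 0" "\<And>f g j. f \<in> D \<Longrightarrow> g \<in> D \<Longrightarrow> lpn p (lp_block j (F f - F g)) \<le> 2 powr (- (real j * a)) * (C * nrm (f - g))"
proof -
  from N_equiv[OF pq1, of a] obtain c where c: "c > 0"
    "\<And>u. ennreal c * besov_norm a (ennreal p) (ennreal q) u \<le> N a (ennreal p) (ennreal q) u"
    unfolding equivalent_on_def by auto
  show thesis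
  proof (rule that[of "L / c"])
    show "L / c > 0" using L c by simp
    fix f g j assume fg: "f \<in> D" "g \<in> D"
    have "ennreal (2 powr (real j * a) * lpn p (lp_block j (F f - F g))) \<le> besov_norm a (ennreal p) (ennreal q) (F f - F g)"
      using p pq1 by (subst besov_norm_real) (auto intro: Lp_norm_count_member)
    then have "ennreal c * ennreal (2 powr (real j * a) * lpn p (lp_block j (F f - F g))) \<le> ennreal L * N 0 (ennreal p) (ennreal q) (f - g)"
      using c(2)[of "F f - F g"] F_Lipschitz[OF fg] by (meson mult_left_mono order_trans zero_le)
    also have "\<dots> = ennreal (L * nrm (f - g))"
      using N_nrm[OF X0_diff[OF D_X0[OF fg(1)] D_X0[OF fg(2)]]] L by (simp add: ennreal_mult)
    finally have "c * (2 powr (real j * a) * lpn p (lp_block j (F f - F g))) \<le> L * nrm (f - g)"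
      using c(1) L by (simp add: ennreal_mult[symmetric] ennreal_le_iff)
    then show "lpn p (lp_block j (F f - F g)) \<le> 2 powr (- (real j * a)) * (L / c * nrm (f - g))"
      using c(1) by (simp add: powr_minus field_simps)
  qed
qed

text \<open>The Lipschitz bound concerns differences only. For a single \<open>F f\<close> mere
  membership in the Besov space is enough to make its pairing with the noise converge.\<close>

lemma F_block:
  assumes f: "f \<in> D"
  obtains C where "C \<ge> 0" "\<And>j. lpn p (lp_block j (F f)) \<le> 2 powr (- (real j * a)) * C"
proof -
  have fin: "besov_norm a (ennreal p) (ennreal q) (F f) < \<infinity>" using F(1)[OF f] by (simp add: besov_def)
  define C where "C = enn2real (besov_norm a (ennreal p) (ennreal q) (F f))"
  have C: "besov_norm a (ennreal p) (ennreal q) (F f) = ennreal C" "C \<ge> 0" using fin by (simp_all add: C_def)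
  show thesis
  proof (rule that[OF C(2)])
    fix j
    have "ennreal (2 powr (real j * a) * lpn p (lp_block j (F f))) \<le> besov_norm a (ennreal p) (ennreal q) (F f)"
      using p pq1 by (subst besov_norm_real) (auto intro: Lp_norm_count_member)
    then have "2 powr (real j * a) * lpn p (lp_block j (F f)) \<le> C" using C by (simp add: ennreal_le_iff)
    then show "lpn p (lp_block j (F f)) \<le> 2 powr (- (real j * a)) * C" by (simp add: powr_minus field_simps)
  qed
qed

text \<open>The growth 2^(j d/2) of the noise blocks is beaten by the decay 2^(-j a), since a >
  d/2.\<close>

lemma noise_convergent:
  assumes Z: "noise Z \<zeta>" and f: "f \<in> D"
  shows "convergent (\<lambda>J. distr_apply Z (lp_partial J (F f)))"
proof -
  note cj = conjugate_exponent[OF p(1)]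
  from F_block[OF f] obtain C where C: "C \<ge> 0" "\<And>j. lpn p (lp_block j (F f)) \<le> 2 powr (- (real j * a)) * C" by blast
  let ?\<tau> = "- (real CARD('d) / 2)"
  show ?thesis
  proof (rule pairing_bound(1)[OF p(1) cj(1,2)])
    show "lpn (p / (p - 1)) (lp_block j Z) \<le> \<zeta> * 2 powr (- (real j * ?\<tau>))" for j using Z by (simp add: noise_def)
    show "\<zeta> \<ge> 0" using Z by (simp add: noise_def)
    show "2 powr (- (real j * ?\<tau>)) * lpn p (lp_block j (F f)) \<le> 2 powr (- (real j * (a - real CARD('d) / 2))) * C" for j
    proof -
      have "2 powr (- (real j * ?\<tau>)) * lpn p (lp_block j (F f)) \<le> 2 powr (- (real j * ?\<tau>)) * (2 powr (- (real j * a)) * C)"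
        by (intro mult_left_mono C) auto
      also have "\<dots> = 2 powr (- (real j * (a - real CARD('d) / 2))) * C"
        unfolding mult.assoc[symmetric] powr_add[symmetric] by (simp add: algebra_simps)
      finally show ?thesis .
    qed
    show "summable (\<lambda>j. 2 powr (- (real j * (a - real CARD('d) / 2))) * C)"
      using a(1) by (intro summable_mult2 geometric_powr_summable) simp
  qed
qed

text \<open>Linearity in the second argument is obtained by letting \<open>lp_partial J\<close>
  change sides, after which the difference acts as a functional.\<close>

lemma pairing_diff_right:
  assumes "convergent (\<lambda>J. distr_apply Z (lp_partial J u))" "convergent (\<lambda>J. distr_apply Z (lp_partial J v))"
  shows "pairing Z (u - v) = pairing Z u - pairing Z v"
proof -
  have e: "distr_apply Z (lp_partial J (u - v)) = distr_apply Z (lp_partial J u) - distr_apply Z (lp_partial J v)" for J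
    unfolding distr_lp_partial_commute[of Z] by (simp add: distr_ops)
  show ?thesis
    unfolding pairing_def e using assms by (intro limI tendsto_diff) (simp_all add: convergent_LIMSEQ_iff)
qed

lemma pairing_noise_diff:
  "noise Z \<zeta> \<Longrightarrow> f \<in> D \<Longrightarrow> g \<in> D \<Longrightarrow> pairing Z (F f - F g) = pairing Z (F f) - pairing Z (F g)"
  by (intro pairing_diff_right noise_convergent)

text \<open>Each level is bounded in two ways: by the L^2 norm of the residual with growth 2^(j
  d/2), and through smoothness \<open>a\<close> with decay 2^(-j (a - d/2)). Summing the minimum
  gives the product with exponents 1 - \<delta> and \<delta>.\<close>

lemma pairing_interpolation:
  obtains K where "K > 0" "\<And>Z \<zeta> f g. noise Z \<zeta> \<Longrightarrow> f \<in> D \<Longrightarrow> g \<in> D \<Longrightarrow>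
    \<bar>pairing Z (F f - F g)\<bar> \<le> K * \<zeta> * (W f g powr (1 - \<delta>) * nrm (f - g) powr \<delta>)"
proof -
  note cj = conjugate_exponent[OF p(1)]
  let ?d2 = "real CARD('d) / 2"
  have d2: "?d2 > 0" by simp
  have a2: "a - ?d2 > 0" using a(1) by simp
  from block_a obtain C where C: "C > 0" "\<And>f g j. f \<in> D \<Longrightarrow> g \<in> D \<Longrightarrow> lpn p (lp_block j (F f - F g)) \<le> 2 powr (- (real j * a)) * (C * nrm (f - g))"
    by blast
  from sum_min_geometric[OF d2 a2] obtain K where K: "K > 0"
    "\<And>X Y. X \<ge> 0 \<Longrightarrow> Y \<ge> 0 \<Longrightarrow> summable (\<lambda>j. min (2 powr (real j * ?d2) * X) (2 powr (- (real j * (a - ?d2))) * Y))"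
    "\<And>X Y. X \<ge> 0 \<Longrightarrow> Y \<ge> 0 \<Longrightarrow> (\<Sum>j. min (2 powr (real j * ?d2) * X) (2 powr (- (real j * (a - ?d2))) * Y))
       \<le> K * (X powr ((a - ?d2) / (?d2 + (a - ?d2))) * Y powr (?d2 / (?d2 + (a - ?d2))))" by blast
  have ex: "(a - ?d2) / (?d2 + (a - ?d2)) = 1 - \<delta>" "?d2 / (?d2 + (a - ?d2)) = \<delta>"
    using a_pos by (simp_all add: \<delta>_def field_simps)
  let ?K = "3 * 2 powr \<bar>- ?d2\<bar> * (K * (2 powr (1 - \<delta>) * C powr \<delta>))"
  show thesis
  proof (rule that[of ?K])
    show "?K > 0" using K(1) C(1) by simp
    fix Z \<zeta> f g assume Z: "noise Z \<zeta>" and fg: "f \<in> D" "g \<in> D"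
    let ?X = "2 * W f g" and ?Y = "C * nrm (f - g)"
    have XY: "?X \<ge> 0" "?Y \<ge> 0" using C(1) by auto
    let ?B = "\<lambda>j. min (2 powr (real j * ?d2) * ?X) (2 powr (- (real j * (a - ?d2))) * ?Y)"
    have z0: "\<zeta> \<ge> 0" using Z by (simp add: noise_def)
    have "\<bar>pairing Z (F f - F g)\<bar> \<le> 3 * 2 powr \<bar>- ?d2\<bar> * \<zeta> * suminf ?B"
    proof (rule pairing_bound(2)[OF p(1) cj(1,2) _ z0 _ K(2)[OF XY]])
      show "lpn (p / (p - 1)) (lp_block j Z) \<le> \<zeta> * 2 powr (- (real j * (- ?d2)))" for j using Z by (simp add: noise_def)
      show "2 powr (- (real j * (- ?d2))) * lpn p (lp_block j (F f - F g)) \<le> ?B j" for j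
      proof (rule min.boundedI)
        show "2 powr (- (real j * (- ?d2))) * lpn p (lp_block j (F f - F g)) \<le> 2 powr (real j * ?d2) * ?X"
          using lpn_block_le_l2[OF L2_diff[OF fg], of p j] p by (simp add: W_def)
        have "2 powr (- (real j * (- ?d2))) * lpn p (lp_block j (F f - F g)) \<le> 2 powr (- (real j * (- ?d2))) * (2 powr (- (real j * a)) * ?Y)"
          by (intro mult_left_mono C fg) auto
        also have "\<dots> = 2 powr (- (real j * (a - ?d2))) * ?Y"
          unfolding mult.assoc[symmetric] powr_add[symmetric] by (simp add: algebra_simps)
        finally show "2 powr (- (real j * (- ?d2))) * lpn p (lp_block j (F f - F g)) \<le> 2 powr (- (real j * (a - ?d2))) * ?Y" .
      qed
    qed
    also have "\<dots> \<le> 3 * 2 powr \<bar>- ?d2\<bar> * \<zeta> * (K * (?X powr (1 - \<delta>) * ?Y powr \<delta>))"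
      using K(3)[OF XY] z0 unfolding ex by (intro mult_left_mono) auto
    also have "\<dots> = ?K * \<zeta> * (W f g powr (1 - \<delta>) * nrm (f - g) powr \<delta>)"
      using C(1) by (simp add: powr_mult)
    finally show "\<bar>pairing Z (F f - F g)\<bar> \<le> ?K * \<zeta> * (W f g powr (1 - \<delta>) * nrm (f - g) powr \<delta>)" .
  qed
qed

text \<open>For data \<open>F g\<close> plus noise the square completes around \<open>F g\<close>,
  and the constant that this produces cancels in the difference.\<close>

lemma tikhonov_diff:
  assumes Z: "noise Z \<zeta>" and fg: "f \<in> D" "g \<in> D"
  shows "tikhonov R F (F g + \<epsilon> *\<^sub>R Z) \<beta> f - tikhonov R F (F g + \<epsilon> *\<^sub>R Z) \<beta> g
    = 1 / 2 * (W f g)\<^sup>2 - \<epsilon> * pairing Z (F f - F g) + \<beta> * (R f - R g)"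
proof -
  have pr: "pairing (F g + \<epsilon> *\<^sub>R Z) (F h) = pairing (F g) (F h) + \<epsilon> * pairing Z (F h)" if h: "h \<in> D" for h
  proof -
    have "(\<lambda>J. distr_apply (F g) (lp_partial J (F h)) + \<epsilon> * distr_apply Z (lp_partial J (F h))) \<longlonglongrightarrow> pairing (F g) (F h) + \<epsilon> * pairing Z (F h)"
      unfolding pairing_def
      using L2_norm_diff(3)[OF F(2)[OF fg(2)] F(2)[OF h]] noise_convergent[OF Z h]
      by (intro tendsto_intros) (simp_all add: convergent_LIMSEQ_iff)
    then show ?thesis unfolding pairing_def[of "F g + \<epsilon> *\<^sub>R Z"] by (intro limI) (simp add: distr_ops)
  qed
  have "1 / 2 * (l2 (F f))\<^sup>2 - pairing (F g) (F f) = 1 / 2 * (W f g)\<^sup>2 - 1 / 2 * (l2 (F g))\<^sup>2"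
    unfolding W_def by (intro L2_norm_diff(2) F fg)
  moreover have "1 / 2 * (l2 (F g))\<^sup>2 - pairing (F g) (F g) = - 1 / 2 * (l2 (F g))\<^sup>2"
  proof -
    from F(2)[OF fg(2)] obtain h where h: "L2fun h" "F g = distr_of_fun h" by (rule L2_norm_finiteE)
    have "pairing (F g) (F g) = (l2 (F g))\<^sup>2"
      unfolding h(2) pairing_fun[OF h(1) h(1)] l2_fun[OF h(1)] n2_sq by (simp add: power2_eq_square)
    then show ?thesis by simp
  qed
  ultimately show ?thesis
    unfolding tikhonov_def pr[OF fg(1)] pr[OF fg(2)] pairing_noise_diff[OF Z fg] l2_def[symmetric]
    by (simp add: algebra_simps)
qed

text \<open>The lower stability bound of \<open>F\<close>, weakened from exponent 2 to
  \<open>p\<close> on blocks and carried to wavelet levels. It supplies the quantity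
  \<open>Y\<close> of the source condition.\<close>

lemma wl_le_W:
  obtains C where "C > 0" "\<And>f g j. f \<in> D \<Longrightarrow> g \<in> D \<Longrightarrow> wl p (f - g) j \<le> 2 powr (real j * a) * (C * W f g)"
proof -
  have ma: "\<bar>- a\<bar> < real m" "1 \<le> p" using a a_pos p by auto
  from wl_le_besov[OF ma] obtain C where C: "C > 0" "\<And>u A j. u \<in> low_order m \<Longrightarrow> (\<And>i. 2 powr (real i * (- a)) * lpn p (lp_block i u) \<le> A)
    \<Longrightarrow> 2 powr (real j * (- a)) * wl p u j \<le> C * A" by blast
  have two: "(1::ennreal) \<le> ennreal 2" by simp
  from N_equiv[OF two two, of "- a"] obtain c where c: "c > 0"
    "\<And>u. ennreal c * besov_norm (- a) (ennreal 2) (ennreal 2) u \<le> N (- a) (ennreal 2) (ennreal 2) u"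
    unfolding equivalent_on_def by auto
  show thesis
  proof (rule that[of "C * (L / c)"])
    show "C * (L / c) > 0" using C(1) c(1) L by simp
    fix f g j assume fg: "f \<in> D" "g \<in> D"
    have lp: "2 powr (real i * (- a)) * lpn p (lp_block i (f - g)) \<le> L / c * W f g" for i
    proof -
      have "ennreal (2 powr (real i * (- a)) * lpn p (lp_block i (f - g))) \<le> ennreal (2 powr (real i * (- a)) * lpn 2 (lp_block i (f - g)))"
        using p by (intro ennreal_leI mult_left_mono lpn_mono_exponent lp_block_cont) auto
      also have "\<dots> \<le> besov_norm (- a) (ennreal 2) (ennreal 2) (f - g)"
        unfolding besov_norm_real[of 2, OF zero_less_numeral]
        by (rule Lp_norm_count_member[of "ennreal 2" i UNIV "\<lambda>i. ennreal (2 powr (real i * (- a)) * lpn 2 (lp_block i (f - g)))"]) auto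
      finally have "ennreal (1 / L) * (ennreal c * ennreal (2 powr (real i * (- a)) * lpn p (lp_block i (f - g))))
          \<le> ennreal (1 / L) * N (- a) (ennreal 2) (ennreal 2) (f - g)"
        using c(2)[of "f - g"] by (meson mult_left_mono order_trans zero_le)
      also have "\<dots> \<le> ennreal (W f g)"
        using F_two_sided[OF fg] L2_W[OF fg] by simp
      finally have "1 / L * (c * (2 powr (real i * (- a)) * lpn p (lp_block i (f - g)))) \<le> W f g"
        using c(1) L by (simp add: ennreal_mult[symmetric] ennreal_le_iff)
      then show ?thesis using c(1) L by (simp add: field_simps)
    qed
    have "2 powr (real j * (- a)) * wl p (f - g) j \<le> C * (L / c * W f g)"
      using C(2)[OF X0_low[OF X0_diff[OF D_X0[OF fg(1)] D_X0[OF fg(2)]]] lp] .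
    then show "wl p (f - g) j \<le> 2 powr (real j * a) * (C * (L / c) * W f g)"
      by (simp add: powr_minus field_simps)
  qed
qed

text \<open>The upper stability bound in wavelet levels. The weight with \<open>gap\<close> is what
  lets \<open>W\<close> tend to zero along bounded sequences whose coefficients converge.\<close>

lemma W_le_wl:
  obtains C where "C > 0" "\<And>f g. f \<in> D \<Longrightarrow> g \<in> D \<Longrightarrow>
    W f g \<le> C * (\<Sum>j. (2 powr (- (real j * gap)) * wl p (f - g) j) powr 2) powr (1 / 2)"
    "\<And>f g. f \<in> D \<Longrightarrow> g \<in> D \<Longrightarrow> summable (\<lambda>j. (2 powr (- (real j * gap)) * wl p (f - g) j) powr 2)"
proof -
  have ma: "\<bar>- a\<bar> < real m" using a a_pos by auto
  have two: "(1::ennreal) \<le> ennreal 2" by simp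
  from N_equiv[OF two two, of "- a"] obtain C1 where C1: "C1 > 0"
    "\<And>u. N (- a) (ennreal 2) (ennreal 2) u \<le> ennreal C1 * besov_norm (- a) (ennreal 2) (ennreal 2) u"
    unfolding equivalent_on_def by auto
  from wavelet_equiv[OF ma two two] obtain c where c: "c > 0"
    "\<And>u. u \<in> low_order m \<Longrightarrow> ennreal c * besov_norm (- a) (ennreal 2) (ennreal 2) u \<le> wavelet_norm I \<phi> (- a) (ennreal 2) (ennreal 2) u"
    unfolding equivalent_on_def by auto
  have summ: "summable (\<lambda>j. (2 powr (- (real j * gap)) * wl p u j) powr 2)" if u: "u \<in> X0" for u
  proof (rule summable_comparison_test')
    show "summable (\<lambda>j. 2 powr (- (real j * (2 * gap))) * (Phi u powr (1 / q)) powr 2)"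
      using gap_pos by (intro summable_mult2 geometric_powr_summable) simp
    fix j :: nat
    have "(2 powr (- (real j * gap)) * wl p u j) powr 2 \<le> (2 powr (- (real j * gap)) * Phi u powr (1 / q)) powr 2"
      using wl_le_Phi[OF u, of j] by (intro powr_mono2 mult_left_mono) auto
    also have "\<dots> = 2 powr (- (real j * (2 * gap))) * (Phi u powr (1 / q)) powr 2"
      unfolding powr_mult powr_powr by (simp add: mult_ac)
    finally show "norm ((2 powr (- (real j * gap)) * wl p u j) powr 2) \<le> 2 powr (- (real j * (2 * gap))) * (Phi u powr (1 / q)) powr 2"
      by simp
  qed
  show thesis
  proof (rule that[of "L * C1 / c"])
    show "L * C1 / c > 0" using L C1(1) c(1) by simp
    fix f g assume fg: "f \<in> D" "g \<in> D"
    let ?u = "f - g"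
    have u: "?u \<in> X0" by (intro X0_diff D_X0 fg)
    show su: "summable (\<lambda>j. (2 powr (- (real j * gap)) * wl p ?u j) powr 2)" by (rule summ[OF u])
    let ?x = "\<lambda>j. 2 powr (real j * (- a)) * wl 2 ?u j"
    have xle: "?x j \<le> 2 powr (- (real j * gap)) * wl p ?u j" for j
      using lnorm2_coeff[of j ?u] by (simp add: wl_def[of 2])
    have x2: "(?x j) powr 2 \<le> (2 powr (- (real j * gap)) * wl p ?u j) powr 2" for j
      using xle[of j] by (intro powr_mono2) auto
    have sx: "summable (\<lambda>j. (?x j) powr 2)"
      by (rule summable_comparison_test'[OF su]) (use x2 in simp)
    have wn: "wavelet_norm I \<phi> (- a) (ennreal 2) (ennreal 2) ?u = ennreal ((\<Sum>j. ?x j powr 2) powr (1 / 2))"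
      unfolding wavelet_norm_real[of 2, OF zero_less_numeral] using Lp_norm_count_real[of 2 ?x] sx by simp
    let ?S = "(\<Sum>j. ?x j powr 2) powr (1 / 2)"
    define b where "b = enn2real (besov_norm (- a) (ennreal 2) (ennreal 2) ?u)"
    have cb: "ennreal c * besov_norm (- a) (ennreal 2) (ennreal 2) ?u \<le> ennreal ?S" using c(2)[OF X0_low[OF u]] wn by simp
    have "besov_norm (- a) (ennreal 2) (ennreal 2) ?u \<noteq> top"
    proof
      assume "besov_norm (- a) (ennreal 2) (ennreal 2) ?u = top"
      then show False using cb c(1) by (simp add: ennreal_mult_top top_unique)
    qed
    then have b: "besov_norm (- a) (ennreal 2) (ennreal 2) ?u = ennreal b" "b \<ge> 0" by (simp_all add: b_def less_top)
    have cb': "c * b \<le> ?S" using cb c(1) b by (simp add: ennreal_mult[symmetric] ennreal_le_iff)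
    have "ennreal (W f g) \<le> ennreal L * N (- a) (ennreal 2) (ennreal 2) ?u" using F_two_sided[OF fg] L2_W[OF fg] by simp
    also have "\<dots> \<le> ennreal L * (ennreal C1 * ennreal b)" using C1(2)[of ?u] b by (intro mult_left_mono) auto
    also have "\<dots> = ennreal (L * (C1 * b))" using L C1(1) b by (simp add: ennreal_mult)
    finally have "W f g \<le> L * (C1 * b)" using L C1(1) b by (simp add: ennreal_le_iff)
    also have "\<dots> = L * C1 / c * (c * b)" using c(1) by simp
    also have "\<dots> \<le> L * C1 / c * ?S" using L C1(1) c(1) by (intro mult_left_mono cb') auto
    also have "\<dots> \<le> L * C1 / c * (\<Sum>j. (2 powr (- (real j * gap)) * wl p ?u j) powr 2) powr (1 / 2)"
      using L C1(1) c(1) x2 sx su by (intro mult_left_mono powr_mono2 suminf_le) (auto intro!: suminf_nonneg)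
    finally show "W f g \<le> L * C1 / c * (\<Sum>j. (2 powr (- (real j * gap)) * wl p ?u j) powr 2) powr (1 / 2)" .
  qed
qed

lemma wavelet_R_eq:
  "f \<in> X0 \<Longrightarrow> 1 / q * enn2real (wavelet_norm I \<phi> 0 (ennreal p) (ennreal q) f) powr q = Phi f / q"
  using q by (simp add: wavelet_norm_X0 wl_summable powr_powr Phi_nonneg)

text \<open>The factor 2 clears the half in the convexity inequality, \<open>2 powr (- q)\<close>
  comes from halving the difference, \<open>(p - 1) powr (q / 2)\<close> is the convexity modulus,
  and 1/q is the factor in the penalty.\<close>

definition kap :: real where
  "kap = 2 powr (1 - q) * (p - 1) powr (q / 2) / q"

lemma kap_pos: "kap > 0"
  using p q by (simp add: kap_def)

text \<open>Variational source condition: smoothness of \<open>g\<close> makes the subgradient of \<open>Phi\<close> at \<open>g\<close> decay like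
  \<open>2 powr (- j * s * (q - 1))\<close>, so it can be paired with the weak norm controlled by \<open>Y\<close>.\<close>

lemma source_condition:
  assumes s: "0 < s" "s < a / (q - 1)"
  obtains K where "K > 0"
    "\<And>f g \<rho>' Y. f \<in> X0 \<Longrightarrow> g \<in> X0 \<Longrightarrow> \<rho>' \<ge> 0 \<Longrightarrow> Y \<ge> 0 \<Longrightarrow> (\<And>j. wl p g j \<le> 2 powr (- (real j * s)) * \<rho>') \<Longrightarrow>
       (\<And>j. wl p (f - g) j \<le> 2 powr (real j * a) * Y) \<Longrightarrow>
       kap * Phi (f - g) - K * \<rho>' powr (q - 1) * (Y powr (s * (q - 1) / a) * (Phi (f - g) powr (1 / q)) powr (1 - s * (q - 1) / a))
         \<le> Phi f / q - Phi g / q"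
proof -
  let ?v = "s * (q - 1)"
  \<comment> \<open>The upper bound on \<open>s\<close> enters here. Paired with the subgradient,
    the weak bound grows at rate \<open>a - ?v\<close> and the norm bound decays at rate
    \<open>?v\<close>, so the sum of minima applies.\<close>
  have v: "?v > 0" "a - ?v > 0" using s q by (auto simp: pos_less_divide_eq)
  from sum_min_geometric[OF v(2,1)] obtain K where K: "K > 0"
    "\<And>X Y. X \<ge> 0 \<Longrightarrow> Y \<ge> 0 \<Longrightarrow> summable (\<lambda>j. min (2 powr (real j * (a - ?v)) * X) (2 powr (- (real j * ?v)) * Y))"
    "\<And>X Y. X \<ge> 0 \<Longrightarrow> Y \<ge> 0 \<Longrightarrow> (\<Sum>j. min (2 powr (real j * (a - ?v)) * X) (2 powr (- (real j * ?v)) * Y))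
       \<le> K * (X powr (?v / (a - ?v + ?v)) * Y powr ((a - ?v) / (a - ?v + ?v)))" by blast
  have ex: "?v / (a - ?v + ?v) = ?v / a" "(a - ?v) / (a - ?v + ?v) = 1 - ?v / a"
    using a_pos by (simp_all add: diff_divide_distrib)
  show thesis
  proof (rule that[OF K(1)])
    fix f g \<rho>' Y
    assume f: "f \<in> X0" and g: "g \<in> X0" and r: "\<rho>' \<ge> 0" and Y: "Y \<ge> 0"
      and gs: "\<And>j. wl p g j \<le> 2 powr (- (real j * s)) * \<rho>'" and hY: "\<And>j. wl p (f - g) j \<le> 2 powr (real j * a) * Y"
    let ?h = "f - g" and ?P = "Phi (f - g) powr (1 / q)"
    \<comment> \<open>Convexity is used at the midpoint, and the tangent inequality bounds
      \<open>Phi md\<close> from below by \<open>Phi g\<close>; no derivative of \<open>Phi\<close>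
      has to be formed.\<close>
    define md where "md = (1 / 2) *\<^sub>R (f + g)"
    have X: "?h \<in> X0" "md \<in> X0" unfolding md_def by (intro X0_diff X0_add X0_scale f g)+
    let ?B = "\<lambda>j. min (2 powr (real j * (a - ?v)) * Y) (2 powr (- (real j * ?v)) * ?P)"
    have P0: "?P \<ge> 0" by simp
    note sB = K(2)[OF Y P0]
    have prod: "wl p g j powr (q - 1) * wl p ?h j \<le> \<rho>' powr (q - 1) * ?B j" for j
    proof -
      have 1: "wl p g j powr (q - 1) \<le> 2 powr (- (real j * ?v)) * \<rho>' powr (q - 1)"
      proof -
        have "wl p g j powr (q - 1) \<le> (2 powr (- (real j * s)) * \<rho>') powr (q - 1)"
          using gs[of j] q by (intro powr_mono2) auto
        then show ?thesis using r by (simp add: powr_mult powr_powr mult_ac)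
      qed
      have "wl p g j powr (q - 1) * wl p ?h j \<le> (2 powr (- (real j * ?v)) * \<rho>' powr (q - 1)) * min (2 powr (real j * a) * Y) ?P"
        using hY[of j] wl_le_Phi[OF X(1), of j] 1 by (intro mult_mono) auto
      also have "\<dots> = \<rho>' powr (q - 1) * (2 powr (- (real j * ?v)) * min (2 powr (real j * a) * Y) ?P)" by (simp only: mult_ac)
      also have "2 powr (- (real j * ?v)) * min (2 powr (real j * a) * Y) ?P = min (2 powr (- (real j * ?v)) * (2 powr (real j * a) * Y)) (2 powr (- (real j * ?v)) * ?P)"
        by (simp add: min_mult_distrib_left)
      also have "2 powr (- (real j * ?v)) * (2 powr (real j * a) * Y) = 2 powr (real j * (a - ?v)) * Y"
        unfolding mult.assoc[symmetric] powr_add[symmetric] by (simp add: algebra_simps)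
      finally show ?thesis .
    qed
    have half: "wl p ((1 / 2) *\<^sub>R ?h) j = wl p ?h j / 2" for j using wl_scale[OF X(1), of p "1 / 2" j] p by simp
    \<comment> \<open>\<open>g\<close> is the midpoint minus half the difference, which gives the
      one-sided bound that \<open>powr_gradient\<close> asks for.\<close>
    have tri: "wl p g j \<le> wl p md j + wl p ?h j / 2" for j
    proof -
      have "md + (- 1 / 2) *\<^sub>R ?h = g" unfolding md_def by (simp add: scaleR_right_distrib scaleR_right_diff_distrib scaleR_add_left[symmetric])
      then have "wl p g j \<le> wl p md j + wl p ((- 1 / 2) *\<^sub>R ?h) j" using wl_add_le[OF X(2) X0_scale[OF X(1)], of "- 1 / 2" j] by simp
      then show ?thesis using wl_scale[OF X(1), of p "- 1 / 2" j] p by simp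
    qed
    have pt: "wl p g j powr q - q / 2 * (\<rho>' powr (q - 1) * ?B j) \<le> wl p md j powr q" for j
    proof -
      have "wl p g j powr q - q * wl p g j powr (q - 1) * (wl p ?h j / 2) \<le> wl p md j powr q"
        using q tri[of j] by (intro powr_gradient) auto
      moreover have "q / 2 * (wl p g j powr (q - 1) * wl p ?h j) \<le> q / 2 * (\<rho>' powr (q - 1) * ?B j)"
        using q prod[of j] by (intro mult_left_mono) auto
      ultimately show ?thesis by simp
    qed
    have sB2: "summable (\<lambda>j. q / 2 * (\<rho>' powr (q - 1) * ?B j))" by (intro summable_mult sB)
    have "(\<Sum>j. wl p g j powr q - q / 2 * (\<rho>' powr (q - 1) * ?B j)) \<le> Phi md"
      unfolding Phi_def[of md] by (intro suminf_le pt summable_diff wl_summable g X sB2)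
    also have "(\<Sum>j. wl p g j powr q - q / 2 * (\<rho>' powr (q - 1) * ?B j)) = Phi g - q / 2 * (\<rho>' powr (q - 1) * suminf ?B)"
      unfolding Phi_def[of g]
      by (simp only: suminf_diff[OF wl_summable[OF g] sB2, symmetric] suminf_mult[OF summable_mult[OF sB]] suminf_mult[OF sB])
    finally have 1: "Phi g - q / 2 * (\<rho>' powr (q - 1) * suminf ?B) \<le> Phi md" .
    have 2: "Phi md + (p - 1) powr (q / 2) * (2 powr (- q) * Phi ?h) \<le> (Phi f + Phi g) / 2"
    proof -
      have "Phi ((1 / 2) *\<^sub>R ?h) = 2 powr (- q) * Phi ?h"
      proof -
        have "\<bar>1 / 2 :: real\<bar> powr q = 2 powr (- q)" by (simp add: powr_divide powr_minus_divide)
        then show ?thesis using Phi_scale[OF X(1), of "1 / 2"] by simp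
      qed
      then show ?thesis using Phi_convex[OF f g] by (simp add: md_def)
    qed
    have 3: "\<rho>' powr (q - 1) * suminf ?B \<le> K * \<rho>' powr (q - 1) * (Y powr (?v / a) * ?P powr (1 - ?v / a))"
      using mult_left_mono[OF K(3)[OF Y P0], of "\<rho>' powr (q - 1)"] unfolding ex by (simp add: mult_ac)
    \<comment> \<open>Combining facts 1 and 2 eliminates \<open>Phi md\<close>.\<close>
    have "2 * ((p - 1) powr (q / 2) * (2 powr (- q) * Phi ?h)) - q * (\<rho>' powr (q - 1) * suminf ?B) \<le> Phi f - Phi g"
      using 1 2 by (simp add: field_simps)
    then have "(2 * ((p - 1) powr (q / 2) * (2 powr (- q) * Phi ?h)) - q * (\<rho>' powr (q - 1) * suminf ?B)) / q \<le> (Phi f - Phi g) / q"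
      using q by (intro divide_right_mono) auto
    moreover have "2 * ((p - 1) powr (q / 2) * (2 powr (- q) * Phi ?h)) / q = kap * Phi ?h"
      using powr_add[of 2 1 "- q"] by (simp add: kap_def)
    ultimately have "kap * Phi ?h - \<rho>' powr (q - 1) * suminf ?B \<le> Phi f / q - Phi g / q"
      using q by (simp add: diff_divide_distrib)
    then show "kap * Phi ?h - K * \<rho>' powr (q - 1) * (Y powr (?v / a) * ?P powr (1 - ?v / a)) \<le> Phi f / q - Phi g / q"
      using 3 by linarith
  qed
qed

end

section \<open>Existence of minimizers\<close>

context tikhonov_setting
begin

lemma wl_coeff: "l \<in> I j \<Longrightarrow> 2 powr (real j * real CARD('d) * (1 / 2 - 1 / p)) * \<bar>wavelet_coeff \<phi> u j l\<bar> \<le> wl p u j"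
  unfolding wl_def using p by (intro mult_left_mono lnorm_component finI) auto

lemma lnorm_tendsto:
  assumes "\<And>l. l \<in> A \<Longrightarrow> (\<lambda>n. x n l) \<longlonglongrightarrow> y l" "P > 0"
  shows "(\<lambda>n. lnorm A P (x n)) \<longlonglongrightarrow> lnorm A P y"
  unfolding lnorm_def using assms
  by (intro tendsto_powr' tendsto_sum tendsto_rabs tendsto_const) (auto intro!: always_eventually sum_nonneg)

lemma wl_tendsto:
  assumes "\<And>l. l \<in> I j \<Longrightarrow> (\<lambda>n. wavelet_coeff \<phi> (f n) j l) \<longlonglongrightarrow> wavelet_coeff \<phi> u j l"
  shows "(\<lambda>n. wl p (f n) j) \<longlonglongrightarrow> wl p u j"
  unfolding wl_def using p assms by (intro tendsto_mult tendsto_const lnorm_tendsto) auto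

lemma wl_diff_le: "u \<in> X0 \<Longrightarrow> v \<in> X0 \<Longrightarrow> wl p (u - v) j \<le> wl p u j + wl p v j"
  using wl_add_le[of u "(-1) *\<^sub>R v" j] wl_scale[of v p "-1" j] X0_scale[of v "-1"] p by simp

lemma nrm_diff_le: "u \<in> X0 \<Longrightarrow> v \<in> X0 \<Longrightarrow> nrm (u - v) \<le> nrm u + nrm v"
proof -
  assume uv: "u \<in> X0" "v \<in> X0"
  have "N 0 (ennreal p) (ennreal q) (u + (-1) *\<^sub>R v) \<le> N 0 (ennreal p) (ennreal q) u + N 0 (ennreal p) (ennreal q) ((-1) *\<^sub>R v)"
    by (rule N_triangle[OF pq1])
  then have "ennreal (nrm (u - v)) \<le> ennreal (nrm u) + ennreal (nrm v)"
    unfolding N_scale[OF pq1] using N_nrm[OF X0_diff[OF uv]] N_nrm[OF uv(1)] N_nrm[OF uv(2)] by simp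
  then show ?thesis by (simp add: ennreal_plus[symmetric] ennreal_le_iff del: ennreal_plus)
qed

text \<open>Weak sequential closedness of the convex set \<open>D\<close>: nearly \<open>Phi\<close>-minimal elements of the convex hulls
  of the tails form a Cauchy sequence by uniform convexity.\<close>

lemma weakly_closed:
  assumes f: "\<And>n. f n \<in> D" and B: "\<And>n. Phi (f n) \<le> B"
    and conv: "\<And>j l. l \<in> I j \<Longrightarrow> (\<lambda>n. wavelet_coeff \<phi> (f n) j l) \<longlonglongrightarrow> c j l"
  obtains u where "u \<in> D" "\<And>j l. l \<in> I j \<Longrightarrow> wavelet_coeff \<phi> u j l = c j l"
proof -
  define H where "H n = convex hull (f ` {n..})" for n
  have HD: "H n \<subseteq> D" for n unfolding H_def using f D(2) by (intro hull_minimal) auto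
  have Hm: "H m \<subseteq> H n" if "n \<le> m" for n m unfolding H_def using that by (intro hull_mono) auto
  have HX: "v \<in> X0" if "v \<in> H n" for v n using HD that D_X0 by blast
  have fH: "f n \<in> H n" for n unfolding H_def by (rule hull_inc) auto
  have cH: "convex (H n)" for n unfolding H_def by (rule convex_convex_hull)
  define \<iota> where "\<iota> n = Inf (Phi ` H n)" for n
  have bdd: "bdd_below (Phi ` H n)" for n using HX Phi_nonneg by (intro bdd_belowI[of _ 0]) auto
  have \<iota>le: "\<iota> n \<le> Phi v" if "v \<in> H n" for n v unfolding \<iota>_def using that bdd by (intro cInf_lower) auto
  \<comment> \<open>The hulls of the tails shrink, so the infima increase; they stay below
    \<open>B\<close> because \<open>H n\<close> contains \<open>f n\<close>.\<close>
  have mono: "incseq \<iota>"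
  proof (unfold incseq_def \<iota>_def, intro allI impI cInf_superset_mono image_mono)
    show "Phi ` H n \<noteq> {}" for n using fH[of n] by blast
  qed (use Hm bdd in auto)
  have "\<iota> n \<le> B" for n using \<iota>le[OF fH, of n] B[of n] by linarith
  then have "convergent \<iota>" using incseq_convergent[OF mono, of B] by (metis convergentI)
  then have cau: "Cauchy \<iota>" by (rule convergent_Cauchy)
  have "\<exists>v\<in>H n. Phi v < \<iota> n + inverse (real (Suc n))" for n
  proof -
    have "Inf (Phi ` H n) < \<iota> n + inverse (real (Suc n))" by (simp add: \<iota>_def)
    then show ?thesis using cInf_lessD[of "Phi ` H n"] fH[of n] by blast
  qed
  then obtain h where h: "\<And>n. h n \<in> H n" "\<And>n. Phi (h n) < \<iota> n + inverse (real (Suc n))" by metis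
  have hX: "h n \<in> X0" for n using h(1) HX by blast
  define \<kappa> where "\<kappa> = (p - 1) powr (q / 2) * (1 / 2) powr q"
  have \<kappa>: "\<kappa> > 0" using p by (simp add: \<kappa>_def)
  \<comment> \<open>The midpoint of \<open>h n\<close> and \<open>h k\<close> lies in
    \<open>H n\<close>, so \<open>Phi\<close> is at least \<open>\<iota> n\<close> there, and the
    convexity inequality leaves a bound on the difference.\<close>
  have key: "\<kappa> * Phi (h n - h k) \<le> (\<iota> k - \<iota> n) / 2 + inverse (real (Suc n))" if nk: "n \<le> k" for n k
  proof -
    have arith: "K \<le> (ik - i) / 2 + e"
      if "i \<le> M" "K = T" "ek \<le> e" "M + T \<le> (x + y) / 2" "x < i + e" "y < ik + ek" for K T M i ik x y e ek :: real
      using that by (simp add: field_simps)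
    have "(1 / 2) *\<^sub>R h n + (1 / 2) *\<^sub>R h k \<in> H n"
      using cH[of n] h(1)[of n] h(1)[of k] Hm[OF nk] by (intro convexD) auto
    then have "\<iota> n \<le> Phi ((1 / 2) *\<^sub>R (h n + h k))" by (intro \<iota>le) (simp add: scaleR_right_distrib)
    moreover have "\<kappa> * Phi (h n - h k) = (p - 1) powr (q / 2) * Phi ((1 / 2) *\<^sub>R (h n - h k))"
      by (simp add: Phi_scale X0_diff hX \<kappa>_def)
    moreover have "inverse (real (Suc k)) \<le> inverse (real (Suc n))" using nk by (intro le_imp_inverse_le) auto
    ultimately show ?thesis
      using Phi_convex[OF hX hX, of n k] h(2)[of n] h(2)[of k] by (rule arith)
  qed
  have sym: "Phi (h n - h k) = Phi (h k - h n)" for n k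
    using Phi_scale[OF X0_diff[OF hX[of k] hX[of n]], of "-1"] by simp
  have cauchy: "\<exists>M. \<forall>k\<ge>M. \<forall>n\<ge>M. Phi (h n - h k) < e" if e: "e > 0" for e
  proof -
    have e': "\<kappa> * e / 2 > 0" using e \<kappa> by simp
    obtain M1 where M1: "\<And>m n. m \<ge> M1 \<Longrightarrow> n \<ge> M1 \<Longrightarrow> dist (\<iota> m) (\<iota> n) < \<kappa> * e / 2"
      using metric_CauchyD[OF cau e'] by blast
    obtain M2 where M2: "inverse (real (Suc M2)) < \<kappa> * e / 2" using reals_Archimedean[OF e'] by blast
    have le: "Phi (h n - h k) < e" if n: "n \<ge> max M1 M2" "n \<le> k" for n k
    proof -
      have "inverse (real (Suc n)) \<le> inverse (real (Suc M2))" using n by (intro le_imp_inverse_le) auto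
      moreover have "\<iota> k - \<iota> n < \<kappa> * e / 2" using M1[of k n] n abs_ge_self[of "\<iota> k - \<iota> n"] unfolding dist_real_def by linarith
      ultimately have "\<kappa> * Phi (h n - h k) < \<kappa> * e" using key[OF n(2)] M2 e' by argo
      then show ?thesis using \<kappa> by simp
    qed
    have "Phi (h n - h k) < e" if "k \<ge> max M1 M2" "n \<ge> max M1 M2" for n k
      using le[of n k] le[of k n] sym[of n k] that by (cases "n \<le> k") auto
    then show ?thesis by blast
  qed
  from X0_complete[of h, OF hX cauchy] obtain u where u: "u \<in> X0" "(\<lambda>n. Phi (h n - u)) \<longlonglongrightarrow> 0" by blast
  have root: "(\<lambda>n. Phi (h n - u) powr (1 / q)) \<longlonglongrightarrow> 0"
  proof -
    have "(\<lambda>n. Phi (h n - u) powr (1 / q)) \<longlonglongrightarrow> 0 powr (1 / q)"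
      using q u(2) by (intro tendsto_powr' tendsto_const) (auto intro!: always_eventually Phi_nonneg X0_diff hX u(1))
    then show ?thesis by simp
  qed
  have uD: "u \<in> D"
  proof -
    obtain C where C: "C > 0" "\<And>u. u \<in> X0 \<Longrightarrow> nrm u \<le> C * Phi u powr (1 / q)"
      by (rule nrm_equiv) (rule that; assumption)
    have "\<exists>g\<in>D. N 0 (ennreal p) (ennreal q) (g - u) < ennreal e" if e: "e > 0" for e
    proof -
      have "\<forall>\<^sub>F n in sequentially. Phi (h n - u) powr (1 / q) < e / C"
        using root e C(1) by (intro order_tendstoD(2)) auto
      then obtain n where n: "Phi (h n - u) powr (1 / q) < e / C" by (auto simp: eventually_sequentially)
      have "nrm (h n - u) < e" using C(2)[OF X0_diff[OF hX u(1)], of n] n C(1) by (simp add: pos_less_divide_eq mult.commute)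
      then have "N 0 (ennreal p) (ennreal q) (h n - u) < ennreal e"
        unfolding N_nrm[OF X0_diff[OF hX u(1)]] by (simp add: ennreal_lessI e)
      then show ?thesis using h(1)[of n] HD by blast
    qed
    then show ?thesis using D(3) u(1) unfolding norm_closed_in_def X0_def by blast
  qed
  have "wavelet_coeff \<phi> u j l = c j l" if l: "l \<in> I j" for j l
  proof -
    have 1: "(\<lambda>n. wavelet_coeff \<phi> (h n) j l) \<longlonglongrightarrow> c j l"
    proof (rule LIMSEQ_I)
      fix e :: real assume e: "e > 0"
      obtain n0 where n0: "\<And>n. n \<ge> n0 \<Longrightarrow> \<bar>wavelet_coeff \<phi> (f n) j l - c j l\<bar> < e"
        using LIMSEQ_D[OF conv[OF l] e] by auto
      \<comment> \<open>A convex set: once it contains a tail of \<open>f\<close>, it contains the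
        hull of that tail and hence the later \<open>h n\<close>.\<close>
      define S where "S = {v \<in> X0. \<bar>wavelet_coeff \<phi> v j l - c j l\<bar> < e}"
      have "convex S"
      proof (rule convexI)
        fix x y and s t :: real assume xy: "x \<in> S" "y \<in> S" and st: "0 \<le> s" "0 \<le> t" "s + t = 1"
        have X: "x \<in> X0" "y \<in> X0" using xy by (auto simp: S_def)
        have "wavelet_coeff \<phi> (s *\<^sub>R x + t *\<^sub>R y) j l = s * wavelet_coeff \<phi> x j l + t * wavelet_coeff \<phi> y j l"
          by (simp add: coeff_add coeff_scale X0_scale X l)
        moreover have "(wavelet_coeff \<phi> x j l) \<in> ball (c j l) e" "(wavelet_coeff \<phi> y j l) \<in> ball (c j l) e"
          using xy by (auto simp: S_def dist_real_def)
        then have "s *\<^sub>R wavelet_coeff \<phi> x j l + t *\<^sub>R wavelet_coeff \<phi> y j l \<in> ball (c j l) e"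
          using st by (intro convexD[OF convex_ball]) auto
        ultimately show "s *\<^sub>R x + t *\<^sub>R y \<in> S" by (auto simp: S_def dist_real_def X0_add X0_scale X)
      qed
      then have "H n \<subseteq> S" if "n \<ge> n0" for n
        unfolding H_def using n0 that D_X0[OF f] by (intro hull_minimal) (auto simp: S_def)
      then show "\<exists>no. \<forall>n\<ge>no. norm (wavelet_coeff \<phi> (h n) j l - c j l) < e" using h(1) unfolding S_def by fastforce
    qed
    let ?w = "2 powr (real j * real CARD('d) * (1 / 2 - 1 / p))"
    have 2: "(\<lambda>n. wavelet_coeff \<phi> (h n) j l - wavelet_coeff \<phi> u j l) \<longlonglongrightarrow> 0"
    proof (rule Lim_null_comparison)
      show "(\<lambda>n. Phi (h n - u) powr (1 / q) / ?w) \<longlonglongrightarrow> 0"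
        using tendsto_divide_zero[OF root] by simp
      have "\<bar>wavelet_coeff \<phi> (h n) j l - wavelet_coeff \<phi> u j l\<bar> \<le> Phi (h n - u) powr (1 / q) / ?w" for n
      proof -
        have "?w * \<bar>wavelet_coeff \<phi> (h n - u) j l\<bar> \<le> Phi (h n - u) powr (1 / q)"
          by (rule order_trans[OF wl_coeff[OF l] wl_le_Phi[OF X0_diff[OF hX u(1)]]])
        then show ?thesis by (simp add: coeff_diff hX u(1) l pos_le_divide_eq mult.commute)
      qed
      then show "\<forall>\<^sub>F n in sequentially. norm (wavelet_coeff \<phi> (h n) j l - wavelet_coeff \<phi> u j l) \<le> Phi (h n - u) powr (1 / q) / ?w"
        by simp
    qed
    have "(\<lambda>n. wavelet_coeff \<phi> (h n) j l) \<longlonglongrightarrow> wavelet_coeff \<phi> u j l" using 2 by (simp add: LIM_zero_iff)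
    from LIMSEQ_unique[OF this 1] show ?thesis .
  qed
  then show thesis using that[OF uD] by blast
qed

text \<open>Tannery's theorem exchanges the limit with the sum over levels; the bound on
  \<open>Phi\<close> and the positive gap provide a geometric majorant.\<close>

lemma W_tendsto:
  assumes f: "\<And>n. f n \<in> D" and u: "u \<in> D" and B: "\<And>n. Phi (f n) \<le> B"
    and conv: "\<And>j l. l \<in> I j \<Longrightarrow> (\<lambda>n. wavelet_coeff \<phi> (f n) j l) \<longlonglongrightarrow> wavelet_coeff \<phi> u j l"
  shows "(\<lambda>n. W (f n) u) \<longlonglongrightarrow> 0"
proof -
  obtain C where C: "C > 0" "\<And>f g. f \<in> D \<Longrightarrow> g \<in> D \<Longrightarrow>
    W f g \<le> C * (\<Sum>j. (2 powr (- (real j * gap)) * wl p (f - g) j) powr 2) powr (1 / 2)"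
    by (rule W_le_wl) (rule that; assumption)
  let ?a = "\<lambda>j n. (2 powr (- (real j * gap)) * wl p (f n - u) j) powr 2"
  define B1 where "B1 = B powr (1 / q) + Phi u powr (1 / q)"
  have wB: "wl p (f n - u) j \<le> B1" for n j
  proof -
    have "wl p (f n) j \<le> B powr (1 / q)"
      using wl_le_Phi[OF D_X0[OF f]] B Phi_nonneg[OF D_X0[OF f]] q by (meson order_trans powr_mono2 zero_le_divide_1_iff order.strict_implies_order less_le_trans zero_less_numeral)
    then show ?thesis
      using wl_diff_le[OF D_X0[OF f] D_X0[OF u], of n j] wl_le_Phi[OF D_X0[OF u], of j] by (simp add: B1_def)
  qed
  have lim: "(\<lambda>n. ?a j n) \<longlonglongrightarrow> 0" for j
  proof -
    have wc: "wl p (f n - u) j = 2 powr (real j * real CARD('d) * (1 / 2 - 1 / p)) * lnorm (I j) p (\<lambda>l. wavelet_coeff \<phi> (f n) j l - wavelet_coeff \<phi> u j l)" for n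
      by (intro wl_cong coeff_diff D_X0 f u)
    have "(\<lambda>n. lnorm (I j) p (\<lambda>l. wavelet_coeff \<phi> (f n) j l - wavelet_coeff \<phi> u j l)) \<longlonglongrightarrow> lnorm (I j) p (\<lambda>l. wavelet_coeff \<phi> u j l - wavelet_coeff \<phi> u j l)"
      using p conv by (intro lnorm_tendsto tendsto_diff tendsto_const) auto
    then have "(\<lambda>n. lnorm (I j) p (\<lambda>l. wavelet_coeff \<phi> (f n) j l - wavelet_coeff \<phi> u j l)) \<longlonglongrightarrow> 0"
      by (simp add: lnorm_def)
    then have "(\<lambda>n. wl p (f n - u) j) \<longlonglongrightarrow> 0" unfolding wc by (rule tendsto_mult_right_zero)
    then have "(\<lambda>n. 2 powr (- (real j * gap)) * wl p (f n - u) j) \<longlonglongrightarrow> 0" by (rule tendsto_mult_right_zero)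
    then have "(\<lambda>n. ?a j n) \<longlonglongrightarrow> 0 powr 2"
      by (intro tendsto_powr' tendsto_const) auto
    then show ?thesis by simp
  qed
  have dom: "norm (?a j n) \<le> 2 powr (- (real j * (2 * gap))) * B1 powr 2" for j n
  proof -
    have "?a j n \<le> (2 powr (- (real j * gap)) * B1) powr 2"
      using wB[of n j] by (intro powr_mono2 mult_left_mono) auto
    also have "\<dots> = 2 powr (- (real j * (2 * gap))) * B1 powr 2"
      unfolding powr_mult powr_powr by (simp add: mult_ac)
    finally show ?thesis by simp
  qed
  have "((\<lambda>n. suminf (\<lambda>j. ?a j n)) \<longlongrightarrow> suminf (\<lambda>j. 0)) sequentially"
  proof (rule tannerys_theorem[THEN conjunct2, THEN conjunct2])
    show "summable (\<lambda>j. 2 powr (- (real j * (2 * gap))) * B1 powr 2)"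
      using gap_pos by (intro summable_mult2 geometric_powr_summable) simp
    show "\<forall>\<^sub>F (k, n) in at_top \<times>\<^sub>F sequentially. norm (?a k n) \<le> 2 powr (- (real k * (2 * gap))) * B1 powr 2"
      using dom by (intro always_eventually) auto
  qed (use lim in auto)
  then have "(\<lambda>n. suminf (\<lambda>j. ?a j n)) \<longlonglongrightarrow> 0" by simp
  moreover have "suminf (\<lambda>j. ?a j n) \<ge> 0" for n
  proof -
    have "summable (\<lambda>j. ?a j n)"
    proof (rule summable_comparison_test')
      show "summable (\<lambda>j. 2 powr (- (real j * (2 * gap))) * B1 powr 2)"
        using gap_pos by (intro summable_mult2 geometric_powr_summable) simp
      show "norm (?a j n) \<le> 2 powr (- (real j * (2 * gap))) * B1 powr 2" for j by (rule dom)
    qed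
    then show ?thesis by (intro suminf_nonneg) auto
  qed
  ultimately have "(\<lambda>n. suminf (\<lambda>j. ?a j n) powr (1 / 2)) \<longlonglongrightarrow> 0 powr (1 / 2)"
    by (intro tendsto_powr' tendsto_const) auto
  then have "(\<lambda>n. C * suminf (\<lambda>j. ?a j n) powr (1 / 2)) \<longlonglongrightarrow> 0" by (intro tendsto_mult_right_zero) simp
  then show ?thesis
    by (rule Lim_null_comparison[rotated]) (use C(2)[OF f u] in simp)
qed

lemma W_triangle: "f \<in> D \<Longrightarrow> g \<in> D \<Longrightarrow> h \<in> D \<Longrightarrow> \<bar>W f g - W h g\<bar> \<le> W f h"
proof -
  assume D': "f \<in> D" "g \<in> D" "h \<in> D"
  note L2 = L2_diff[OF D'(1,2)] L2_diff[OF D'(3,2)]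
  have e: "(F f - F g) - (F h - F g) = F f - F h" "(F h - F g) - (F f - F g) = F h - F f" by simp_all
  have "l2 (F h - F f) = l2 (F f - F h)" by (intro l2_minus_commute F D')
  then show ?thesis
    using L2_norm_diff(4)[OF L2] L2_norm_diff(4)[OF L2(2,1)] unfolding e W_def by linarith
qed

text \<open>Either \<open>x\<close> is below the threshold where b x^(q-1) reaches A, or the power
  dominates the linear term. This absorbs the linear contribution of the noise into the
  penalty.\<close>

lemma linear_absorb:
  fixes A b :: real
  assumes "A > 0" "b > 0" "x \<ge> 0"
  shows "A * x \<le> b * x powr q + A * (A / b) powr (1 / (q - 1))"
proof (cases "x \<le> (A / b) powr (1 / (q - 1))")
  case True
  then have "A * x \<le> A * (A / b) powr (1 / (q - 1))" using assms by (intro mult_left_mono) auto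
  moreover have "b * x powr q \<ge> 0" using assms by simp
  ultimately show ?thesis by linarith
next
  case False
  then have x: "x > 0" by (smt (verit) powr_ge_zero)
  have "((A / b) powr (1 / (q - 1))) powr (q - 1) \<le> x powr (q - 1)"
    using False q by (intro powr_mono2) auto
  then have "A / b \<le> x powr (q - 1)" using q assms by (simp add: powr_powr)
  then have "A \<le> b * x powr (q - 1)" using assms by (simp add: pos_divide_le_eq mult.commute)
  then have "A * x \<le> b * x powr (q - 1) * x" using x by (intro mult_right_mono) auto
  also have "\<dots> = b * x powr q" using x powr_add[of x "q - 1" 1] by simp
  finally show ?thesis using assms by (smt (verit) mult_nonneg_nonneg powr_ge_zero)
qed

theorem minimizer_exists:
  assumes Z: "noise Z \<zeta>" and g: "g \<in> D" and \<epsilon>: "\<epsilon> > 0" and \<beta>: "\<beta> > 0"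
    and R: "\<And>f. f \<in> D \<Longrightarrow> R f = Phi f / q"
  shows "\<exists>f. is_arg_min (tikhonov R F (F g + \<epsilon> *\<^sub>R Z) \<beta>) (\<lambda>f. f \<in> D) f"
proof -
  \<comment> \<open>It differs from the Tikhonov functional only by the value of the latter at
    \<open>g\<close>, so it has the same minimizers, and each of its terms passes to the
    limit.\<close>
  define J where "J f = 1 / 2 * (W f g)\<^sup>2 - \<epsilon> * pairing Z (F f - F g) + \<beta> * (R f - R g)" for f
  have TJ: "tikhonov R F (F g + \<epsilon> *\<^sub>R Z) \<beta> f = J f + tikhonov R F (F g + \<epsilon> *\<^sub>R Z) \<beta> g" if "f \<in> D" for f
    using tikhonov_diff[OF Z that g, of R \<epsilon> \<beta>] by (simp add: J_def)
  from pairing_interpolation obtain K where K: "K > 0" "\<And>Z \<zeta> f g. noise Z \<zeta> \<Longrightarrow> f \<in> D \<Longrightarrow> g \<in> D \<Longrightarrow>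
    \<bar>pairing Z (F f - F g)\<bar> \<le> K * \<zeta> * (W f g powr (1 - \<delta>) * nrm (f - g) powr \<delta>)" by blast
  obtain C where C: "C > 0" "\<And>u. u \<in> X0 \<Longrightarrow> nrm u \<le> C * Phi u powr (1 / q)"
      by (rule nrm_equiv) (rule that; assumption)
  have z0: "\<zeta> \<ge> 0" using Z by (simp add: noise_def)
  \<comment> \<open>One is added to keep the constant positive for \<zeta> = 0, as
    \<open>linear_absorb\<close> requires.\<close>
  define K0 where "K0 = \<epsilon> * (K * \<zeta>) + 1"
  have "\<epsilon> * (K * \<zeta>) \<ge> 0" using \<epsilon> K(1) z0 by simp
  then have K0: "K0 > 0" "\<epsilon> * (K * \<zeta>) \<le> K0" by (simp_all add: K0_def)
  \<comment> \<open>Half of the penalty weight \<open>\<beta> / q\<close>: one half absorbs the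
    noise, the other remains for coercivity.\<close>
  define b where "b = \<beta> / (2 * q)"
  have b: "b > 0" using \<beta> q by (simp add: b_def)
  define A0 where "A0 = K0 * C * (K0 * C / b) powr (1 / (q - 1))"
  define b0 where "b0 = K0\<^sup>2 / 2 + K0 * nrm g + A0 + \<beta> * R g"
  have coer: "b * Phi f - b0 \<le> J f" if f: "f \<in> D" for f
  proof -
    let ?W = "W f g" and ?n = "nrm (f - g)" and ?x = "Phi f powr (1 / q)"
    have "?W powr (1 - \<delta>) * ?n powr \<delta> \<le> ?W + ?n"
    proof (cases "?W = 0 \<or> ?n = 0")
      case False
      then have pos: "?W > 0" "?n > 0" by (auto simp: less_le)
      have "?W powr (1 - \<delta>) * ?n powr \<delta> \<le> (1 - \<delta>) * ?W + \<delta> * ?n"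
        using delta pos by (intro Youngs_inequality_0) auto
      also have "\<dots> \<le> 1 * ?W + 1 * ?n" using delta pos by (intro add_mono mult_right_mono) auto
      finally show ?thesis by simp
    qed auto
    then have "\<epsilon> * (K * \<zeta>) * (?W powr (1 - \<delta>) * ?n powr \<delta>) \<le> K0 * (?W + ?n)"
      using K0 by (intro mult_mono) auto
    moreover have "\<epsilon> * pairing Z (F f - F g) \<le> \<epsilon> * (K * \<zeta> * (?W powr (1 - \<delta>) * ?n powr \<delta>))"
      using K(2)[OF Z f g] \<epsilon> by (intro mult_left_mono) auto
    moreover have "K0 * ?W \<le> 1 / 2 * ?W\<^sup>2 + K0\<^sup>2 / 2"
      using sum_squares_bound[of K0 ?W] by simp
    moreover have "K0 * ?n \<le> K0 * (C * ?x + nrm g)"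
      using nrm_diff_le[OF D_X0[OF f] D_X0[OF g]] C(2)[OF D_X0[OF f]] K0 by (intro mult_left_mono) auto
    moreover have "K0 * C * ?x \<le> b * ?x powr q + A0"
      unfolding A0_def using K0 C(1) b by (intro linear_absorb) auto
    moreover have "?x powr q = Phi f" using q Phi_nonneg[OF D_X0[OF f]] by (simp add: powr_powr)
    moreover have "\<beta> * R f = 2 * (b * Phi f)" using q by (simp add: R[OF f] b_def)
    ultimately show ?thesis
      unfolding J_def b0_def by (simp add: distrib_left right_diff_distrib mult.assoc)
  qed
  have Jlow: "- b0 \<le> J f" if f: "f \<in> D" for f
    using coer[OF f] mult_nonneg_nonneg[OF less_imp_le[OF b] Phi_nonneg[OF D_X0[OF f]]] by linarith
  define \<mu> where "\<mu> = Inf (J ` D)"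
  have bdd: "bdd_below (J ` D)" using Jlow by (intro bdd_belowI[of _ "- b0"]) auto
  have \<mu>le: "\<mu> \<le> J f" if "f \<in> D" for f unfolding \<mu>_def using that bdd by (intro cInf_lower) auto
  have "\<exists>f\<in>D. J f < \<mu> + inverse (real (Suc n))" for n
  proof -
    have "Inf (J ` D) < \<mu> + inverse (real (Suc n))" by (simp add: \<mu>_def)
    then show ?thesis using cInf_lessD[of "J ` D"] D(1) by blast
  qed
  then obtain f0 where f0: "\<And>n. f0 n \<in> D" "\<And>n. J (f0 n) < \<mu> + inverse (real (Suc n))" by metis
  define B where "B = (\<mu> + 1 + b0) / b"
  have PB: "Phi (f0 n) \<le> B" for n
  proof -
    have "inverse (real (Suc n)) \<le> 1" by (simp add: field_simps)
    then have "b * Phi (f0 n) \<le> \<mu> + 1 + b0" using coer[OF f0(1), of n] f0(2)[of n] by linarith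
    then show ?thesis using b by (simp add: B_def pos_le_divide_eq mult.commute)
  qed
  let ?w = "\<lambda>j. 2 powr (real j * real CARD('d) * (1 / 2 - 1 / p))"
  \<comment> \<open>With the level weight one constant bounds all coefficients of the sequence, so a
    single subsequence converges at every index.\<close>
  define G where "G n jl = ?w (fst jl) * wavelet_coeff \<phi> (f0 n) (fst jl) (snd jl)" for n jl
  have cs: "countable (Sigma UNIV I)" by (intro countable_SIGMA) (auto intro: countable_finite finI)
  have Gb: "norm (G n jl) \<le> B powr (1 / q)" if "jl \<in> Sigma UNIV I" for n jl
  proof -
    have "norm (G n jl) \<le> wl p (f0 n) (fst jl)"
      using wl_coeff[of "snd jl" "fst jl" "f0 n"] that by (auto simp: G_def abs_mult)
    also have "\<dots> \<le> Phi (f0 n) powr (1 / q)" by (rule wl_le_Phi[OF D_X0[OF f0(1)]])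
    also have "\<dots> \<le> B powr (1 / q)" using PB Phi_nonneg[OF D_X0[OF f0(1)]] q by (intro powr_mono2) auto
    finally show ?thesis .
  qed
  obtain k where k: "strict_mono (k :: nat \<Rightarrow> nat)" "\<And>jl. jl \<in> Sigma UNIV I \<Longrightarrow> \<exists>l. (\<lambda>n. G (k n) jl) \<longlonglongrightarrow> l"
    by (rule function_convergent_subsequence[OF cs, of G "B powr (1 / q)"]) (use Gb in blast)+
  define f where "f n = f0 (k n)" for n
  have fD: "f n \<in> D" and fB: "Phi (f n) \<le> B" for n using f0 PB by (auto simp: f_def)
  have fJ: "J (f n) < \<mu> + inverse (real (Suc n))" for n
  proof -
    have "inverse (real (Suc (k n))) \<le> inverse (real (Suc n))"
      using seq_suble[OF k(1), of n] by (intro le_imp_inverse_le) auto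
    then show ?thesis using f0(2)[of "k n"] unfolding f_def by linarith
  qed
  define c where "c j l = lim (\<lambda>n. wavelet_coeff \<phi> (f n) j l)" for j l
  have c: "(\<lambda>n. wavelet_coeff \<phi> (f n) j l) \<longlonglongrightarrow> c j l" if l: "l \<in> I j" for j l
  proof -
    obtain b where "(\<lambda>n. G (k n) (j, l)) \<longlonglongrightarrow> b" using k(2)[of "(j, l)"] l by auto
    then have "(\<lambda>n. G (k n) (j, l) / ?w j) \<longlonglongrightarrow> b / ?w j" by (intro tendsto_divide tendsto_const) auto
    then have "(\<lambda>n. wavelet_coeff \<phi> (f n) j l) \<longlonglongrightarrow> b / ?w j" by (simp add: G_def f_def)
    then show ?thesis unfolding c_def by (metis limI)
  qed
  obtain u where u: "u \<in> D" "\<And>j l. l \<in> I j \<Longrightarrow> wavelet_coeff \<phi> u j l = c j l"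
    using weakly_closed[of f B c, OF fD fB c] by blast
  have cu: "(\<lambda>n. wavelet_coeff \<phi> (f n) j l) \<longlonglongrightarrow> wavelet_coeff \<phi> u j l" if "l \<in> I j" for j l
    using c[OF that] u(2)[OF that] by simp
  have W0: "(\<lambda>n. W (f n) u) \<longlonglongrightarrow> 0" by (rule W_tendsto[OF fD u(1) fB cu])
  have Wl: "(\<lambda>n. W (f n) g) \<longlonglongrightarrow> W u g"
  proof -
    have "(\<lambda>n. W (f n) g - W u g) \<longlonglongrightarrow> 0"
      by (rule Lim_null_comparison[OF _ W0]) (use W_triangle[OF fD g u(1)] in simp)
    then show ?thesis by (simp add: LIM_zero_iff)
  qed
  \<comment> \<open>The interpolation estimate with bounded norms and \<open>W\<close> tending to
    zero; the positive exponent 1 - \<delta> makes the noise term continuous along the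
    subsequence.\<close>
  have Pl: "(\<lambda>n. pairing Z (F (f n) - F g)) \<longlonglongrightarrow> pairing Z (F u - F g)"
  proof -
    define nb where "nb = C * B powr (1 / q) + nrm u"
    have nb: "nrm (f n - u) \<le> nb" for n
    proof -
      have "C * Phi (f n) powr (1 / q) \<le> C * B powr (1 / q)"
        using fB Phi_nonneg[OF D_X0[OF fD]] q C(1) by (intro mult_left_mono powr_mono2) auto
      then show ?thesis
        using nrm_diff_le[OF D_X0[OF fD] D_X0[OF u(1)], of n] C(2)[OF D_X0[OF fD], of n] by (simp add: nb_def)
    qed
    have "(\<lambda>n. K * \<zeta> * (W (f n) u powr (1 - \<delta>) * nb powr \<delta>)) \<longlonglongrightarrow> K * \<zeta> * (0 powr (1 - \<delta>) * nb powr \<delta>)"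
      using delta W0 by (intro tendsto_mult tendsto_const tendsto_powr') auto
    then have z: "(\<lambda>n. K * \<zeta> * (W (f n) u powr (1 - \<delta>) * nb powr \<delta>)) \<longlonglongrightarrow> 0" by simp
    have bd: "\<bar>pairing Z (F (f n) - F g) - pairing Z (F u - F g)\<bar> \<le> K * \<zeta> * (W (f n) u powr (1 - \<delta>) * nb powr \<delta>)" for n
    proof -
      have "pairing Z (F (f n) - F g) - pairing Z (F u - F g) = pairing Z (F (f n) - F u)"
        by (simp add: pairing_noise_diff[OF Z] fD g u(1))
      also have "\<bar>\<dots>\<bar> \<le> K * \<zeta> * (W (f n) u powr (1 - \<delta>) * nrm (f n - u) powr \<delta>)" by (rule K(2)[OF Z fD u(1)])
      also have "\<dots> \<le> K * \<zeta> * (W (f n) u powr (1 - \<delta>) * nb powr \<delta>)"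
        using K(1) z0 delta nb[of n] by (intro mult_left_mono powr_mono2) auto
      finally show ?thesis .
    qed
    have "(\<lambda>n. pairing Z (F (f n) - F g) - pairing Z (F u - F g)) \<longlonglongrightarrow> 0"
      by (rule Lim_null_comparison[OF _ z]) (use bd in simp)
    then show ?thesis by (simp add: LIM_zero_iff)
  qed
  \<comment> \<open>Only finitely many levels pass to the limit at once; letting \<open>J0\<close>
    grow afterwards gives lower semicontinuity of the penalty.\<close>
  have part: "1 / 2 * (W u g)\<^sup>2 - \<epsilon> * pairing Z (F u - F g) + \<beta> * ((\<Sum>j<J0. wl p u j powr q) / q - R g) \<le> \<mu>" for J0
  proof (rule LIMSEQ_le)
    have wj: "(\<lambda>n. wl p (f n) j powr q) \<longlonglongrightarrow> wl p u j powr q" for j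
      using q by (intro tendsto_powr'[OF wl_tendsto[OF cu] tendsto_const]) auto
    have ws: "(\<lambda>n. \<Sum>j<J0. wl p (f n) j powr q) \<longlonglongrightarrow> (\<Sum>j<J0. wl p u j powr q)"
      by (rule tendsto_sum[OF wj])
    have q0: "q \<noteq> 0" using q by simp
    show "(\<lambda>n. 1 / 2 * (W (f n) g)\<^sup>2 - \<epsilon> * pairing Z (F (f n) - F g) + \<beta> * ((\<Sum>j<J0. wl p (f n) j powr q) / q - R g))
      \<longlonglongrightarrow> 1 / 2 * (W u g)\<^sup>2 - \<epsilon> * pairing Z (F u - F g) + \<beta> * ((\<Sum>j<J0. wl p u j powr q) / q - R g)"
      by (rule tendsto_add[OF tendsto_diff[OF tendsto_mult[OF tendsto_const tendsto_power[OF Wl]] tendsto_mult[OF tendsto_const Pl]]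
            tendsto_mult[OF tendsto_const tendsto_diff[OF tendsto_divide[OF ws tendsto_const q0] tendsto_const]]])
    show "(\<lambda>n. \<mu> + inverse (real (Suc n))) \<longlonglongrightarrow> \<mu>"
      using tendsto_add[OF tendsto_const LIMSEQ_inverse_real_of_nat, of \<mu>] by simp
    have "1 / 2 * (W (f n) g)\<^sup>2 - \<epsilon> * pairing Z (F (f n) - F g) + \<beta> * ((\<Sum>j<J0. wl p (f n) j powr q) / q - R g) \<le> \<mu> + inverse (real (Suc n))" for n
    proof -
      have "(\<Sum>j<J0. wl p (f n) j powr q) \<le> Phi (f n)"
        unfolding Phi_def using wl_summable[OF D_X0[OF fD]] by (intro sum_le_suminf) auto
      then have "\<beta> * ((\<Sum>j<J0. wl p (f n) j powr q) / q - R g) \<le> \<beta> * (Phi (f n) / q - R g)"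
        using \<beta> q by (intro mult_left_mono diff_right_mono divide_right_mono) auto
      then show ?thesis using fJ[of n] unfolding J_def R[OF fD] by linarith
    qed
    then show "\<exists>N. \<forall>n\<ge>N. 1 / 2 * (W (f n) g)\<^sup>2 - \<epsilon> * pairing Z (F (f n) - F g) + \<beta> * ((\<Sum>j<J0. wl p (f n) j powr q) / q - R g) \<le> \<mu> + inverse (real (Suc n))"
      by blast
  qed
  have "Phi u \<le> q * ((\<mu> - 1 / 2 * (W u g)\<^sup>2 + \<epsilon> * pairing Z (F u - F g)) / \<beta> + R g)"
    unfolding Phi_def
  proof (rule suminf_le_const[OF wl_summable[OF D_X0[OF u(1)]]])
    fix J0
    have "\<beta> * ((\<Sum>j<J0. wl p u j powr q) / q - R g) \<le> \<mu> - 1 / 2 * (W u g)\<^sup>2 + \<epsilon> * pairing Z (F u - F g)"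
      using part[of J0] by linarith
    then have "(\<Sum>j<J0. wl p u j powr q) / q - R g \<le> (\<mu> - 1 / 2 * (W u g)\<^sup>2 + \<epsilon> * pairing Z (F u - F g)) / \<beta>"
      using \<beta> by (simp add: pos_le_divide_eq mult.commute)
    then have "(\<Sum>j<J0. wl p u j powr q) / q \<le> (\<mu> - 1 / 2 * (W u g)\<^sup>2 + \<epsilon> * pairing Z (F u - F g)) / \<beta> + R g" by linarith
    then show "(\<Sum>j<J0. wl p u j powr q) \<le> q * ((\<mu> - 1 / 2 * (W u g)\<^sup>2 + \<epsilon> * pairing Z (F u - F g)) / \<beta> + R g)"
      using q by (simp add: pos_divide_le_eq mult.commute)
  qed
  then have "Phi u / q \<le> (\<mu> - 1 / 2 * (W u g)\<^sup>2 + \<epsilon> * pairing Z (F u - F g)) / \<beta> + R g"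
    using q by (simp add: pos_divide_le_eq mult.commute)
  then have "\<beta> * (R u - R g) \<le> \<mu> - 1 / 2 * (W u g)\<^sup>2 + \<epsilon> * pairing Z (F u - F g)"
  proof -
    assume "Phi u / q \<le> (\<mu> - 1 / 2 * (W u g)\<^sup>2 + \<epsilon> * pairing Z (F u - F g)) / \<beta> + R g"
    then have "R u - R g \<le> (\<mu> - 1 / 2 * (W u g)\<^sup>2 + \<epsilon> * pairing Z (F u - F g)) / \<beta>" unfolding R[OF u(1)] by linarith
    then show ?thesis using \<beta> by (simp add: pos_le_divide_eq mult.commute)
  qed
  then have "J u \<le> \<mu>" unfolding J_def by linarith
  then have "J u \<le> J f" if "f \<in> D" for f using \<mu>le[OF that] by linarith
  then show ?thesis
    unfolding is_arg_min_def using u(1) TJ by (intro exI[of _ u]) fastforce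
qed

end

section \<open>Convergence rates\<close>

context tikhonov_setting
begin

lemma noise_of_N:
  obtains c where "c > 0" "\<And>Z \<nu>. \<nu> \<ge> 0 \<Longrightarrow>
    N (- real CARD('d) / 2) (ennreal (p / (p - 1))) \<infinity> Z \<le> ennreal \<nu> \<Longrightarrow> noise Z (\<nu> / c)"
proof -
  let ?p' = "p / (p - 1)" and ?s = "- real CARD('d) / 2"
  have p': "?p' > 1" using conjugate_exponent[OF p(1)] by simp
  have p1: "1 \<le> ennreal ?p'" "(1::ennreal) \<le> \<infinity>" using p' by auto
  from N_equiv[OF p1, of ?s] obtain c where c: "c > 0"
    "\<And>u. ennreal c * besov_norm ?s (ennreal ?p') \<infinity> u \<le> N ?s (ennreal ?p') \<infinity> u"
    unfolding equivalent_on_def by auto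
  show thesis
  proof (rule that[OF c(1)])
    fix Z \<nu> assume \<nu>: "\<nu> \<ge> 0" and Z: "N ?s (ennreal ?p') \<infinity> Z \<le> ennreal \<nu>"
    show "noise Z (\<nu> / c)"
      unfolding noise_def
    proof (intro conjI allI)
      show "\<nu> / c \<ge> 0" using \<nu> c by simp
      fix j
      have "ennreal (2 powr (real j * ?s) * lpn ?p' (lp_block j Z)) \<le> besov_norm ?s (ennreal ?p') \<infinity> Z"
        unfolding besov_norm_real[OF less_trans[OF zero_less_one p']]
        by (rule Lp_norm_count_member[of \<infinity> j UNIV "\<lambda>j. ennreal (2 powr (real j * ?s) * lpn ?p' (lp_block j Z))"]) auto
      then have "ennreal c * ennreal (2 powr (real j * ?s) * lpn ?p' (lp_block j Z)) \<le> ennreal \<nu>"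
        using c(2)[of Z] Z by (meson mult_left_mono order_trans zero_le)
      then have "c * (2 powr (real j * ?s) * lpn ?p' (lp_block j Z)) \<le> \<nu>"
        using c(1) \<nu> by (simp add: ennreal_mult[symmetric] ennreal_le_iff)
      then have "2 powr (real j * ?s) * lpn ?p' (lp_block j Z) \<le> \<nu> / c"
        using c(1) by (simp add: pos_le_divide_eq mult.commute)
      then have "2 powr (- (real j * ?s)) * (2 powr (real j * ?s) * lpn ?p' (lp_block j Z)) \<le> 2 powr (- (real j * ?s)) * (\<nu> / c)"
        by (rule mult_left_mono) simp
      moreover have "2 powr (- (real j * ?s)) * (2 powr (real j * ?s) * lpn ?p' (lp_block j Z)) = lpn ?p' (lp_block j Z)"
        unfolding mult.assoc[symmetric] powr_add[symmetric] by simp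
      ultimately have "lpn ?p' (lp_block j Z) \<le> 2 powr (- (real j * ?s)) * (\<nu> / c)"
        by (simp only:)
      moreover have "- (real j * ?s) = - (real j * (- (real CARD('d) / 2)))" by simp
      ultimately show "lpn ?p' (lp_block j Z) \<le> \<nu> / c * 2 powr (- (real j * (- (real CARD('d) / 2))))"
        by (simp only: mult.commute)
    qed
  qed
qed

lemma smooth_wl:
  assumes s: "0 < s" "s < a / (q - 1)"
  obtains C where "C > 0" "\<And>f \<rho> j. \<rho> \<ge> 0 \<Longrightarrow> f \<in> X0 \<Longrightarrow> N s (ennreal p) \<infinity> f \<le> ennreal \<rho> \<Longrightarrow>
    wl p f j \<le> 2 powr (- (real j * s)) * (C * \<rho>)"
proof -
  \<comment> \<open>As \<open>q - 1\<close> is at least one, s < a < m, so the wavelet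
    characterization covers smoothness \<open>s\<close>.\<close>
  have "a / (q - 1) \<le> a / 1" using q a_pos by (intro divide_left_mono) auto
  then have sm: "\<bar>s\<bar> < real m" "1 \<le> p" using s a(3) p by auto
  from wl_le_besov[OF sm] obtain C where C: "C > 0" "\<And>u A j. u \<in> low_order m \<Longrightarrow> (\<And>i. 2 powr (real i * s) * lpn p (lp_block i u) \<le> A)
    \<Longrightarrow> 2 powr (real j * s) * wl p u j \<le> C * A" by blast
  have i1: "(1::ennreal) \<le> \<infinity>" by simp
  from N_equiv[OF pq1(1) i1, of s] obtain c where c: "c > 0"
    "\<And>u. ennreal c * besov_norm s (ennreal p) \<infinity> u \<le> N s (ennreal p) \<infinity> u"
    unfolding equivalent_on_def by auto
  show thesis
  proof (rule that[of "C / c"])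
    show "C / c > 0" using C(1) c(1) by simp
    fix f \<rho> j assume \<rho>: "\<rho> \<ge> 0" and f: "f \<in> X0" and Nf: "N s (ennreal p) \<infinity> f \<le> ennreal \<rho>"
    have "2 powr (real i * s) * lpn p (lp_block i f) \<le> \<rho> / c" for i
    proof -
      have "ennreal (2 powr (real i * s) * lpn p (lp_block i f)) \<le> besov_norm s (ennreal p) \<infinity> f"
        unfolding besov_norm_real[OF less_trans[OF zero_less_one p(1)]]
        by (rule Lp_norm_count_member[of \<infinity> i UNIV "\<lambda>i. ennreal (2 powr (real i * s) * lpn p (lp_block i f))"]) auto
      then have "ennreal c * ennreal (2 powr (real i * s) * lpn p (lp_block i f)) \<le> ennreal \<rho>"
        using c(2)[of f] Nf by (meson mult_left_mono order_trans zero_le)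
      then have "c * (2 powr (real i * s) * lpn p (lp_block i f)) \<le> \<rho>"
        using c(1) \<rho> by (simp add: ennreal_mult[symmetric] ennreal_le_iff)
      then show ?thesis using c(1) by (simp add: pos_le_divide_eq mult.commute)
    qed
    then have "2 powr (real j * s) * wl p f j \<le> C * (\<rho> / c)" by (rule C(2)[OF X0_low[OF f]])
    then have "2 powr (- (real j * s)) * (2 powr (real j * s) * wl p f j) \<le> 2 powr (- (real j * s)) * (C * (\<rho> / c))"
      by (rule mult_left_mono) simp
    moreover have "2 powr (- (real j * s)) * (2 powr (real j * s) * wl p f j) = wl p f j"
      unfolding mult.assoc[symmetric] powr_add[symmetric] by simp
    ultimately show "wl p f j \<le> 2 powr (- (real j * s)) * (C / c * \<rho>)" by simp
  qed
qed

definition alpha0 :: "real \<Rightarrow> real \<Rightarrow> real \<Rightarrow> real" where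
  "alpha0 s \<rho> \<epsilon> = \<rho> powr (- (q * a + real CARD('d) * q / 2 * (1 - 2 / q)) / (a + s + real CARD('d) / 2))
      * \<epsilon> powr ((2 * (a + s) - q * s) / (a + s + real CARD('d) / 2))"

definition rate :: "real \<Rightarrow> real \<Rightarrow> real \<Rightarrow> real" where
  "rate s \<rho> \<epsilon> = \<rho> powr ((a + real CARD('d) / 2) / (a + s + real CARD('d) / 2)) * \<epsilon> powr (s / (a + s + real CARD('d) / 2))"

text \<open>The exponent that relates noise and error when the noise term dominates, after the
  residual has been eliminated. With \<delta> = d / (2 a) it is the factor that multiplies \<mu> in
  the probability bound.\<close>

definition expo :: real where
  "expo = q / 2 + (q - 2) * \<delta> / 2"

theorem deterministic_rate:
  assumes s: "0 < s" "s < a / (q - 1)"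
  obtains \<kappa> c where "\<kappa> > 0" "c > 0"
    "\<And>R fdag fh Z \<nu> \<epsilon> \<rho>. (\<And>f. f \<in> D \<Longrightarrow> R f = Phi f / q) \<Longrightarrow> fdag \<in> D \<Longrightarrow> N s (ennreal p) \<infinity> fdag \<le> ennreal \<rho> \<Longrightarrow>
       \<epsilon> > 0 \<Longrightarrow> \<rho> > 0 \<Longrightarrow> \<nu> \<ge> 0 \<Longrightarrow> N (- real CARD('d) / 2) (ennreal (p / (p - 1))) \<infinity> Z \<le> ennreal \<nu> \<Longrightarrow>
       is_arg_min (tikhonov R F (F fdag + \<epsilon> *\<^sub>R Z) (\<kappa> * alpha0 s \<rho> \<epsilon>)) (\<lambda>f. f \<in> D) fh \<Longrightarrow>
       nrm (fh - fdag) \<le> max c (\<nu> powr (1 / expo)) * rate s \<rho> \<epsilon>"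
proof -
  let ?d = "real CARD('d)"
  define \<theta> where "\<theta> = s * (q - 1) / a"
  have \<theta>: "0 < \<theta>" "\<theta> < 1"
    using s q a_pos by (auto simp: \<theta>_def pos_less_divide_eq)
  from noise_of_N obtain c4 where c4: "c4 > 0" "\<And>Z \<nu>. \<nu> \<ge> 0 \<Longrightarrow>
    N (- ?d / 2) (ennreal (p / (p - 1))) \<infinity> Z \<le> ennreal \<nu> \<Longrightarrow> noise Z (\<nu> / c4)" by blast
  from smooth_wl[OF s] obtain C3 where C3: "C3 > 0" "\<And>f \<rho> j. \<rho> \<ge> 0 \<Longrightarrow> f \<in> X0 \<Longrightarrow> N s (ennreal p) \<infinity> f \<le> ennreal \<rho> \<Longrightarrow>
    wl p f j \<le> 2 powr (- (real j * s)) * (C3 * \<rho>)" by blast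
  from wl_le_W obtain C2 where C2: "C2 > 0" "\<And>f g j. f \<in> D \<Longrightarrow> g \<in> D \<Longrightarrow> wl p (f - g) j \<le> 2 powr (real j * a) * (C2 * W f g)" by blast
  obtain C1 where C1: "C1 > 0" "\<And>u. u \<in> X0 \<Longrightarrow> nrm u \<le> C1 * Phi u powr (1 / q)"
      by (rule nrm_equiv) (rule that; assumption)
  from pairing_interpolation obtain K where K: "K > 0" "\<And>Z \<zeta> f g. noise Z \<zeta> \<Longrightarrow> f \<in> D \<Longrightarrow> g \<in> D \<Longrightarrow>
    \<bar>pairing Z (F f - F g)\<bar> \<le> K * \<zeta> * (W f g powr (1 - \<delta>) * nrm (f - g) powr \<delta>)" by blast
  from source_condition[OF s] obtain Ks where Ks: "Ks > 0"
    "\<And>f g \<rho>' Y. f \<in> X0 \<Longrightarrow> g \<in> X0 \<Longrightarrow> \<rho>' \<ge> 0 \<Longrightarrow> Y \<ge> 0 \<Longrightarrow> (\<And>j. wl p g j \<le> 2 powr (- (real j * s)) * \<rho>') \<Longrightarrow>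
       (\<And>j. wl p (f - g) j \<le> 2 powr (real j * a) * Y) \<Longrightarrow>
       kap * Phi (f - g) - Ks * \<rho>' powr (q - 1) * (Y powr (s * (q - 1) / a) * (Phi (f - g) powr (1 / q)) powr (1 - s * (q - 1) / a))
         \<le> Phi f / q - Phi g / q" by blast
  \<comment> \<open>What is left of the constants once error and residual are written as
    \<open>x\<close> and \<open>y\<close> times their scales.\<close>
  define k1 where "k1 = kap / C1 powr q"
  define K2 where "K2 = Ks * C3 powr (q - 1) * C2 powr \<theta> / C1 powr (1 - \<theta>)"
  define K3 where "K3 = K / c4"
  have k: "k1 > 0" "K2 > 0" "K3 > 0"
    using kap_pos C1(1) C2(1) C3(1) Ks(1) K(1) c4(1) by (simp_all add: k1_def K2_def K3_def)
  from scaled_rate[OF q \<theta> delta k] obtain \<kappa> c where \<kappa>: "\<kappa> > 0" "c > 0"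
    "\<And>x y \<zeta>. x \<ge> 0 \<Longrightarrow> y \<ge> 0 \<Longrightarrow> \<zeta> \<ge> 0 \<Longrightarrow>
       1 / 2 * y\<^sup>2 + \<kappa> * k1 * x powr q \<le> \<kappa> * K2 * (x powr (1 - \<theta>) * y powr \<theta>) + K3 * \<zeta> * (y powr (1 - \<delta>) * x powr \<delta>) \<Longrightarrow>
       x \<le> max c (\<zeta> powr (1 / expo))" unfolding expo_def by blast
  show thesis
  proof (rule that[OF \<kappa>(1,2)])
    fix R fdag fh Z \<nu> \<epsilon> \<rho>
    assume R: "\<And>f. f \<in> D \<Longrightarrow> R f = Phi f / q" and g: "fdag \<in> D" and gN: "N s (ennreal p) \<infinity> fdag \<le> ennreal \<rho>"
      and \<epsilon>: "\<epsilon> > 0" and \<rho>: "\<rho> > 0" and \<nu>: "\<nu> \<ge> 0" and Z: "N (- ?d / 2) (ennreal (p / (p - 1))) \<infinity> Z \<le> ennreal \<nu>"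
      and arg: "is_arg_min (tikhonov R F (F fdag + \<epsilon> *\<^sub>R Z) (\<kappa> * alpha0 s \<rho> \<epsilon>)) (\<lambda>f. f \<in> D) fh"
    have f: "fh \<in> D" using arg by (simp add: is_arg_min_def)
    note nz = c4(2)[OF \<nu> Z]
    let ?al = "alpha0 s \<rho> \<epsilon>" and ?r = "rate s \<rho> \<epsilon>"
    let ?alpha = "\<kappa> * ?al"
    define \<omega> where "\<omega> = \<rho> powr (?d / 2 / (a + s + ?d / 2)) * \<epsilon> powr ((a + s) / (a + s + ?d / 2))"
    have pos: "?r > 0" "\<omega> > 0" "?al > 0" using \<rho> \<epsilon> by (simp_all add: rate_def \<omega>_def alpha0_def)
    have q1: "q > 1" and d0: "?d > 0" using q by auto
    note sc = rate_scaling[OF a_pos d0 s(1) q1 \<epsilon> \<rho>, folded rate_def alpha0_def \<omega>_def \<theta>_def \<delta>_def]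
    let ?h = "fh - fdag"
    let ?P = "Phi ?h powr (1 / q)" and ?W = "W fh fdag"
    have hX: "?h \<in> X0" by (intro X0_diff D_X0 f g)
    \<comment> \<open>Normalised through \<open>Phi\<close> with the factor \<open>C1\<close>: then
      \<open>Phi ?h\<close> is an exact power of \<open>x * ?r / C1\<close>, and still
      \<open>nrm ?h \<le> x * ?r\<close>.\<close>
    define x where "x = C1 * ?P / ?r"
    define y where "y = ?W / \<omega>"
    have xy: "x \<ge> 0" "y \<ge> 0" using C1(1) pos by (simp_all add: x_def y_def)
    have Px: "?P = x * ?r / C1" using C1(1) pos by (simp add: x_def)
    have Wy: "?W = y * \<omega>" using pos by (simp add: y_def)
    have nx: "nrm ?h \<le> x * ?r" using C1(2)[OF hX] pos by (simp add: x_def)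
    have "Phi ?h = ?P powr q" using q Phi_nonneg[OF hX] by (simp add: powr_powr)
    then have PhiE: "Phi ?h = (x * ?r / C1) powr q" using Px by metis
    have J: "1 / 2 * ?W\<^sup>2 - \<epsilon> * pairing Z (F fh - F fdag) + ?alpha * (R fh - R fdag) \<le> 0"
    proof -
      have "tikhonov R F (F fdag + \<epsilon> *\<^sub>R Z) ?alpha fh \<le> tikhonov R F (F fdag + \<epsilon> *\<^sub>R Z) ?alpha fdag"
        using arg g by (force simp: is_arg_min_def)
      then show ?thesis using tikhonov_diff[OF nz f g, of R \<epsilon> ?alpha] by simp
    qed
    have p1: "\<epsilon> * pairing Z (F fh - F fdag) \<le> \<omega>\<^sup>2 * (K3 * \<nu> * (y powr (1 - \<delta>) * x powr \<delta>))"
    proof -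
      have "\<epsilon> * pairing Z (F fh - F fdag) \<le> \<epsilon> * (K * (\<nu> / c4) * (?W powr (1 - \<delta>) * nrm ?h powr \<delta>))"
        using K(2)[OF nz f g] \<epsilon> by (intro mult_left_mono) auto
      also have "\<dots> \<le> \<epsilon> * (K * (\<nu> / c4) * (?W powr (1 - \<delta>) * (x * ?r) powr \<delta>))"
        using \<epsilon> K(1) \<nu> c4(1) nx delta by (intro mult_left_mono powr_mono2) auto
      also have "\<dots> = (\<epsilon> * (\<omega> powr (1 - \<delta>) * ?r powr \<delta>)) * (K3 * \<nu> * (y powr (1 - \<delta>) * x powr \<delta>))"
        using xy pos by (simp add: Wy powr_mult K3_def)
      finally show ?thesis unfolding sc(3) .
    qed
    have p2: "\<omega>\<^sup>2 * (k1 * x powr q) - \<omega>\<^sup>2 * (K2 * (x powr (1 - \<theta>) * y powr \<theta>)) \<le> ?al * (R fh - R fdag)"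
    proof -
      have Y: "C2 * ?W \<ge> 0" "C3 * \<rho> \<ge> 0" using C2(1) C3(1) \<rho> by auto
      have "kap * Phi ?h - Ks * (C3 * \<rho>) powr (q - 1) * ((C2 * ?W) powr \<theta> * ?P powr (1 - \<theta>)) \<le> Phi fh / q - Phi fdag / q"
        using Ks(2)[OF D_X0[OF f] D_X0[OF g] Y(2,1) C3(2)[OF less_imp_le[OF \<rho>] D_X0[OF g] gN] C2(2)[OF f g]] unfolding \<theta>_def .
      then have "?al * (kap * Phi ?h - Ks * (C3 * \<rho>) powr (q - 1) * ((C2 * ?W) powr \<theta> * ?P powr (1 - \<theta>))) \<le> ?al * (R fh - R fdag)"
        using pos(3) by (simp add: R f g)
      moreover have "?al * (kap * Phi ?h) = \<omega>\<^sup>2 * (k1 * x powr q)"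
      proof -
        have "?al * (kap * Phi ?h) = (?al * ?r powr q) * (k1 * x powr q)"
          unfolding PhiE using xy pos C1(1) by (simp add: powr_mult powr_divide k1_def)
        then show ?thesis unfolding sc(1) .
      qed
      moreover have "?al * (Ks * (C3 * \<rho>) powr (q - 1) * ((C2 * ?W) powr \<theta> * ?P powr (1 - \<theta>))) = \<omega>\<^sup>2 * (K2 * (x powr (1 - \<theta>) * y powr \<theta>))"
      proof -
        have "?al * (Ks * (C3 * \<rho>) powr (q - 1) * ((C2 * ?W) powr \<theta> * ?P powr (1 - \<theta>))) =
           (?al * \<rho> powr (q - 1) * (?r powr (1 - \<theta>) * \<omega> powr \<theta>)) * (K2 * (x powr (1 - \<theta>) * y powr \<theta>))"
          unfolding Px Wy using xy pos C1(1) C2(1) C3(1) \<rho> by (simp add: powr_mult powr_divide K2_def)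
        then show ?thesis unfolding sc(2) .
      qed
      ultimately show ?thesis by (simp add: right_diff_distrib)
    qed
    have "\<omega>\<^sup>2 * (1 / 2 * y\<^sup>2 + \<kappa> * k1 * x powr q) \<le> \<omega>\<^sup>2 * (\<kappa> * K2 * (x powr (1 - \<theta>) * y powr \<theta>) + K3 * \<nu> * (y powr (1 - \<delta>) * x powr \<delta>))"
    proof -
      have "1 / 2 * ?W\<^sup>2 = \<omega>\<^sup>2 * (1 / 2 * y\<^sup>2)" by (simp add: Wy power_mult_distrib)
      moreover have "\<kappa> * (\<omega>\<^sup>2 * (k1 * x powr q) - \<omega>\<^sup>2 * (K2 * (x powr (1 - \<theta>) * y powr \<theta>))) \<le> \<kappa> * (?al * (R fh - R fdag))"
        using p2 \<kappa>(1) by (intro mult_left_mono) auto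
      ultimately show ?thesis using J p1 by (simp add: algebra_simps)
    qed
    then have "1 / 2 * y\<^sup>2 + \<kappa> * k1 * x powr q \<le> \<kappa> * K2 * (x powr (1 - \<theta>) * y powr \<theta>) + K3 * \<nu> * (y powr (1 - \<delta>) * x powr \<delta>)"
      using pos(2) by (simp add: mult_le_cancel_left_pos)
    then have "x \<le> max c (\<nu> powr (1 / expo))" by (rule \<kappa>(3)[OF xy \<nu>])
    then have "x * ?r \<le> max c (\<nu> powr (1 / expo)) * ?r" using pos(1) by (intro mult_right_mono) auto
    then show "nrm ?h \<le> max c (\<nu> powr (1 / expo)) * ?r" using nx by linarith
  qed
qed

end

section \<open>From tail bounds to moments\<close>

lemma exp_ge_power: "x \<ge> 0 \<Longrightarrow> x ^ k / fact k \<le> exp x" for x :: real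
proof -
  assume x: "x \<ge> 0"
  have "x ^ k /\<^sub>R fact k \<le> (\<Sum>n. x ^ n /\<^sub>R fact n)"
    using sum_le_suminf[OF summable_exp_generic[of x], of "{k}"] x by simp
  then have "inverse (fact k) * x ^ k \<le> exp x" unfolding exp_def by simp
  then show ?thesis by (simp only: divide_inverse mult.commute)
qed

text \<open>A single term of the exponential series beats the polynomial factor: \<open>k\<close> is
  chosen with \<nu> k at least \<sigma> + 2, which leaves a multiple of 1/n^2.\<close>

lemma summable_stretched_exp:
  fixes c \<sigma> C \<nu> :: real
  assumes "c \<ge> 0" "\<sigma> \<ge> 0" "C > 0" "\<nu> > 0"
  shows "summable (\<lambda>n. (c + real n + 1) powr \<sigma> * exp (- C * real n powr \<nu>))"
proof (rule summable_comparison_test_ev)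
  define k where "k = nat \<lceil>(\<sigma> + 2) / \<nu>\<rceil>"
  have "(\<sigma> + 2) / \<nu> \<le> real k" unfolding k_def by linarith
  then have k: "\<sigma> + 2 \<le> \<nu> * real k" using assms by (simp add: pos_divide_le_eq mult.commute)
  let ?K = "(c + 2) powr \<sigma> * fact k / C ^ k"
  show "summable (\<lambda>n. ?K * (1 / real n ^ 2))"
    using inverse_power_summable[of 2, where ?'a = real] by (intro summable_mult) (simp add: field_simps)
  show "\<forall>\<^sub>F n in sequentially. norm ((c + real n + 1) powr \<sigma> * exp (- C * real n powr \<nu>)) \<le> ?K * (1 / real n ^ 2)"
  proof (rule eventually_sequentiallyI[of 1])
    fix n :: nat assume n: "n \<ge> 1"
    have x: "C * real n powr \<nu> > 0" using assms n by simp
    have "c * 1 \<le> c * real n" using assms n by (intro mult_left_mono) auto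
    then have "c + real n + 1 \<le> (c + 2) * real n" using n by (simp add: algebra_simps)
    then have "(c + real n + 1) powr \<sigma> \<le> ((c + 2) * real n) powr \<sigma>" using assms by (intro powr_mono2) auto
    also have "\<dots> = (c + 2) powr \<sigma> * real n powr \<sigma>" using assms by (simp add: powr_mult)
    finally have 1: "(c + real n + 1) powr \<sigma> \<le> (c + 2) powr \<sigma> * real n powr \<sigma>" .
    have "(C * real n powr \<nu>) ^ k / fact k \<le> exp (C * real n powr \<nu>)"
      using x by (intro exp_ge_power) simp
    then have "exp (- (C * real n powr \<nu>)) \<le> fact k / (C * real n powr \<nu>) ^ k"
    proof -
      assume le: "(C * real n powr \<nu>) ^ k / fact k \<le> exp (C * real n powr \<nu>)"
      have "1 / exp (C * real n powr \<nu>) \<le> 1 / ((C * real n powr \<nu>) ^ k / fact k)"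
        using x by (intro divide_left_mono le mult_pos_pos divide_pos_pos zero_less_power x) auto
      then show ?thesis by (simp add: exp_minus inverse_eq_divide)
    qed
    also have "(C * real n powr \<nu>) ^ k = C ^ k * real n powr (\<nu> * real k)"
      using n by (simp add: power_mult_distrib powr_realpow[symmetric] powr_powr)
    also have "fact k / (C ^ k * real n powr (\<nu> * real k)) \<le> fact k / (C ^ k * real n powr (\<sigma> + 2))"
      using k n assms by (intro divide_left_mono mult_left_mono powr_mono mult_pos_pos zero_less_power) auto
    finally have 2: "exp (- (C * real n powr \<nu>)) \<le> fact k / (C ^ k * real n powr (\<sigma> + 2))" .
    have "(c + real n + 1) powr \<sigma> * exp (- (C * real n powr \<nu>)) \<le> ((c + 2) powr \<sigma> * real n powr \<sigma>) * (fact k / (C ^ k * real n powr (\<sigma> + 2)))"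
      by (intro mult_mono 1 2) auto
    also have "\<dots> = ?K * (1 / real n ^ 2)"
      using n by (simp add: powr_add field_simps)
    finally show "norm ((c + real n + 1) powr \<sigma> * exp (- C * real n powr \<nu>)) \<le> ?K * (1 / real n ^ 2)"
      by simp
  qed
qed

text \<open>Slice by the least \<open>n\<close> with V at most (c + n + 1) r. There the power of V
  is at most \<open>b n\<close>, and the slice lies in the tail event \<open>A n\<close>.\<close>

lemma moment_of_tail:
  fixes V :: "'w \<Rightarrow> ennreal" and c r C \<nu> \<sigma> :: real
  assumes M: "prob_space M" and V: "V \<in> borel_measurable M" and fin: "AE \<omega> in M. V \<omega> < \<infinity>"
    and pos: "c > 0" "r > 0" "C > 0" "\<nu> > 0" "\<sigma> > 0"
    and tail: "\<And>t. t > 0 \<Longrightarrow> \<P>(\<omega> in M. V \<omega> > ennreal ((c + t) * r)) \<le> exp (- C * t powr \<nu>)"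
  shows "enn_powr (\<integral>\<^sup>+ \<omega>. enn_powr (V \<omega>) \<sigma> \<partial>M) (1 / \<sigma>)
     \<le> ennreal ((\<Sum>n. (c + real n + 1) powr \<sigma> * exp (- C * real n powr \<nu>)) powr (1 / \<sigma>) * r)"
proof -
  interpret prob_space M by (rule M)
  \<comment> \<open>The tail bound holds for positive \<open>t\<close> only. Level 0 takes the whole
    space, whose probability equals the bound there because \<open>0 powr \<nu> = 0\<close>.\<close>
  define A where "A n = (if n = 0 then space M else {\<omega> \<in> space M. V \<omega> > ennreal ((c + real n) * r)})" for n :: nat
  have Am: "A n \<in> sets M" for n unfolding A_def using V by auto
  define w where "w n = (c + real n + 1) powr \<sigma> * exp (- C * real n powr \<nu>)" for n :: nat
  have sw: "summable w" unfolding w_def using pos by (intro summable_stretched_exp) auto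
  have w0: "w n \<ge> 0" for n by (simp add: w_def)
  define b where "b n = ((c + real n + 1) * r) powr \<sigma>" for n :: nat
  have pr: "measure M (A n) \<le> exp (- C * real n powr \<nu>)" for n
    using tail[of "real n"] pos by (cases "n = 0") (simp_all add: A_def prob_space)
  have pt: "enn_powr (V \<omega>) \<sigma> \<le> (\<Sum>n. ennreal (b n) * indicator (A n) \<omega>)" if V': "V \<omega> < \<infinity>" and \<omega>: "\<omega> \<in> space M" for \<omega>
  proof -
    obtain v where v: "V \<omega> = ennreal v" "v \<ge> 0" using V' by (cases "V \<omega>") auto
    have ex: "\<exists>n::nat. v \<le> (c + real n + 1) * r"
    proof -
      obtain n :: nat where "v / r \<le> real n" using real_arch_simple by blast
      then have "v \<le> real n * r" using pos by (simp add: pos_divide_le_eq)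
      also have "\<dots> \<le> (c + real n + 1) * r" using pos by (intro mult_right_mono) auto
      finally show ?thesis by blast
    qed
    define n where "n = (LEAST n::nat. v \<le> (c + real n + 1) * r)"
    have n: "v \<le> (c + real n + 1) * r" unfolding n_def by (rule LeastI_ex[OF ex])
    have "\<omega> \<in> A n"
    proof (cases "n = 0")
      case False
      then have "n - 1 < n" by simp
      then have "\<not> v \<le> (c + real (n - 1) + 1) * r" unfolding n_def by (rule not_less_Least)
      moreover have "c + real (n - 1) + 1 = c + real n" using False by simp
      ultimately have "(c + real n) * r < v" by simp
      then show ?thesis using False \<omega> pos by (simp add: A_def v ennreal_less_iff)
    qed (use \<omega> in \<open>simp add: A_def\<close>)
    have "enn_powr (V \<omega>) \<sigma> = ennreal (v powr \<sigma>)" using v by simp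
    also have "\<dots> \<le> ennreal (b n)" unfolding b_def using n v pos by (intro ennreal_leI powr_mono2) auto
    also have "\<dots> = ennreal (b n) * indicator (A n) \<omega>" using \<open>\<omega> \<in> A n\<close> by simp
    also have "\<dots> \<le> (\<Sum>n. ennreal (b n) * indicator (A n) \<omega>)"
    proof -
      have "h n \<le> suminf h" for h :: "nat \<Rightarrow> ennreal" using sum_le_suminf[of h "{n}"] by simp
      then show ?thesis .
    qed
    finally show ?thesis .
  qed
  have "AE \<omega> in M. enn_powr (V \<omega>) \<sigma> \<le> (\<Sum>n. ennreal (b n) * indicator (A n) \<omega>)"
    using fin AE_space by eventually_elim (rule pt)
  then have "(\<integral>\<^sup>+ \<omega>. enn_powr (V \<omega>) \<sigma> \<partial>M) \<le> (\<integral>\<^sup>+ \<omega>. (\<Sum>n. ennreal (b n) * indicator (A n) \<omega>) \<partial>M)"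
    by (rule nn_integral_mono_AE)
  also have "\<dots> = (\<Sum>n. \<integral>\<^sup>+ \<omega>. ennreal (b n) * indicator (A n) \<omega> \<partial>M)"
    using Am by (intro nn_integral_suminf) auto
  also have "\<dots> = (\<Sum>n. ennreal (b n) * emeasure M (A n))"
    using Am by (simp add: nn_integral_cmult_indicator)
  also have "\<dots> \<le> (\<Sum>n. ennreal (r powr \<sigma> * w n))"
  proof (intro suminf_le allI)
    fix n
    have "ennreal (b n) * emeasure M (A n) \<le> ennreal (b n) * ennreal (exp (- C * real n powr \<nu>))"
      using pr[of n] by (intro mult_left_mono) (simp_all add: emeasure_eq_measure)
    also have "\<dots> = ennreal (r powr \<sigma> * w n)"
      using pos by (simp add: ennreal_mult[symmetric] b_def w_def powr_mult mult_ac)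
    finally show "ennreal (b n) * emeasure M (A n) \<le> ennreal (r powr \<sigma> * w n)" .
  qed auto
  also have "\<dots> = ennreal (r powr \<sigma> * suminf w)"
    using sw w0 by (subst suminf_ennreal2) (auto simp: suminf_mult)
  finally have "enn_powr (\<integral>\<^sup>+ \<omega>. enn_powr (V \<omega>) \<sigma> \<partial>M) (1 / \<sigma>) \<le> enn_powr (ennreal (r powr \<sigma> * suminf w)) (1 / \<sigma>)"
    using pos by (intro enn_powr_mono) auto
  also have "\<dots> = ennreal (suminf w powr (1 / \<sigma>) * r)"
    using pos suminf_nonneg[OF sw w0] by (simp add: powr_mult powr_powr mult.commute)
  finally show ?thesis unfolding w_def .
qed

section \<open>Main theorem\<close>

theorem theorem4p11:
  fixes p q a r s L d p' :: real
    and m :: nat and I :: "nat \<Rightarrow> 'i set" and \<phi> :: "nat \<Rightarrow> 'i \<Rightarrow> real ^ 'd \<Rightarrow> real"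
    and N :: "real \<Rightarrow> ennreal \<Rightarrow> ennreal \<Rightarrow> ('d::finite) distr \<Rightarrow> ennreal"
    and D :: "'d distr set" and F :: "'d distr \<Rightarrow> 'd distr" and R :: "'d distr \<Rightarrow> real"
    and M :: "'w measure" and Z :: "'w \<Rightarrow> 'd distr" and C\<^sub>Z M\<^sub>Z \<mu> :: "real \<Rightarrow> real"
  defines "d \<equiv> real CARD('d)"
    and "p' \<equiv> p / (p - 1)"
    and "r \<equiv> Max {2, p, q}"
    and "R \<equiv> (\<lambda>f. 1 / r * enn2real (wavelet_norm I \<phi> 0 (ennreal p) (ennreal q) f) powr r)"
  assumes p: "1 < p" "p \<le> 2" and q: "2 \<le> q" and a: "a > d / 2" "a > d / p - d / 2"
    and norms: "besov_norm_family N"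
    and wavelets: "besov_wavelets m I \<phi> TYPE('d)" "real m > a"
    and D: "D \<noteq> {}" "convex D"
      "norm_closed_in (besov 0 (ennreal p) (ennreal q)) (N 0 (ennreal p) (ennreal q)) D"
    and F: "\<And>f. f \<in> D \<Longrightarrow> F f \<in> besov a (ennreal p) (ennreal q)"
      "\<And>f. f \<in> D \<Longrightarrow> L2_norm (F f) < \<infinity>"
    and L: "L > 0"
    and F_Lipschitz: "\<And>f1 f2. f1 \<in> D \<Longrightarrow> f2 \<in> D \<Longrightarrow>
      N a (ennreal p) (ennreal q) (F f1 - F f2) \<le> ennreal L * N 0 (ennreal p) (ennreal q) (f1 - f2)"
    and F_two_sided: "\<And>f1 f2. f1 \<in> D \<Longrightarrow> f2 \<in> D \<Longrightarrow>
      ennreal (1 / L) * N (- a) 2 2 (f1 - f2) \<le> L2_norm (F f1 - F f2) \<and>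
      L2_norm (F f1 - F f2) \<le> ennreal L * N (- a) 2 2 (f1 - f2)"
    and M: "prob_space M"
    and Z: "deviation_inequality N M Z C\<^sub>Z M\<^sub>Z \<mu>"
    and s: "0 < s" "s < a / (q - 1)"
  shows "\<exists>\<kappa>\<^sub>0>0. \<exists>c>0. \<exists>C::real \<Rightarrow> real. (\<forall>\<sigma>\<ge>1. C \<sigma> > 0) \<and>
    (\<forall>fdag \<epsilon> \<rho>. fdag \<in> D \<inter> besov s (ennreal p) \<infinity> \<and> N s (ennreal p) \<infinity> fdag \<le> ennreal \<rho> \<and> \<epsilon> > 0 \<and> \<rho> > 0 \<longrightarrow>
      (let minimizer = (\<lambda>\<alpha> \<omega>. is_arg_min (tikhonov R F (F fdag + \<epsilon> *\<^sub>R Z \<omega>) \<alpha>) (\<lambda>f. f \<in> D));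
           \<alpha> = \<kappa>\<^sub>0 * \<rho> powr (- (q * a + d * q / 2 * (1 - 2 / q)) / (a + s + d / 2))
                  * \<epsilon> powr ((2 * (a + s) - q * s) / (a + s + d / 2));
           rate = \<rho> powr ((a + d / 2) / (a + s + d / 2)) * \<epsilon> powr (s / (a + s + d / 2))
       in (\<forall>\<beta>>0. AE \<omega> in M. \<exists>f. minimizer \<beta> \<omega> f) \<and>
          (\<forall>fhat :: 'w \<Rightarrow> 'd distr.
             (AE \<omega> in M. minimizer \<alpha> \<omega> (fhat \<omega>)) \<and>
             (\<lambda>\<omega>. N 0 (ennreal p) (ennreal q) (fhat \<omega> - fdag)) \<in> borel_measurable M \<longrightarrow>
             (\<forall>t>0. \<P>(\<omega> in M. N 0 (ennreal p) (ennreal q) (fhat \<omega> - fdag) > ennreal ((c + t) * rate))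
                \<le> exp (- C\<^sub>Z p' * t powr (\<mu> p' * (q / 2 + (q - 2) * d / (4 * a))))) \<and>
             (\<forall>\<sigma>\<ge>1. enn_powr (\<integral>\<^sup>+ \<omega>. enn_powr (N 0 (ennreal p) (ennreal q) (fhat \<omega> - fdag)) \<sigma> \<partial>M) (1 / \<sigma>)
                \<le> ennreal (C \<sigma> * rate)))))"
proof -
  interpret P: prob_space M by (rule M)
  have a': "a > real CARD('d) / 2" "a > real CARD('d) / p - real CARD('d) / 2" "a < real m"
    using a wavelets(2) by (simp_all add: d_def)
  interpret T: tikhonov_setting m I \<phi> N p q a D F L
    using p q a' norms wavelets(1) D F L F_Lipschitz F_two_sided by unfold_locales auto
  have r: "r = q" using p q by (auto simp: r_def)
  have R: "R f = T.Phi f / q" if "f \<in> D" for f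
    using T.wavelet_R_eq[OF T.D_X0[OF that]] by (simp add: R_def r)
  have p'1: "p' > 1" using conjugate_exponent[OF p(1)] by (simp add: p'_def)
  let ?e = "q / 2 + (q - 2) * d / (4 * a)"
  have e: "T.expo = ?e" by (simp add: T.expo_def T.\<delta>_def d_def)
  have "(q - 2) * d / (4 * a) \<ge> 0" using q T.a_pos by (simp add: d_def)
  then have e1: "?e \<ge> 1" using q by simp
  let ?NZ = "\<lambda>\<omega>. N (- d / 2) (ennreal p') \<infinity> (Z \<omega>)"
  have Z': "?NZ \<in> borel_measurable M" "AE \<omega> in M. Z \<omega> \<in> besov (- d / 2) (ennreal p') \<infinity>"
    "C\<^sub>Z p' > 0" "M\<^sub>Z p' > 0" "\<mu> p' > 0"
    "\<And>t. t > 0 \<Longrightarrow> \<P>(\<omega> in M. ?NZ \<omega> > ennreal (M\<^sub>Z p' + t)) \<le> exp (- C\<^sub>Z p' * t powr \<mu> p')"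
    using Z p'1 unfolding deviation_inequality_def d_def by auto
  show ?thesis
  proof (rule T.deterministic_rate[OF s])
    fix \<kappa> c0 assume \<kappa>: "\<kappa> > 0" "c0 > 0"
      "\<And>R fdag fh Z \<nu> \<epsilon> \<rho>. (\<And>f. f \<in> D \<Longrightarrow> R f = T.Phi f / q) \<Longrightarrow> fdag \<in> D \<Longrightarrow> N s (ennreal p) \<infinity> fdag \<le> ennreal \<rho> \<Longrightarrow>
         \<epsilon> > 0 \<Longrightarrow> \<rho> > 0 \<Longrightarrow> \<nu> \<ge> 0 \<Longrightarrow> N (- real CARD('d) / 2) (ennreal (p / (p - 1))) \<infinity> Z \<le> ennreal \<nu> \<Longrightarrow>
         is_arg_min (tikhonov R F (F fdag + \<epsilon> *\<^sub>R Z) (\<kappa> * T.alpha0 s \<rho> \<epsilon>)) (\<lambda>f. f \<in> D) fh \<Longrightarrow>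
         T.nrm (fh - fdag) \<le> max c0 (\<nu> powr (1 / T.expo)) * T.rate s \<rho> \<epsilon>"
    \<comment> \<open>\<open>c0\<close> covers the part of the bound without noise, and the root of
      \<open>M\<^sub>Z p'\<close> the typical noise; subadditivity of the root then separates the
      deviation \<open>t\<close>.\<close>
    define c where "c = c0 + M\<^sub>Z p' powr (1 / ?e)"
    have c: "c > 0" using \<kappa>(2) by (simp add: c_def add_pos_nonneg)
    let ?\<nu> = "\<mu> p' * ?e"
    have \<nu>: "?\<nu> > 0" using Z'(5) e1 by (intro mult_pos_pos) auto
    \<comment> \<open>The moment constant is the series produced by the tail bound; it contains
      neither \<open>fdag\<close> nor \<epsilon> nor \<rho>.\<close>
    define Sm where "Sm \<sigma> = (\<Sum>n. (c + real n + 1) powr \<sigma> * exp (- C\<^sub>Z p' * real n powr ?\<nu>)) powr (1 / \<sigma>)" for \<sigma>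
    have Sm: "Sm \<sigma> > 0" if "\<sigma> \<ge> 1" for \<sigma>
    proof -
      have "(\<Sum>n. (c + real n + 1) powr \<sigma> * exp (- C\<^sub>Z p' * real n powr ?\<nu>)) > 0"
        using that c Z'(3) \<nu> by (intro suminf_pos summable_stretched_exp) (auto intro!: mult_pos_pos)
      then show ?thesis by (simp add: Sm_def)
    qed
    have noise: "AE \<omega> in M. \<exists>\<zeta>. T.noise (Z \<omega>) \<zeta>"
      using Z'(2)
    proof eventually_elim
      case (elim \<omega>)
      have "1 \<le> ennreal p'" "(1::ennreal) \<le> \<infinity>" using p'1 by auto
      from T.besov_iff_N[OF this] elim have fin: "?NZ \<omega> < \<infinity>" by blast
      obtain c4 where c4: "\<And>Z \<nu>. \<nu> \<ge> 0 \<Longrightarrow>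
        N (- real CARD('d) / 2) (ennreal (p / (p - 1))) \<infinity> Z \<le> ennreal \<nu> \<Longrightarrow> T.noise Z (\<nu> / c4)"
        by (rule T.noise_of_N) (rule that; assumption)
      have "N (- real CARD('d) / 2) (ennreal (p / (p - 1))) \<infinity> (Z \<omega>) \<le> ennreal (enn2real (?NZ \<omega>))"
        using fin by (simp add: d_def p'_def)
      from c4[OF enn2real_nonneg this] show ?case by blast
    qed
    show ?thesis
    proof (rule exI[of _ \<kappa>], rule conjI[OF \<kappa>(1)], rule exI[of _ c], rule conjI[OF c],
        rule exI[of _ Sm], intro conjI allI impI Sm)
      fix fdag :: "'d distr" and \<epsilon> \<rho> :: real
      assume as: "fdag \<in> D \<inter> besov s (ennreal p) \<infinity> \<and> N s (ennreal p) \<infinity> fdag \<le> ennreal \<rho> \<and> \<epsilon> > 0 \<and> \<rho> > 0"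
      then have g: "fdag \<in> D" "N s (ennreal p) \<infinity> fdag \<le> ennreal \<rho>" "\<epsilon> > 0" "\<rho> > 0" by auto
      have al: "\<kappa> * \<rho> powr (- (q * a + d * q / 2 * (1 - 2 / q)) / (a + s + d / 2)) * \<epsilon> powr ((2 * (a + s) - q * s) / (a + s + d / 2))
          = \<kappa> * T.alpha0 s \<rho> \<epsilon>" by (simp add: T.alpha0_def d_def)
      have ra: "\<rho> powr ((a + d / 2) / (a + s + d / 2)) * \<epsilon> powr (s / (a + s + d / 2)) = T.rate s \<rho> \<epsilon>"
        by (simp add: T.rate_def d_def)
      have r0: "T.rate s \<rho> \<epsilon> > 0" using g by (simp add: T.rate_def)
      have exmin: "AE \<omega> in M. \<exists>f. is_arg_min (tikhonov R F (F fdag + \<epsilon> *\<^sub>R Z \<omega>) \<beta>) (\<lambda>f. f \<in> D) f" if "\<beta> > 0" for \<beta>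
        using noise
      proof eventually_elim
        case (elim \<omega>)
        then obtain \<zeta> where z: "T.noise (Z \<omega>) \<zeta>" by blast
        show ?case by (rule T.minimizer_exists[OF z g(1) g(3) that R])
      qed
      have tailmom: "(\<forall>t>0. \<P>(\<omega> in M. N 0 (ennreal p) (ennreal q) (fhat \<omega> - fdag) > ennreal ((c + t) * T.rate s \<rho> \<epsilon>))
                  \<le> exp (- C\<^sub>Z p' * t powr ?\<nu>)) \<and>
               (\<forall>\<sigma>\<ge>1. enn_powr (\<integral>\<^sup>+ \<omega>. enn_powr (N 0 (ennreal p) (ennreal q) (fhat \<omega> - fdag)) \<sigma> \<partial>M) (1 / \<sigma>)
                  \<le> ennreal (Sm \<sigma> * T.rate s \<rho> \<epsilon>))"
        if fh: "AE \<omega> in M. is_arg_min (tikhonov R F (F fdag + \<epsilon> *\<^sub>R Z \<omega>) (\<kappa> * T.alpha0 s \<rho> \<epsilon>)) (\<lambda>f. f \<in> D) (fhat \<omega>)"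
          and meas: "(\<lambda>\<omega>. N 0 (ennreal p) (ennreal q) (fhat \<omega> - fdag)) \<in> borel_measurable M"
        for fhat :: "'w \<Rightarrow> 'd distr"
      proof -
        let ?V = "\<lambda>\<omega>. N 0 (ennreal p) (ennreal q) (fhat \<omega> - fdag)"
        have inD: "fhat \<omega> \<in> D" if "is_arg_min (tikhonov R F (F fdag + \<epsilon> *\<^sub>R Z \<omega>) (\<kappa> * T.alpha0 s \<rho> \<epsilon>)) (\<lambda>f. f \<in> D) (fhat \<omega>)" for \<omega>
          using that by (simp add: is_arg_min_def)
        have tail: "\<P>(\<omega> in M. ?V \<omega> > ennreal ((c + t) * T.rate s \<rho> \<epsilon>)) \<le> exp (- C\<^sub>Z p' * t powr ?\<nu>)" if t: "t > 0" for t
        proof -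
          \<comment> \<open>An excess \<open>t\<close> of the error corresponds to an excess
            \<open>t powr ?e\<close> of the noise; this turns the exponent \<open>\<mu> p'\<close>
            into \<open>\<mu> p' * ?e\<close>.\<close>
          define te where "te = t powr ?e"
          have te: "te > 0" using t by (simp add: te_def)
          have root: "(M\<^sub>Z p' + te) powr (1 / ?e) \<le> M\<^sub>Z p' powr (1 / ?e) + t"
          proof -
            have inv: "(y powr (1 / ?e)) powr ?e = y" "(y powr ?e) powr (1 / ?e) = y" if "y \<ge> 0" for y
              using that e1 by (simp_all add: powr_powr del: add_divide_distrib)
            have "M\<^sub>Z p' + te \<le> (M\<^sub>Z p' powr (1 / ?e) + t) powr ?e"
              using powr_superadd[OF e1, of "M\<^sub>Z p' powr (1 / ?e)" t] inv(1)[of "M\<^sub>Z p'"] Z'(4) t by (simp add: te_def)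
            then have "(M\<^sub>Z p' + te) powr (1 / ?e) \<le> ((M\<^sub>Z p' powr (1 / ?e) + t) powr ?e) powr (1 / ?e)"
              using e1 Z'(4) te by (intro powr_mono2) auto
            also have "\<dots> = M\<^sub>Z p' powr (1 / ?e) + t" using t by (intro inv(2)) simp
            finally show ?thesis .
          qed
          have "\<P>(\<omega> in M. ?V \<omega> > ennreal ((c + t) * T.rate s \<rho> \<epsilon>)) \<le> \<P>(\<omega> in M. ?NZ \<omega> > ennreal (M\<^sub>Z p' + te))"
          proof (rule P.finite_measure_mono_AE)
            \<comment> \<open>Shown by contraposition: where the noise norm stays below the
              threshold, the deterministic estimate applies to every minimizer.\<close>
            show "AE \<omega> in M. \<omega> \<in> {\<omega> \<in> space M. ?V \<omega> > ennreal ((c + t) * T.rate s \<rho> \<epsilon>)} \<longrightarrow> \<omega> \<in> {\<omega> \<in> space M. ?NZ \<omega> > ennreal (M\<^sub>Z p' + te)}"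
              using fh
            proof eventually_elim
              case (elim \<omega>)
              have hX: "fhat \<omega> - fdag \<in> T.X0" by (intro T.X0_diff T.D_X0 inD elim g)
              have "?V \<omega> \<le> ennreal ((c + t) * T.rate s \<rho> \<epsilon>)" if le: "?NZ \<omega> \<le> ennreal (M\<^sub>Z p' + te)"
              proof -
                have "T.nrm (fhat \<omega> - fdag) \<le> max c0 ((M\<^sub>Z p' + te) powr (1 / T.expo)) * T.rate s \<rho> \<epsilon>"
                  using le Z'(4) te by (intro \<kappa>(3)[OF R g _ _ elim]) (auto simp: d_def p'_def)
                also have "\<dots> \<le> (c + t) * T.rate s \<rho> \<epsilon>"
                proof (intro mult_right_mono)
                  have "M\<^sub>Z p' powr (1 / ?e) \<ge> 0" by simp
                  then show "max c0 ((M\<^sub>Z p' + te) powr (1 / T.expo)) \<le> c + t"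
                    using root \<kappa>(2) t unfolding e c_def by linarith
                qed (use r0 in simp)
                finally show ?thesis unfolding T.N_nrm[OF hX] by (rule ennreal_leI)
              qed
              then show ?case by (auto simp: not_less[symmetric])
            qed
            show "{\<omega> \<in> space M. ?NZ \<omega> > ennreal (M\<^sub>Z p' + te)} \<in> P.events" using Z'(1) by measurable
          qed
          also have "\<dots> \<le> exp (- C\<^sub>Z p' * te powr \<mu> p')" by (rule Z'(6)[OF te])
          also have "te powr \<mu> p' = t powr ?\<nu>" by (simp only: te_def powr_powr mult.commute)
          finally show ?thesis .
        qed
        have fin: "AE \<omega> in M. ?V \<omega> < \<infinity>"
          using fh
        proof eventually_elim
          case (elim \<omega>)
          show ?case using T.X0_iff_N T.X0_diff[OF T.D_X0[OF inD[OF elim]] T.D_X0[OF g(1)]] by blast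
        qed
        have "enn_powr (\<integral>\<^sup>+ \<omega>. enn_powr (?V \<omega>) \<sigma> \<partial>M) (1 / \<sigma>) \<le> ennreal (Sm \<sigma> * T.rate s \<rho> \<epsilon>)" if "\<sigma> \<ge> 1" for \<sigma>
          unfolding Sm_def using that by (intro moment_of_tail[OF M meas fin c r0 Z'(3) \<nu> _ tail]) auto
        then show ?thesis using tail by blast
      qed
      show "let minimizer = (\<lambda>\<alpha> \<omega>. is_arg_min (tikhonov R F (F fdag + \<epsilon> *\<^sub>R Z \<omega>) \<alpha>) (\<lambda>f. f \<in> D));
             \<alpha> = \<kappa> * \<rho> powr (- (q * a + d * q / 2 * (1 - 2 / q)) / (a + s + d / 2))
                    * \<epsilon> powr ((2 * (a + s) - q * s) / (a + s + d / 2));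
             rate = \<rho> powr ((a + d / 2) / (a + s + d / 2)) * \<epsilon> powr (s / (a + s + d / 2))
         in (\<forall>\<beta>>0. AE \<omega> in M. \<exists>f. minimizer \<beta> \<omega> f) \<and>
            (\<forall>fhat :: 'w \<Rightarrow> 'd distr.
               (AE \<omega> in M. minimizer \<alpha> \<omega> (fhat \<omega>)) \<and>
               (\<lambda>\<omega>. N 0 (ennreal p) (ennreal q) (fhat \<omega> - fdag)) \<in> borel_measurable M \<longrightarrow>
               (\<forall>t>0. \<P>(\<omega> in M. N 0 (ennreal p) (ennreal q) (fhat \<omega> - fdag) > ennreal ((c + t) * rate))
                  \<le> exp (- C\<^sub>Z p' * t powr (\<mu> p' * (q / 2 + (q - 2) * d / (4 * a))))) \<and>
               (\<forall>\<sigma>\<ge>1. enn_powr (\<integral>\<^sup>+ \<omega>. enn_powr (N 0 (ennreal p) (ennreal q) (fhat \<omega> - fdag)) \<sigma> \<partial>M) (1 / \<sigma>)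
                  \<le> ennreal (Sm \<sigma> * rate)))"
        unfolding Let_def al ra using exmin tailmom by blast
    qed
  qed
qed

end
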